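(* Suppose that there exist a function $w:S\to[1,\infty)$ and constants $\rho_1,\rho_2,\rho_3>0$, $b_1,b_2,b_3\ge0$, $L>0$, $M>0$ such that: (1) $\sum_{j\in S}w(j)q(j|i,a)\le\rho_1w(i)+b_1$ for all $(i,a)\in K$, and $q^*(i)\le Lw(i)$ for all $i\in S$; (2) $\sum_{i\in S}w(i)\gamma(i)<\infty$, and $|c_n(i,a)|\le Mw(i)$ for all $(i,a)\in K$ and $n=0,1,\ldots,N$; (3) $\sum_{j\in S}w^2(j)q(j|i,a)\le\rho_2w^2(i)+b_2$ and $\sum_{j\in S}w^3(j)q(j|i,a)\le\rho_3w^3(i)+b_3$ for all $(i,a)\in K$; (4) for each $i\in S$ the set $A(i)$ is compact; (5) for each fixed $i,j\in S$ and $n=0,1,\ldots,N$, the functions $c_n(i,a)$, $q(j|i,a)$ and $\sum_{k\in S}w(k)q(k|i,a)$ are continuous in $a\in A(i)$; (6) for each integer $m\ge1$ the set $S_m:=\{i\in S:w(i)\le m\}$ is nonempty and finite; (7) $\sum_{i\in S}w^2(i)\gamma(i)<\infty$ and $\sum_{i\in S}w^3(i)\gamma(i)<\infty$. Then for each randomized history-dependent policy $\pi\in\Pi$ there exists a randomized Markov policy $\widetilde\pi\in\Pi^M$ with the same occupation measure, $\eta^{\widetilde\pi}=\eta^\pi$. Hence for any $\pi\in\Pi$ there exists $\widetilde\pi\in\Pi^M$ such that $V_n(\pi)=V_n(\widetilde\pi)$ for all $1\le n\le N$.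
   Context: Model. $S$ is a denumerable set (discrete topology), $A$ is a Polish space with Borel $\sigma$-algebra $\mathcal{B}(A)$, and for each $i\in S$, $A(i)\in\mathcal{B}(A)$ is the set of admissible actions in state $i$; $K:=\{(i,a): i\in S, a\in A(i)\}$. The transition rates $q(j|i,a)$ are real numbers, measurable in $a\in A(i)$ for fixed $i,j\in S$, with $q(j|i,a)\ge 0$ for $j\ne i$, $\sum_{j\in S}q(j|i,a)=0$ for all $(i,a)\in K$, and $q^*(i):=\sup_{a\in A(i)}|q(i|i,a)|<\infty$ for all $i\in S$. The cost functions $c_n:K\to\mathbb{R}$ $(0\le n\le N)$ are measurable in $a\in A(i)$ for each $i$. $T>0$ is a fixed terminal time and $\gamma$ a fixed (initial) probability distribution on $S$. Path space. $S_\infty:=S\cup\{i_\infty\}$ and $A_\infty:=A\cup\{a_\infty\}$ with isolated points $i_\infty\notin S$, $a_\infty\notin A$; $A(i_\infty):=\{a_\infty\}$ and $q(\cdot|i_\infty,a_\infty):=0$. $\mathbb{R}_+:=(0,\infty)$, $\mathbb{R}_+^0:=[0,\infty)$. $\Omega$ is the union of $(S\times\mathbb{R}_+)^\infty$ (sequences $(i_0,\theta_1,i_1,\theta_2,i_2,\ldots)$) and the set of all sequences $(i_0,\theta_1,i_1,\ldots,\theta_{m-1},i_{m-1},\infty,i_\infty,\infty,i_\infty,\ldots)$ with $m\ge1$, $i_l\in S$, $\theta_l\in\mathbb{R}_+$; $\mathcal{F}$ is its Borel $\sigma$-algebra. For $\omega=(i_0,\theta_1,i_1,\ldots)$: $T_0:=0$,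 $X_m(\omega):=i_m$ $(m\ge 0)$, $T_m:=\theta_1+\cdots+\theta_m$ $(m\ge1)$, $T_\infty:=\lim_mT_m$, and $\xi_t:=X_m$ for $T_m\le t<T_{m+1}$, $\xi_t:=i_\infty$ for $t\ge T_\infty$. $\xi_{t-}:=X_m$ for $T_m<t\le T_{m+1}$ with $t<T_\infty$, $\xi_{0-}:=\xi_0$, $\xi_{t-}:=i_\infty$ for $t\ge T_\infty$. $\mathcal{F}_t:=\sigma(\{T_m\le s,X_m=j\}:j\in S,s\le t,m\ge0)$, $\mathcal{F}_{s-}:=\bigvee_{0\le t<s}\mathcal{F}_t$, and $\mathcal{P}:=\sigma(B\times\{0\}\,(B\in\mathcal{F}_0),\ B\times(s,\infty)\,(B\in\mathcal{F}_{s-},s>0))$ is the predictable $\sigma$-algebra on $\Omega\times\mathbb{R}_+^0$. Policies. $\Pi$ is the set of randomized history-dependent policies: $\mathcal{P}$-measurable transition probabilities $\pi(\cdot|\omega,t)$ on $(A_\infty,\mathcal{B}(A_\infty))$ concentrated on $A(\xi_{t-}(\omega))$. $\Pi^M\subseteq\Pi$ is the set of randomized Markov policies: those of the form $\pi(\cdot|\omega,t)=\varphi(\cdot|\xi_{t-}(\omega),t)$ for a kernel $\varphi$ on $A_\infty$ given $S_\infty\times\mathbb{R}_+^0$. Probability. For $\pi\in\Pi$, $P_\gamma^\pi$ is the unique probability measure on $(\Omega,\mathcal{F})$ with $P_\gamma^\pi(\xi_0=i)=\gamma(i)$ for all $i\in S$ and such that, under it, $\nu^\pi(\omega,dt,j):=\left[\int_A\pi(da|\omega,t)q(j|\xi_{t-}(\omega),a)I_{\{j\ne\xi_{t-}(\omega)\}}\right]dt$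 is the dual predictable projection (compensator) of the random measure $\mu(\omega,dt,j):=\sum_{m\ge1}I_{\{T_m<\infty\}}I_{\{X_m=j\}}\delta_{T_m}(dt)$ on $\mathbb{R}_+\times S$; the stochastic basis is assumed complete. $E_\gamma^\pi$ is the corresponding expectation. Costs and occupation measures. $V_n(\pi):=E_\gamma^\pi\left[\int_0^T\int_Ac_n(\xi_{t-},a)\pi(da|\omega,t)dt\right]$ (integrands at $i_\infty$ are taken to be $0$; immaterial). With $X:=[0,T]\times K$, the occupation measure of $\pi\in\Pi$ on $\mathcal{B}(X)$ is $\eta^\pi(dt,i,da):=\frac1TE_\gamma^\pi\left[I_{\{\xi_t=i\}}\pi(da|\omega,t)\right]dt$, $i\in S$. *)

theory Defs
  imports "HOL-Probability.Probability"
begin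

section \<open>Adjoining an isolated point\<close>

text \<open>
  The extensions \<open>S\<^sub>\<infinity>\<close> and \<open>A\<^sub>\<infinity>\<close> are \<open>'s option\<close> and \<open>'a option\<close>; \<open>None\<close> plays the role of the
  adjoined points \<open>i\<^sub>\<infinity>\<close> and \<open>a\<^sub>\<infinity>\<close>, and both \<open>{None}\<close> and \<open>range Some\<close> are open.
\<close>

instantiation option :: (topological_space) topological_space
begin

definition open_option :: "'a option set \<Rightarrow> bool" where
  "open_option U \<longleftrightarrow> open (Some -` U)"

instance
proof
  show "open (UNIV :: 'a option set)"
    by (simp add: open_option_def)
next
  fix U V :: "'a option set"
  assume "open U" "open V"
  then show "open (U \<inter> V)"
    by (simp add: open_option_def vimage_Int open_Int)
next
  fix \<U> :: "'a option set set"
  assume "\<forall>U\<in>\<U>. open U"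
  then show "open (\<Union>\<U>)"
    by (auto simp: open_option_def vimage_Union intro!: open_UN)
qed

end


section \<open>Path space\<close>

text \<open>
  A path \<open>(i\<^sub>0, \<theta>\<^sub>1, i\<^sub>1, \<theta>\<^sub>2, \<dots>)\<close> is encoded as the sequence of pairs \<open>\<omega> m = (i\<^sub>m, \<theta>\<^sub>m\<^sub>+\<^sub>1)\<close>.
\<close>

type_synonym 's path = "nat \<Rightarrow> 's option \<times> ennreal"

definition Omega :: "'s path set" where
  "Omega =
     {\<omega>. \<forall>m. fst (\<omega> m) \<in> range Some \<and> 0 < snd (\<omega> m) \<and> snd (\<omega> m) < \<infinity>} \<union>
     {\<omega>. \<exists>m\<ge>1. (\<forall>l<m. fst (\<omega> l) \<in> range Some) \<and>
               (\<forall>l<m-1. 0 < snd (\<omega> l) \<and> snd (\<omega> l) < \<infinity>) \<and>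
               snd (\<omega> (m-1)) = \<infinity> \<and>
               (\<forall>l\<ge>m. \<omega> l = (None, \<infinity>))}"

definition path_space :: "'s::topological_space path measure" where
  "path_space = restrict_space borel Omega"

definition jump_state :: "nat \<Rightarrow> 's path \<Rightarrow> 's option" where
  "jump_state m \<omega> = fst (\<omega> m)"

definition jump_time :: "nat \<Rightarrow> 's path \<Rightarrow> ennreal" where
  "jump_time m \<omega> = (\<Sum>l<m. snd (\<omega> l))"

definition explosion_time :: "'s path \<Rightarrow> ennreal" where
  "explosion_time \<omega> = lim (\<lambda>m. jump_time m \<omega>)"

text \<open>\<open>\<xi>\<^sub>t\<close> and \<open>\<xi>\<^sub>t\<^sub>-\<close>, for \<open>\<omega> \<in> Omega\<close> and \<open>t \<ge> 0\<close>.\<close>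

definition xi :: "'s path \<Rightarrow> real \<Rightarrow> 's option" where
  "xi \<omega> t =
     (if explosion_time \<omega> \<le> ennreal t then None
      else jump_state (THE m. jump_time m \<omega> \<le> ennreal t \<and> ennreal t < jump_time (Suc m) \<omega>) \<omega>)"

definition xi_minus :: "'s path \<Rightarrow> real \<Rightarrow> 's option" where
  "xi_minus \<omega> t =
     (if t = 0 then xi \<omega> 0
      else if explosion_time \<omega> \<le> ennreal t then None
      else jump_state (THE m. jump_time m \<omega> < ennreal t \<and> ennreal t \<le> jump_time (Suc m) \<omega>) \<omega>)"

definition filt :: "real \<Rightarrow> 's path measure" where
  "filt t = sigma Omega
     {{\<omega>\<in>Omega. jump_time m \<omega> \<le> ennreal s \<and> jump_state m \<omega> = Some j} | m s j. 0 \<le> s \<and> s \<le> t}"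

definition filt_minus :: "real \<Rightarrow> 's path measure" where
  "filt_minus s = sigma Omega (\<Union>t\<in>{0..<s}. sets (filt t))"

definition predictable :: "('s path \<times> real) measure" where
  "predictable = sigma (Omega \<times> {0..})
     ({B \<times> {0} | B. B \<in> sets (filt 0)} \<union>
      {B \<times> {s<..} | B s. 0 < s \<and> B \<in> sets (filt_minus s)})"


section \<open>Policies\<close>

fun act_inf :: "('s \<Rightarrow> 'a set) \<Rightarrow> 's option \<Rightarrow> 'a option set" where
  "act_inf A (Some i) = Some ` A i"
| "act_inf A None = {None}"

definition policies ::
  "('s \<Rightarrow> 'a::topological_space set) \<Rightarrow> ('s path \<Rightarrow> real \<Rightarrow> 'a option measure) set" where
  "policies A =
     {\<pi>. (\<lambda>(\<omega>, t). \<pi> \<omega> t) \<in> measurable predictable (prob_algebra borel) \<and>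
         (\<forall>\<omega>\<in>Omega. \<forall>t\<ge>0. measure (\<pi> \<omega> t) (act_inf A (xi_minus \<omega> t)) = 1)}"

definition markov_policies ::
  "('s::topological_space \<Rightarrow> 'a::topological_space set) \<Rightarrow>
     ('s path \<Rightarrow> real \<Rightarrow> 'a option measure) set" where
  "markov_policies A =
     {\<pi>\<in>policies A.
        \<exists>\<phi>\<in>measurable (borel \<Otimes>\<^sub>M restrict_space borel {0..}) (prob_algebra borel).
          \<forall>\<omega>\<in>Omega. \<forall>t\<ge>0. \<pi> \<omega> t = \<phi> (xi_minus \<omega> t, t)}"


section \<open>Random measures and the controlled law\<close>

text \<open>
  A function \<open>f\<close> on \<open>K\<close> is extended by \<open>0\<close> to \<open>S\<^sub>\<infinity> \<times> A\<^sub>\<infinity>\<close>. Nothing is assumed about the values of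
  \<open>f\<close> outside \<open>K\<close> (not even measurability), so these have to be cut off before integrating.
\<close>

definition ext_K :: "('s \<Rightarrow> 'a set) \<Rightarrow> ('s \<Rightarrow> 'a \<Rightarrow> real) \<Rightarrow> 's option \<Rightarrow> 'a option \<Rightarrow> real" where
  "ext_K A f x y =
     (case (x, y) of (Some i, Some a) \<Rightarrow> if a \<in> A i then f i a else 0 | _ \<Rightarrow> 0)"

text \<open>
  \<open>jump_rate A q \<pi> \<omega> t j\<close> is the density of \<open>\<nu>\<^sup>\<pi>(\<omega>, dt, j)\<close>; the rate \<open>q(j|i,a)\<close> is written \<open>q j i a\<close>.
\<close>

definition jump_rate ::
  "('s \<Rightarrow> 'a::topological_space set) \<Rightarrow> ('s \<Rightarrow> 's \<Rightarrow> 'a \<Rightarrow> real) \<Rightarrow>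
     ('s path \<Rightarrow> real \<Rightarrow> 'a option measure) \<Rightarrow> 's path \<Rightarrow> real \<Rightarrow> 's \<Rightarrow> real" where
  "jump_rate A q \<pi> \<omega> t j =
     (if Some j \<noteq> xi_minus \<omega> t then (\<integral>a. ext_K A (q j) (xi_minus \<omega> t) a \<partial>\<pi> \<omega> t) else 0)"

definition nu ::
  "('s \<Rightarrow> 'a::topological_space set) \<Rightarrow> ('s \<Rightarrow> 's \<Rightarrow> 'a \<Rightarrow> real) \<Rightarrow>
     ('s path \<Rightarrow> real \<Rightarrow> 'a option measure) \<Rightarrow> 's path \<Rightarrow> (real \<times> 's) measure" where
  "nu A q \<pi> \<omega> =
     density (restrict_space lborel {0<..} \<Otimes>\<^sub>M count_space UNIV)
       (\<lambda>(t, j). ennreal (jump_rate A q \<pi> \<omega> t j))"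

text \<open>The sum of the Dirac masses at \<open>(T\<^sub>m, X\<^sub>m)\<close>, as an image of counting measure.\<close>

definition mu :: "'s path \<Rightarrow> (real \<times> 's) measure" where
  "mu \<omega> =
     distr (count_space {m. 1 \<le> m \<and> jump_time m \<omega> < \<infinity>})
       (restrict_space borel {0<..} \<Otimes>\<^sub>M count_space UNIV)
       (\<lambda>m. (enn2real (jump_time m \<omega>), the (jump_state m \<omega>)))"

definition predictable_random_measure :: "('s path \<Rightarrow> (real \<times> 's) measure) \<Rightarrow> bool" where
  "predictable_random_measure \<kappa> \<longleftrightarrow>
     (\<forall>W :: ('s path \<times> real) \<times> 's \<Rightarrow> ennreal.
        W \<in> borel_measurable (predictable \<Otimes>\<^sub>M count_space UNIV) \<longrightarrow>
        (\<lambda>(\<omega>, t). \<integral>\<^sup>+(s, j). W ((\<omega>, s), j) * indicator {0<..t} s \<partial>\<kappa> \<omega>)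
          \<in> borel_measurable predictable)"

definition dual_predictable_projection ::
  "'s path measure \<Rightarrow> ('s path \<Rightarrow> (real \<times> 's) measure) \<Rightarrow>
     ('s path \<Rightarrow> (real \<times> 's) measure) \<Rightarrow> bool" where
  "dual_predictable_projection P \<mu> \<nu> \<longleftrightarrow>
     predictable_random_measure \<nu> \<and>
     (\<forall>W :: ('s path \<times> real) \<times> 's \<Rightarrow> ennreal.
        W \<in> borel_measurable (predictable \<Otimes>\<^sub>M count_space UNIV) \<longrightarrow>
        (\<integral>\<^sup>+\<omega>. (\<integral>\<^sup>+(t, j). W ((\<omega>, t), j) \<partial>\<mu> \<omega>) \<partial>P) =
        (\<integral>\<^sup>+\<omega>. (\<integral>\<^sup>+(t, j). W ((\<omega>, t), j) \<partial>\<nu> \<omega>) \<partial>P))"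

definition controlled_law ::
  "('s::topological_space \<Rightarrow> 'a::topological_space set) \<Rightarrow> ('s \<Rightarrow> 's \<Rightarrow> 'a \<Rightarrow> real) \<Rightarrow> 's pmf \<Rightarrow>
     ('s path \<Rightarrow> real \<Rightarrow> 'a option measure) \<Rightarrow> 's path measure" where
  "controlled_law A q \<gamma> \<pi> =
     (THE P. prob_space P \<and> sets P = sets path_space \<and>
        (\<forall>i. measure P {\<omega>\<in>Omega. xi \<omega> 0 = Some i} = pmf \<gamma> i) \<and>
        dual_predictable_projection P mu (nu A q \<pi>))"


section \<open>Costs and occupation measures\<close>

definition expected_cost ::
  "('s::topological_space \<Rightarrow> 'a::topological_space set) \<Rightarrow> ('s \<Rightarrow> 's \<Rightarrow> 'a \<Rightarrow> real) \<Rightarrow> 's pmf \<Rightarrow>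
     real \<Rightarrow> ('s \<Rightarrow> 'a \<Rightarrow> real) \<Rightarrow> ('s path \<Rightarrow> real \<Rightarrow> 'a option measure) \<Rightarrow> real" where
  "expected_cost A q \<gamma> Tm f \<pi> =
     (\<integral>\<omega>. (LINT t:{0..Tm}|lborel. (\<integral>a. ext_K A f (xi_minus \<omega> t) a \<partial>\<pi> \<omega> t))
        \<partial>controlled_law A q \<gamma> \<pi>)"

definition occ_space :: "('s \<Rightarrow> 'a set) \<Rightarrow> real \<Rightarrow> (real \<times> 's \<times> 'a) set" where
  "occ_space A Tm = {0..Tm} \<times> {(i, a). a \<in> A i}"

definition occupation_measure ::
  "('s::topological_space \<Rightarrow> 'a::topological_space set) \<Rightarrow> ('s \<Rightarrow> 's \<Rightarrow> 'a \<Rightarrow> real) \<Rightarrow> 's pmf \<Rightarrow>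
     real \<Rightarrow> ('s path \<Rightarrow> real \<Rightarrow> 'a option measure) \<Rightarrow> (real \<times> 's \<times> 'a) measure" where
  "occupation_measure A q \<gamma> Tm \<pi> =
     measure_of (occ_space A Tm) (sets (restrict_space borel (occ_space A Tm)))
       (\<lambda>B. ennreal (1 / Tm) *
          (\<integral>\<^sup>+t\<in>{0..Tm}. (\<integral>\<^sup>+i.
             (\<integral>\<^sup>+\<omega>. indicator {\<omega>. xi \<omega> t = Some i} \<omega> *
                    emeasure (\<pi> \<omega> t) (Some ` {a. (t, i, a) \<in> B})
                \<partial>controlled_law A q \<gamma> \<pi>)
             \<partial>count_space UNIV) \<partial>lborel))"


section \<open>The bound on the exit rates\<close>

text \<open>\<open>q\<^sup>*(i)\<close>, with values in \<open>[0, \<infinity>]\<close> so that its finiteness is a genuine condition.\<close>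

definition qstar :: "('s \<Rightarrow> 'a set) \<Rightarrow> ('s \<Rightarrow> 's \<Rightarrow> 'a \<Rightarrow> real) \<Rightarrow> 's \<Rightarrow> ennreal" where
  "qstar A q i = (SUP a\<in>A i. ennreal \<bar>q i i a\<bar>)"

end

theory Submission imports Defs
begin

text \<open>
  Let \<open>\<phi> i t\<close> be the conditional law of the action at time \<open>t\<close> under \<open>\<pi>\<close> given \<open>\<xi>\<^sub>t\<^sub>- = i\<close>. The state probabilities
  \<open>p\<^sub>t(i) = P(\<xi>\<^sub>t\<^sub>- = i)\<close> under \<open>\<pi>\<close> satisfy the forward equation with the rates averaged by \<open>\<phi>\<close>, which is also
  the forward equation of the Markov policy \<open>\<phi>\<close>. Its solutions satisfy \<open>\<Sum>i. p\<^sub>t(i) w(i) < \<infinity>\<close> by the drift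
  condition, so the total flow between states is integrable. For the difference \<open>d\<close> of two solutions,
  \<open>\<bar>d\<^sub>t(j)\<bar>\<close> plus the outflow of \<open>\<bar>d\<bar>\<close> from \<open>j\<close> is at most the inflow of \<open>\<bar>d\<bar>\<close> into \<open>j\<close>; summed over \<open>j\<close>, the
  two flows are equal and finite and cancel, so that \<open>d = 0\<close>. Hence both
  policies have the same state probabilities, and the occupation measure and the costs only depend
  on \<open>p\<close> and \<open>\<phi>\<close>.

  The forward equation is the compensator identity for the indicator of \<open>\<xi>\<^sub>t\<^sub>-\<close>. That the compensator determines the law
  rests on two facts: a function on \<open>Omega \<times> [0, \<infinity>)\<close> is predictable iff it is product measurable and
  depends on a path only through the path stopped at \<open>t\<close>; and the compensator identity is
  equivalent to the prescription of the law of each jump given the path up to the previous one,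
  so that the Ionescu-Tulcea theorem provides the law.
\<close>

section \<open>Topology of the adjoined point\<close>

text \<open>\<open>controlled_law\<close> is a definite description, so nothing can be said about
  either policy before existence and uniqueness of its law are settled; most of the work on paths
  and predictability serves this end. The rates are unbounded over the states and explosion is not
  excluded in advance. Identities are mostly stated in \<open>ennreal\<close> with all terms added,
  so that infinite values and truncated subtraction do no harm; a term is cancelled only after it
  has been shown to be finite. As the states are countable, the conditional law of the action is an
  elementary quotient for each time, and its measurability in time follows from Tonelli's theorem.
  The occupation measure is written with \<open>xi\<close>, policies and rates with
  \<open>xi_minus\<close>; for almost every time the two agree almost surely, because a path has
  only countably many jump times.\<close>

instance option :: (discrete_topology) discrete_topology
  by standard (unfold open_option_def, rule discrete_topology_class.open_discrete)

text \<open>Second countability is what makes the Borel sets of pairs and sequences of states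
  generated by the coordinates.\<close>

instance option :: ("{countable, discrete_topology}") second_countable_topology
proof
  let ?B = "range (\<lambda>x. {x}) :: 'a option set set"
  have "generate_topology ?B U" for U :: "'a option set"
  proof -
    have "generate_topology ?B (\<Union>x\<in>U. {x})"
      by (rule generate_topology.UN) (auto intro: generate_topology.Basis)
    then show ?thesis by simp
  qed
  then have "open = generate_topology ?B"
    using discrete_topology_class.open_discrete by (intro ext) blast
  then show "\<exists>B::'a option set set. countable B \<and> open = generate_topology B"
    by (intro exI[of _ ?B]) auto
qed

lemma sets_borel_discrete: "A \<in> sets (borel :: 'b::discrete_topology measure)"
  by (intro borel_open discrete_topology_class.open_discrete)

lemma measurable_borel_discrete_iff:
  "f \<in> M \<rightarrow>\<^sub>M (borel :: 'b::{discrete_topology} measure) \<longleftrightarrow> f \<in> M \<rightarrow>\<^sub>M count_space UNIV"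
proof (rule arg_cong[where f="\<lambda>X. f \<in> X"], rule measurable_cong_sets[OF refl])
  show "sets (borel :: 'b measure) = sets (count_space UNIV)"
    using sets_borel_discrete by auto
qed

text \<open>Openness in \<open>option\<close> is tested on \<open>range Some\<close> alone, because
  \<open>None\<close> is isolated; the unspecified value \<open>the None\<close> therefore cannot
  destroy continuity.\<close>

lemma measurable_the_borel [measurable]: "the \<in> (borel :: 'b::topological_space option measure) \<rightarrow>\<^sub>M borel"
proof (intro borel_measurable_continuous_onI)
  show "continuous_on UNIV (the :: 'b option \<Rightarrow> 'b)"
    by (auto simp: continuous_on_open_vimage open_option_def vimage_comp comp_def)
qed

lemma range_Some_borel [measurable]: "range Some \<in> sets (borel :: 'b::topological_space option measure)"
  by (rule borel_open) (simp add: open_option_def vimage_def)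

lemma None_borel [measurable]: "{None} \<in> sets (borel :: 'b::topological_space option measure)"
proof -
  have "x \<in> {None} \<longleftrightarrow> x \<in> space borel - range (Some :: 'b \<Rightarrow> 'b option)" for x by (cases x) auto
  then have "{None} = space borel - range (Some :: 'b \<Rightarrow> 'b option)" by blast
  then show ?thesis by simp
qed

lemma Some_image_borel [measurable]:
  assumes "B \<in> sets (borel :: 'b::topological_space measure)"
  shows "Some ` B \<in> sets borel"
proof -
  have "Some ` B = (the -` B \<inter> space borel) \<inter> range Some" by (auto simp: image_iff)
  then show ?thesis using assms by (simp only:) (intro sets.Int measurable_sets[OF measurable_the_borel] range_Some_borel)
qed

section \<open>Paths\<close>

text \<open>Every condition on the right involves one coordinate or two neighbouring ones. This
  local form gives the measurability of \<open>Omega\<close> and is easy to check after a path has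
  been cut or extended.\<close>

lemma Omega_iff:
  "\<omega> \<in> Omega \<longleftrightarrow> fst (\<omega> 0) \<noteq> None \<and> (\<forall>l. 0 < snd (\<omega> l)) \<and>
     (\<forall>l. snd (\<omega> l) = \<infinity> \<longrightarrow> \<omega> (Suc l) = (None, \<infinity>)) \<and>
     (\<forall>l. snd (\<omega> l) \<noteq> \<infinity> \<longrightarrow> fst (\<omega> (Suc l)) \<noteq> None)" (is "_ \<longleftrightarrow> ?R")
proof
  assume "\<omega> \<in> Omega"
  then consider
    (a) "\<forall>m. fst (\<omega> m) \<in> range Some \<and> 0 < snd (\<omega> m) \<and> snd (\<omega> m) < \<infinity>"
  | (b) m where "m \<ge> 1" "\<forall>l<m. fst (\<omega> l) \<in> range Some"
      "\<forall>l<m-1. 0 < snd (\<omega> l) \<and> snd (\<omega> l) < \<infinity>" "snd (\<omega> (m-1)) = \<infinity>" "\<forall>l\<ge>m. \<omega> l = (None, \<infinity>)"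
    unfolding Omega_def by auto
  then show ?R
  proof cases
    case a
    have "fst (\<omega> l) \<noteq> None" "0 < snd (\<omega> l)" "snd (\<omega> l) \<noteq> \<infinity>" for l
      using a[rule_format, of l] by auto
    then show ?thesis by auto
  next
    case b
    have 1: "fst (\<omega> l) \<noteq> None" if "l < m" for l using b(2) that by force
    have 2: "0 < snd (\<omega> l) \<and> snd (\<omega> l) \<noteq> \<infinity>" if "l < m - 1" for l using b(3) that by auto
    have 4: "\<omega> l = (None, \<infinity>)" if "l \<ge> m" for l using b(5) that by auto
    have tri: "l < m - 1 \<or> l = m - 1 \<or> l \<ge> m" for l using b(1) by linarith
    have "0 < snd (\<omega> l)" for l using tri[of l] 2[of l] 4[of l] b(4) by auto
    moreover have "\<omega> (Suc l) = (None, \<infinity>)" if "snd (\<omega> l) = \<infinity>" for l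
      using tri[of l] that 2[of l] 4[of "Suc l"] b(1) by auto
    moreover have "fst (\<omega> (Suc l)) \<noteq> None" if "snd (\<omega> l) \<noteq> \<infinity>" for l
      using tri[of l] that 4[of l] 1[of "Suc l"] b(4) by auto
    moreover have "fst (\<omega> 0) \<noteq> None" using 1[of 0] b(1) by auto
    ultimately show ?thesis by auto
  qed
next
  assume R: ?R
  show "\<omega> \<in> Omega"
  proof (cases "\<exists>l. snd (\<omega> l) = \<infinity>")
    case False
    have "fst (\<omega> m) \<noteq> None" for m using R False by (cases m) auto
    then have "fst (\<omega> m) \<in> range Some" for m by (metis not_None_eq range_eqI)
    then show ?thesis using R False unfolding Omega_def by (auto simp: less_top)
  next
    case True
    \<comment> \<open>The sojourn \<open>n\<close> is the one that never ends, so the index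
      \<open>m\<close> in the definition of \<open>Omega\<close> is \<open>Suc n\<close>.\<close>
    define n where "n = (LEAST l. snd (\<omega> l) = \<infinity>)"
    have n: "snd (\<omega> n) = \<infinity>" unfolding n_def using True by (rule LeastI_ex)
    have n': "snd (\<omega> l) \<noteq> \<infinity>" if "l < n" for l using that not_less_Least unfolding n_def by blast
    have a: "\<omega> l = (None, \<infinity>)" if "l \<ge> Suc n" for l
      using that by (induction l rule: dec_induct) (use R n in auto)
    have b: "fst (\<omega> l) \<noteq> None" if "l < Suc n" for l
      using that R n' by (cases l) auto
    show ?thesis unfolding Omega_def
    proof (intro UnI2 CollectI exI[of _ "Suc n"] conjI allI impI)
      fix l assume "l < Suc n" then show "fst (\<omega> l) \<in> range Some" using b by (metis not_None_eq range_eqI)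
    qed (use R n n' a in \<open>auto simp: less_top\<close>)
  qed
qed

lemma
  assumes "\<omega> \<in> Omega"
  shows Omega_start: "fst (\<omega> 0) \<noteq> None"
    and Omega_pos: "0 < snd (\<omega> l)"
    and Omega_end: "snd (\<omega> l) = \<infinity> \<Longrightarrow> \<omega> (Suc l) = (None, \<infinity>)"
    and Omega_next: "snd (\<omega> l) \<noteq> \<infinity> \<Longrightarrow> fst (\<omega> (Suc l)) \<noteq> None"
proof -
  note R = assms[unfolded Omega_iff]
  show "fst (\<omega> 0) \<noteq> None" "0 < snd (\<omega> l)" using R by simp_all
  show "\<omega> (Suc l) = (None, \<infinity>)" if "snd (\<omega> l) = \<infinity>"
    by (rule R[THEN conjunct2, THEN conjunct2, THEN conjunct1, rule_format, OF that])
  show "fst (\<omega> (Suc l)) \<noteq> None" if "snd (\<omega> l) \<noteq> \<infinity>"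
    by (rule R[THEN conjunct2, THEN conjunct2, THEN conjunct2, rule_format, OF that])
qed

lemma jump_time_0 [simp]: "jump_time 0 \<omega> = 0" by (simp add: jump_time_def)

lemma jump_time_Suc: "jump_time (Suc m) \<omega> = jump_time m \<omega> + snd (\<omega> m)"
  by (simp add: jump_time_def)

lemma jump_time_mono: "m \<le> n \<Longrightarrow> jump_time m \<omega> \<le> jump_time n \<omega>"
  unfolding jump_time_def by (intro sum_mono2) auto

lemma explosion_time_eq: "explosion_time \<omega> = (SUP m. jump_time m \<omega>)"
  unfolding explosion_time_def
  by (rule limI, rule LIMSEQ_SUP) (simp add: incseq_def jump_time_mono)

lemma jump_time_less_Suc: "\<omega> \<in> Omega \<Longrightarrow> jump_time m \<omega> < \<infinity> \<Longrightarrow> jump_time m \<omega> < jump_time (Suc m) \<omega>"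
  using ennreal_add_left_cancel_less[of "jump_time m \<omega>" 0 "snd (\<omega> m)"] Omega_pos[of \<omega> m]
  by (simp add: jump_time_Suc)

lemma jump_time_pos: "\<omega> \<in> Omega \<Longrightarrow> 0 < m \<Longrightarrow> 0 < jump_time m \<omega>"
  using jump_time_less_Suc[of \<omega> 0] jump_time_mono[of 1 m \<omega>] by (auto simp: less_le_trans)

lemma snd_path_finite: "\<omega> \<in> Omega \<Longrightarrow> jump_time (Suc m) \<omega> < \<infinity> \<Longrightarrow> snd (\<omega> m) \<noteq> \<infinity>"
  by (auto simp: jump_time_Suc)

lemma jump_state_finite: "\<omega> \<in> Omega \<Longrightarrow> jump_time m \<omega> < \<infinity> \<Longrightarrow> jump_state m \<omega> \<noteq> None"
  using Omega_start[of \<omega>] Omega_next[of \<omega> "m - 1"] by (cases m) (auto simp: jump_state_def jump_time_Suc)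

lemma path_infinite:
  assumes "\<omega> \<in> Omega" "jump_time m \<omega> = \<infinity>" shows "\<omega> m = (None, \<infinity>)"
  using assms(2)
proof (induction m)
  case (Suc m)
  then have "snd (\<omega> m) = \<infinity>" by (cases "jump_time m \<omega> = \<infinity>") (auto simp: jump_time_Suc)
  with assms(1) show ?case by (rule Omega_end)
qed simp

text \<open>The history up to the jump \<open>m\<close>, encoded as a path that stays for ever in
  the state reached there. Histories of every length thus live in the same space
  \<open>Omega\<close>, and a path without a further jump is its own history.\<close>

definition cut :: "nat \<Rightarrow> 's path \<Rightarrow> 's path" where
  "cut m \<omega> = (\<lambda>l. if l < m then \<omega> l else if l = m then (fst (\<omega> m), \<infinity>) else (None, \<infinity>))"

text \<open>\<open>before m \<omega> t\<close> says that the \<open>m\<close>-th jump has happened strictly before \<open>t\<close>, the start of the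
  path counting as happened even at \<open>t = 0\<close>; \<open>stopped \<omega> t\<close> forgets all jumps of \<open>\<omega>\<close> from time \<open>t\<close> on.\<close>

definition before :: "nat \<Rightarrow> 's path \<Rightarrow> real \<Rightarrow> bool" where
  "before m \<omega> t \<longleftrightarrow> m = 0 \<or> jump_time m \<omega> < ennreal t"

definition stopped :: "'s path \<Rightarrow> real \<Rightarrow> 's path" where
  "stopped \<omega> t = (\<lambda>l. if before l \<omega> t then (fst (\<omega> l), if before (Suc l) \<omega> t then snd (\<omega> l) else \<infinity>)
                     else (None, \<infinity>))"

lemma before_0 [simp]: "before 0 \<omega> t" by (simp add: before_def)

lemma before_mono: "before m \<omega> t \<Longrightarrow> l \<le> m \<Longrightarrow> before l \<omega> t"
  using jump_time_mono[of l m \<omega>] by (auto simp: before_def)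

lemma before_finite: "before m \<omega> t \<Longrightarrow> jump_time m \<omega> < \<infinity>"
  by (auto simp: before_def) (metis ennreal_less_top order.strict_trans infinity_ennreal_def)

lemma stopped_eq_cut:
  assumes "before m \<omega> t" "\<not> before (Suc m) \<omega> t"
  shows "stopped \<omega> t = cut m \<omega>"
proof
  fix l
  have "before l \<omega> t \<longleftrightarrow> l \<le> m" for l
    using assms before_mono[of m \<omega> t l] before_mono[of l \<omega> t "Suc m"] by (meson not_less_eq_eq)
  then show "stopped \<omega> t l = cut m \<omega> l" by (auto simp: stopped_def cut_def)
qed

lemma stopped_eq_self: "(\<And>m. before m \<omega> t) \<Longrightarrow> stopped \<omega> t = \<omega>"
  by (auto simp: stopped_def)

text \<open>The case distinction behind all pointwise arguments: either infinitely many jumps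
  precede \<open>t\<close>, which on \<open>Omega\<close> means explosion by time \<open>t\<close>,
  or there is a last one and the stopped path is a cut.\<close>

lemma before_cases:
  obtains (all) "\<And>m. before m \<omega> t" | (last) m where "before m \<omega> t" "\<not> before (Suc m) \<omega> t"
proof (cases "\<forall>m. before m \<omega> t")
  case False
  define n where "n = (LEAST m. \<not> before m \<omega> t)"
  have n: "\<not> before n \<omega> t" unfolding n_def by (rule LeastI_ex) (use False in auto)
  moreover have "before l \<omega> t" if "l < n" for l using that not_less_Least unfolding n_def by blast
  moreover from n have "n \<noteq> 0" by (intro notI) simp
  ultimately show thesis using last[of "n - 1"] by auto
qed (use all in auto)

lemma before_last_unique:
  "before m \<omega> t \<Longrightarrow> \<not> before (Suc m) \<omega> t \<Longrightarrow> before n \<omega> t \<Longrightarrow> \<not> before (Suc n) \<omega> t \<Longrightarrow> m = n"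
  by (metis before_mono not_less_eq_eq order_antisym)

lemma jump_time_cut: "jump_time l (cut m \<omega>) = (if l \<le> m then jump_time l \<omega> else \<infinity>)"
proof -
  have "jump_time l (cut m \<omega>) = jump_time l \<omega>" if "l \<le> m"
    unfolding jump_time_def using that by (intro sum.cong) (auto simp: cut_def)
  moreover have "jump_time l (cut m \<omega>) = \<infinity>" if "m < l"
  proof -
    have "snd (cut m \<omega> m) = \<infinity>" by (simp add: cut_def)
    then have "jump_time (Suc m) (cut m \<omega>) = \<infinity>" by (simp add: jump_time_Suc)
    with jump_time_mono[of "Suc m" l "cut m \<omega>"] that show ?thesis by (auto simp: top.extremum_unique)
  qed
  ultimately show ?thesis by auto
qed

lemma jump_state_cut: "l \<le> m \<Longrightarrow> jump_state l (cut m \<omega>) = jump_state l \<omega>"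
  by (auto simp: jump_state_def cut_def)

lemma cut_cut: "l \<le> m \<Longrightarrow> cut l (cut m \<omega>) = cut l \<omega>"
  by (auto simp: cut_def fun_eq_iff)

lemma cut_eq_self: "\<omega> \<in> Omega \<Longrightarrow> jump_time (Suc m) \<omega> = \<infinity> \<Longrightarrow> cut m \<omega> = \<omega>"
proof
  fix l assume \<omega>: "\<omega> \<in> Omega" "jump_time (Suc m) \<omega> = \<infinity>"
  have "jump_time l \<omega> = \<infinity>" if "l > m" using \<omega> jump_time_mono[of "Suc m" l \<omega>] that by (auto simp: top.extremum_unique)
  moreover have "snd (\<omega> m) = \<infinity>"
    using \<omega> path_infinite[of \<omega> m] by (cases "jump_time m \<omega> = \<infinity>") (auto simp: jump_time_Suc)
  ultimately show "cut m \<omega> l = \<omega> l" using path_infinite[OF \<omega>(1), of l] by (auto simp: cut_def prod_eq_iff)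
qed

lemma cut_Omega [simp]: "\<omega> \<in> Omega \<Longrightarrow> cut m \<omega> \<in> Omega"
proof (cases "jump_time m \<omega> = \<infinity>")
  case True
  assume \<omega>: "\<omega> \<in> Omega"
  from True jump_time_mono[of m "Suc m" \<omega>] have "jump_time (Suc m) \<omega> = \<infinity>" by (auto simp: top.extremum_unique)
  with cut_eq_self \<omega> show ?thesis by metis
next
  case False
  assume \<omega>: "\<omega> \<in> Omega"
  have f: "fst (\<omega> l) \<noteq> None" if "l \<le> m" for l
    using jump_state_finite[OF \<omega>, of l] le_less_trans[OF jump_time_mono[OF that, of \<omega>], of \<infinity>] False
    by (auto simp: jump_state_def less_top[symmetric])
  have s: "snd (\<omega> l) \<noteq> \<infinity>" if "l < m" for l
    using snd_path_finite[OF \<omega>, of l] le_less_trans[OF jump_time_mono[of "Suc l" m \<omega>], of \<infinity>] False that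
    by (auto simp: less_top[symmetric])
  show ?thesis unfolding Omega_iff
  proof (intro conjI allI impI)
    fix l
    show "fst (cut m \<omega> 0) \<noteq> None" using f[of 0] by (auto simp: cut_def)
    show "0 < snd (cut m \<omega> l)" using Omega_pos[OF \<omega>, of l] by (auto simp: cut_def)
    { assume "snd (cut m \<omega> l) = \<infinity>"
      then have "m \<le> l" using s[of l] by (cases "l < m") (simp_all add: cut_def)
      then show "cut m \<omega> (Suc l) = (None, \<infinity>)" by (auto simp: cut_def) }
    { assume "snd (cut m \<omega> l) \<noteq> \<infinity>"
      then have "l < m" by (auto simp: cut_def split: if_splits)
      then show "fst (cut m \<omega> (Suc l)) \<noteq> None" using f[of "Suc l"] by (cases "Suc l = m") (auto simp: cut_def) }
  qed
qed

lemma stopped_Omega [simp]: "\<omega> \<in> Omega \<Longrightarrow> stopped \<omega> t \<in> Omega"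
  by (rule before_cases[of \<omega> t]) (simp_all add: stopped_eq_self stopped_eq_cut)

lemma jump_time_stopped:
  "jump_time l (stopped \<omega> t) = (if before l \<omega> t then jump_time l \<omega> else \<infinity>)"
proof (rule before_cases[of \<omega> t])
  fix m assume "before m \<omega> t" "\<not> before (Suc m) \<omega> t"
  moreover from this have "before l \<omega> t \<longleftrightarrow> l \<le> m" for l
    using before_mono[of m \<omega> t l] before_mono[of l \<omega> t "Suc m"] by (meson not_less_eq_eq)
  ultimately show ?thesis using stopped_eq_cut[of m \<omega> t] jump_time_cut[of l m \<omega>] by simp
qed (simp add: stopped_eq_self)

lemma jump_state_stopped: "jump_state l (stopped \<omega> t) = (if before l \<omega> t then jump_state l \<omega> else None)"
  by (auto simp: jump_state_def stopped_def)

lemma before_stopped: "before l (stopped \<omega> t) s \<longleftrightarrow> before l \<omega> t \<and> before l \<omega> s"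
  by (auto simp: before_def jump_time_stopped)

lemma before_mono_time: "before l \<omega> s \<Longrightarrow> s \<le> t \<Longrightarrow> before l \<omega> t"
  by (auto simp: before_def intro: less_le_trans ennreal_leI)

lemma stopped_stopped: "s \<le> t \<Longrightarrow> stopped (stopped \<omega> t) s = stopped \<omega> s"
proof
  fix l assume "s \<le> t"
  then have "before l (stopped \<omega> t) s \<longleftrightarrow> before l \<omega> s" for l
    using before_mono_time[of l \<omega> s t] by (auto simp: before_stopped)
  then show "stopped (stopped \<omega> t) s l = stopped \<omega> s l"
    using before_mono_time[of _ \<omega> s t] \<open>s \<le> t\<close> by (simp add: stopped_def[of _ s]) (simp add: stopped_def)
qed

text \<open>Jump times increase strictly as long as they are finite, so a bound on their supremum is
  strict for each of them. Explosion exactly at \<open>t\<close> therefore also means that every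
  jump lies before \<open>t\<close>.\<close>

lemma explosion_le_iff:
  assumes "\<omega> \<in> Omega" "0 \<le> t"
  shows "explosion_time \<omega> \<le> ennreal t \<longleftrightarrow> (\<forall>m. before m \<omega> t)"
proof
  assume L: "explosion_time \<omega> \<le> ennreal t"
  have "jump_time m \<omega> < ennreal t" for m
  proof -
    have "jump_time (Suc m) \<omega> \<le> explosion_time \<omega>" unfolding explosion_time_eq by (rule SUP_upper) simp
    with L have 1: "jump_time (Suc m) \<omega> \<le> ennreal t" by simp
    then have "jump_time m \<omega> < \<infinity>" using jump_time_mono[of m "Suc m" \<omega>]
      by (metis ennreal_less_top infinity_ennreal_def le_less_trans lessI less_or_eq_imp_le)
    from jump_time_less_Suc[OF assms(1) this] 1 show ?thesis by simp
  qed
  then show "\<forall>m. before m \<omega> t" by (simp add: before_def)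
next
  assume R: "\<forall>m. before m \<omega> t"
  then have "jump_time m \<omega> \<le> ennreal t" for m
    using assms by (cases "m = 0") (auto simp: before_def dest: spec[of _ m])
  then show "explosion_time \<omega> \<le> ennreal t" by (auto simp: explosion_time_eq SUP_le_iff)
qed

section \<open>The state process and its left limits\<close>

lemma xi_eqI:
  assumes "\<omega> \<in> Omega" "jump_time m \<omega> \<le> ennreal t" "ennreal t < jump_time (Suc m) \<omega>"
  shows "xi \<omega> t = jump_state m \<omega>"
proof -
  have "\<not> explosion_time \<omega> \<le> ennreal t"
  proof -
    have "jump_time (Suc m) \<omega> \<le> explosion_time \<omega>" unfolding explosion_time_eq by (rule SUP_upper) simp
    then show ?thesis using assms(3) by (auto dest: order.strict_trans2)
  qed
  moreover have "(THE m. jump_time m \<omega> \<le> ennreal t \<and> ennreal t < jump_time (Suc m) \<omega>) = m"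
  proof (rule the_equality)
    fix n assume n: "jump_time n \<omega> \<le> ennreal t \<and> ennreal t < jump_time (Suc n) \<omega>"
    have "\<not> Suc n \<le> m" "\<not> Suc m \<le> n"
      using n assms jump_time_mono[of "Suc n" m \<omega>] jump_time_mono[of "Suc m" n \<omega>] by auto
    then show "n = m" by simp
  qed (use assms in simp)
  ultimately show ?thesis by (simp add: xi_def)
qed

lemma xi_minus_last:
  assumes "\<omega> \<in> Omega" "0 \<le> t" "before m \<omega> t" "\<not> before (Suc m) \<omega> t"
  shows "xi_minus \<omega> t = jump_state m \<omega>"
\<comment> \<open>At time 0 the definition of \<open>xi_minus\<close> falls back on
  \<open>xi\<close>; the convention that jump 0 counts as having happened makes this the case
  \<open>m = 0\<close>.\<close>
proof (cases "t = 0")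
  case True
  with assms(3) have "m = 0" by (auto simp: before_def)
  with True show ?thesis using assms jump_time_pos[of \<omega> 1] by (auto simp: xi_minus_def intro!: xi_eqI)
next
  case False
  have "\<not> explosion_time \<omega> \<le> ennreal t" using explosion_le_iff[OF assms(1,2)] assms(4) by auto
  moreover have *: "jump_time n \<omega> < ennreal t \<longleftrightarrow> before n \<omega> t" for n
    using False assms(2) by (auto simp: before_def)
  moreover have "(THE m. jump_time m \<omega> < ennreal t \<and> ennreal t \<le> jump_time (Suc m) \<omega>) = m"
  proof -
    have **: "ennreal t \<le> jump_time n \<omega> \<longleftrightarrow> \<not> before n \<omega> t" for n
      using *[of n] by (metis not_less)
    show ?thesis unfolding * ** using assms(3,4) before_last_unique by (intro the_equality) blast+
  qed
  ultimately show ?thesis using False by (simp add: xi_minus_def)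
qed

lemma xi_minus_exploded:
  assumes "\<omega> \<in> Omega" "0 \<le> t" "\<And>m. before m \<omega> t"
  shows "xi_minus \<omega> t = None"
  using assms explosion_le_iff[OF assms(1,2)] by (auto simp: xi_minus_def xi_def)

lemma xi_minus_eq_Some_iff:
  assumes "\<omega> \<in> Omega" "0 \<le> t"
  shows "xi_minus \<omega> t = Some i \<longleftrightarrow> (\<exists>m. before m \<omega> t \<and> \<not> before (Suc m) \<omega> t \<and> jump_state m \<omega> = Some i)"
proof (rule before_cases[of \<omega> t])
  fix m assume m: "before m \<omega> t" "\<not> before (Suc m) \<omega> t"
  then show ?thesis unfolding xi_minus_last[OF assms m] using before_last_unique[OF m] by blast
next
  assume "\<And>m. before m \<omega> t"
  then show ?thesis by (simp add: xi_minus_exploded[OF assms])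
qed

text \<open>The left limit ignores a jump at its own time, so forgetting all jumps from
  \<open>t\<close> on does not change it at any \<open>s \<le> t\<close>. This makes
  \<open>xi_minus\<close> predictable.\<close>

lemma xi_minus_stopped:
  assumes "\<omega> \<in> Omega" "0 \<le> t" "s \<le> t" "0 \<le> s"
  shows "xi_minus (stopped \<omega> t) s = xi_minus \<omega> s"
proof (rule before_cases[of \<omega> s])
  assume a: "\<And>m. before m \<omega> s"
  with before_mono_time assms have "\<And>m. before m \<omega> t" by blast
  then show ?thesis using a by (simp add: stopped_eq_self)
next
  fix m assume "before m \<omega> s" "\<not> before (Suc m) \<omega> s"
  moreover from this before_mono_time assms have "before m \<omega> t" by blast
  ultimately show ?thesis using assms
    by (subst (1 2) xi_minus_last[where m=m]) (auto simp: before_stopped jump_state_stopped)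
qed

lemma xi_minus_cut:
  assumes "\<omega> \<in> Omega" "0 \<le> t" "before m \<omega> t"
  shows "xi_minus (cut m \<omega>) t = jump_state m \<omega>"
  using assms by (subst xi_minus_last[where m=m]) (auto simp: before_def jump_time_cut jump_state_cut)

section \<open>Measurability of path functionals\<close>

lemma measurable_path_state [measurable]:
  "(\<lambda>\<omega>. fst (\<omega> l)) \<in> (borel :: 's::{countable,discrete_topology} path measure) \<rightarrow>\<^sub>M count_space UNIV"
proof -
  have "(\<lambda>\<omega>::'s path. fst (\<omega> l)) \<in> borel \<rightarrow>\<^sub>M borel"
    by (rule measurable_compose[of "\<lambda>\<omega>. \<omega> l" borel borel])
       (auto intro!: measurable_product_then_coordinatewise borel_measurable_continuous_onI continuous_intros)
  then show ?thesis by (simp add: measurable_borel_discrete_iff)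
qed

lemma measurable_path_holding [measurable]:
  "(\<lambda>\<omega>. snd (\<omega> l)) \<in> (borel :: 's::{countable,discrete_topology} path measure) \<rightarrow>\<^sub>M borel"
  by (rule measurable_compose[of "\<lambda>\<omega>. \<omega> l" borel borel])
     (auto intro!: measurable_product_then_coordinatewise borel_measurable_continuous_onI continuous_intros)

text \<open>Borel measurability into the sequence space reduces to the coordinates, where states
  carry the discrete and holding times the usual Borel structure.\<close>

lemma measurable_into_path:
  fixes f :: "'b \<Rightarrow> 's::{countable,discrete_topology} path"
  assumes "\<And>l. (\<lambda>x. fst (f x l)) \<in> M \<rightarrow>\<^sub>M count_space UNIV" "\<And>l. (\<lambda>x. snd (f x l)) \<in> borel_measurable M"
  shows "f \<in> M \<rightarrow>\<^sub>M borel"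
proof (rule measurable_coordinatewise_then_product)
  fix l
  have "(\<lambda>x. (fst (f x l), snd (f x l))) \<in> M \<rightarrow>\<^sub>M borel"
    using assms by (intro borel_measurable_Pair) (simp_all add: measurable_borel_discrete_iff)
  then show "(\<lambda>x. f x l) \<in> M \<rightarrow>\<^sub>M borel" by simp
qed

lemma Omega_borel [measurable]: "(Omega :: 's::{countable,discrete_topology} path set) \<in> sets borel"
proof -
  have "{\<omega> \<in> space (borel :: 's path measure). fst (\<omega> 0) \<noteq> None \<and> (\<forall>l. 0 < snd (\<omega> l)) \<and>
     (\<forall>l. snd (\<omega> l) = \<infinity> \<longrightarrow> fst (\<omega> (Suc l)) = None \<and> snd (\<omega> (Suc l)) = \<infinity>) \<and>
     (\<forall>l. snd (\<omega> l) \<noteq> \<infinity> \<longrightarrow> fst (\<omega> (Suc l)) \<noteq> None)} \<in> sets borel"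
    by measurable
  also have "{\<omega> \<in> space (borel :: 's path measure). fst (\<omega> 0) \<noteq> None \<and> (\<forall>l. 0 < snd (\<omega> l)) \<and>
     (\<forall>l. snd (\<omega> l) = \<infinity> \<longrightarrow> fst (\<omega> (Suc l)) = None \<and> snd (\<omega> (Suc l)) = \<infinity>) \<and>
     (\<forall>l. snd (\<omega> l) \<noteq> \<infinity> \<longrightarrow> fst (\<omega> (Suc l)) \<noteq> None)} = Omega"
    by (rule set_eqI) (simp add: Omega_iff prod_eq_iff)
  finally show ?thesis .
qed

lemma space_path_space [simp]: "space path_space = Omega"
  by (simp add: path_space_def space_restrict_space)

lemma measurable_path_space_iff:
  fixes f :: "'b \<Rightarrow> 's::{countable,discrete_topology} path"
  shows "f \<in> M \<rightarrow>\<^sub>M path_space \<longleftrightarrow> f \<in> M \<rightarrow>\<^sub>M borel \<and> f \<in> space M \<rightarrow> Omega"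
  unfolding path_space_def by (auto simp: measurable_restrict_space2_iff)

lemma measurable_path_spaceD:
  "f \<in> borel \<rightarrow>\<^sub>M N \<Longrightarrow> f \<in> (path_space :: 's::{countable,discrete_topology} path measure) \<rightarrow>\<^sub>M N"
  unfolding path_space_def by (rule measurable_restrict_space1)

lemma measurable_jump_time_borel [measurable]:
  "jump_time m \<in> (borel :: 's::{countable,discrete_topology} path measure) \<rightarrow>\<^sub>M borel"
  unfolding jump_time_def by measurable

lemma measurable_jump_time [measurable]:
  "jump_time m \<in> (path_space :: 's::{countable,discrete_topology} path measure) \<rightarrow>\<^sub>M borel"
  by (rule measurable_path_spaceD) measurable

lemma measurable_jump_state_borel [measurable]:
  "jump_state m \<in> (borel :: 's::{countable,discrete_topology} path measure) \<rightarrow>\<^sub>M count_space UNIV"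
  unfolding jump_state_def by measurable

lemma measurable_jump_state [measurable]:
  "jump_state m \<in> (path_space :: 's::{countable,discrete_topology} path measure) \<rightarrow>\<^sub>M count_space UNIV"
  by (rule measurable_path_spaceD) measurable

lemma measurable_cut_borel [measurable]:
  "cut m \<in> (borel :: 's::{countable,discrete_topology} path measure) \<rightarrow>\<^sub>M borel"
proof (rule measurable_into_path)
  fix l
  have "(\<lambda>\<omega>::'s path. fst (cut m \<omega> l)) = (if l < m then (\<lambda>\<omega>. fst (\<omega> l)) else if l = m then (\<lambda>\<omega>. fst (\<omega> m)) else (\<lambda>_. None))"
    "(\<lambda>\<omega>::'s path. snd (cut m \<omega> l)) = (if l < m then (\<lambda>\<omega>. snd (\<omega> l)) else (\<lambda>_. \<infinity>))"
    by (auto simp: cut_def fun_eq_iff)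
  then show "(\<lambda>\<omega>. fst (cut m \<omega> l)) \<in> (borel :: 's path measure) \<rightarrow>\<^sub>M count_space UNIV"
     "(\<lambda>\<omega>. snd (cut m \<omega> l)) \<in> (borel :: 's path measure) \<rightarrow>\<^sub>M borel" by auto
qed

lemma measurable_cut [measurable]:
  "cut m \<in> (path_space :: 's::{countable,discrete_topology} path measure) \<rightarrow>\<^sub>M path_space"
  unfolding measurable_path_space_iff using measurable_path_spaceD[OF measurable_cut_borel] by auto

section \<open>The predictable sigma-algebra\<close>

lemma space_filt [simp]: "space (filt t) = Omega"
  by (simp add: filt_def space_measure_of_conv)

lemma space_filt_minus [simp]: "space (filt_minus t) = Omega"
  by (simp add: filt_minus_def space_measure_of_conv)

lemma space_predictable [simp]: "space predictable = Omega \<times> {0..}"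
  by (simp add: predictable_def space_measure_of_conv)

lemma Omega_times_predictable [simp]: "Omega \<times> {0..} \<in> sets predictable"
  using sets.top[of predictable] by simp

lemma sets_filt_eq:
  "sets (filt t) = sigma_sets Omega
     {{\<omega>\<in>Omega. jump_time m \<omega> \<le> ennreal s \<and> jump_state m \<omega> = Some j} | m s j. 0 \<le> s \<and> s \<le> t}"
  unfolding filt_def by (rule sets_measure_of) auto

lemma sets_filt_minus_eq: "sets (filt_minus s) = sigma_sets Omega (\<Union>t\<in>{0..<s}. sets (filt t))"
  unfolding filt_minus_def
proof (rule sets_measure_of, intro UN_least subsetI PowI)
  show "x \<in> Omega" if "A \<in> sets (filt t)" "x \<in> A" for A x t
    using sets.sets_into_space[OF that(1)] that(2) by auto
qed

lemma filt_in_filt_minus: "0 \<le> r \<Longrightarrow> r < s \<Longrightarrow> B \<in> sets (filt r) \<Longrightarrow> B \<in> sets (filt_minus s)"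
  unfolding sets_filt_minus_eq by (rule sigma_sets.Basic) auto

lemma sets_predictable_eq:
  "sets predictable = sigma_sets (Omega \<times> {0..})
     ({B \<times> {0} | B. B \<in> sets (filt 0)} \<union> {B \<times> {s<..} | B s. 0 < s \<and> B \<in> sets (filt_minus s)})"
  unfolding predictable_def
proof (rule sets_measure_of, intro Un_least subsetI PowI)
  fix A and x :: "'a path \<times> real"
  show "x \<in> Omega \<times> {0..}" if "A \<in> {B \<times> {0} | B. B \<in> sets (filt 0)}" "x \<in> A"
    using that sets.sets_into_space[of _ "filt 0"] by auto
  show "x \<in> Omega \<times> {0..}" if "A \<in> {B \<times> {s<..} | B s. 0 < s \<and> B \<in> sets (filt_minus s)}" "x \<in> A"
    using that sets.sets_into_space[of _ "filt_minus _"] by fastforce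
qed

lemma filt_generator:
  "0 \<le> s \<Longrightarrow> s \<le> t \<Longrightarrow> {\<omega>\<in>Omega. jump_time m \<omega> \<le> ennreal s \<and> jump_state m \<omega> = Some j} \<in> sets (filt t)"
  unfolding sets_filt_eq by (rule sigma_sets.Basic) auto

lemma sets_filt_path_space:
  "B \<in> sets (filt t) \<Longrightarrow> B \<in> sets (path_space :: 's::{countable,discrete_topology} path measure)"
proof -
  have "sets (filt t) \<subseteq> sets (path_space :: 's path measure)"
    unfolding sets_filt_eq
  proof (rule sets.sigma_sets_subset[of _ path_space, unfolded space_path_space], clarify)
    fix m :: nat and s :: real and j :: 's
    have "{\<omega> \<in> space path_space. jump_time m \<omega> \<le> ennreal s \<and> jump_state m \<omega> = Some j} \<in> sets path_space"
      by measurable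
    then show "{\<omega>\<in>Omega. jump_time m \<omega> \<le> ennreal s \<and> jump_state m \<omega> = Some j} \<in> sets path_space" by simp
  qed
  then show "B \<in> sets (filt t) \<Longrightarrow> B \<in> sets path_space" by auto
qed

lemma sets_filt_minus_path_space:
  "B \<in> sets (filt_minus t) \<Longrightarrow> B \<in> sets (path_space :: 's::{countable,discrete_topology} path measure)"
proof -
  have "sets (filt_minus t) \<subseteq> sets (path_space :: 's path measure)"
    unfolding sets_filt_minus_eq
    by (rule sets.sigma_sets_subset[of _ path_space, unfolded space_path_space]) (auto intro: sets_filt_path_space)
  then show "B \<in> sets (filt_minus t) \<Longrightarrow> B \<in> sets path_space" by auto
qed

abbreviation nonneg_time :: "real measure" where "nonneg_time \<equiv> restrict_space borel {0..}"

lemma sets_predictable_product: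
  "sets predictable \<subseteq> sets ((path_space :: 's::{countable,discrete_topology} path measure) \<Otimes>\<^sub>M nonneg_time)"
  unfolding sets_predictable_eq
proof (rule sets.sigma_sets_subset[of _ "path_space \<Otimes>\<^sub>M nonneg_time",
      unfolded space_pair_measure space_path_space space_restrict_space, simplified], intro Un_least subsetI)
  have sp: "{0} \<in> sets nonneg_time" "0 < s \<Longrightarrow> {s<..} \<in> sets nonneg_time" for s :: real
    by (auto simp: sets_restrict_space_iff)
  fix A :: "('s path \<times> real) set"
  show "A \<in> sets (path_space \<Otimes>\<^sub>M nonneg_time)" if "A \<in> {B \<times> {0} | B. B \<in> sets (filt 0)}"
    using that sp by (auto intro!: pair_measureI sets_filt_path_space)
  show "A \<in> sets (path_space \<Otimes>\<^sub>M nonneg_time)" if "A \<in> {B \<times> {s<..} | B s. 0 < s \<and> B \<in> sets (filt_minus s)}"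
    using that sp by (auto intro!: pair_measureI sets_filt_minus_path_space)
qed

lemma predictable_imp_product_measurable:
  fixes f :: "'s::{countable,discrete_topology} path \<times> real \<Rightarrow> 'b"
  assumes "f \<in> predictable \<rightarrow>\<^sub>M N" shows "f \<in> path_space \<Otimes>\<^sub>M nonneg_time \<rightarrow>\<^sub>M N"
proof (rule measurableI)
  fix x :: "'s path \<times> real" assume "x \<in> space (path_space \<Otimes>\<^sub>M nonneg_time)"
  then show "f x \<in> space N"
    using measurable_space[OF assms, of x] by (simp add: space_pair_measure space_restrict_space)
next
  fix A assume "A \<in> sets N"
  from measurable_sets[OF assms this] sets_predictable_product
  show "f -` A \<inter> space (path_space \<Otimes>\<^sub>M nonneg_time) \<in> sets (path_space \<Otimes>\<^sub>M nonneg_time)"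
    by (auto simp: space_pair_measure space_restrict_space)
qed

text \<open>The generators of \<open>filt r\<close> only speak of jumps up to time \<open>r\<close>.
  These survive stopping at a later \<open>t\<close>; for \<open>r = t = 0\<close> the only such
  jump is the start of the path, which stopping always keeps.\<close>

lemma filt_stopped:
  assumes B: "B \<in> sets (filt r)" and r: "r < t \<or> (r = 0 \<and> t = 0)" "0 \<le> r" and \<omega>: "\<omega> \<in> Omega"
  shows "stopped \<omega> t \<in> B \<longleftrightarrow> \<omega> \<in> B"
  using B unfolding sets_filt_eq
proof (induction rule: sigma_sets.induct)
  case (Basic a)
  then obtain m s j where a: "a = {\<omega>\<in>Omega. jump_time m \<omega> \<le> ennreal s \<and> jump_state m \<omega> = Some j}" "0 \<le> s" "s \<le> r"
    by auto
  have "before m \<omega> t" if "jump_time m \<omega> \<le> ennreal s"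
  proof (cases "m = 0")
    case False
    then have "0 < jump_time m \<omega>" using jump_time_pos[OF \<omega>] by simp
    with that a r have "s < t" by auto
    then have "ennreal s < ennreal t" using a by (simp add: ennreal_less_iff)
    with that show ?thesis by (auto simp: before_def dest: order.strict_trans1)
  qed simp
  then show ?case using \<omega> by (auto simp: a jump_time_stopped jump_state_stopped split: if_splits)
qed (use \<omega> in auto)

lemma filt_minus_stopped:
  assumes B: "B \<in> sets (filt_minus s)" and t: "s < t" and \<omega>: "\<omega> \<in> Omega"
  shows "stopped \<omega> t \<in> B \<longleftrightarrow> \<omega> \<in> B"
  using B unfolding sets_filt_minus_eq
proof (induction rule: sigma_sets.induct)
  case (Basic a)
  then show ?case using filt_stopped[of a _ t \<omega>] t \<omega> by auto
qed (use \<omega> in auto)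

text \<open>One half of a test of Galmarino type: it holds for the generators and is preserved under
  complements and countable unions.\<close>

lemma predictable_stopped:
  assumes B: "B \<in> sets predictable" and t: "0 \<le> t" and \<omega>: "\<omega> \<in> Omega"
  shows "(stopped \<omega> t, t) \<in> B \<longleftrightarrow> (\<omega>, t) \<in> B"
  using B unfolding sets_predictable_eq
proof (induction rule: sigma_sets.induct)
  case (Basic a)
  then show ?case using filt_stopped[of _ 0 0 \<omega>] filt_minus_stopped[OF _ _ \<omega>, of _ _ t] t \<omega> by auto
qed (use \<omega> t in auto)

text \<open>Singletons are closed in the target space, so the set version applies to the level set
  through the point in question.\<close>

lemma predictable_fun_stopped:
  fixes f :: "'s path \<times> real \<Rightarrow> 'b::t2_space"
  assumes f: "f \<in> borel_measurable predictable" and t: "0 \<le> t" and \<omega>: "\<omega> \<in> Omega"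
  shows "f (stopped \<omega> t, t) = f (\<omega>, t)"
proof -
  have "f -` {f (\<omega>, t)} \<inter> space predictable \<in> sets predictable"
    using f by (rule measurable_sets) simp
  from predictable_stopped[OF this t \<omega>] t \<omega> show ?thesis by simp
qed

lemma sets_predictable_open_ray:
  assumes "B \<in> sets (filt r)" "0 \<le> r" "r < s" shows "B \<times> {s<..} \<in> sets predictable"
  unfolding sets_predictable_eq
proof (intro sigma_sets.Basic UnI2 CollectI exI conjI)
  show "B \<in> sets (filt_minus s)" using assms by (intro filt_in_filt_minus[of r])
qed (use assms in auto)

text \<open>The generators of \<open>predictable\<close> contain half-lines only from a strictly
  positive time on; the half-line from 0 has to be exhausted by them.\<close>

lemma greaterThan_0_UN: "{0::real<..} = (\<Union>n::nat. {1 / Suc n<..})"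
proof (intro set_eqI iffI)
  fix x :: real assume "x \<in> {0<..}"
  then show "x \<in> (\<Union>n::nat. {1 / Suc n<..})" using nat_approx_posE[of x] by auto
next
  fix x :: real assume "x \<in> (\<Union>n::nat. {1 / Suc n<..})"
  then obtain n :: nat where "1 / real (Suc n) < x" by auto
  moreover have "0 < 1 / real (Suc n)" by simp
  ultimately show "x \<in> {0<..}" by (metis greaterThan_iff order.strict_trans)
qed

text \<open>These events determine the jump times and jump states of the stopped path, so stopping
  becomes a measurable map.\<close>

lemma predictable_jump_event:
  assumes "0 \<le> r"
  shows "{(\<omega>, t). \<omega> \<in> Omega \<and> 0 \<le> t \<and> before m \<omega> t \<and> jump_time m \<omega> \<le> ennreal r \<and> jump_state m \<omega> = Some j}
     \<in> sets predictable" (is "?S \<in> _")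
proof (cases "m = 0")
  case True
  let ?B = "{\<omega>\<in>Omega. jump_time 0 \<omega> \<le> ennreal 0 \<and> jump_state 0 \<omega> = Some j}"
  have "?S = ?B \<times> {0} \<union> ?B \<times> {0<..}"
    using True by auto
  also have "\<dots> = ?B \<times> {0} \<union> (\<Union>n::nat. ?B \<times> {1 / Suc n<..})"
    unfolding greaterThan_0_UN by blast
  finally have "?S = ?B \<times> {0} \<union> (\<Union>n::nat. ?B \<times> {1 / Suc n<..})" .
  moreover have "?B \<in> sets (filt 0)" by (rule filt_generator) auto
  then have "?B \<times> {0} \<in> sets predictable" "?B \<times> {1 / Suc n<..} \<in> sets predictable" for n :: nat
    using sets_predictable_open_ray[of ?B 0 "1 / Suc n"]
    by (auto simp: sets_predictable_eq intro!: sigma_sets.Basic)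
  ultimately show ?thesis by auto
next
  case False
  let ?B = "\<lambda>u. {\<omega>\<in>Omega. jump_time m \<omega> \<le> ennreal u \<and> jump_state m \<omega> = Some j}"
  let ?I = "{(u, v). u \<in> \<rat> \<and> v \<in> \<rat> \<and> 0 \<le> u \<and> u < v} :: (real \<times> real) set"
  \<comment> \<open>The strict inequality between the jump time and \<open>t\<close> is witnessed by
    two rationals: \<open>u\<close> after the jump, and a larger \<open>v\<close> below
    \<open>t\<close>, so that the event up to \<open>u\<close> already belongs to
    \<open>filt_minus v\<close>.\<close>
  have "?S = (\<Union>(u, v)\<in>?I. ?B (min u r) \<times> {v<..})"
  proof safe
    fix \<omega> :: "'a path" and t :: real
    assume *: "\<omega> \<in> Omega" "0 \<le> t" "before m \<omega> t" "jump_time m \<omega> \<le> ennreal r" "jump_state m \<omega> = Some j"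
    then have lt: "jump_time m \<omega> < ennreal t" using False by (simp add: before_def)
    then obtain x where x: "jump_time m \<omega> = ennreal x" "0 \<le> x"
      by (cases "jump_time m \<omega>") auto
    with lt have "x < t" by (simp add: ennreal_less_iff)
    from Rats_dense_in_real[OF this] obtain v where v: "v \<in> \<rat>" "x < v" "v < t" by auto
    from Rats_dense_in_real[OF v(2)] obtain u where u: "u \<in> \<rat>" "x < u" "u < v" by auto
    have "jump_time m \<omega> \<le> ennreal (min u r)" using x u * by (auto simp: min_def ennreal_leI)
    then have "(\<omega>, t) \<in> ?B (min u r) \<times> {v<..}" using * v by auto
    moreover have "(u, v) \<in> ?I" using u v x by auto
    ultimately show "(\<omega>, t) \<in> (\<Union>(u, v)\<in>?I. ?B (min u r) \<times> {v<..})" by blast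
  next
    fix \<omega> :: "'a path" and t u v :: real
    assume *: "\<omega> \<in> Omega" "u < v" "v < t" "0 \<le> u" "jump_time m \<omega> \<le> ennreal (min u r)"
    have "ennreal (min u r) < ennreal t" using * assms by (intro ennreal_lessI) auto
    with * show "before m \<omega> t" by (auto simp: before_def)
    show "jump_time m \<omega> \<le> ennreal r" using * order_trans[OF *(5) ennreal_leI[of "min u r" r]] by simp
  qed auto
  moreover have "countable ?I"
    by (rule countable_subset[of _ "\<rat> \<times> \<rat>"]) (auto intro: countable_rat)
  moreover have "?B (min u r) \<times> {v<..} \<in> sets predictable" if "(u, v) \<in> ?I" for u v
    using that assms by (intro sets_predictable_open_ray[of _ "min u r"] filt_generator) auto
  ultimately show ?thesis by (auto intro!: sets.countable_UN')
qed

lemma measurable_predictable_time: "snd \<in> predictable \<rightarrow>\<^sub>M nonneg_time"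
proof (rule measurable_restrict_space2)
  show "snd \<in> predictable \<rightarrow>\<^sub>M (borel :: real measure)"
  proof (rule borel_measurableI_greater)
    fix a :: real
    have *: "Omega \<times> {s<..} \<in> sets predictable" if "0 < s" for s
      using sets_predictable_open_ray[of Omega 0 s] sets.top[of "filt 0"] that by simp
    have "Omega \<times> {0<..} = (\<Union>n::nat. Omega \<times> {1 / Suc n<..})"
      unfolding greaterThan_0_UN by blast
    also have "\<dots> \<in> sets predictable"
      by (rule sets.countable_UN, rule image_subsetI, rule *) simp
    finally have 0: "Omega \<times> {0<..} \<in> sets predictable" .
    have eq: "{x \<in> space predictable. a < snd x} = (if a < 0 then space predictable else Omega \<times> {a<..})"
      by auto
    consider "a < 0" | "a = 0" | "a > 0" by linarith
    then show "{x \<in> space predictable. a < snd x} \<in> sets predictable"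
      unfolding eq using 0 * sets.top[of predictable] by cases simp_all
  qed
qed auto

text \<open>The core of the other half of the test: a product measurable function becomes
  predictable once it is evaluated on the stopped path.\<close>

lemma measurable_stopped:
  "(\<lambda>x. stopped (fst x) (snd x)) \<in> predictable \<rightarrow>\<^sub>M (path_space :: 's::{countable,discrete_topology} path measure)"
proof -
  have st: "(\<lambda>x::'s path \<times> real. jump_state m (stopped (fst x) (snd x))) \<in> predictable \<rightarrow>\<^sub>M count_space UNIV" for m
  proof -
    have ev: "{x \<in> space predictable. jump_state m (stopped (fst x) (snd x)) = Some j} \<in> sets predictable" for j :: 's
    proof -
      have "{x \<in> space predictable. jump_state m (stopped (fst x) (snd x)) = Some j} =
        (\<Union>n::nat. {(\<omega>, t). \<omega> \<in> Omega \<and> 0 \<le> t \<and> before m \<omega> t \<and> jump_time m \<omega> \<le> ennreal (real n) \<and> jump_state m \<omega> = Some j})"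
      proof safe
        fix \<omega> :: "'s path" and t assume *: "(\<omega>, t) \<in> space predictable" "jump_state m (stopped (fst (\<omega>, t)) (snd (\<omega>, t))) = Some j"
        then have "before m \<omega> t" by (auto simp: jump_state_stopped split: if_splits)
        from before_finite[OF this] obtain n :: nat where "jump_time m \<omega> \<le> ennreal (real n)"
          using ennreal_Ex_less_of_nat[of "jump_time m \<omega>"] by (auto simp: ennreal_of_nat_eq_real_of_nat dest: less_imp_le)
        then show "(\<omega>, t) \<in> (\<Union>n::nat. {(\<omega>, t). \<omega> \<in> Omega \<and> 0 \<le> t \<and> before m \<omega> t \<and> jump_time m \<omega> \<le> ennreal (real n) \<and> jump_state m \<omega> = Some j})"
          using * by (auto simp: jump_state_stopped split: if_splits)
      qed (auto simp: jump_state_stopped)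
      also have "\<dots> \<in> sets predictable" by (intro sets.countable_UN) (auto intro!: predictable_jump_event)
      finally show ?thesis .
    qed
    have "{x \<in> space predictable. jump_state m (stopped (fst x) (snd x)) = (None :: 's option)} \<in> sets predictable"
    proof -
      have "{x \<in> space predictable. jump_state m (stopped (fst x) (snd x)) = (None :: 's option)} =
        space predictable - (\<Union>j::'s. {x \<in> space predictable. jump_state m (stopped (fst x) (snd x)) = Some j})"
        by auto
      then show ?thesis using ev by (simp only:) (intro sets.Diff sets.countable_UN'; auto)
    qed
    with ev have ev': "{x \<in> space predictable. jump_state m (stopped (fst x) (snd x)) = y} \<in> sets predictable" for y :: "'s option"
      by (cases y) (simp_all del: space_predictable)
    show ?thesis
    proof (rule measurable_count_space_eq_countable[THEN iffD2], simp, intro conjI ballI)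
      fix y :: "'s option"
      have "(\<lambda>x. jump_state m (stopped (fst x) (snd x))) -` {y} \<inter> space predictable
        = {x \<in> space predictable. jump_state m (stopped (fst x) (snd x)) = y}" by blast
      then show "(\<lambda>x. jump_state m (stopped (fst x) (snd x))) -` {y} \<inter> space predictable \<in> sets predictable"
        using ev'[of y] by (simp only:)
    qed simp
  qed
  have tm: "(\<lambda>x::'s path \<times> real. jump_time m (stopped (fst x) (snd x))) \<in> borel_measurable predictable" for m
  proof (rule borel_measurableI_le)
    fix a :: ennreal
    show "{x::'s path \<times> real \<in> space predictable. jump_time m (stopped (fst x) (snd x)) \<le> a} \<in> sets predictable"
    proof (cases a)
      case (real r)
      have "{x::'s path \<times> real \<in> space predictable. jump_time m (stopped (fst x) (snd x)) \<le> a} =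
        (\<Union>j. {(\<omega>, t). \<omega> \<in> Omega \<and> 0 \<le> t \<and> before m \<omega> t \<and> jump_time m \<omega> \<le> ennreal r \<and> jump_state m \<omega> = Some j})"
        using real jump_state_finite[OF _ before_finite, of _ m]
        by (auto simp: jump_time_stopped top_unique split: if_splits)
      also have "\<dots> \<in> sets predictable" using real by (intro sets.countable_UN') (auto intro!: predictable_jump_event)
      finally show ?thesis .
    qed (simp del: space_predictable)
  qed
  \<comment> \<open>Also correct beyond the last jump: there the holding time is infinite, and in
    \<open>ennreal\<close> infinity minus infinity is infinity.\<close>
  have hold: "snd (\<omega> l) = jump_time (Suc l) \<omega> - jump_time l \<omega>" if "\<omega> \<in> Omega" for \<omega> :: "'s path" and l
    using path_infinite[OF that, of l] by (cases "jump_time l \<omega> = \<infinity>") (auto simp: jump_time_Suc)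
  show ?thesis unfolding measurable_path_space_iff
  proof (intro conjI measurable_into_path)
    fix l
    show "(\<lambda>x. fst (stopped (fst x) (snd x) l)) \<in> predictable \<rightarrow>\<^sub>M (count_space UNIV :: 's option measure)"
      using st[of l] by (simp add: jump_state_def)
    have "(\<lambda>x::'s path \<times> real. jump_time (Suc l) (stopped (fst x) (snd x)) - jump_time l (stopped (fst x) (snd x)))
        \<in> borel_measurable predictable" using tm by measurable
    then show "(\<lambda>x::'s path \<times> real. snd (stopped (fst x) (snd x) l)) \<in> borel_measurable predictable"
      by (rule measurable_cong[THEN iffD1, rotated]) (auto simp: hold)
  qed auto
qed

lemma predictable_stopped_comp:
  fixes f :: "'s::{countable,discrete_topology} path \<times> real \<Rightarrow> 'b"
  assumes "f \<in> path_space \<Otimes>\<^sub>M nonneg_time \<rightarrow>\<^sub>M N"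
  shows "(\<lambda>x. f (stopped (fst x) (snd x), snd x)) \<in> predictable \<rightarrow>\<^sub>M N"
  using measurable_stopped measurable_predictable_time assms
  by (intro measurable_compose[OF _ assms] measurable_Pair) auto

lemma predictableI_stopped:
  fixes f :: "'s::{countable,discrete_topology} path \<times> real \<Rightarrow> 'b"
  assumes "f \<in> path_space \<Otimes>\<^sub>M nonneg_time \<rightarrow>\<^sub>M N"
    and "\<And>\<omega> t. \<omega> \<in> Omega \<Longrightarrow> 0 \<le> t \<Longrightarrow> f (stopped \<omega> t, t) = f (\<omega>, t)"
  shows "f \<in> predictable \<rightarrow>\<^sub>M N"
  by (rule measurable_cong[THEN iffD1, OF _ predictable_stopped_comp[OF assms(1)]]) (use assms(2) in auto)

section \<open>Predictability of the left-limit process\<close>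

lemma measurable_before:
  "Measurable.pred ((path_space :: 's::{countable,discrete_topology} path measure) \<Otimes>\<^sub>M nonneg_time) (\<lambda>x. before m (fst x) (snd x))"
proof -
  have [measurable]: "(\<lambda>x. x) \<in> nonneg_time \<rightarrow>\<^sub>M borel" by (rule measurable_restrict_space1) simp
  have [measurable]: "snd \<in> (path_space :: 's path measure) \<Otimes>\<^sub>M nonneg_time \<rightarrow>\<^sub>M borel"
    by (rule measurable_compose[OF measurable_snd]) measurable
  show ?thesis unfolding before_def by measurable
qed

lemma measurable_xi_minus_product:
  "(\<lambda>x. xi_minus (fst x) (snd x)) \<in> (path_space :: 's::{countable,discrete_topology} path measure) \<Otimes>\<^sub>M nonneg_time \<rightarrow>\<^sub>M count_space UNIV"
    (is "?f \<in> ?M \<rightarrow>\<^sub>M _")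
proof -
  note [measurable] = measurable_before
  have ev: "{x \<in> space ?M. xi_minus (fst x) (snd x) = Some i} \<in> sets ?M" for i :: 's
  proof -
    have "{x \<in> space ?M. \<exists>m. before m (fst x) (snd x) \<and> \<not> before (Suc m) (fst x) (snd x) \<and> jump_state m (fst x) = Some i} \<in> sets ?M"
      by measurable
    also have "{x \<in> space ?M. \<exists>m. before m (fst x) (snd x) \<and> \<not> before (Suc m) (fst x) (snd x) \<and> jump_state m (fst x) = Some i}
      = {x \<in> space ?M. xi_minus (fst x) (snd x) = Some i}"
    proof (rule Collect_cong, rule conj_cong[OF refl])
      fix x :: "'s path \<times> real" assume "x \<in> space ?M"
      then show "(\<exists>m. before m (fst x) (snd x) \<and> \<not> before (Suc m) (fst x) (snd x) \<and> jump_state m (fst x) = Some i)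
        \<longleftrightarrow> xi_minus (fst x) (snd x) = Some i"
        by (intro xi_minus_eq_Some_iff[symmetric]) (auto simp: space_pair_measure space_restrict_space)
    qed
    finally show ?thesis .
  qed
  have "{x \<in> space ?M. xi_minus (fst x) (snd x) = None} = space ?M - (\<Union>i. {x \<in> space ?M. xi_minus (fst x) (snd x) = Some i})"
    by auto
  then have "{x \<in> space ?M. xi_minus (fst x) (snd x) = None} \<in> sets ?M"
    using ev by (simp only:) (intro sets.Diff sets.countable_UN'; auto)
  with ev have ev': "{x \<in> space ?M. xi_minus (fst x) (snd x) = y} \<in> sets ?M" for y
    by (cases y) auto
  show ?thesis
    by (rule measurable_count_space_eq_countable[THEN iffD2])
       (use ev' in \<open>simp_all add: vimage_def Int_def conj_commute\<close>)
qed

lemma measurable_xi_minus: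
  "(\<lambda>x. xi_minus (fst x) (snd x)) \<in> predictable \<rightarrow>\<^sub>M (count_space UNIV :: 's::{countable,discrete_topology} option measure)"
  by (rule predictableI_stopped[OF measurable_xi_minus_product]) (simp add: xi_minus_stopped)

section \<open>Indefinite integrals of bounded functions\<close>

text \<open>Summation over a partition finer than \<open>d\<close> bounds the total increment by
  \<open>e * (b - a)\<close>, for every \<open>e\<close>. It replaces the sign of the derivative for
  functions that are only absolutely continuous.\<close>

lemma le_of_small_increments:
  fixes H :: "real \<Rightarrow> real"
  assumes ab: "a \<le> b"
    and H: "\<And>e. 0 < e \<Longrightarrow> \<exists>d>0. \<forall>s t. a \<le> s \<longrightarrow> s \<le> t \<longrightarrow> t \<le> b \<longrightarrow> t - s < d \<longrightarrow> H t - H s \<le> e * (t - s)"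
  shows "H b \<le> H a"
proof (rule field_le_epsilon)
  fix e' :: real assume "0 < e'"
  \<comment> \<open>The summand 1 keeps the denominator positive when \<open>a = b\<close>.\<close>
  define e where "e = e' / (b - a + 1)"
  have e: "0 < e" "e * (b - a) \<le> e'" using ab \<open>0 < e'\<close> by (auto simp: e_def field_simps)
  from H[OF e(1)] obtain d where d: "0 < d"
    "\<And>s t. a \<le> s \<Longrightarrow> s \<le> t \<Longrightarrow> t \<le> b \<Longrightarrow> t - s < d \<Longrightarrow> H t - H s \<le> e * (t - s)" by blast
  obtain n :: nat where n: "(b - a) / d < real n" using reals_Archimedean2 by blast
  have "0 \<le> (b - a) / d" using ab d by simp
  with n have n0: "0 < real n" by linarith
  define h where "h = (b - a) / n"
  have h: "0 \<le> h" "h < d" "h * n = b - a" using n n0 d ab by (auto simp: h_def field_simps)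
  have "H (a + k * h) \<le> H a + e * (k * h)" if "k \<le> n" for k :: nat
    using that
  proof (induction k)
    case (Suc k)
    have "real (Suc k) * h \<le> n * h" using Suc h by (intro mult_right_mono) auto
    then have "H (a + Suc k * h) - H (a + k * h) \<le> e * ((a + Suc k * h) - (a + k * h))"
      using h by (intro d(2)) (auto simp: algebra_simps)
    with Suc show ?case by (simp add: algebra_simps)
  qed simp
  from this[of n] h e show "H b \<le> H a + e'" by (simp add: mult.commute)
qed

lemma bounded_measurable_integrable_on:
  fixes g :: "real \<Rightarrow> real"
  assumes "g \<in> borel_measurable borel" "\<And>x. x \<in> {s..t} \<Longrightarrow> \<bar>g x\<bar> \<le> C"
  shows "g integrable_on {s..t}"
proof (rule measurable_bounded_by_integrable_imp_integrable)
  show "g \<in> borel_measurable (lebesgue_on {s..t})"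
    using assms(1) by (intro measurable_restrict_space1 measurable_completion) simp
qed (use assms in auto)

lemma nn_integral_eq_integral_interval:
  fixes g :: "real \<Rightarrow> real"
  assumes "g integrable_on {s..t}" "\<And>x. 0 \<le> g x"
  shows "(\<integral>\<^sup>+x. ennreal (g x) * indicator {s..t} x \<partial>lborel) = ennreal (integral {s..t} g)"
  using nn_integral_has_integral_lebesgue[OF assms(2) integrable_integral[OF assms(1)]]
  by (simp add: mult.commute ennreal_mult'' flip: ennreal_indicator)

text \<open>As \<open>g\<close> is merely measurable, \<open>F\<close> need not be differentiable
  everywhere and the fundamental theorem does not apply directly. Instead the difference of the two
  sides, as a function of the upper limit, is shown to have increments of second order, hence to be
  constant.\<close>

lemma integral_chain_rule:
  fixes g :: "real \<Rightarrow> real"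
  assumes g: "g \<in> borel_measurable borel" "\<And>x. 0 \<le> g x" "\<And>x. g x \<le> C"
    and F: "\<And>t. F t = integral {a..t} g"
    and \<phi>: "\<And>x. (\<phi> has_real_derivative \<phi>' x) (at x)" "\<phi>' \<in> borel_measurable borel"
    and lip: "\<And>x y. 0 \<le> x \<Longrightarrow> x \<le> y \<Longrightarrow> y \<le> F b \<Longrightarrow> \<bar>\<phi>' y - \<phi>' x\<bar> \<le> K * (y - x)"
    and ab: "a \<le> b"
  shows "integral {a..b} (\<lambda>s. g s * \<phi>' (F s)) = \<phi> (F b) - \<phi> 0"
proof -
  have C: "0 \<le> C" using g(2,3) order_trans by blast
  have gi: "g integrable_on {s..t}" for s t
    by (rule bounded_measurable_integrable_on[OF g(1), of _ _ C]) (use g in auto)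
  have Fc: "continuous_on {a..b} F"
    using indefinite_integral_continuous_1[OF gi[of a b]] by (simp add: F[abs_def])
  have Fd: "F t - F s = integral {s..t} g" if "a \<le> s" "s \<le> t" for s t
    using Henstock_Kurzweil_Integration.integral_combine[of a s t g] that gi by (simp add: F)
  have F0: "0 \<le> integral {s..t} g" for s t using g(2) gi by (intro integral_nonneg) auto
  have Flip: "integral {s..t} g \<le> C * (t - s)" if "s \<le> t" for s t
    using integral_le[OF gi[of s t] integrable_const_ivl[of C]] g(3) that by (simp add: mult.commute)
  \<comment> \<open>If \<open>F b = 0\<close>, the Lipschitz assumption puts no restriction on the
    sign of \<open>K\<close>.\<close>
  define K' where "K' = max K 0"
  have lip': "\<bar>\<phi>' y - \<phi>' x\<bar> \<le> K' * (y - x)" if "0 \<le> x" "x \<le> y" "y \<le> F b" for x y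
    using lip[OF that] mult_right_mono[of K K' "y - x"] that by (auto simp: K'_def)
  \<comment> \<open>Clamping the argument to \<open>{a..b}\<close> makes \<open>f\<close> bounded
    and measurable on the whole line; on \<open>{a..b}\<close> it changes nothing.\<close>
  define f where "f s = g s * \<phi>' (F (max a (min b s)))" for s
  have Fmono: "F s \<le> F t" if "a \<le> s" "s \<le> t" for s t using Fd[OF that] F0[of s t] by simp
  have Fm: "(\<lambda>s. F (max a (min b s))) \<in> borel_measurable borel"
    by (intro borel_measurable_continuous_onI continuous_on_compose2[OF Fc] continuous_intros) (use ab in auto)
  have fm: "f \<in> borel_measurable borel" unfolding f_def using Fm g(1) \<phi>(2) by measurable
  have Fa: "F a = 0" by (simp add: F)
  have Fr: "0 \<le> F s \<and> F s \<le> F b" if "a \<le> s" "s \<le> b" for s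
    using Fmono[of a s] Fmono[of s b] that Fa by auto
  have fb: "\<bar>f s\<bar> \<le> C * (\<bar>\<phi>' 0\<bar> + K' * F b)" for s
  proof -
    let ?x = "F (max a (min b s))"
    have x: "0 \<le> ?x" "?x \<le> F b" using Fr[of "max a (min b s)"] ab by auto
    from lip'[of 0 ?x] x have "\<bar>\<phi>' ?x - \<phi>' 0\<bar> \<le> K' * ?x" by simp
    also have "\<dots> \<le> K' * F b" using x by (intro mult_left_mono) (auto simp: K'_def)
    finally have "\<bar>\<phi>' ?x\<bar> \<le> \<bar>\<phi>' 0\<bar> + K' * F b" by linarith
    then show ?thesis unfolding f_def abs_mult using g(2,3)[of s] C by (intro mult_mono) auto
  qed
  have fi: "f integrable_on {s..t}" for s t
    by (rule bounded_measurable_integrable_on[OF fm]) (use fb in auto)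
  define H where "H t = \<phi> (F t) - integral {a..t} f" for t
  \<comment> \<open>By the mean value theorem the increment of \<phi> along \<open>F\<close> is
    \<open>\<phi>' z\<close> times the integral of \<open>g\<close>. Replacing \<open>z\<close> by
    \<open>F u\<close> under the integral costs at most \<open>K' * (C * (t - s))\<close>.\<close>
  have step: "\<bar>H t - H s\<bar> \<le> (K' * C * C) * (t - s) * (t - s)" if st: "a \<le> s" "s \<le> t" "t \<le> b" for s t
  proof -
    have "\<exists>z. F s \<le> z \<and> z \<le> F t \<and> \<phi> (F t) - \<phi> (F s) = (F t - F s) * \<phi>' z"
    proof (cases "F s = F t")
      case False
      then have "F s < F t" using Fmono[of s t] that by simp
      from MVT2[OF this, of \<phi> \<phi>'] \<phi>(1) show ?thesis by (metis less_imp_le)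
    qed auto
    then obtain z where z: "F s \<le> z" "z \<le> F t" "\<phi> (F t) - \<phi> (F s) = (F t - F s) * \<phi>' z" by blast
    have "H t - H s = \<phi> (F t) - \<phi> (F s) - integral {s..t} f"
      using Henstock_Kurzweil_Integration.integral_combine[of a s t f] that fi by (simp add: H_def)
    also have "\<dots> = integral {s..t} (\<lambda>u. g u * \<phi>' z - f u)"
      using z gi fi Fd[OF st(1,2)] by (subst Henstock_Kurzweil_Integration.integral_diff) (auto intro: integrable_on_mult_left)
    finally have "\<bar>H t - H s\<bar> = norm (integral {s..t} (\<lambda>u. g u * \<phi>' z - f u))" by simp
    also have "\<dots> \<le> integral {s..t} (\<lambda>u. C * (K' * (C * (t - s))))"
    proof (rule integral_norm_bound_integral)
      fix u assume u: "u \<in> {s..t}"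
      then have m: "max a (min b u) = u" using st by auto
      have Fu: "F s \<le> F u" "F u \<le> F t" using Fmono[of s u] Fmono[of u t] u st by auto
      have "\<bar>\<phi>' z - \<phi>' (F u)\<bar> \<le> K' * \<bar>z - F u\<bar>"
        using lip'[of z "F u"] lip'[of "F u" z] z Fu Fr[of s] Fr[of t] st by (cases "z \<le> F u") auto
      also have "\<dots> \<le> K' * (C * (t - s))"
        using Fu z Fd[OF st(1,2)] Flip[OF st(2)] by (intro mult_left_mono) (auto simp: K'_def)
      finally have "\<bar>g u\<bar> * \<bar>\<phi>' z - \<phi>' (F u)\<bar> \<le> C * (K' * (C * (t - s)))"
        using g(2,3)[of u] C by (intro mult_mono) auto
      then show "norm (g u * \<phi>' z - f u) \<le> C * (K' * (C * (t - s)))"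
        by (simp add: f_def m abs_mult[symmetric] right_diff_distrib)
    qed (use gi fi in \<open>auto intro!: integrable_diff integrable_on_mult_left\<close>)
    also have "\<dots> = (K' * C * C) * (t - s) * (t - s)" using st by simp
    finally show ?thesis .
  qed
  have small: "\<exists>d>0. \<forall>s t. a \<le> s \<longrightarrow> s \<le> t \<longrightarrow> t \<le> b \<longrightarrow> t - s < d \<longrightarrow> \<bar>H t - H s\<bar> \<le> e * (t - s)"
    if "0 < e" for e
  proof (intro exI[of _ "e / (K' * C * C + 1)"] conjI allI impI)
    have P: "0 < K' * C * C + 1" using C by (intro add_nonneg_pos mult_nonneg_nonneg) (auto simp: K'_def)
    then show "0 < e / (K' * C * C + 1)" using that by simp
    fix s t assume st: "a \<le> s" "s \<le> t" "t \<le> b" "t - s < e / (K' * C * C + 1)"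
    then have "(K' * C * C + 1) * (t - s) \<le> e" using P by (simp add: field_simps)
    then have "(K' * C * C) * (t - s) \<le> e" using st by (simp add: algebra_simps)
    then have "(K' * C * C) * (t - s) * (t - s) \<le> e * (t - s)" using st by (intro mult_right_mono) auto
    with step[OF st(1-3)] show "\<bar>H t - H s\<bar> \<le> e * (t - s)" by simp
  qed
  have "H b \<le> H a"
  proof (rule le_of_small_increments[OF ab])
    fix e :: real assume "0 < e" from small[OF this]
    show "\<exists>d>0. \<forall>s t. a \<le> s \<longrightarrow> s \<le> t \<longrightarrow> t \<le> b \<longrightarrow> t - s < d \<longrightarrow> H t - H s \<le> e * (t - s)"
      by (meson abs_le_D1)
  qed
  moreover have "- H b \<le> - H a"
  proof (rule le_of_small_increments[OF ab])
    fix e :: real assume "0 < e" from small[OF this]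
    show "\<exists>d>0. \<forall>s t. a \<le> s \<longrightarrow> s \<le> t \<longrightarrow> t \<le> b \<longrightarrow> t - s < d \<longrightarrow> - H t - - H s \<le> e * (t - s)"
      by (elim ex_forward conjE, intro conjI) (auto simp: abs_le_iff)
  qed
  ultimately have "H b = H a" by simp
  moreover have "integral {a..b} f = integral {a..b} (\<lambda>s. g s * \<phi>' (F s))"
    by (rule integral_cong) (auto simp: f_def min_def max_def)
  ultimately show ?thesis by (simp add: H_def F)
qed

text \<open>The integrals of the derivatives of \<open>exp (F t)\<close> and
  \<open>exp (- F t)\<close>, arranged as sums. The growing exponential is used to extract the
  sojourn law from the compensator, the decaying one to compute the law of the next jump.\<close>

lemma
  fixes f :: "real \<Rightarrow> ennreal"
  assumes f: "f \<in> borel_measurable borel" "\<And>s. f s \<le> ennreal C" and ab: "a \<le> b"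
    and F: "\<And>t. F t = enn2real (\<integral>\<^sup>+s. f s * indicator {a..t} s \<partial>lborel)"
  shows nn_integral_rate_exp:
      "(\<integral>\<^sup>+s. f s * ennreal (exp (F s)) * indicator {a..b} s \<partial>lborel) + 1 = ennreal (exp (F b))"
    and nn_integral_rate_exp_minus:
      "(\<integral>\<^sup>+s. f s * ennreal (exp (- F s)) * indicator {a..b} s \<partial>lborel) + ennreal (exp (- F b)) = 1"
proof -
  define g where "g s = enn2real (f s)" for s
  have fg: "f s = ennreal (g s)" for s
    unfolding g_def using le_less_trans[OF f(2)] by (intro ennreal_enn2real[symmetric]) auto
  define C' where "C' = max C 0"
  have g: "g \<in> borel_measurable borel" "\<And>x. 0 \<le> g x" "\<And>x. g x \<le> C'"
  proof -
    show "g \<in> borel_measurable borel" unfolding g_def using f(1) by measurable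
    show "0 \<le> g x" for x by (simp add: g_def)
    show "g x \<le> C'" for x using f(2)[of x] unfolding fg C'_def by (cases "0 \<le> C") (auto simp: ennreal_neg g_def)
  qed
  have gi: "g integrable_on {s..t}" for s t
    by (rule bounded_measurable_integrable_on[OF g(1), of _ _ C']) (use g in auto)
  have F': "F t = integral {a..t} g" for t
    unfolding F fg using nn_integral_eq_integral_interval[OF gi g(2)] gi g(2)
    by (simp add: integral_nonneg)
  have Fm: "F \<in> borel_measurable borel"
  proof -
    have "(\<lambda>t. \<integral>\<^sup>+s. f s * indicator {x. a \<le> fst x \<and> fst x \<le> snd x} (s, t) \<partial>lborel) \<in> borel_measurable borel"
      using f(1) by measurable
    then show ?thesis unfolding F[abs_def] by (simp add: indicator_def)
  qed
  have Fpos: "0 \<le> F t" for t by (simp add: F)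
  have Fle: "F s \<le> F b" if "s \<le> b" for s
    unfolding F' using that gi g by (intro integral_subset_le) auto
  have elip: "\<bar>exp y - exp x\<bar> \<le> exp y * (y - x)" if "x \<le> y" for x y :: real
  proof -
    have "exp y * (1 + (x - y)) \<le> exp y * exp (x - y)"
      by (intro mult_left_mono exp_ge_add_one_self) simp
    then show ?thesis using that by (simp add: exp_diff algebra_simps)
  qed
  \<comment> \<open>On \<open>[0, F b]\<close> the exponential is Lipschitz with constant
    \<open>exp (F b)\<close>; for the decaying one below, the constant 1 suffices.\<close>
  have 1: "integral {a..b} (\<lambda>s. g s * exp (F s)) = exp (F b) - exp 0"
  proof (rule integral_chain_rule[where C=C' and K="exp (F b)", OF g F'])
    show "\<bar>exp y - exp x\<bar> \<le> exp (F b) * (y - x)" if "0 \<le> x" "x \<le> y" "y \<le> F b" for x y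
      using elip[OF that(2)] mult_right_mono[of "exp y" "exp (F b)" "y - x"] that by simp
  qed (use ab in \<open>auto intro!: derivative_eq_intros\<close>)
  have 2: "integral {a..b} (\<lambda>s. g s * - exp (- F s)) = exp (- F b) - exp (- 0)"
  proof (rule integral_chain_rule[where C=C' and K=1 and \<phi>'="\<lambda>x. - exp (- x)", OF g F'])
    show "\<bar>- exp (- y) - - exp (- x)\<bar> \<le> 1 * (y - x)" if "0 \<le> x" "x \<le> y" "y \<le> F b" for x y
      using elip[of "- y" "- x"] mult_right_mono[of "exp (- x)" 1 "y - x"] that by simp
  qed (use ab in \<open>auto intro!: derivative_eq_intros\<close>)
  have i1: "(\<lambda>s. g s * exp (F s)) integrable_on {a..b}"
    by (rule bounded_measurable_integrable_on[where C="C' * exp (F b)"])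
       (use g Fm Fle in \<open>auto simp: abs_mult intro!: mult_mono order_trans[OF g(2,3)]\<close>)
  have i2: "(\<lambda>s. g s * exp (- F s)) integrable_on {a..b}"
  proof (rule bounded_measurable_integrable_on)
    show "\<bar>g x * exp (- F x)\<bar> \<le> C' * 1" for x
      unfolding abs_mult using g(2,3)[of x] Fpos[of x] order_trans[OF g(2,3)] by (intro mult_mono) auto
  qed (use g(1) Fm in measurable)
  show "(\<integral>\<^sup>+s. f s * ennreal (exp (F s)) * indicator {a..b} s \<partial>lborel) + 1 = ennreal (exp (F b))"
    using nn_integral_eq_integral_interval[OF i1] g(2) 1 Fpos[of b]
    by (simp add: fg ennreal_mult' flip: ennreal_1 ennreal_plus del: ennreal_1)
  show "(\<integral>\<^sup>+s. f s * ennreal (exp (- F s)) * indicator {a..b} s \<partial>lborel) + ennreal (exp (- F b)) = 1"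
  proof -
    have "0 \<le> integral {a..b} (\<lambda>s. g s * exp (- F s))" using i2 g(2) by (intro integral_nonneg) auto
    then show ?thesis using nn_integral_eq_integral_interval[OF i2] g(2) 2
      by (simp add: fg ennreal_mult' flip: ennreal_1 ennreal_plus del: ennreal_1)
  qed
qed

text \<open>The integrated form of \<open>\<bar>x\<bar>' \<le> \<bar>\<beta>\<bar> - \<alpha> \<bar>x\<bar>\<close>. Since \<open>x\<close> is only absolutely continuous, the increments
  over short intervals are compared instead of derivatives.\<close>

lemma linear_integral_equation_abs_bound:
  fixes x \<alpha> \<beta> :: "real \<Rightarrow> real"
  assumes T: "0 \<le> T" and \<alpha>: "\<alpha> \<in> borel_measurable borel" "\<And>s. 0 \<le> \<alpha> s" "\<And>s. \<alpha> s \<le> K"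
    and \<beta>: "\<beta> absolutely_integrable_on {0..T}"
    and x: "x \<in> borel_measurable borel" "\<And>s. \<bar>x s\<bar> \<le> B"
      "\<And>t. 0 \<le> t \<Longrightarrow> t \<le> T \<Longrightarrow> x t = integral {0..t} (\<lambda>s. \<beta> s - \<alpha> s * x s)"
  shows "\<bar>x T\<bar> + integral {0..T} (\<lambda>s. \<alpha> s * \<bar>x s\<bar>) \<le> integral {0..T} (\<lambda>s. \<bar>\<beta> s\<bar>)"
proof -
  have K: "0 \<le> K" using \<alpha> order_trans by blast
  have B: "0 \<le> B" using x(2) abs_ge_zero order_trans by blast
  have ax: "\<bar>\<alpha> s * x s\<bar> \<le> K * B" "\<bar>\<alpha> s * \<bar>x s\<bar>\<bar> \<le> K * B" for s
    using mult_mono[OF \<alpha>(3)[of s] x(2)[of s] K] \<alpha>(2)[of s] by (auto simp: abs_mult)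
  have ai: "\<alpha> integrable_on {s..t}" for s t
    by (rule bounded_measurable_integrable_on[OF \<alpha>(1), of _ _ K]) (use \<alpha> in auto)
  have axi: "(\<lambda>s. \<alpha> s * x s) integrable_on {s..t}" for s t
    by (rule bounded_measurable_integrable_on[OF _ ax(1)]) (use \<alpha>(1) x(1) in measurable)
  have aai: "(\<lambda>s. \<alpha> s * \<bar>x s\<bar>) integrable_on {s..t}" for s t
    by (rule bounded_measurable_integrable_on[OF _ ax(2)]) (use \<alpha>(1) x(1) in measurable)
  have sub: "{s..t} \<subseteq> {0..T}" if "0 \<le> s" "t \<le> T" for s t using that by auto
  have bi: "\<beta> integrable_on {s..t}" "(\<lambda>s. \<bar>\<beta> s\<bar>) integrable_on {s..t}" if "0 \<le> s" "t \<le> T" for s t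
  proof -
    have "\<beta> absolutely_integrable_on {s..t}" by (rule set_integrable_subset[OF \<beta>]) (use sub[OF that] in auto)
    then show "\<beta> integrable_on {s..t}" "(\<lambda>s. \<bar>\<beta> s\<bar>) integrable_on {s..t}"
      by (auto simp: absolutely_integrable_on_def)
  qed
  have yi: "(\<lambda>s. \<beta> s - \<alpha> s * x s) integrable_on {s..t}" if "0 \<le> s" "t \<le> T" for s t
    using bi[OF that] axi by (intro integrable_diff)
  have xc: "continuous_on {0..T} x"
  proof -
    have "continuous_on {0..T} (\<lambda>t. integral {0..t} (\<lambda>s. \<beta> s - \<alpha> s * x s))"
      by (rule indefinite_integral_continuous_1[OF yi]) auto
    then show ?thesis by (rule continuous_on_cong[THEN iffD1, rotated -1]) (auto simp: x(3))
  qed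
  define H where "H t = \<bar>x t\<bar> + integral {0..t} (\<lambda>s. \<alpha> s * \<bar>x s\<bar>) - integral {0..t} (\<lambda>s. \<bar>\<beta> s\<bar>)" for t
  have "H T \<le> H 0"
  proof (rule le_of_small_increments[OF T])
    fix e :: real assume e: "0 < e"
    \<comment> \<open>The oscillation of \<open>x\<close> over a short interval is paid twice, each
      time with weight \<open>K * (t - s)\<close>: once in the equation for \<open>x\<close> and
      once in the integral of \<open>\<alpha> * \<bar>x\<bar>\<close>.\<close>
    define e' where "e' = e / (2 * K + 1)"
    have e': "0 < e'" "2 * K * e' \<le> e" using e K by (auto simp: e'_def field_simps)
    have "uniformly_continuous_on {0..T} x" using xc by (intro compact_uniformly_continuous) auto
    from this[unfolded uniformly_continuous_on_def, rule_format, OF e'(1)]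
    obtain d where d: "0 < d" "\<And>s t. s \<in> {0..T} \<Longrightarrow> t \<in> {0..T} \<Longrightarrow> \<bar>t - s\<bar> < d \<Longrightarrow> \<bar>x t - x s\<bar> < e'"
      by (auto simp: dist_real_def)
    \<comment> \<open>The second bound gives \<open>A \<le> 1\<close> for the integral
      \<open>A\<close> of \<alpha> over \<open>{s..t}\<close>, so that \<open>1 - A\<close> is
      nonnegative and may be pulled out of the absolute value.\<close>
    define d' where "d' = min d (1 / (K + 1))"
    show "\<exists>d>0. \<forall>s t. 0 \<le> s \<longrightarrow> s \<le> t \<longrightarrow> t \<le> T \<longrightarrow> t - s < d \<longrightarrow> H t - H s \<le> e * (t - s)"
    proof (intro exI[of _ d'] conjI allI impI)
      show "0 < d'" using d K by (auto simp: d'_def)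
      fix s t assume st: "0 \<le> s" "s \<le> t" "t \<le> T" "t - s < d'"
      have osc: "\<bar>x u - x s\<bar> \<le> e'" if "u \<in> {s..t}" for u
        using d(2)[of s u] that st by (auto simp: d'_def less_imp_le)
      define A where "A = integral {s..t} \<alpha>"
      have A: "0 \<le> A" "A \<le> 1"
      proof -
        show "0 \<le> A" unfolding A_def using ai \<alpha> by (intro integral_nonneg) auto
        have "A \<le> K * (t - s)"
          unfolding A_def using integral_le[OF ai[of s t] integrable_const_ivl[of K]] \<alpha> st by (simp add: mult.commute)
        also have "\<dots> \<le> K * (1 / (K + 1))" using st K by (intro mult_left_mono) (auto simp: d'_def)
        also have "\<dots> \<le> 1" using K by simp
        finally show "A \<le> 1" .
      qed
      have comb: "integral {0..t} f - integral {0..s} f = integral {s..t} f"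
        if "\<And>u v. 0 \<le> u \<Longrightarrow> v \<le> T \<Longrightarrow> f integrable_on {u..v}" for f :: "real \<Rightarrow> real"
        using Henstock_Kurzweil_Integration.integral_combine[of 0 s t f] that[of 0 t] st by simp
      have "x t - x s = integral {s..t} (\<lambda>s. \<beta> s - \<alpha> s * x s)"
        using x(3)[of t] x(3)[of s] comb[OF yi] st by auto
      also have "\<dots> = integral {s..t} (\<lambda>u. \<beta> u - (\<alpha> u * x s + \<alpha> u * (x u - x s)))"
        by (simp add: algebra_simps)
      also have "\<dots> = integral {s..t} \<beta> - (A * x s + integral {s..t} (\<lambda>u. \<alpha> u * (x u - x s)))"
      proof -
        have i1: "(\<lambda>u. \<alpha> u * x s) integrable_on {s..t}" using ai by (rule integrable_on_mult_left)
        have i2: "(\<lambda>u. \<alpha> u * (x u - x s)) integrable_on {s..t}"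
          unfolding right_diff_distrib by (intro integrable_diff axi i1)
        show ?thesis using bi(1)[of s t] st i1 i2
          by (subst Henstock_Kurzweil_Integration.integral_diff)
             (auto simp: Henstock_Kurzweil_Integration.integral_add A_def intro!: integrable_add)
      qed
      \<comment> \<open>One Euler step with the exact integrals of \<alpha> and \<beta>: the damping
        factor is \<open>1 - A\<close>, and the remainder only involves the oscillation of
        \<open>x\<close>.\<close>
      finally have xt: "x t = (1 - A) * x s + integral {s..t} \<beta> - integral {s..t} (\<lambda>u. \<alpha> u * (x u - x s))"
        by (simp add: algebra_simps)
      have r1: "\<bar>integral {s..t} (\<lambda>u. \<alpha> u * (x u - x s))\<bar> \<le> K * e' * (t - s)"
      proof -
        have i1: "(\<lambda>u. \<alpha> u * x s) integrable_on {s..t}" using ai by (rule integrable_on_mult_left)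
        have "norm (integral {s..t} (\<lambda>u. \<alpha> u * (x u - x s))) \<le> integral {s..t} (\<lambda>u. K * e')"
        proof (rule integral_norm_bound_integral)
          show "(\<lambda>u. \<alpha> u * (x u - x s)) integrable_on {s..t}"
            unfolding right_diff_distrib by (intro integrable_diff axi i1)
          show "norm (\<alpha> u * (x u - x s)) \<le> K * e'" if "u \<in> {s..t}" for u
            using \<alpha>(2,3)[of u] osc[OF that] K by (auto simp: abs_mult intro!: mult_mono)
        qed (rule integrable_const_ivl)
        then show ?thesis using st by (simp add: mult_ac)
      qed
      have r2: "\<bar>integral {s..t} \<beta>\<bar> \<le> integral {s..t} (\<lambda>u. \<bar>\<beta> u\<bar>)"
        using integral_norm_bound_integral[of \<beta> "{s..t}" "\<lambda>u. \<bar>\<beta> u\<bar>"] bi[of s t] st by simp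
      have r3: "integral {s..t} (\<lambda>u. \<alpha> u * \<bar>x u\<bar>) \<le> A * \<bar>x s\<bar> + K * e' * (t - s)"
      proof -
        have i1: "(\<lambda>u. \<alpha> u * \<bar>x s\<bar>) integrable_on {s..t}" using ai by (rule integrable_on_mult_left)
        have "integral {s..t} (\<lambda>u. \<alpha> u * \<bar>x u\<bar>) \<le> integral {s..t} (\<lambda>u. \<alpha> u * \<bar>x s\<bar> + K * e')"
        proof (rule integral_le)
          fix u assume u: "u \<in> {s..t}"
          have "\<alpha> u * \<bar>x u\<bar> \<le> \<alpha> u * (\<bar>x s\<bar> + e')" using osc[OF u] \<alpha>(2) by (intro mult_left_mono) auto
          also have "\<dots> \<le> \<alpha> u * \<bar>x s\<bar> + K * e'"
            using mult_right_mono[OF \<alpha>(3)[of u], of e'] e' by (simp add: algebra_simps)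
          finally show "\<alpha> u * \<bar>x u\<bar> \<le> \<alpha> u * \<bar>x s\<bar> + K * e'" .
        qed (use aai i1 in \<open>auto intro!: integrable_add\<close>)
        also have "\<dots> = A * \<bar>x s\<bar> + K * e' * (t - s)"
          using i1 st by (subst Henstock_Kurzweil_Integration.integral_add) (auto simp: A_def mult.commute)
        finally show ?thesis .
      qed
      have "\<bar>(1 - A) * x s\<bar> = \<bar>x s\<bar> - A * \<bar>x s\<bar>" using A by (simp only: abs_mult) (simp add: algebra_simps)
      then have "\<bar>x t\<bar> \<le> \<bar>x s\<bar> - A * \<bar>x s\<bar> + integral {s..t} (\<lambda>u. \<bar>\<beta> u\<bar>) + K * e' * (t - s)"
        using xt r1 r2 by linarith
      then have "H t - H s \<le> (2 * K * e') * (t - s)"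
        using r3 comb[OF aai] comb[OF bi(2)] unfolding H_def by linarith
      also have "\<dots> \<le> e * (t - s)" using e' st by (intro mult_right_mono) auto
      finally show "H t - H s \<le> e * (t - s)" .
    qed
  qed
  moreover have "x 0 = 0" using x(3)[of 0] T by simp
  ultimately show ?thesis by (simp add: H_def)
qed

section \<open>Multivariate point processes with a given intensity\<close>

lemma nn_integral_count_measure_swap:
  fixes f :: "'s::countable \<Rightarrow> 'b \<Rightarrow> ennreal"
  assumes "sigma_finite_measure M" "\<And>i. f i \<in> borel_measurable M"
  shows "(\<integral>\<^sup>+i. \<integral>\<^sup>+s. f i s \<partial>M \<partial>count_space UNIV) = (\<integral>\<^sup>+s. \<integral>\<^sup>+i. f i s \<partial>count_space UNIV \<partial>M)"
proof -
  interpret cs: sigma_finite_measure "count_space (UNIV :: 's set)" by (rule sigma_finite_measure_count_space)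
  interpret M: sigma_finite_measure M by fact
  interpret pair_sigma_finite "count_space (UNIV :: 's set)" M ..
  have "case_prod f \<in> borel_measurable (count_space UNIV \<Otimes>\<^sub>M M)"
  proof (rule measurable_pair_measure_countable1)
    show "(\<lambda>t. case_prod f (j, t)) \<in> borel_measurable M" for j
      using assms(2)[of j] by simp
  qed (rule countableI_type)
  from Fubini'[OF this] show ?thesis by (rule sym)
qed

lemma measurable_nn_integral_count_space [measurable (raw)]:
  fixes f :: "'b \<Rightarrow> 's::countable \<Rightarrow> ennreal"
  assumes "\<And>j. (\<lambda>x. f x j) \<in> borel_measurable M"
  shows "(\<lambda>x. \<integral>\<^sup>+j. f x j \<partial>count_space UNIV) \<in> borel_measurable M"
proof -
  interpret sigma_finite_measure "count_space (UNIV :: 's set)" by (rule sigma_finite_measure_count_space)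
  have "(\<lambda>p. f (fst p) (snd p)) \<in> borel_measurable (M \<Otimes>\<^sub>M count_space UNIV)"
    by (rule measurable_compose_countable[where f="\<lambda>j p. f (fst p) j" and g=snd])
       (auto intro: measurable_compose[OF measurable_fst assms])
  then show ?thesis by (intro borel_measurable_nn_integral) (simp add: case_prod_unfold)
qed

lemma measurable_pair_countable_iff:
  fixes f :: "'b \<times> 's::countable \<Rightarrow> 'c"
  shows "f \<in> M \<Otimes>\<^sub>M count_space UNIV \<rightarrow>\<^sub>M N \<longleftrightarrow> (\<forall>j. (\<lambda>x. f (x, j)) \<in> M \<rightarrow>\<^sub>M N)"
proof (intro iffI allI)
  fix j assume "f \<in> M \<Otimes>\<^sub>M count_space UNIV \<rightarrow>\<^sub>M N"
  then show "(\<lambda>x. f (x, j)) \<in> M \<rightarrow>\<^sub>M N" by (rule measurable_compose[rotated]) measurable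
next
  assume *: "\<forall>j. (\<lambda>x. f (x, j)) \<in> M \<rightarrow>\<^sub>M N"
  have "(\<lambda>p. f (fst p, snd p)) \<in> M \<Otimes>\<^sub>M count_space UNIV \<rightarrow>\<^sub>M N"
    by (rule measurable_compose_countable[where f="\<lambda>j p. f (fst p, j)" and g=snd])
       (auto intro: measurable_compose[OF measurable_fst] *[rule_format])
  then show "f \<in> M \<Otimes>\<^sub>M count_space UNIV \<rightarrow>\<^sub>M N" by simp
qed

text \<open>Predictable functions live on nonnegative times. The guard yields functions on the whole
  line; it may also discard time 0, since jumps and compensators live on strictly positive
  times.\<close>

lemma measurable_predictable_compose:
  fixes u :: "('s::{countable,discrete_topology} path \<times> real) \<Rightarrow> ennreal"
  assumes "u \<in> borel_measurable predictable" "f \<in> M \<rightarrow>\<^sub>M path_space" "g \<in> borel_measurable M"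
  shows "(\<lambda>x. if 0 < g x then u (f x, g x) else 0) \<in> borel_measurable M"
proof -
  have "(\<lambda>x. (f x, max 0 (g x))) \<in> M \<rightarrow>\<^sub>M path_space \<Otimes>\<^sub>M nonneg_time"
    using assms(2,3) by (intro measurable_Pair measurable_restrict_space2) auto
  from measurable_compose[OF this predictable_imp_product_measurable[OF assms(1)]]
  have "(\<lambda>x. if 0 < g x then u (f x, max 0 (g x)) else 0) \<in> borel_measurable M"
    using assms(3) by measurable
  then show ?thesis by (rule measurable_cong[THEN iffD1, rotated]) (simp add: max_def)
qed

lemma nn_integral_mu:
  fixes g :: "real \<times> 's \<Rightarrow> ennreal"
  assumes \<omega>: "\<omega> \<in> Omega" and g: "g \<in> borel_measurable (restrict_space borel {0<..} \<Otimes>\<^sub>M count_space UNIV)"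
  shows "(\<integral>\<^sup>+x. g x \<partial>mu \<omega>) = (\<Sum>n. if jump_time (Suc n) \<omega> < \<infinity>
      then g (enn2real (jump_time (Suc n) \<omega>), the (jump_state (Suc n) \<omega>)) else 0)"
proof -
  let ?A = "{m. 1 \<le> m \<and> jump_time m \<omega> < \<infinity>}"
  let ?f = "\<lambda>m. (enn2real (jump_time m \<omega>), the (jump_state m \<omega>))"
  have "(\<integral>\<^sup>+x. g x \<partial>mu \<omega>) = (\<integral>\<^sup>+m. g (?f m) \<partial>count_space ?A)"
    unfolding mu_def
  proof (rule nn_integral_distr)
    show "g \<in> borel_measurable (distr (count_space ?A) (restrict_space borel {0<..} \<Otimes>\<^sub>M count_space UNIV) ?f)"
      using g by simp
    show "?f \<in> count_space ?A \<rightarrow>\<^sub>M restrict_space borel {0<..} \<Otimes>\<^sub>M count_space UNIV"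
      using jump_time_pos[OF \<omega>]
      by (auto simp: measurable_count_space_eq1 space_pair_measure space_restrict_space enn2real_positive_iff)
  qed
  also have "\<dots> = (\<integral>\<^sup>+n. g (?f (Suc n)) \<partial>count_space {n. jump_time (Suc n) \<omega> < \<infinity>})"
  proof (rule nn_integral_bij_count_space[symmetric])
    have "m \<in> Suc ` {n. jump_time (Suc n) \<omega> < \<infinity>}" if "m \<in> ?A" for m
      using that by (intro image_eqI[of _ _ "m - 1"]) auto
    then show "bij_betw Suc {n. jump_time (Suc n) \<omega> < \<infinity>} ?A"
      unfolding bij_betw_def by fastforce
  qed
  also have "\<dots> = (\<integral>\<^sup>+n. (if jump_time (Suc n) \<omega> < \<infinity> then g (?f (Suc n)) else 0) \<partial>count_space UNIV)"
    by (subst nn_integral_count_space_indicator) (auto intro!: nn_integral_cong simp: indicator_def)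
  finally show ?thesis by (simp add: nn_integral_count_space_nat)
qed

text \<open>The bound depends only on the current state, hence is constant on each sojourn while
  jumps may still accumulate. The last assumption switches the intensity off after
  explosion.\<close>

locale jump_intensity =
  fixes r :: "'s::{countable,discrete_topology} path \<Rightarrow> real \<Rightarrow> 's \<Rightarrow> ennreal" and K :: "'s \<Rightarrow> real"
  assumes r_predictable: "\<And>j. (\<lambda>x. r (fst x) (snd x) j) \<in> borel_measurable predictable"
    and r_bound: "\<And>\<omega> t i. \<omega> \<in> Omega \<Longrightarrow> 0 \<le> t \<Longrightarrow> xi_minus \<omega> t = Some i \<Longrightarrow>
          (\<integral>\<^sup>+j. r \<omega> t j \<partial>count_space UNIV) \<le> ennreal (K i)"
    and r_None: "\<And>\<omega> t j. \<omega> \<in> Omega \<Longrightarrow> 0 \<le> t \<Longrightarrow> xi_minus \<omega> t = None \<Longrightarrow> r \<omega> t j = 0"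
begin

definition comp_measure :: "'s path \<Rightarrow> (real \<times> 's) measure" where
  "comp_measure \<omega> = density (restrict_space lborel {0<..} \<Otimes>\<^sub>M count_space UNIV) (\<lambda>(t, j). r \<omega> t j)"

text \<open>Setting the intensity to 0 off the positive times lets all integrals run over the full
  Lebesgue measure.\<close>

definition rp :: "'s path \<Rightarrow> real \<Rightarrow> 's \<Rightarrow> ennreal" where
  "rp \<omega> t j = (if 0 < t then r \<omega> t j else 0)"

text \<open>The total intensity after the \<open>m\<close>-th jump, and the probability that the sojourn which it starts
  lasts at least until \<open>t\<close>. Both are meant for paths stopped at the \<open>m\<close>-th jump.\<close>

definition total_rate :: "nat \<Rightarrow> 's path \<Rightarrow> real \<Rightarrow> ennreal" where
  "total_rate m h t = (if jump_time m h < ennreal t then (\<integral>\<^sup>+j. rp h t j \<partial>count_space UNIV) else 0)"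

definition cum_rate :: "nat \<Rightarrow> 's path \<Rightarrow> real \<Rightarrow> real" where
  "cum_rate m h t = enn2real (\<integral>\<^sup>+s. total_rate m h s * indicator {0..t} s \<partial>lborel)"

definition survival :: "nat \<Rightarrow> 's path \<Rightarrow> real \<Rightarrow> ennreal" where
  "survival m h t = ennreal (exp (- cum_rate m h t))"

lemma measurable_rp [measurable (raw)]:
  "f \<in> M \<rightarrow>\<^sub>M path_space \<Longrightarrow> g \<in> borel_measurable M \<Longrightarrow> (\<lambda>x. rp (f x) (g x) j) \<in> borel_measurable M"
  unfolding rp_def using measurable_predictable_compose[OF r_predictable[of j], of f M g] by (simp only: fst_conv snd_conv)

lemma measurable_total_rate [measurable (raw)]:
  assumes [measurable]: "f \<in> M \<rightarrow>\<^sub>M path_space" "g \<in> borel_measurable M"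
  shows "(\<lambda>x. total_rate m (f x) (g x)) \<in> borel_measurable M"
  unfolding total_rate_def by measurable

lemma measurable_cum_rate [measurable (raw)]:
  assumes [measurable]: "f \<in> M \<rightarrow>\<^sub>M path_space" "g \<in> borel_measurable M"
  shows "(\<lambda>x. cum_rate m (f x) (g x)) \<in> borel_measurable M"
proof -
  have "(\<lambda>x. enn2real (\<integral>\<^sup>+s. (if 0 \<le> s \<and> s \<le> g x then total_rate m (f x) s else 0) \<partial>lborel)) \<in> borel_measurable M"
    by measurable
  also have "(\<lambda>x. enn2real (\<integral>\<^sup>+s. (if 0 \<le> s \<and> s \<le> g x then total_rate m (f x) s else 0) \<partial>lborel)) = (\<lambda>x. cum_rate m (f x) (g x))"
    unfolding cum_rate_def by (intro ext arg_cong[where f=enn2real] nn_integral_cong) (auto simp: indicator_def)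
  finally show ?thesis .
qed

lemma measurable_survival [measurable (raw)]:
  assumes [measurable]: "f \<in> M \<rightarrow>\<^sub>M path_space" "g \<in> borel_measurable M"
  shows "(\<lambda>x. survival m (f x) (g x)) \<in> borel_measurable M"
  unfolding survival_def by measurable

lemma r_stopped: "\<omega> \<in> Omega \<Longrightarrow> 0 \<le> t \<Longrightarrow> r (stopped \<omega> t) t j = r \<omega> t j"
  using predictable_fun_stopped[OF r_predictable, of t \<omega> j] by simp

text \<open>After the jump \<open>m\<close> the cut path never leaves its state \<open>i\<close>, so
  \<open>K i\<close> bounds the rate for all later times. If the jump does not happen, the guard in
  \<open>total_rate\<close> makes the rate 0.\<close>

lemma total_rate_bound:
  assumes "h \<in> Omega"
  shows "\<exists>C. \<forall>s. total_rate m (cut m h) s \<le> ennreal C"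
proof (cases "jump_state m h")
  case None
  then have "jump_time m h = \<infinity>" using jump_state_finite[OF assms, of m] by (metis infinity_ennreal_def top.not_eq_extremum)
  then show ?thesis by (auto simp: total_rate_def jump_time_cut)
next
  case (Some i)
  have "total_rate m (cut m h) s \<le> ennreal (K i)" for s
  proof (cases "jump_time m h < ennreal s")
    case True
    then have "0 < s" by (metis ennreal_neg not_le not_less_zero)
    moreover from True have "before m h s" by (simp add: before_def)
    ultimately show ?thesis
      using r_bound[of "cut m h" s i] xi_minus_cut[OF assms, of s m] assms Some
      by (simp add: total_rate_def jump_time_cut rp_def)
  qed (simp add: total_rate_def jump_time_cut)
  then show ?thesis by blast
qed

lemma
  assumes h: "h \<in> Omega" and t: "0 \<le> t"
  shows total_rate_exp: "(\<integral>\<^sup>+s. total_rate m (cut m h) s * ennreal (exp (cum_rate m (cut m h) s)) * indicator {0..t} s \<partial>lborel) + 1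
          = ennreal (exp (cum_rate m (cut m h) t))" (is ?A)
    and total_rate_survival: "(\<integral>\<^sup>+s. total_rate m (cut m h) s * survival m (cut m h) s * indicator {0..t} s \<partial>lborel) + survival m (cut m h) t = 1" (is ?B)
proof -
  from total_rate_bound[OF h] obtain C where C: "\<And>s. total_rate m (cut m h) s \<le> ennreal C" by blast
  have m: "total_rate m (cut m h) \<in> borel_measurable borel"
    using measurable_total_rate[of "\<lambda>_. cut m h" borel "\<lambda>x. x" m] h by simp
  show ?A by (rule nn_integral_rate_exp[OF m C t]) (simp add: cum_rate_def)
  show ?B unfolding survival_def by (rule nn_integral_rate_exp_minus[OF m C t]) (simp add: cum_rate_def)
qed

lemma cum_rate_mono:
  assumes h: "h \<in> Omega" and st: "s \<le> t"
  shows "cum_rate m (cut m h) s \<le> cum_rate m (cut m h) t"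
proof -
  from total_rate_bound[OF h] obtain C where C: "\<And>s. total_rate m (cut m h) s \<le> ennreal C" by blast
  have "(\<integral>\<^sup>+s. total_rate m (cut m h) s * indicator {0..t} s \<partial>lborel) \<le> (\<integral>\<^sup>+s. ennreal C * indicator {0..t} s \<partial>lborel)"
    using C by (intro nn_integral_mono) (auto simp: indicator_def)
  also have "\<dots> < \<infinity>" by (cases "0 \<le> t") (auto simp: nn_integral_cmult ennreal_mult_less_top)
  finally show ?thesis unfolding cum_rate_def using st
    by (intro enn2real_mono nn_integral_mono) (auto simp: indicator_def)
qed

text \<open>\<open>jump_mark m F\<close> evaluates the mark \<open>F\<close> at the jump \<open>m + 1\<close>, \<open>jump_comp m F\<close> is its compensator along the
  path, and \<open>jump_law m F\<close> its conditional mean given the path up to the jump \<open>m\<close>.\<close>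

definition jump_mark :: "nat \<Rightarrow> ('s path \<Rightarrow> real \<Rightarrow> 's \<Rightarrow> ennreal) \<Rightarrow> 's path \<Rightarrow> ennreal" where
  "jump_mark m F \<omega> = (if jump_time (Suc m) \<omega> < \<infinity>
     then F (cut m \<omega>) (enn2real (jump_time (Suc m) \<omega>)) (the (jump_state (Suc m) \<omega>)) else 0)"

definition jump_comp :: "nat \<Rightarrow> ('s path \<Rightarrow> real \<Rightarrow> 's \<Rightarrow> ennreal) \<Rightarrow> 's path \<Rightarrow> ennreal" where
  "jump_comp m F \<omega> = (\<integral>\<^sup>+t. (if jump_time m \<omega> < ennreal t \<and> ennreal t \<le> jump_time (Suc m) \<omega>
     then (\<integral>\<^sup>+j. rp (cut m \<omega>) t j * F (cut m \<omega>) t j \<partial>count_space UNIV) else 0) \<partial>lborel)"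

definition jump_law :: "nat \<Rightarrow> ('s path \<Rightarrow> real \<Rightarrow> 's \<Rightarrow> ennreal) \<Rightarrow> 's path \<Rightarrow> ennreal" where
  "jump_law m F h = (\<integral>\<^sup>+t. (if jump_time m h < ennreal t
     then survival m h t * (\<integral>\<^sup>+j. rp h t j * F h t j \<partial>count_space UNIV) else 0) \<partial>lborel)"

text \<open>Product measurability takes the place of predictability here: a mark is only ever
  evaluated at a cut path, which carries no information about the jump to come.\<close>

definition meas_mark :: "('s path \<Rightarrow> real \<Rightarrow> 's \<Rightarrow> ennreal) \<Rightarrow> bool" where
  "meas_mark F \<longleftrightarrow> (\<forall>j. (\<lambda>x. F (fst x) (snd x) j) \<in> borel_measurable (path_space \<Otimes>\<^sub>M borel))"

lemma meas_markD:
  assumes "meas_mark F" "f \<in> M \<rightarrow>\<^sub>M path_space" "g \<in> borel_measurable M"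
  shows "(\<lambda>x. F (f x) (g x) j) \<in> borel_measurable M"
proof -
  have "(\<lambda>x. (f x, g x)) \<in> M \<rightarrow>\<^sub>M path_space \<Otimes>\<^sub>M borel" using assms by simp
  from measurable_compose[OF this assms(1)[unfolded meas_mark_def, rule_format, of j]] show ?thesis
    by (simp only: fst_conv snd_conv)
qed

lemma measurable_jump_mark [measurable]:
  assumes F: "meas_mark F" shows "jump_mark m F \<in> borel_measurable path_space"
proof -
  note [measurable (raw)] = meas_markD[OF F]
  have [measurable]: "(\<lambda>\<omega>. the (jump_state (Suc m) \<omega>)) \<in> path_space \<rightarrow>\<^sub>M (count_space UNIV :: 's measure)"
    by (rule measurable_compose[OF measurable_jump_state]) simp
  have "(\<lambda>\<omega>. F (cut m \<omega>) (enn2real (jump_time (Suc m) \<omega>)) (the (jump_state (Suc m) \<omega>))) \<in> borel_measurable path_space"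
    by (rule measurable_compose_countable[where g="\<lambda>\<omega>. the (jump_state (Suc m) \<omega>)"]) measurable
  then show ?thesis unfolding jump_mark_def[abs_def] by measurable
qed

lemma measurable_jump_comp [measurable]:
  assumes F: "meas_mark F" shows "jump_comp m F \<in> borel_measurable path_space"
proof -
  note [measurable (raw)] = meas_markD[OF F]
  show ?thesis unfolding jump_comp_def[abs_def] by measurable
qed

lemma measurable_jump_law [measurable]:
  assumes F: "meas_mark F" shows "jump_law m F \<in> borel_measurable path_space"
proof -
  note [measurable (raw)] = meas_markD[OF F]
  show ?thesis unfolding jump_law_def[abs_def] by measurable
qed

section \<open>The compensator identity, jump by jump\<close>

definition mark_of :: "(('s path \<times> real) \<times> 's \<Rightarrow> ennreal) \<Rightarrow> 's path \<Rightarrow> real \<Rightarrow> 's \<Rightarrow> ennreal" where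
  "mark_of W h t j = (if 0 < t then W ((h, t), j) else 0)"

lemma meas_mark_of:
  assumes "W \<in> borel_measurable (predictable \<Otimes>\<^sub>M count_space UNIV)"
  shows "meas_mark (mark_of W)"
  unfolding meas_mark_def mark_of_def
  using measurable_predictable_compose[of "\<lambda>x. W (x, _)", OF assms[unfolded measurable_pair_countable_iff, rule_format] measurable_fst measurable_snd]
  by simp

lemma predictable_section:
  fixes u :: "('s path \<times> real) \<Rightarrow> ennreal"
  assumes "u \<in> borel_measurable predictable" "\<omega> \<in> Omega"
  shows "(\<lambda>t. u (\<omega>, t)) \<in> borel_measurable (restrict_space borel {0<..})"
proof -
  have "(\<lambda>t. if 0 < t then u (\<omega>, t) else 0) \<in> borel_measurable borel"
    using measurable_predictable_compose[OF assms(1), of "\<lambda>_. \<omega>" borel "\<lambda>t. t"] assms(2) by simp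
  then have "(\<lambda>t. if 0 < t then u (\<omega>, t) else 0) \<in> borel_measurable (restrict_space borel {0<..})"
    by (rule measurable_restrict_space1)
  then show ?thesis by (rule measurable_cong[THEN iffD1, rotated]) (simp add: space_restrict_space)
qed

text \<open>At the time of the jump \<open>n + 1\<close> that jump itself is not yet before
  \<open>t\<close>, so the stopped path is \<open>cut n \<omega>\<close>, and a predictable
  integrand sees nothing else.\<close>

lemma nn_integral_mu_marks:
  assumes W: "W \<in> borel_measurable (predictable \<Otimes>\<^sub>M count_space UNIV)" and \<omega>: "\<omega> \<in> Omega"
  shows "(\<integral>\<^sup>+(t, j). W ((\<omega>, t), j) \<partial>mu \<omega>) = (\<Sum>n. jump_mark n (mark_of W) \<omega>)"
proof -
  note Wj = W[unfolded measurable_pair_countable_iff, rule_format]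
  have "(\<integral>\<^sup>+(t, j). W ((\<omega>, t), j) \<partial>mu \<omega>) = (\<Sum>n. if jump_time (Suc n) \<omega> < \<infinity>
      then W ((\<omega>, enn2real (jump_time (Suc n) \<omega>)), the (jump_state (Suc n) \<omega>)) else 0)"
    using predictable_section[OF Wj \<omega>]
    by (subst nn_integral_mu[OF \<omega>]) (auto simp: measurable_pair_countable_iff)
  also have "\<dots> = (\<Sum>n. jump_mark n (mark_of W) \<omega>)"
  proof (rule arg_cong[where f=suminf], rule ext)
    fix n
    show "(if jump_time (Suc n) \<omega> < \<infinity>
      then W ((\<omega>, enn2real (jump_time (Suc n) \<omega>)), the (jump_state (Suc n) \<omega>)) else 0) = jump_mark n (mark_of W) \<omega>"
    proof (cases "jump_time (Suc n) \<omega> < \<infinity>")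
      case True
      define t where "t = enn2real (jump_time (Suc n) \<omega>)"
      have t: "0 < t" "ennreal t = jump_time (Suc n) \<omega>"
        using True jump_time_pos[OF \<omega>, of "Suc n"] by (auto simp: t_def enn2real_positive_iff)
      have "jump_time n \<omega> < jump_time (Suc n) \<omega>"
        using jump_time_less_Suc[OF \<omega>, of n] le_less_trans[OF jump_time_mono[of n "Suc n" \<omega>] True] by simp
      then have "stopped \<omega> t = cut n \<omega>" using t by (intro stopped_eq_cut) (auto simp: before_def)
      then show ?thesis using True predictable_fun_stopped[OF Wj, of t \<omega>] t \<omega>
        by (auto simp: jump_mark_def mark_of_def t_def[symmetric])
    qed (simp add: jump_mark_def)
  qed
  finally show ?thesis .
qed

lemma between_iff:
  assumes "0 < t"
  shows "jump_time n \<omega> < ennreal t \<and> ennreal t \<le> jump_time (Suc n) \<omega> \<longleftrightarrow> before n \<omega> t \<and> \<not> before (Suc n) \<omega> t"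
  using assms by (auto simp: before_def not_less)

lemma nn_integral_comp_measure:
  assumes g: "g \<in> borel_measurable (restrict_space borel {0<..} \<Otimes>\<^sub>M count_space UNIV)" and \<omega>: "\<omega> \<in> Omega"
  shows "(\<integral>\<^sup>+x. g x \<partial>comp_measure \<omega>) = (\<integral>\<^sup>+t. (if 0 < t then \<integral>\<^sup>+j. r \<omega> t j * g (t, j) \<partial>count_space UNIV else 0) \<partial>lborel)"
proof -
  interpret cs: sigma_finite_measure "count_space (UNIV :: 's set)" by (rule sigma_finite_measure_count_space)
  let ?M = "restrict_space lborel {0<..} \<Otimes>\<^sub>M count_space (UNIV :: 's set)"
  have sM: "sets ?M = sets (restrict_space borel {0<..} \<Otimes>\<^sub>M count_space UNIV)"
    by (intro sets_pair_measure_cong) (auto simp: sets_restrict_space)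
  have rm: "(\<lambda>(t, j). r \<omega> t j) \<in> borel_measurable ?M"
    unfolding measurable_cong_sets[OF sM refl] measurable_pair_countable_iff
    using predictable_section[OF r_predictable \<omega>] by simp
  have gm: "g \<in> borel_measurable ?M" using g unfolding measurable_cong_sets[OF sM refl] .
  have "(\<integral>\<^sup>+x. g x \<partial>comp_measure \<omega>) = (\<integral>\<^sup>+x. (case x of (t, j) \<Rightarrow> r \<omega> t j) * g x \<partial>?M)"
    unfolding comp_measure_def by (rule nn_integral_density[OF rm gm])
  also have "\<dots> = (\<integral>\<^sup>+t. \<integral>\<^sup>+j. r \<omega> t j * g (t, j) \<partial>count_space UNIV \<partial>restrict_space lborel {0<..})"
    using rm gm by (subst cs.nn_integral_fst[symmetric]) auto
  also have "\<dots> = (\<integral>\<^sup>+t. (if 0 < t then \<integral>\<^sup>+j. r \<omega> t j * g (t, j) \<partial>count_space UNIV else 0) \<partial>lborel)"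
    by (subst nn_integral_restrict_space) (auto intro!: nn_integral_cong simp: indicator_def)
  finally show ?thesis .
qed

text \<open>The intervals between successive jump times, open on the left and closed on the right,
  exhaust the positive times before explosion; from explosion on the intensity vanishes.\<close>

lemma nn_integral_comp_measure_marks:
  assumes W: "W \<in> borel_measurable (predictable \<Otimes>\<^sub>M count_space UNIV)" and \<omega>: "\<omega> \<in> Omega"
  shows "(\<integral>\<^sup>+(t, j). W ((\<omega>, t), j) \<partial>comp_measure \<omega>) = (\<Sum>n. jump_comp n (mark_of W) \<omega>)"
proof -
  note Wj = W[unfolded measurable_pair_countable_iff, rule_format]
  note [measurable (raw)] = meas_markD[OF meas_mark_of[OF W]]
  have [simp]: "\<omega> \<in> space path_space" using \<omega> by simp
  have pt: "(if 0 < t then \<integral>\<^sup>+j. r \<omega> t j * W ((\<omega>, t), j) \<partial>count_space UNIV else 0) =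
     (\<Sum>n. if jump_time n \<omega> < ennreal t \<and> ennreal t \<le> jump_time (Suc n) \<omega>
       then (\<integral>\<^sup>+j. rp (cut n \<omega>) t j * mark_of W (cut n \<omega>) t j \<partial>count_space UNIV) else 0)" (is "?L = (\<Sum>n. ?g n)") for t
  proof (cases "0 < t")
    case t: True
    then have t0: "0 \<le> t" by simp
    show ?thesis
    proof (rule before_cases[of \<omega> t])
      assume b: "\<And>m. before m \<omega> t"
      then have "?g n = 0" for n unfolding between_iff[OF t] by simp
      moreover have "xi_minus \<omega> t = None" using xi_minus_exploded[OF \<omega> t0 b] .
      ultimately show ?thesis using r_None[OF \<omega> t0] by simp
    next
      fix m assume b: "before m \<omega> t" "\<not> before (Suc m) \<omega> t"
      then have g: "?g n = (if n = m then (\<integral>\<^sup>+j. rp (cut n \<omega>) t j * mark_of W (cut n \<omega>) t j \<partial>count_space UNIV) else 0)" for n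
      proof (cases "n = m")
        case False
        then have "\<not> (before n \<omega> t \<and> \<not> before (Suc n) \<omega> t)" using before_last_unique[OF b, of n] by blast
        with False show ?thesis unfolding between_iff[OF t] by (simp only: if_False)
      qed (use b in \<open>simp add: between_iff[OF t]\<close>)
      have "(\<Sum>n. ?g n) = ?g m" unfolding g by (subst suminf_finite[of "{m}"]) simp_all
      also have "\<dots> = ?L"
        unfolding g using r_stopped[OF \<omega> t0] predictable_fun_stopped[OF Wj t0 \<omega>] t
        by (simp add: stopped_eq_cut[OF b] rp_def mark_of_def)
      finally show ?thesis by simp
    qed
  qed (simp add: ennreal_neg)
  have "(\<integral>\<^sup>+(t, j). W ((\<omega>, t), j) \<partial>comp_measure \<omega>) =
      (\<integral>\<^sup>+t. (if 0 < t then \<integral>\<^sup>+j. r \<omega> t j * W ((\<omega>, t), j) \<partial>count_space UNIV else 0) \<partial>lborel)"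
    using predictable_section[OF Wj \<omega>]
    by (subst nn_integral_comp_measure[OF _ \<omega>]) (auto simp: measurable_pair_countable_iff)
  also have "\<dots> = (\<Sum>n. jump_comp n (mark_of W) \<omega>)"
    unfolding pt jump_comp_def using \<omega> by (subst nn_integral_suminf) measurable
  finally show ?thesis .
qed

text \<open>Both the intensity and the integrand at a time \<open>s \<le> t\<close> depend on the
  path stopped at \<open>s\<close> only, so the integral up to \<open>t\<close> depends on the path
  stopped at \<open>t\<close>.\<close>

lemma predictable_comp_measure: "predictable_random_measure comp_measure"
  unfolding predictable_random_measure_def
proof (intro allI impI)
  fix W :: "('s path \<times> real) \<times> 's \<Rightarrow> ennreal"
  assume W: "W \<in> borel_measurable (predictable \<Otimes>\<^sub>M count_space UNIV)"
  note Wj = W[unfolded measurable_pair_countable_iff, rule_format]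
  note [measurable (raw)] = meas_markD[OF meas_mark_of[OF W]]
  let ?G = "\<lambda>x. \<integral>\<^sup>+s. (if s \<le> snd x then \<integral>\<^sup>+j. rp (fst x) s j * mark_of W (fst x) s j \<partial>count_space UNIV else 0) \<partial>lborel"
  have [measurable]: "snd \<in> (path_space :: 's path measure) \<Otimes>\<^sub>M nonneg_time \<rightarrow>\<^sub>M borel"
    by (rule measurable_compose[OF measurable_snd]) (rule measurable_restrict_space1, simp)
  have "?G \<in> borel_measurable predictable"
  proof (rule predictableI_stopped)
    show "?G \<in> borel_measurable (path_space \<Otimes>\<^sub>M nonneg_time)" by measurable
    fix \<omega> :: "'s path" and t :: real assume \<omega>: "\<omega> \<in> Omega" and t: "0 \<le> t"
    have "rp (stopped \<omega> t) s j * mark_of W (stopped \<omega> t) s j = rp \<omega> s j * mark_of W \<omega> s j" if "s \<le> t" for s j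
    proof (cases "0 < s")
      case True
      then have s: "0 \<le> s" by simp
      have eq: "stopped (stopped \<omega> t) s = stopped \<omega> s" using that by (rule stopped_stopped)
      have "r (stopped \<omega> t) s j = r \<omega> s j"
        using r_stopped[OF \<omega> s, of j] r_stopped[OF stopped_Omega[OF \<omega>] s, of t j] eq by simp
      moreover have "W ((stopped \<omega> t, s), j) = W ((\<omega>, s), j)"
        using predictable_fun_stopped[OF Wj s \<omega>, of j] predictable_fun_stopped[OF Wj s stopped_Omega[OF \<omega>], of t j] eq by simp
      ultimately show ?thesis by (simp add: rp_def mark_of_def)
    qed (simp add: rp_def)
    then show "?G (stopped \<omega> t, t) = ?G (\<omega>, t)" by (intro nn_integral_cong) (auto intro!: nn_integral_cong)
  qed
  moreover have "?G x = (case x of (\<omega>, t) \<Rightarrow> \<integral>\<^sup>+(s, j). W ((\<omega>, s), j) * indicator {0<..t} s \<partial>comp_measure \<omega>)"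
    if sx: "x \<in> space predictable" for x
  proof -
    obtain \<omega> t where x: "x = (\<omega>, t)" "\<omega> \<in> Omega" using sx by auto
    have "(\<lambda>(s, j). W ((\<omega>, s), j) * indicator {0<..t} s) \<in> borel_measurable (restrict_space borel {0<..} \<Otimes>\<^sub>M count_space UNIV)"
      unfolding measurable_pair_countable_iff prod.case
      by (intro allI borel_measurable_times_ennreal predictable_section[OF Wj x(2)])
         (rule measurable_restrict_space1, simp)
    then show ?thesis unfolding x(1) prod.case
      by (subst nn_integral_comp_measure[OF _ x(2)])
         (auto intro!: nn_integral_cong simp: rp_def mark_of_def indicator_def)
  qed
  ultimately show "(\<lambda>(\<omega>, t). \<integral>\<^sup>+(s, j). W ((\<omega>, s), j) * indicator {0<..t} s \<partial>comp_measure \<omega>) \<in> borel_measurable predictable"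
    by (rule measurable_cong[THEN iffD1, rotated])
qed

text \<open>Predictable integrands supported on one sojourn correspond to marks of the path cut at
  its beginning. The identity for all predictable integrands is thus a sequence of independent
  identities, one for each jump.\<close>

lemma dual_predictable_projection_iff:
  assumes P: "sets P = sets path_space"
  shows "dual_predictable_projection P mu comp_measure \<longleftrightarrow>
    (\<forall>m F. meas_mark F \<longrightarrow> (\<integral>\<^sup>+\<omega>. jump_mark m F \<omega> \<partial>P) = (\<integral>\<^sup>+\<omega>. jump_comp m F \<omega> \<partial>P))"
proof
  have sp: "space P = Omega" using sets_eq_imp_space_eq[OF P] by simp
  note [measurable_cong] = P
  have split: "(\<integral>\<^sup>+\<omega>. (\<integral>\<^sup>+(t, j). W ((\<omega>, t), j) \<partial>mu \<omega>) \<partial>P) = (\<Sum>n. \<integral>\<^sup>+\<omega>. jump_mark n (mark_of W) \<omega> \<partial>P)"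
    "(\<integral>\<^sup>+\<omega>. (\<integral>\<^sup>+(t, j). W ((\<omega>, t), j) \<partial>comp_measure \<omega>) \<partial>P) = (\<Sum>n. \<integral>\<^sup>+\<omega>. jump_comp n (mark_of W) \<omega> \<partial>P)"
    if W: "W \<in> borel_measurable (predictable \<Otimes>\<^sub>M count_space UNIV)" for W
  proof -
    have "(\<integral>\<^sup>+\<omega>. (\<integral>\<^sup>+(t, j). W ((\<omega>, t), j) \<partial>mu \<omega>) \<partial>P) = (\<integral>\<^sup>+\<omega>. (\<Sum>n. jump_mark n (mark_of W) \<omega>) \<partial>P)"
      by (intro nn_integral_cong nn_integral_mu_marks[OF W]) (simp add: sp)
    also have "\<dots> = (\<Sum>n. \<integral>\<^sup>+\<omega>. jump_mark n (mark_of W) \<omega> \<partial>P)"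
      using measurable_jump_mark[OF meas_mark_of[OF W]] by (intro nn_integral_suminf) simp
    finally show "(\<integral>\<^sup>+\<omega>. (\<integral>\<^sup>+(t, j). W ((\<omega>, t), j) \<partial>mu \<omega>) \<partial>P) = (\<Sum>n. \<integral>\<^sup>+\<omega>. jump_mark n (mark_of W) \<omega> \<partial>P)" .
    have "(\<integral>\<^sup>+\<omega>. (\<integral>\<^sup>+(t, j). W ((\<omega>, t), j) \<partial>comp_measure \<omega>) \<partial>P) = (\<integral>\<^sup>+\<omega>. (\<Sum>n. jump_comp n (mark_of W) \<omega>) \<partial>P)"
      by (intro nn_integral_cong nn_integral_comp_measure_marks[OF W]) (simp add: sp)
    also have "\<dots> = (\<Sum>n. \<integral>\<^sup>+\<omega>. jump_comp n (mark_of W) \<omega> \<partial>P)"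
      using measurable_jump_comp[OF meas_mark_of[OF W]] by (intro nn_integral_suminf) simp
    finally show "(\<integral>\<^sup>+\<omega>. (\<integral>\<^sup>+(t, j). W ((\<omega>, t), j) \<partial>comp_measure \<omega>) \<partial>P) = (\<Sum>n. \<integral>\<^sup>+\<omega>. jump_comp n (mark_of W) \<omega> \<partial>P)" .
  qed
  {
    assume R: "\<forall>m F. meas_mark F \<longrightarrow> (\<integral>\<^sup>+\<omega>. jump_mark m F \<omega> \<partial>P) = (\<integral>\<^sup>+\<omega>. jump_comp m F \<omega> \<partial>P)"
    show "dual_predictable_projection P mu comp_measure"
      unfolding dual_predictable_projection_def
    proof (intro conjI predictable_comp_measure allI impI)
      fix W :: "('s path \<times> real) \<times> 's \<Rightarrow> ennreal"
      assume W: "W \<in> borel_measurable (predictable \<Otimes>\<^sub>M count_space UNIV)"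
      show "(\<integral>\<^sup>+\<omega>. (\<integral>\<^sup>+(t, j). W ((\<omega>, t), j) \<partial>mu \<omega>) \<partial>P) = (\<integral>\<^sup>+\<omega>. (\<integral>\<^sup>+(t, j). W ((\<omega>, t), j) \<partial>comp_measure \<omega>) \<partial>P)"
        unfolding split[OF W] using R meas_mark_of[OF W] by simp
    qed
  }
  assume D: "dual_predictable_projection P mu comp_measure"
  show "\<forall>m F. meas_mark F \<longrightarrow> (\<integral>\<^sup>+\<omega>. jump_mark m F \<omega> \<partial>P) = (\<integral>\<^sup>+\<omega>. jump_comp m F \<omega> \<partial>P)"
  proof (intro allI impI)
    fix m F assume F: "meas_mark F"
    \<comment> \<open>\<open>W\<close> is switched on during the sojourn after the jump
      \<open>m\<close> only, where the stopped path is the argument that \<open>F\<close> expects.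
      All other terms of the series over the jumps vanish.\<close>
    define W where "W = (\<lambda>((\<omega>, t), j). if before m \<omega> t \<and> \<not> before (Suc m) \<omega> t then F (stopped \<omega> t) t j else 0)"
    have before: "Measurable.pred predictable (\<lambda>x::'s path \<times> real. before n (fst x) (snd x))" for n
      by (rule predictableI_stopped[OF measurable_before]) (simp add: before_stopped)
    have W: "W \<in> borel_measurable (predictable \<Otimes>\<^sub>M count_space UNIV)"
      unfolding measurable_pair_countable_iff
    proof
      fix j
      note [measurable] = before
      have [measurable]: "snd \<in> borel_measurable (predictable :: ('s path \<times> real) measure)"
        using measurable_compose[OF measurable_predictable_time measurable_restrict_space1[of "\<lambda>x. x" borel borel]] by simp
      have [measurable]: "(\<lambda>x. F (stopped (fst x) (snd x)) (snd x) j) \<in> borel_measurable predictable"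
        by (rule meas_markD[OF F measurable_stopped]) measurable
      show "(\<lambda>x. W (x, j)) \<in> borel_measurable predictable"
        unfolding W_def case_prod_unfold fst_conv snd_conv by measurable
    qed
    have cutW: "mark_of W (cut n \<omega>) t j = (if n = m then F (cut m \<omega>) t j else 0)"
      if "\<omega> \<in> Omega" "0 < t" "before n \<omega> t" "\<not> before (Suc n) \<omega> t" for n \<omega> t j
    proof -
      have bc: "before l (cut n \<omega>) t \<longleftrightarrow> before l \<omega> t" for l
        using stopped_eq_cut[OF that(3,4)] before_stopped[of l \<omega> t t] by simp
      have "stopped (cut n \<omega>) t = cut n \<omega>" using stopped_eq_cut[OF that(3,4)] stopped_stopped[of t t \<omega>] by simp
      then have 1: "mark_of W (cut n \<omega>) t j = (if before m \<omega> t \<and> \<not> before (Suc m) \<omega> t then F (cut n \<omega>) t j else 0)"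
        using that(2) by (simp only: W_def mark_of_def bc prod.case if_True)
      have 2: "(before m \<omega> t \<and> \<not> before (Suc m) \<omega> t) = (n = m)"
        using that(3,4) before_last_unique[OF that(3,4), of m] by blast
      show ?thesis unfolding 1 2 by simp
    qed
    have jm: "jump_mark n (mark_of W) \<omega> = (if n = m then jump_mark m F \<omega> else 0)" if \<omega>: "\<omega> \<in> Omega" for n \<omega>
    proof (cases "jump_time (Suc n) \<omega> < \<infinity>")
      case True
      define t where "t = enn2real (jump_time (Suc n) \<omega>)"
      have t: "0 < t" "ennreal t = jump_time (Suc n) \<omega>"
        using True jump_time_pos[OF \<omega>, of "Suc n"] by (auto simp: t_def enn2real_positive_iff)
      have "jump_time n \<omega> < jump_time (Suc n) \<omega>"
        using jump_time_less_Suc[OF \<omega>, of n] le_less_trans[OF jump_time_mono[of n "Suc n" \<omega>] True] by simp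
      then have "before n \<omega> t" "\<not> before (Suc n) \<omega> t" using t by (auto simp: before_def)
      from cutW[OF \<omega> t(1) this] show ?thesis using True by (auto simp: jump_mark_def t_def)
    qed (auto simp: jump_mark_def)
    have jc: "jump_comp n (mark_of W) \<omega> = (if n = m then jump_comp m F \<omega> else 0)" if \<omega>: "\<omega> \<in> Omega" for n \<omega>
    proof -
      have "jump_comp n (mark_of W) \<omega> = (\<integral>\<^sup>+t. (if jump_time n \<omega> < ennreal t \<and> ennreal t \<le> jump_time (Suc n) \<omega>
          then (\<integral>\<^sup>+j. rp (cut n \<omega>) t j * (if n = m then F (cut m \<omega>) t j else 0) \<partial>count_space UNIV) else 0) \<partial>lborel)"
        unfolding jump_comp_def
      proof (intro nn_integral_cong if_cong refl)
        fix t j assume *: "jump_time n \<omega> < ennreal t \<and> ennreal t \<le> jump_time (Suc n) \<omega>"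
        then have "0 < t" by (metis ennreal_neg not_le not_less_zero)
        with cutW[OF \<omega> this] * between_iff[OF this, of n \<omega>]
        show "rp (cut n \<omega>) t j * mark_of W (cut n \<omega>) t j = rp (cut n \<omega>) t j * (if n = m then F (cut m \<omega>) t j else 0)"
          by simp
      qed
      also have "\<dots> = (if n = m then jump_comp m F \<omega> else 0)"
      proof (cases "n = m")
        case True
        then show ?thesis by (simp only: if_True refl jump_comp_def)
      next
        case False
        then show ?thesis by (simp cong: if_cong)
      qed
      finally show ?thesis .
    qed
    have one: "(\<Sum>n. \<integral>\<^sup>+\<omega>. f n \<omega> \<partial>P) = (\<integral>\<^sup>+\<omega>. g \<omega> \<partial>P)"
      if "\<And>n \<omega>. \<omega> \<in> Omega \<Longrightarrow> f n \<omega> = (if n = m then g \<omega> else 0)" for f :: "nat \<Rightarrow> 's path \<Rightarrow> ennreal" and g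
    proof -
      have "(\<integral>\<^sup>+\<omega>. f n \<omega> \<partial>P) = (if n = m then (\<integral>\<^sup>+\<omega>. g \<omega> \<partial>P) else 0)" for n
      proof -
        have "(\<integral>\<^sup>+\<omega>. f n \<omega> \<partial>P) = (\<integral>\<^sup>+\<omega>. (if n = m then g \<omega> else 0) \<partial>P)"
          by (intro nn_integral_cong that) (simp add: sp)
        then show ?thesis by (cases "n = m") simp_all
      qed
      then show ?thesis by (subst suminf_finite[of "{m}"]) simp_all
    qed
    have "(\<integral>\<^sup>+\<omega>. jump_mark m F \<omega> \<partial>P) = (\<Sum>n. \<integral>\<^sup>+\<omega>. jump_mark n (mark_of W) \<omega> \<partial>P)"
      by (rule one[OF jm, symmetric])
    also have "\<dots> = (\<integral>\<^sup>+\<omega>. (\<integral>\<^sup>+(t, j). W ((\<omega>, t), j) \<partial>mu \<omega>) \<partial>P)" by (rule split(1)[OF W, symmetric])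
    also have "\<dots> = (\<integral>\<^sup>+\<omega>. (\<integral>\<^sup>+(t, j). W ((\<omega>, t), j) \<partial>comp_measure \<omega>) \<partial>P)"
      using D W unfolding dual_predictable_projection_def by blast
    also have "\<dots> = (\<Sum>n. \<integral>\<^sup>+\<omega>. jump_comp n (mark_of W) \<omega> \<partial>P)" by (rule split(2)[OF W])
    also have "\<dots> = (\<integral>\<^sup>+\<omega>. jump_comp m F \<omega> \<partial>P)" by (rule one[OF jc])
    finally show "(\<integral>\<^sup>+\<omega>. jump_mark m F \<omega> \<partial>P) = (\<integral>\<^sup>+\<omega>. jump_comp m F \<omega> \<partial>P)" .
  qed
qed

end

section \<open>Extending a history by one jump\<close>

definition append_jump :: "nat \<Rightarrow> 's path \<Rightarrow> real \<Rightarrow> 's \<Rightarrow> 's path" where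
  "append_jump m h t j = (\<lambda>l. if l < m then h l else if l = m then (fst (h m), ennreal t - jump_time m h)
     else if l = Suc m then (Some j, \<infinity>) else (None, \<infinity>))"

lemma append_jump_cut: "append_jump m (cut m h) t j = append_jump m h t j"
  by (auto simp: append_jump_def fun_eq_iff jump_time_cut) (auto simp: cut_def)

lemma cut_append_jump: "cut m (append_jump m h t j) = cut m h"
  by (auto simp: append_jump_def fun_eq_iff cut_def)

lemma cut_Suc_append_jump: "cut (Suc m) (append_jump m h t j) = append_jump m h t j"
  by (auto simp: append_jump_def fun_eq_iff cut_def)

lemma jump_time_append_jump:
  assumes "jump_time m h < ennreal t"
  shows "jump_time (Suc m) (append_jump m h t j) = ennreal t"
proof -
  have "jump_time m (append_jump m h t j) = jump_time m h"
    unfolding jump_time_def by (intro sum.cong) (auto simp: append_jump_def)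
  then show ?thesis using assms by (simp add: jump_time_Suc append_jump_def[of m h t j] less_imp_le)
qed

lemma jump_state_append_jump: "jump_state (Suc m) (append_jump m h t j) = Some j"
  by (simp add: jump_state_def append_jump_def)

text \<open>A history of \<open>m + 1\<close> jumps is the same thing as a history of
  \<open>m\<close> jumps together with the time and the target of the next one. Inductions on the
  number of jumps rest on this.\<close>

lemma cut_Suc_eq_append_jump:
  assumes "\<omega> \<in> Omega" "jump_time (Suc m) \<omega> < \<infinity>"
  shows "cut (Suc m) \<omega> = append_jump m (cut m \<omega>) (enn2real (jump_time (Suc m) \<omega>)) (the (jump_state (Suc m) \<omega>))"
proof -
  have "jump_time m \<omega> < \<infinity>" using jump_time_mono[of m "Suc m" \<omega>] assms(2) by (auto dest: order.strict_trans1)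
  then have 1: "snd (\<omega> m) = ennreal (enn2real (jump_time (Suc m) \<omega>)) - jump_time m \<omega>"
    using assms(2) by (simp add: jump_time_Suc)
  have 2: "fst (\<omega> (Suc m)) = Some (the (jump_state (Suc m) \<omega>))"
    using jump_state_finite[OF assms] by (simp add: jump_state_def)
  show ?thesis unfolding append_jump_cut
    using 1 2 by (auto simp: append_jump_def cut_def fun_eq_iff prod_eq_iff less_Suc_eq)
qed

lemma append_jump_Omega:
  assumes h: "h \<in> Omega" and t: "jump_time m h < ennreal t"
  shows "append_jump m h t j \<in> Omega"
proof -
  have "jump_time m h < \<infinity>" using order.strict_trans[OF t ennreal_less_top] by simp
  then have fin: "jump_time l h < \<infinity>" if "l \<le> m" for l
    using jump_time_mono[OF that, of h] by (rule le_less_trans[rotated])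
  have f: "fst (h l) \<noteq> None" if "l \<le> m" for l
    using jump_state_finite[OF h fin[OF that]] by (simp add: jump_state_def)
  have s: "snd (h l) \<noteq> \<infinity>" if "l < m" for l using snd_path_finite[OF h fin[of "Suc l"]] that by auto
  have d: "0 < ennreal t - jump_time m h" using t by (rule diff_gr0_ennreal)
  have d': "ennreal t - jump_time m h \<noteq> \<infinity>"
    by (metis diff_less_top_ennreal ennreal_less_top infinity_ennreal_def less_irrefl)
  show ?thesis unfolding Omega_iff
  proof (intro conjI allI impI)
    fix l
    show "fst (append_jump m h t j 0) \<noteq> None" using f[of 0] by (cases "m = 0") (auto simp: append_jump_def)
    show "0 < snd (append_jump m h t j l)" using Omega_pos[OF h, of l] d by (auto simp: append_jump_def)
    { assume "snd (append_jump m h t j l) = \<infinity>"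
      then have "m < l" using s[of l] d' by (cases "l < m"; cases "l = m") (simp_all add: append_jump_def)
      then show "append_jump m h t j (Suc l) = (None, \<infinity>)" by (simp add: append_jump_def) }
    { assume "snd (append_jump m h t j l) \<noteq> \<infinity>"
      then have "l \<le> m" by (cases "l \<le> m"; cases "l = Suc m") (simp_all add: append_jump_def)
      then show "fst (append_jump m h t j (Suc l)) \<noteq> None"
        using f[of "Suc l"] by (cases "Suc l < m"; cases "Suc l = m") (simp_all add: append_jump_def) }
  qed
qed

text \<open>The target is the full sequence space: if \<open>t\<close> does not exceed the jump
  time, the truncated difference makes a holding time 0 and the result leaves
  \<open>Omega\<close>.\<close>

lemma measurable_append_jump [measurable (raw)]:
  fixes f :: "'b \<Rightarrow> 's::{countable,discrete_topology} path"
  assumes f: "f \<in> M \<rightarrow>\<^sub>M path_space" and g [measurable]: "g \<in> borel_measurable M"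
  shows "(\<lambda>x. append_jump m (f x) (g x) j) \<in> M \<rightarrow>\<^sub>M borel"
proof (rule measurable_into_path)
  have [measurable]: "f \<in> M \<rightarrow>\<^sub>M borel" using f by (simp add: measurable_path_space_iff)
  have [measurable]: "(\<lambda>x. fst (f x k)) \<in> M \<rightarrow>\<^sub>M count_space UNIV" "(\<lambda>x. snd (f x k)) \<in> borel_measurable M" for k
    using measurable_compose[OF \<open>f \<in> M \<rightarrow>\<^sub>M borel\<close> measurable_path_state]
      measurable_compose[OF \<open>f \<in> M \<rightarrow>\<^sub>M borel\<close> measurable_path_holding] by simp_all
  have [measurable]: "(\<lambda>x. jump_time m (f x)) \<in> borel_measurable M" by measurable
  fix l
  have "(\<lambda>x. fst (append_jump m (f x) (g x) j l)) =
     (if l \<le> m then (\<lambda>x. fst (f x l)) else if l = Suc m then (\<lambda>x. Some j) else (\<lambda>x. None))"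
    by (auto simp: append_jump_def fun_eq_iff)
  then show "(\<lambda>x. fst (append_jump m (f x) (g x) j l)) \<in> M \<rightarrow>\<^sub>M count_space UNIV" by simp
  have "(\<lambda>x. snd (append_jump m (f x) (g x) j l)) =
     (if l < m then (\<lambda>x. snd (f x l)) else if l = m then (\<lambda>x. ennreal (g x) - jump_time m (f x)) else (\<lambda>x. \<infinity>))"
    by (auto simp: append_jump_def fun_eq_iff)
  then show "(\<lambda>x. snd (append_jump m (f x) (g x) j l)) \<in> borel_measurable M" by simp
qed

definition start_path :: "'s option \<Rightarrow> 's path" where
  "start_path x = (\<lambda>l. if l = 0 then (x, \<infinity>) else (None, \<infinity>))"

lemma xi_0: "\<omega> \<in> Omega \<Longrightarrow> xi \<omega> 0 = jump_state 0 \<omega>"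
  using jump_time_pos[of \<omega> 1] by (intro xi_eqI) auto

lemma sets_path_space_borel:
  "B \<in> sets path_space \<Longrightarrow> B \<in> sets (borel :: 's::{countable,discrete_topology} path measure)"
  unfolding path_space_def by (auto simp: sets_restrict_space)

text \<open>A cylinder set over finitely many coordinates is an event about \<open>cut m\<close> as
  soon as \<open>m\<close> exceeds all of them, and cylinder sets determine a finite
  measure.\<close>

lemma path_measure_eqI:
  fixes P Q :: "'s::{countable,discrete_topology} path measure"
  assumes P: "prob_space P" "sets P = sets path_space" and Q: "sets Q = sets path_space"
    and eq: "\<And>m B. B \<in> sets path_space \<Longrightarrow> emeasure P {\<omega>\<in>Omega. cut m \<omega> \<in> B} = emeasure Q {\<omega>\<in>Omega. cut m \<omega> \<in> B}"
  shows "P = Q"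
proof -
  interpret P: prob_space P by fact
  have sp: "space P = Omega" "space Q = Omega"
    using sets_eq_imp_space_eq[OF P(2)] sets_eq_imp_space_eq[OF Q] by simp_all
  let ?B = "PiM UNIV (\<lambda>_::nat. borel :: ('s option \<times> ennreal) measure)"
  have sB: "sets ?B = sets (borel :: 's path measure)" by (rule sets_PiM_equal_borel)
  have id: "(\<lambda>x. x) \<in> path_space \<rightarrow>\<^sub>M ?B"
    by (simp add: measurable_cong_sets[OF refl sB] path_space_def measurable_restrict_space1)
  then have idP: "(\<lambda>x. x) \<in> P \<rightarrow>\<^sub>M ?B" and idQ: "(\<lambda>x. x) \<in> Q \<rightarrow>\<^sub>M ?B"
    by (simp_all add: measurable_cong_sets[OF P(2) refl] measurable_cong_sets[OF Q refl])
  have "distr P ?B (\<lambda>x. x) = distr Q ?B (\<lambda>x. x)"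
  proof (rule measure_eqI_PiM_infinite)
    show "finite_measure (distr P ?B (\<lambda>x. x))"
      by (intro prob_space.axioms(1) prob_space.finite_measure P.finite_measure_distr idP)
    fix A and J :: "nat set"
    assume J: "finite J" "J \<subseteq> UNIV" "\<And>i. i \<in> J \<Longrightarrow> A i \<in> sets (borel :: ('s option \<times> ennreal) measure)"
    let ?E = "prod_emb UNIV (\<lambda>_. borel) J (Pi\<^sub>E J A) :: 's path set"
    have E: "?E \<in> sets ?B" using J by (intro sets_PiM_I) auto
    obtain m where m: "J \<subseteq> {..<m}" using J(1) by (metis finite_nat_iff_bounded)
    have iff: "\<omega> \<in> ?E \<longleftrightarrow> cut m \<omega> \<in> ?E" for \<omega>
      using m by (auto simp: prod_emb_iff cut_def PiE_iff subset_iff)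
    have "{\<omega> \<in> Omega. cut m \<omega> \<in> ?E \<inter> Omega} = ?E \<inter> Omega" using iff by auto
    moreover have "?E \<inter> Omega \<in> sets path_space"
      using E sB by (auto simp: path_space_def sets_restrict_space)
    ultimately have "emeasure P (?E \<inter> Omega) = emeasure Q (?E \<inter> Omega)" using eq[of "?E \<inter> Omega" m] by simp
    then show "emeasure (distr P ?B (\<lambda>x. x)) ?E = emeasure (distr Q ?B (\<lambda>x. x)) ?E"
      by (simp add: emeasure_distr[OF idP E] emeasure_distr[OF idQ E] sp)
  qed simp_all
  show "P = Q"
  proof (rule measure_eqI)
    fix B assume "B \<in> sets P"
    then have B: "B \<in> sets ?B" "B \<subseteq> Omega" using P sB sets_path_space_borel sets.sets_into_space[of B P] sp by auto
    have "emeasure (distr P ?B (\<lambda>x. x)) B = emeasure (distr Q ?B (\<lambda>x. x)) B" by (simp add: \<open>distr P ?B (\<lambda>x. x) = distr Q ?B (\<lambda>x. x)\<close>)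
    then show "emeasure P B = emeasure Q B"
      using B by (simp add: emeasure_distr[OF idP B(1)] emeasure_distr[OF idQ B(1)] sp Int_absorb2)
  qed (simp add: P Q)
qed

section \<open>Equivalence of compensator identity and jump laws; uniqueness of the law\<close>

context jump_intensity
begin

text \<open>Given the history, the next sojourn lasts at least until \<open>t\<close> with
  probability \<open>survival\<close>. Both descriptions of the law imply this property, and under
  it their right-hand sides coincide; hence they are equivalent.\<close>

definition surviving :: "nat \<Rightarrow> 's path measure \<Rightarrow> bool" where
  "surviving m P \<longleftrightarrow> (\<forall>A\<in>sets path_space. \<forall>t.
     (\<integral>\<^sup>+\<omega>. (if cut m \<omega> \<in> A \<and> jump_time m \<omega> < ennreal t \<and> ennreal t \<le> jump_time (Suc m) \<omega> then 1 else 0) \<partial>P) =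
     (\<integral>\<^sup>+\<omega>. (if cut m \<omega> \<in> A \<and> jump_time m \<omega> < ennreal t then survival m (cut m \<omega>) t else 0) \<partial>P))"

text \<open>The two sides of \<open>surviving\<close> are the masses of a set of histories under two
  image measures; these measures agree, hence so do their integrals.\<close>

lemma surviving_integral:
  assumes P: "prob_space P" "sets P = sets path_space" and S: "surviving m P"
    and g: "g \<in> borel_measurable path_space"
  shows "(\<integral>\<^sup>+\<omega>. (if jump_time m \<omega> < ennreal t \<and> ennreal t \<le> jump_time (Suc m) \<omega> then g (cut m \<omega>) else 0) \<partial>P) =
     (\<integral>\<^sup>+\<omega>. (if jump_time m \<omega> < ennreal t then survival m (cut m \<omega>) t * g (cut m \<omega>) else 0) \<partial>P)"
proof -
  note [measurable_cong] = P(2)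
  note [measurable] = g
  let ?f = "\<lambda>\<omega>. if jump_time m \<omega> < ennreal t \<and> ennreal t \<le> jump_time (Suc m) \<omega> then 1 else 0 :: ennreal"
  let ?f' = "\<lambda>\<omega>. if jump_time m \<omega> < ennreal t then survival m (cut m \<omega>) t else 0"
  have f: "?f \<in> borel_measurable P" "?f' \<in> borel_measurable P" by measurable
  have cm: "cut m \<in> P \<rightarrow>\<^sub>M path_space" by measurable
  have "distr (density P ?f) path_space (cut m) = distr (density P ?f') path_space (cut m)"
  proof (rule measure_eqI)
    fix A assume "A \<in> sets (distr (density P ?f) path_space (cut m))"
    then have A[measurable]: "A \<in> sets path_space" by simp
    have m: "cut m -` A \<inter> space P \<in> sets P" using measurable_sets[OF cm A] .
    have e: "emeasure (distr (density P u) path_space (cut m)) A = (\<integral>\<^sup>+\<omega>. (if cut m \<omega> \<in> A then u \<omega> else 0) \<partial>P)"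
      if "u \<in> borel_measurable P" for u
      using that m by (auto simp: emeasure_distr cm emeasure_density indicator_def intro!: nn_integral_cong)
    have "(\<integral>\<^sup>+\<omega>. (if cut m \<omega> \<in> A then ?f \<omega> else 0) \<partial>P) = (\<integral>\<^sup>+\<omega>. (if cut m \<omega> \<in> A then ?f' \<omega> else 0) \<partial>P)"
      using S[unfolded surviving_def, rule_format, OF A, of t]
      by (simp only: if_if_eq_conj[symmetric])
    then show "emeasure (distr (density P ?f) path_space (cut m)) A = emeasure (distr (density P ?f') path_space (cut m)) A"
      unfolding e[OF f(1)] e[OF f(2)] .
  qed simp
  then have "(\<integral>\<^sup>+h. g h \<partial>distr (density P ?f) path_space (cut m)) = (\<integral>\<^sup>+h. g h \<partial>distr (density P ?f') path_space (cut m))" by simp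
  moreover have "(\<integral>\<^sup>+h. g h \<partial>distr (density P u) path_space (cut m)) = (\<integral>\<^sup>+\<omega>. u \<omega> * g (cut m \<omega>) \<partial>P)"
    if [measurable]: "u \<in> borel_measurable P" for u
    by (subst nn_integral_distr) (simp_all add: cm nn_integral_density measurable_compose[OF cm g])
  ultimately have "(\<integral>\<^sup>+\<omega>. ?f \<omega> * g (cut m \<omega>) \<partial>P) = (\<integral>\<^sup>+\<omega>. ?f' \<omega> * g (cut m \<omega>) \<partial>P)" using f by simp
  moreover have "?f \<omega> * g (cut m \<omega>) = (if jump_time m \<omega> < ennreal t \<and> ennreal t \<le> jump_time (Suc m) \<omega> then g (cut m \<omega>) else 0)"
    "?f' \<omega> * g (cut m \<omega>) = (if jump_time m \<omega> < ennreal t then survival m (cut m \<omega>) t * g (cut m \<omega>) else 0)" for \<omega>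
    by simp_all
  ultimately show ?thesis by simp
qed

text \<open>For fixed \<open>t\<close> the compensator uses more than the history only through the
  event that the sojourn reaches \<open>t\<close>. After exchanging the integrals, this event may be
  replaced by its conditional probability.\<close>

lemma surviving_imp_comp_eq_law:
  assumes P: "prob_space P" "sets P = sets path_space" and S: "surviving m P" and F: "meas_mark F"
  shows "(\<integral>\<^sup>+\<omega>. jump_comp m F \<omega> \<partial>P) = (\<integral>\<^sup>+\<omega>. jump_law m F (cut m \<omega>) \<partial>P)"
proof -
  interpret P: prob_space P by fact
  interpret PL: pair_sigma_finite P lborel ..
  note [measurable_cong] = P(2)
  note [measurable (raw)] = meas_markD[OF F]
  let ?G = "\<lambda>h t. \<integral>\<^sup>+j. rp h t j * F h t j \<partial>count_space UNIV"
  have "(\<integral>\<^sup>+\<omega>. jump_comp m F \<omega> \<partial>P) = (\<integral>\<^sup>+\<omega>. \<integral>\<^sup>+t. (if jump_time m \<omega> < ennreal t \<and> ennreal t \<le> jump_time (Suc m) \<omega> then ?G (cut m \<omega>) t else 0) \<partial>lborel \<partial>P)"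
    by (simp add: jump_comp_def)
  also have "\<dots> = (\<integral>\<^sup>+t. \<integral>\<^sup>+\<omega>. (if jump_time m \<omega> < ennreal t \<and> ennreal t \<le> jump_time (Suc m) \<omega> then ?G (cut m \<omega>) t else 0) \<partial>P \<partial>lborel)"
    by (rule PL.Fubini'[symmetric]) measurable
  also have "\<dots> = (\<integral>\<^sup>+t. \<integral>\<^sup>+\<omega>. (if jump_time m \<omega> < ennreal t then survival m (cut m \<omega>) t * ?G (cut m \<omega>) t else 0) \<partial>P \<partial>lborel)"
    by (intro nn_integral_cong surviving_integral[OF P S]) measurable
  also have "\<dots> = (\<integral>\<^sup>+\<omega>. \<integral>\<^sup>+t. (if jump_time m \<omega> < ennreal t then survival m (cut m \<omega>) t * ?G (cut m \<omega>) t else 0) \<partial>lborel \<partial>P)"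
    by (rule PL.Fubini') measurable
  also have "\<dots> = (\<integral>\<^sup>+\<omega>. jump_law m F (cut m \<omega>) \<partial>P)"
    by (simp add: jump_law_def jump_time_cut)
  finally show ?thesis .
qed

lemma less_ennrealD: "(x::ennreal) < ennreal t \<Longrightarrow> 0 < t"
  by (metis ennreal_neg not_le not_less_zero)

text \<open>The compensator identity is tested with a mark proportional to \<open>exp (cum_rate m h s)\<close> on \<open>s < t\<close>: its
  compensator integrates to an exponential that cancels against the mark of the jump itself, and
  only the paths without a jump before \<open>t\<close> remain.\<close>

lemma compensated_imp_surviving:
  assumes P: "prob_space P" "sets P = sets path_space"
    and C: "\<And>F. meas_mark F \<Longrightarrow> (\<integral>\<^sup>+\<omega>. jump_mark m F \<omega> \<partial>P) = (\<integral>\<^sup>+\<omega>. jump_comp m F \<omega> \<partial>P)"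
  shows "surviving m P"
  unfolding surviving_def
proof (intro ballI allI)
  fix A :: "'s path set" and t :: real assume A[measurable]: "A \<in> sets path_space"
  interpret P: prob_space P by fact
  note [measurable_cong] = P(2)
  have sp: "space P = Omega" using sets_eq_imp_space_eq[OF P(2)] by simp
  let ?X = "\<lambda>h s. ennreal (exp (cum_rate m h s))"
  \<comment> \<open>The factor \<open>survival m h t\<close>, constant in \<open>s\<close>, keeps
    the mark at most 1, because \<open>cum_rate\<close> is increasing; its integral is then finite
    and can be cancelled.\<close>
  define F where "F = (\<lambda>h s (j::'s). if h \<in> A \<and> jump_time m h < ennreal t \<and> s < t then survival m h t * ?X h s else 0)"
  have F: "meas_mark F" unfolding meas_mark_def F_def by measurable
  define Y where "Y \<omega> = (if cut m \<omega> \<in> A \<and> jump_time m \<omega> < ennreal t then survival m (cut m \<omega>) t else 0)" for \<omega>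
  \<comment> \<open>The end of the sojourn, or \<open>t\<close> if that comes first. The compensator
    plus \<open>Y\<close> and the mark plus \<open>Z\<close> both equal the exponential at this
    time, weighted by \<open>Y\<close>.\<close>
  define b where "b \<omega> = enn2real (min (ennreal t) (jump_time (Suc m) \<omega>))" for \<omega> :: "'s path"
  define Z where "Z \<omega> = (if cut m \<omega> \<in> A \<and> jump_time m \<omega> < ennreal t \<and> ennreal t \<le> jump_time (Suc m) \<omega> then 1 else 0 :: ennreal)" for \<omega> :: "'s path"
  have [measurable]: "Y \<in> borel_measurable P" "Z \<in> borel_measurable P" unfolding Y_def[abs_def] Z_def[abs_def] by measurable
  have SX: "survival m h u * ?X h u = 1" for h u
    by (simp add: survival_def ennreal_mult[symmetric] exp_minus field_simps)
  have a: "jump_comp m F \<omega> + Y \<omega> = Y \<omega> * ?X (cut m \<omega>) (b \<omega>)" if \<omega>: "\<omega> \<in> Omega" for \<omega>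
  proof (cases "cut m \<omega> \<in> A \<and> jump_time m \<omega> < ennreal t")
    case True
    then have t: "0 < t" using less_ennrealD by blast
    have "jump_comp m F \<omega> = (\<integral>\<^sup>+s. survival m (cut m \<omega>) t * (total_rate m (cut m \<omega>) s * ?X (cut m \<omega>) s * indicator {0..b \<omega>} s) \<partial>lborel)"
      unfolding jump_comp_def
    proof (rule nn_integral_cong_AE)
      \<comment> \<open>The mark stops strictly before \<open>t\<close>, while the exponential
        integral includes its endpoint.\<close>
      have "AE s in lborel. s \<noteq> t" by (rule AE_lborel_singleton)
      then show "AE s in lborel. (if jump_time m \<omega> < ennreal s \<and> ennreal s \<le> jump_time (Suc m) \<omega>
           then \<integral>\<^sup>+ j. rp (cut m \<omega>) s j * F (cut m \<omega>) s j \<partial>count_space UNIV else 0) =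
         survival m (cut m \<omega>) t * (total_rate m (cut m \<omega>) s * ?X (cut m \<omega>) s * indicator {0..b \<omega>} s)"
      proof eventually_elim
        case (elim s)
        show ?case
        proof (cases "jump_time m \<omega> < ennreal s")
          case s: True
          then have s0: "0 < s" using less_ennrealD by blast
          have "s \<le> b \<omega> \<longleftrightarrow> ennreal s \<le> min (ennreal t) (jump_time (Suc m) \<omega>)"
            unfolding b_def using s0
            by (metis enn2real_leI enn2real_nonneg ennreal_enn2real ennreal_le_iff less_imp_le min.cobounded1 ennreal_less_top le_less_trans)
          also have "\<dots> \<longleftrightarrow> s < t \<and> ennreal s \<le> jump_time (Suc m) \<omega>" using elim t s0 by auto
          finally show ?thesis using s s0 True
            by (auto simp: F_def total_rate_def jump_time_cut indicator_def nn_integral_multc ac_simps)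
        qed (simp add: total_rate_def jump_time_cut)
      qed
    qed
    also have "\<dots> = survival m (cut m \<omega>) t * (\<integral>\<^sup>+s. total_rate m (cut m \<omega>) s * ?X (cut m \<omega>) s * indicator {0..b \<omega>} s \<partial>lborel)"
    proof (rule nn_integral_cmult)
      have [measurable]: "(\<lambda>s::real. cut m \<omega>) \<in> borel \<rightarrow>\<^sub>M path_space" using \<omega> by simp
      have "(\<lambda>s. total_rate m (cut m \<omega>) s * ?X (cut m \<omega>) s) \<in> borel_measurable borel" by measurable
      then show "(\<lambda>s. total_rate m (cut m \<omega>) s * ?X (cut m \<omega>) s * indicator {0..b \<omega>} s) \<in> borel_measurable lborel"
        by simp
    qed
    finally have "jump_comp m F \<omega> + Y \<omega> = survival m (cut m \<omega>) t * ((\<integral>\<^sup>+s. total_rate m (cut m \<omega>) s * ?X (cut m \<omega>) s * indicator {0..b \<omega>} s \<partial>lborel) + 1)"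
      using True by (simp add: Y_def distrib_left)
    also have "\<dots> = Y \<omega> * ?X (cut m \<omega>) (b \<omega>)"
      by (subst total_rate_exp[OF \<omega>]) (use True in \<open>simp_all add: Y_def b_def\<close>)
    finally show ?thesis .
  next
    case False
    then have "F (cut m \<omega>) s j = 0" for s j by (auto simp: F_def jump_time_cut)
    then have "jump_comp m F \<omega> = 0" by (simp add: jump_comp_def cong: if_cong)
    moreover have "Y \<omega> = 0" using False by (auto simp: Y_def)
    ultimately show ?thesis by simp
  qed
  have b: "jump_mark m F \<omega> + Z \<omega> = Y \<omega> * ?X (cut m \<omega>) (b \<omega>)" "jump_mark m F \<omega> \<le> 1" if \<omega>: "\<omega> \<in> Omega" for \<omega>
  proof -
    consider (1) "cut m \<omega> \<in> A" "jump_time m \<omega> < ennreal t" "jump_time (Suc m) \<omega> < ennreal t"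
      | (2) "cut m \<omega> \<in> A" "jump_time m \<omega> < ennreal t" "ennreal t \<le> jump_time (Suc m) \<omega>"
      | (3) "\<not> (cut m \<omega> \<in> A \<and> jump_time m \<omega> < ennreal t)" by fastforce
    then have "jump_mark m F \<omega> + Z \<omega> = Y \<omega> * ?X (cut m \<omega>) (b \<omega>) \<and> jump_mark m F \<omega> \<le> 1"
    proof cases
      case 1
      then have t: "0 < t" using less_ennrealD by blast
      have fin: "jump_time (Suc m) \<omega> < \<infinity>" using order.strict_trans[OF 1(3) ennreal_less_top] by simp
      have lt: "enn2real (jump_time (Suc m) \<omega>) < t" using 1(3) t fin
        by (metis enn2real_nonneg ennreal_enn2real ennreal_less_iff infinity_ennreal_def)
      have "jump_mark m F \<omega> = Y \<omega> * ?X (cut m \<omega>) (b \<omega>)"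
        using 1 fin lt 1(3)[folded not_le] by (simp add: jump_mark_def F_def Y_def b_def jump_time_cut min_def)
      moreover have "Y \<omega> * ?X (cut m \<omega>) (b \<omega>) \<le> survival m (cut m \<omega>) t * ?X (cut m \<omega>) t"
        using 1 lt cum_rate_mono[OF \<omega>, of "b \<omega>" t m]
        by (intro mult_mono) (auto simp: Y_def b_def min_def)
      moreover have "\<not> ennreal t \<le> jump_time (Suc m) \<omega>" using 1(3) by (simp add: not_le)
      ultimately show ?thesis by (simp add: Z_def SX)
    next
      case 2
      then have t: "0 < t" using less_ennrealD by blast
      have "jump_mark m F \<omega> = 0"
        using 2(3) by (auto simp: jump_mark_def F_def not_less dest: enn2real_mono[of "ennreal t"])
      then show ?thesis using 2 t SX[of "cut m \<omega>" t] by (simp add: Z_def Y_def b_def min_def)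
    next
      case 3
      then show ?thesis by (auto simp: jump_mark_def F_def Z_def Y_def jump_time_cut)
    qed
    then show "jump_mark m F \<omega> + Z \<omega> = Y \<omega> * ?X (cut m \<omega>) (b \<omega>)" "jump_mark m F \<omega> \<le> 1" by auto
  qed
  note mm[measurable] = measurable_jump_mark[OF F, of m] measurable_jump_comp[OF F, of m]
  have "(\<integral>\<^sup>+\<omega>. jump_mark m F \<omega> \<partial>P) + (\<integral>\<^sup>+\<omega>. Z \<omega> \<partial>P) = (\<integral>\<^sup>+\<omega>. jump_mark m F \<omega> + Z \<omega> \<partial>P)"
    by (rule nn_integral_add[symmetric]) measurable
  also have "\<dots> = (\<integral>\<^sup>+\<omega>. jump_comp m F \<omega> + Y \<omega> \<partial>P)" by (intro nn_integral_cong) (simp add: a b sp)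
  also have "\<dots> = (\<integral>\<^sup>+\<omega>. jump_comp m F \<omega> \<partial>P) + (\<integral>\<^sup>+\<omega>. Y \<omega> \<partial>P)" by (rule nn_integral_add) measurable
  also have "\<dots> = (\<integral>\<^sup>+\<omega>. jump_mark m F \<omega> \<partial>P) + (\<integral>\<^sup>+\<omega>. Y \<omega> \<partial>P)" using C[OF F] by simp
  finally have eq: "(\<integral>\<^sup>+\<omega>. jump_mark m F \<omega> \<partial>P) + (\<integral>\<^sup>+\<omega>. Z \<omega> \<partial>P) = (\<integral>\<^sup>+\<omega>. jump_mark m F \<omega> \<partial>P) + (\<integral>\<^sup>+\<omega>. Y \<omega> \<partial>P)" .
  have "(\<integral>\<^sup>+\<omega>. jump_mark m F \<omega> \<partial>P) \<le> (\<integral>\<^sup>+\<omega>. 1 \<partial>P)" by (intro nn_integral_mono) (simp add: b sp)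
  then have "(\<integral>\<^sup>+\<omega>. jump_mark m F \<omega> \<partial>P) \<noteq> \<infinity>" by (auto simp: P.emeasure_space_1 top_unique)
  with eq show "(\<integral>\<^sup>+\<omega>. (if cut m \<omega> \<in> A \<and> jump_time m \<omega> < ennreal t \<and> ennreal t \<le> jump_time (Suc m) \<omega> then 1 else 0) \<partial>P) =
     (\<integral>\<^sup>+\<omega>. (if cut m \<omega> \<in> A \<and> jump_time m \<omega> < ennreal t then survival m (cut m \<omega>) t else 0) \<partial>P)"
    by (simp add: ennreal_add_left_cancel Z_def[symmetric] Y_def[symmetric])
qed

text \<open>From \<open>total_rate_survival\<close>: jumping before \<open>t\<close> and surviving
  until \<open>t\<close> are complementary once the sojourn has begun before \<open>t\<close>, and
  otherwise neither has any mass.\<close>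

lemma jump_law_before:
  assumes \<omega>: "h \<in> Omega"
  shows "jump_law m (\<lambda>_ s _. if s < t then 1 else 0) (cut m h)
     + (if jump_time m h < ennreal t then survival m (cut m h) t else 0) = (if jump_time m h < ennreal t then 1 else 0)"
proof (cases "jump_time m h < ennreal t")
  case True
  then have t: "0 < t" using less_ennrealD by blast
  have "jump_law m (\<lambda>_ s _. if s < t then 1 else 0) (cut m h) =
      (\<integral>\<^sup>+s. total_rate m (cut m h) s * survival m (cut m h) s * indicator {0..t} s \<partial>lborel)"
    unfolding jump_law_def
  proof (rule nn_integral_cong_AE)
    have "AE s in lborel. s \<noteq> t" by (rule AE_lborel_singleton)
    then show "AE s in lborel. (if jump_time m (cut m h) < ennreal s
           then survival m (cut m h) s * (\<integral>\<^sup>+ j. rp (cut m h) s j * (if s < t then 1 else 0) \<partial>count_space UNIV) else 0) =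
         total_rate m (cut m h) s * survival m (cut m h) s * indicator {0..t} s"
    proof eventually_elim
      case (elim s)
      then show ?case using less_ennrealD[of "jump_time m h" s]
        by (auto simp: total_rate_def jump_time_cut indicator_def ac_simps)
    qed
  qed
  then show ?thesis using total_rate_survival[OF \<omega>, of t m] t True by simp
next
  case False
  have "jump_law m (\<lambda>_ s _. if s < t then 1 else 0) (cut m h) = (\<integral>\<^sup>+s. 0 \<partial>(lborel :: real measure))"
    unfolding jump_law_def
  proof (intro nn_integral_cong)
    fix s :: real
    have "\<not> s < t" if "jump_time m h < ennreal s"
      using that False less_ennrealD[OF that] by (meson dual_order.strict_trans ennreal_lessI not_less_iff_gr_or_eq)
    then show "(if jump_time m (cut m h) < ennreal s
           then survival m (cut m h) s * (\<integral>\<^sup>+ j. rp (cut m h) s j * (if s < t then 1 else 0) \<partial>count_space UNIV) else 0) = 0"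
      by (simp add: jump_time_cut)
  qed
  with False show ?thesis by simp
qed

text \<open>Here the test mark is the indicator of a jump before \<open>t\<close>; survival is
  obtained by passing to the complement, which is possible since all masses are at most 1.\<close>

lemma transition_imp_surviving:
  assumes P: "prob_space P" "sets P = sets path_space"
    and C: "\<And>F. meas_mark F \<Longrightarrow> (\<integral>\<^sup>+\<omega>. jump_mark m F \<omega> \<partial>P) = (\<integral>\<^sup>+\<omega>. jump_law m F (cut m \<omega>) \<partial>P)"
  shows "surviving m P"
  unfolding surviving_def
proof (intro ballI allI)
  fix A :: "'s path set" and t :: real assume A[measurable]: "A \<in> sets path_space"
  interpret P: prob_space P by fact
  note [measurable_cong] = P(2)
  have sp: "space P = Omega" using sets_eq_imp_space_eq[OF P(2)] by simp
  define F where "F = (\<lambda>h s (j::'s). if h \<in> A then if s < t then 1 else 0 else 0 :: ennreal)"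
  have F: "meas_mark F" unfolding meas_mark_def F_def by measurable
  define Y where "Y \<omega> = (if cut m \<omega> \<in> A \<and> jump_time m \<omega> < ennreal t then survival m (cut m \<omega>) t else 0)" for \<omega>
  define Z where "Z \<omega> = (if cut m \<omega> \<in> A \<and> jump_time m \<omega> < ennreal t \<and> ennreal t \<le> jump_time (Suc m) \<omega> then 1 else 0 :: ennreal)" for \<omega> :: "'s path"
  have [measurable]: "Y \<in> borel_measurable P" "Z \<in> borel_measurable P" unfolding Y_def[abs_def] Z_def[abs_def] by measurable
  have a: "jump_law m F (cut m \<omega>) + Y \<omega> = (if cut m \<omega> \<in> A \<and> jump_time m \<omega> < ennreal t then 1 else 0)" if \<omega>: "\<omega> \<in> Omega" for \<omega>
  proof (cases "cut m \<omega> \<in> A")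
    case True
    then have "jump_law m F (cut m \<omega>) = jump_law m (\<lambda>_ s _. if s < t then 1 else 0) (cut m \<omega>)"
      by (simp add: jump_law_def F_def cong: if_cong)
    then show ?thesis using jump_law_before[OF \<omega>, of m t] True by (simp add: Y_def)
  next
    case False
    then show ?thesis by (simp add: jump_law_def F_def Y_def cong: if_cong)
  qed
  have b: "jump_mark m F \<omega> + Z \<omega> = (if cut m \<omega> \<in> A \<and> jump_time m \<omega> < ennreal t then 1 else 0)" "jump_mark m F \<omega> \<le> 1" if \<omega>: "\<omega> \<in> Omega" for \<omega>
  proof -
    have fin: "jump_time (Suc m) \<omega> < \<infinity> \<and> enn2real (jump_time (Suc m) \<omega>) < t \<longleftrightarrow> jump_time (Suc m) \<omega> < ennreal t"
      by (cases "jump_time (Suc m) \<omega>") (auto simp: ennreal_less_iff)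
    have jm: "jump_mark m F \<omega> = (if cut m \<omega> \<in> A \<and> jump_time (Suc m) \<omega> < ennreal t then 1 else 0)"
      unfolding fin[symmetric] by (auto simp: jump_mark_def F_def)
    show "jump_mark m F \<omega> \<le> 1" by (simp add: jm)
    have "jump_time (Suc m) \<omega> < ennreal t \<Longrightarrow> jump_time m \<omega> < ennreal t"
      using jump_time_mono[of m "Suc m" \<omega>] by (auto dest: order.strict_trans1)
    then show "jump_mark m F \<omega> + Z \<omega> = (if cut m \<omega> \<in> A \<and> jump_time m \<omega> < ennreal t then 1 else 0)"
      by (auto simp: jm Z_def)
  qed
  note mm[measurable] = measurable_jump_mark[OF F, of m] measurable_compose[OF measurable_cut measurable_jump_law[OF F], of m m]
  have "(\<integral>\<^sup>+\<omega>. jump_mark m F \<omega> \<partial>P) + (\<integral>\<^sup>+\<omega>. Z \<omega> \<partial>P) = (\<integral>\<^sup>+\<omega>. jump_mark m F \<omega> + Z \<omega> \<partial>P)"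
    by (rule nn_integral_add[symmetric]) measurable
  also have "\<dots> = (\<integral>\<^sup>+\<omega>. jump_law m F (cut m \<omega>) + Y \<omega> \<partial>P)" by (intro nn_integral_cong) (simp add: a b sp)
  also have "\<dots> = (\<integral>\<^sup>+\<omega>. jump_law m F (cut m \<omega>) \<partial>P) + (\<integral>\<^sup>+\<omega>. Y \<omega> \<partial>P)" by (rule nn_integral_add) measurable
  also have "\<dots> = (\<integral>\<^sup>+\<omega>. jump_mark m F \<omega> \<partial>P) + (\<integral>\<^sup>+\<omega>. Y \<omega> \<partial>P)" using C[OF F] by simp
  finally have eq: "(\<integral>\<^sup>+\<omega>. jump_mark m F \<omega> \<partial>P) + (\<integral>\<^sup>+\<omega>. Z \<omega> \<partial>P) = (\<integral>\<^sup>+\<omega>. jump_mark m F \<omega> \<partial>P) + (\<integral>\<^sup>+\<omega>. Y \<omega> \<partial>P)" .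
  have "(\<integral>\<^sup>+\<omega>. jump_mark m F \<omega> \<partial>P) \<le> (\<integral>\<^sup>+\<omega>. 1 \<partial>P)" by (intro nn_integral_mono) (simp add: b sp)
  then have "(\<integral>\<^sup>+\<omega>. jump_mark m F \<omega> \<partial>P) \<noteq> \<infinity>" by (auto simp: P.emeasure_space_1 top_unique)
  with eq show "(\<integral>\<^sup>+\<omega>. (if cut m \<omega> \<in> A \<and> jump_time m \<omega> < ennreal t \<and> ennreal t \<le> jump_time (Suc m) \<omega> then 1 else 0) \<partial>P) =
     (\<integral>\<^sup>+\<omega>. (if cut m \<omega> \<in> A \<and> jump_time m \<omega> < ennreal t then survival m (cut m \<omega>) t else 0) \<partial>P)"
    by (simp add: ennreal_add_left_cancel Z_def[symmetric] Y_def[symmetric])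
qed

lemma dual_predictable_projection_iff_transition:
  assumes P: "prob_space P" "sets P = sets path_space"
  shows "dual_predictable_projection P mu comp_measure \<longleftrightarrow>
    (\<forall>m F. meas_mark F \<longrightarrow> (\<integral>\<^sup>+\<omega>. jump_mark m F \<omega> \<partial>P) = (\<integral>\<^sup>+\<omega>. jump_law m F (cut m \<omega>) \<partial>P))"
  unfolding dual_predictable_projection_iff[OF P(2)]
  using compensated_imp_surviving[OF P] transition_imp_surviving[OF P] surviving_imp_comp_eq_law[OF P]
  by metis

text \<open>Induction over the number of jumps: the law of the history of \<open>m\<close> jumps
  fixes the law of the next jump, hence that of the history of \<open>m + 1\<close> jumps. The paths
  without a further jump are accounted for by subtraction.\<close>

lemma transition_law_unique:
  assumes P: "prob_space P" "sets P = sets path_space" and Q: "prob_space Q" "sets Q = sets path_space"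
    and init: "\<And>i. measure P {\<omega>\<in>Omega. xi \<omega> 0 = Some i} = measure Q {\<omega>\<in>Omega. xi \<omega> 0 = Some i}"
    and tP: "\<And>m F. meas_mark F \<Longrightarrow> (\<integral>\<^sup>+\<omega>. jump_mark m F \<omega> \<partial>P) = (\<integral>\<^sup>+\<omega>. jump_law m F (cut m \<omega>) \<partial>P)"
    and tQ: "\<And>m F. meas_mark F \<Longrightarrow> (\<integral>\<^sup>+\<omega>. jump_mark m F \<omega> \<partial>Q) = (\<integral>\<^sup>+\<omega>. jump_law m F (cut m \<omega>) \<partial>Q)"
  shows "P = Q"
proof (rule path_measure_eqI[OF P Q(2)])
  interpret P: prob_space P by fact
  interpret Q: prob_space Q by fact
  have sp: "space P = Omega" "space Q = Omega"
    using sets_eq_imp_space_eq[OF P(2)] sets_eq_imp_space_eq[OF Q(2)] by simp_all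
  have ev: "{\<omega>\<in>Omega. cut m \<omega> \<in> B} \<in> sets path_space" if "B \<in> sets path_space" for m and B :: "'s path set"
    using measurable_sets[OF measurable_cut that, of m] by (simp add: vimage_def Int_def conj_commute)
  have distr_eq: "distr P path_space (cut m) = distr Q path_space (cut m)" for m
  proof (induction m)
    case 0
    show ?case
    proof (rule measure_eqI)
      fix B :: "'s path set" assume "B \<in> sets (distr P path_space (cut 0))"
      then have B: "B \<in> sets path_space" by simp
      define I where "I = {i. start_path (Some i) \<in> B}"
      let ?X = "\<lambda>i. {\<omega>\<in>Omega. xi \<omega> 0 = Some i}"
      have cut0: "cut 0 \<omega> = start_path (xi \<omega> 0)" if "\<omega> \<in> Omega" for \<omega> :: "'s path"
        using xi_0[OF that] by (auto simp: cut_def jump_state_def start_path_def)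
      have eq: "cut 0 -` B \<inter> Omega = \<Union>(?X ` I)"
      proof (intro set_eqI iffI)
        fix \<omega> assume \<omega>: "\<omega> \<in> cut 0 -` B \<inter> Omega"
        then obtain i where i: "xi \<omega> 0 = Some i" using Omega_start[of \<omega>] xi_0[of \<omega>] by (auto simp: jump_state_def)
        with \<omega> cut0[of \<omega>] show "\<omega> \<in> \<Union>(?X ` I)" by (auto simp: I_def)
      next
        fix \<omega> assume "\<omega> \<in> \<Union>(?X ` I)"
        then show "\<omega> \<in> cut 0 -` B \<inter> Omega" using cut0[of \<omega>] by (auto simp: I_def)
      qed
      have Xs: "?X i \<in> sets path_space" for i :: 's
      proof -
        have "{\<omega>\<in>space path_space. jump_state 0 \<omega> = Some i} \<in> sets path_space" by measurable
        also have "{\<omega>\<in>space path_space. jump_state 0 \<omega> = Some i} = ?X i" by (rule Collect_cong) (auto simp: xi_0)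
        finally show ?thesis .
      qed
      have dj: "disjoint_family_on ?X I" by (auto simp: disjoint_family_on_def)
      have "emeasure P (\<Union>(?X ` I)) = (\<integral>\<^sup>+i. emeasure P (?X i) \<partial>count_space I)"
        using Xs P(2) dj by (intro emeasure_UN_countable) auto
      also have "\<dots> = (\<integral>\<^sup>+i. emeasure Q (?X i) \<partial>count_space I)"
        by (simp add: P.emeasure_eq_measure Q.emeasure_eq_measure init)
      also have "\<dots> = emeasure Q (\<Union>(?X ` I))"
        using Xs Q(2) dj by (intro emeasure_UN_countable[symmetric]) auto
      finally show "emeasure (distr P path_space (cut 0)) B = emeasure (distr Q path_space (cut 0)) B"
        using B by (simp add: emeasure_distr measurable_cong_sets[OF P(2) refl] measurable_cong_sets[OF Q(2) refl] sp eq)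
    qed simp
  next
    case (Suc m)
    have ih: "(\<integral>\<^sup>+\<omega>. g (cut m \<omega>) \<partial>P) = (\<integral>\<^sup>+\<omega>. g (cut m \<omega>) \<partial>Q)" if "g \<in> borel_measurable path_space" for g
      using arg_cong[OF Suc.IH, of "\<lambda>M. integral\<^sup>N M g"] that
      by (simp add: nn_integral_distr measurable_cong_sets[OF P(2) refl] measurable_cong_sets[OF Q(2) refl])
    have marks: "(\<integral>\<^sup>+\<omega>. jump_mark m F \<omega> \<partial>P) = (\<integral>\<^sup>+\<omega>. jump_mark m F \<omega> \<partial>Q)" if "meas_mark F" for F
      using tP[OF that] tQ[OF that] ih[OF measurable_jump_law[OF that]] by simp
    show ?case
    proof (rule measure_eqI)
      fix B :: "'s path set" assume "B \<in> sets (distr P path_space (cut (Suc m)))"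
      then have B[measurable]: "B \<in> sets path_space" by simp
      note [measurable] = sets_path_space_borel[OF B]
      \<comment> \<open>\<open>F1\<close> asks whether the extended history lies in
        \<open>B\<close>, \<open>F2\<close> whether the old one does while a jump still occurs. The
        mass of histories in \<open>B\<close> without another jump is the total mass of
        \<open>B\<close> less that of \<open>F2\<close>.\<close>
      define F1 where "F1 = (\<lambda>h t j. indicator B (append_jump m h t j) :: ennreal)"
      define F2 where "F2 = (\<lambda>h (t::real) (j::'s). indicator B h :: ennreal)"
      have F: "meas_mark F1" "meas_mark F2" unfolding meas_mark_def F1_def F2_def by measurable
      \<comment> \<open>\<open>c\<close> is the mass of the paths that never make the jump
        \<open>m + 1\<close>; cutting them at \<open>m\<close> or at \<open>m + 1\<close> gives the
        same path.\<close>
      have R: "\<exists>c. (\<integral>\<^sup>+\<omega>. jump_mark m F2 \<omega> \<partial>R) + c = (\<integral>\<^sup>+\<omega>. indicator B (cut m \<omega>) \<partial>R) \<and>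
          emeasure (distr R path_space (cut (Suc m))) B = (\<integral>\<^sup>+\<omega>. jump_mark m F1 \<omega> \<partial>R) + c \<and>
          (\<integral>\<^sup>+\<omega>. jump_mark m F2 \<omega> \<partial>R) \<noteq> \<infinity>" if R: "prob_space R" "sets R = sets path_space" for R
      proof -
        interpret R: prob_space R by fact
        note [measurable_cong] = R(2)
        have sR: "space R = Omega" using sets_eq_imp_space_eq[OF R(2)] by simp
        note [measurable] = measurable_jump_mark[OF F(1), of m] measurable_jump_mark[OF F(2), of m]
        let ?c = "\<lambda>\<omega>. if jump_time (Suc m) \<omega> = \<infinity> then indicator B (cut m \<omega>) else 0 :: ennreal"
        have 1: "(\<integral>\<^sup>+\<omega>. jump_mark m F2 \<omega> \<partial>R) + (\<integral>\<^sup>+\<omega>. ?c \<omega> \<partial>R) = (\<integral>\<^sup>+\<omega>. indicator B (cut m \<omega>) \<partial>R)"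
        proof -
          have "(\<integral>\<^sup>+\<omega>. jump_mark m F2 \<omega> \<partial>R) + (\<integral>\<^sup>+\<omega>. ?c \<omega> \<partial>R) = (\<integral>\<^sup>+\<omega>. jump_mark m F2 \<omega> + ?c \<omega> \<partial>R)"
            by (rule nn_integral_add[symmetric]) measurable
          also have "\<dots> = (\<integral>\<^sup>+\<omega>. indicator B (cut m \<omega>) \<partial>R)"
            by (intro nn_integral_cong) (auto simp: jump_mark_def F2_def less_top[symmetric])
          finally show ?thesis .
        qed
        have "emeasure (distr R path_space (cut (Suc m))) B = (\<integral>\<^sup>+\<omega>. indicator B (cut (Suc m) \<omega>) \<partial>R)"
          by (subst nn_integral_indicator[symmetric], simp, subst nn_integral_distr) auto
        also have "\<dots> = (\<integral>\<^sup>+\<omega>. jump_mark m F1 \<omega> + ?c \<omega> \<partial>R)"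
        proof (rule nn_integral_cong)
          fix \<omega> assume "\<omega> \<in> space R"
          then have \<omega>: "\<omega> \<in> Omega" by (simp add: sR)
          show "indicator B (cut (Suc m) \<omega>) = jump_mark m F1 \<omega> + ?c \<omega>"
          proof (cases "jump_time (Suc m) \<omega> = \<infinity>")
            case True
            then have "jump_time (Suc (Suc m)) \<omega> = \<infinity>" by (simp add: jump_time_Suc[of "Suc m"])
            with True show ?thesis using cut_eq_self[OF \<omega>] by (simp add: jump_mark_def)
          next
            case False
            then show ?thesis using cut_Suc_eq_append_jump[OF \<omega>, of m] by (simp add: jump_mark_def F1_def less_top[symmetric])
          qed
        qed
        also have "\<dots> = (\<integral>\<^sup>+\<omega>. jump_mark m F1 \<omega> \<partial>R) + (\<integral>\<^sup>+\<omega>. ?c \<omega> \<partial>R)" by (rule nn_integral_add) measurable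
        finally have 2: "emeasure (distr R path_space (cut (Suc m))) B = (\<integral>\<^sup>+\<omega>. jump_mark m F1 \<omega> \<partial>R) + (\<integral>\<^sup>+\<omega>. ?c \<omega> \<partial>R)" .
        have "(\<integral>\<^sup>+\<omega>. jump_mark m F2 \<omega> \<partial>R) \<le> (\<integral>\<^sup>+\<omega>. 1 \<partial>R)"
          by (intro nn_integral_mono) (auto simp: jump_mark_def F2_def indicator_def)
        then have "(\<integral>\<^sup>+\<omega>. jump_mark m F2 \<omega> \<partial>R) \<noteq> \<infinity>" by (auto simp: R.emeasure_space_1 top_unique)
        with 1 2 show ?thesis by blast
      qed
      from R[OF P] obtain c where c: "(\<integral>\<^sup>+\<omega>. jump_mark m F2 \<omega> \<partial>P) + c = (\<integral>\<^sup>+\<omega>. indicator B (cut m \<omega>) \<partial>P)"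
         "emeasure (distr P path_space (cut (Suc m))) B = (\<integral>\<^sup>+\<omega>. jump_mark m F1 \<omega> \<partial>P) + c"
         "(\<integral>\<^sup>+\<omega>. jump_mark m F2 \<omega> \<partial>P) \<noteq> \<infinity>" by blast
      from R[OF Q] obtain d where d: "(\<integral>\<^sup>+\<omega>. jump_mark m F2 \<omega> \<partial>Q) + d = (\<integral>\<^sup>+\<omega>. indicator B (cut m \<omega>) \<partial>Q)"
         "emeasure (distr Q path_space (cut (Suc m))) B = (\<integral>\<^sup>+\<omega>. jump_mark m F1 \<omega> \<partial>Q) + d" by blast
      have "(\<integral>\<^sup>+\<omega>. indicator B (cut m \<omega>) \<partial>P) = (\<integral>\<^sup>+\<omega>. indicator B (cut m \<omega>) \<partial>Q)" by (rule ih) measurable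
      then have "(\<integral>\<^sup>+\<omega>. jump_mark m F2 \<omega> \<partial>P) + c = (\<integral>\<^sup>+\<omega>. jump_mark m F2 \<omega> \<partial>P) + d"
        using c(1) d(1) marks[OF F(2)] by simp
      then have "c = d" using c(3) by (simp add: ennreal_add_left_cancel)
      then show "emeasure (distr P path_space (cut (Suc m))) B = emeasure (distr Q path_space (cut (Suc m))) B"
        using c(2) d(2) marks[OF F(1)] by simp
    qed simp
  qed
  fix m and B :: "'s path set" assume B: "B \<in> sets path_space"
  have "emeasure R {\<omega>\<in>Omega. cut m \<omega> \<in> B} = emeasure (distr R path_space (cut m)) B"
    if "sets R = sets path_space" "space R = Omega" for R :: "'s path measure"
    using B that by (subst emeasure_distr) (auto simp: measurable_cong_sets[OF that(1) refl] intro!: arg_cong[where f="emeasure R"])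
  then show "emeasure P {\<omega>\<in>Omega. cut m \<omega> \<in> B} = emeasure Q {\<omega>\<in>Omega. cut m \<omega> \<in> B}"
    using P(2) Q(2) sp distr_eq[of m] by simp
qed

end

section \<open>Integration against the Ionescu-Tulcea measure\<close>

context Ionescu_Tulcea
begin

text \<open>The marginal of the projective limit on an initial segment is the iterated kernel; the
  library phrases it with the least bound \<open>up_to\<close> of the index set, which for
  \<open>{0..<n}\<close> is \<open>n\<close>.\<close>

lemma nn_integral_lim_restrict:
  assumes g: "g \<in> borel_measurable (PiM {0..<n} M)"
  shows "(\<integral>\<^sup>+y. g (restrict y {0..<n}) \<partial>PF.lim) = (\<integral>\<^sup>+y. g y \<partial>C 0 n (\<lambda>x. undefined))"
proof -
  have r: "(\<lambda>y. restrict y {0..<n}) \<in> PF.lim \<rightarrow>\<^sub>M PiM {0..<n} M"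
    unfolding measurable_cong_sets[OF PF.sets_lim refl] by (rule measurable_restrict_subset) simp
  have up: "up_to {0..<n} = n"
  proof (rule antisym)
    show "up_to {0..<n} \<le> n" by (subst up_to_iff) auto
    show "n \<le> up_to {0..<n}" using up_to_less[of "{0..<n}" "n - 1"] by (cases n) auto
  qed
  have "(\<integral>\<^sup>+y. g (restrict y {0..<n}) \<partial>PF.lim) = (\<integral>\<^sup>+y. g y \<partial>CI {0..<n})"
    by (subst distr_lim[symmetric], simp, subst nn_integral_distr[OF r]) (use g in auto)
  also have "\<dots> = (\<integral>\<^sup>+y. g (restrict y {0..<n}) \<partial>C 0 n (\<lambda>x. undefined))"
    unfolding CI_def up
  proof (subst nn_integral_distr)
    have "sets (C 0 n (\<lambda>x. undefined)) = sets (PiM {0..<n} M)" using sets_C[of "\<lambda>x. undefined" 0 n] by simp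
    note sC = this
    show "(\<lambda>f. restrict f {0..<n}) \<in> C 0 n (\<lambda>x. undefined) \<rightarrow>\<^sub>M PiM {0..<n} M"
      unfolding measurable_cong_sets[OF sC refl] by (rule measurable_restrict_subset) simp
  qed (use g in auto)
  also have "\<dots> = (\<integral>\<^sup>+y. g y \<partial>C 0 n (\<lambda>x. undefined))"
    using space_C[of "\<lambda>x. undefined" 0 n]
    by (intro nn_integral_cong arg_cong[where f=g]) (auto simp: space_PiM PiE_restrict)
  finally show ?thesis .
qed

text \<open>The disintegration property in usable form: given the first \<open>n\<close>
  coordinates, the next one is drawn from the kernel \<open>P n\<close>.\<close>

lemma nn_integral_lim_step:
  assumes G: "G \<in> borel_measurable (PiM {0..<Suc n} M)"
  shows "(\<integral>\<^sup>+y. G (restrict y {0..<Suc n}) \<partial>PF.lim) =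
    (\<integral>\<^sup>+y. (\<integral>\<^sup>+z. G ((restrict y {0..<n})(n := z)) \<partial>P n (restrict y {0..<n})) \<partial>PF.lim)"
proof -
  have sC: "sets (C 0 n (\<lambda>x. undefined)) = sets (PiM {0..<n} M)" using sets_C[of "\<lambda>x. undefined" 0 n] by simp
  have "(\<integral>\<^sup>+y. G (restrict y {0..<Suc n}) \<partial>PF.lim) = (\<integral>\<^sup>+y. G y \<partial>(C 0 n (\<lambda>x. undefined) \<bind> eP n))"
    using nn_integral_lim_restrict[OF G] by simp
  also have "\<dots> = (\<integral>\<^sup>+y. \<integral>\<^sup>+z. G z \<partial>eP n y \<partial>C 0 n (\<lambda>x. undefined))"
    by (rule nn_integral_bind[OF G]) (simp add: measurable_cong_sets[OF sC refl])
  also have "\<dots> = (\<integral>\<^sup>+y. \<integral>\<^sup>+z. G z \<partial>eP n (restrict y {0..<n}) \<partial>PF.lim)"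
  proof (rule nn_integral_lim_restrict[symmetric])
    show "(\<lambda>y. \<integral>\<^sup>+z. G z \<partial>eP n y) \<in> borel_measurable (PiM {0..<n} M)"
      by (rule measurable_compose[OF measurable_eP nn_integral_measurable_subprob_algebra[OF G]])
  qed
  also have "\<dots> = (\<integral>\<^sup>+y. (\<integral>\<^sup>+z. G ((restrict y {0..<n})(n := z)) \<partial>P n (restrict y {0..<n})) \<partial>PF.lim)"
  proof (rule nn_integral_cong)
    fix y assume "y \<in> space PF.lim"
    then have "y \<in> space (PiM UNIV M)" using sets_eq_imp_space_eq[OF PF.sets_lim] by simp
    then have "restrict y {0..<n} \<in> space (PiM {0..<n} M)" by (auto simp: space_PiM)
    then show "(\<integral>\<^sup>+z. G z \<partial>eP n (restrict y {0..<n})) = (\<integral>\<^sup>+z. G ((restrict y {0..<n})(n := z)) \<partial>P n (restrict y {0..<n}))"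
      by (rule nn_integral_eP[OF _ G])
  qed
  finally show ?thesis .
qed

lemma prob_space_lim: "prob_space PF.lim"
proof -
  interpret C: prob_space "C 0 0 (\<lambda>x. undefined)" by (rule prob_space_C) simp
  have "(\<integral>\<^sup>+y. 1 \<partial>PF.lim) = (\<integral>\<^sup>+y. 1 \<partial>C 0 0 (\<lambda>x. undefined))"
    using nn_integral_lim_restrict[of "\<lambda>_. 1" 0] by (simp del: C.simps nn_integral_const)
  also have "\<dots> = 1" using C.emeasure_space_1 by (simp del: C.simps)
  finally show ?thesis by (intro prob_spaceI) simp
qed

end

lemma nn_integral_count_space_option:
  fixes f :: "'b option \<Rightarrow> ennreal"
  shows "(\<integral>\<^sup>+x. f x \<partial>count_space UNIV) = f None + (\<integral>\<^sup>+j. f (Some j) \<partial>count_space UNIV)"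
proof -
  have "(\<integral>\<^sup>+x. f x \<partial>count_space UNIV) = (\<integral>\<^sup>+x. f x * indicator {None} x + f x * indicator (range Some) x \<partial>count_space UNIV)"
  proof (rule nn_integral_cong)
    show "f x = f x * indicator {None} x + f x * indicator (range Some) x" for x by (cases x) auto
  qed
  also have "\<dots> = (\<integral>\<^sup>+x. f x * indicator {None} x \<partial>count_space UNIV) + (\<integral>\<^sup>+x. f x * indicator (range Some) x \<partial>count_space UNIV)"
    by (rule nn_integral_add) simp_all
  also have "(\<integral>\<^sup>+x. f x * indicator {None} x \<partial>count_space UNIV) = f None"
    by (subst nn_integral_indicator_singleton) simp_all
  also have "(\<integral>\<^sup>+x. f x * indicator (range Some) x \<partial>count_space UNIV) = (\<integral>\<^sup>+x. f x \<partial>count_space (range Some))"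
    by (subst nn_integral_count_space_indicator) simp_all
  also have "\<dots> = (\<integral>\<^sup>+j. f (Some j) \<partial>count_space UNIV)"
    by (rule nn_integral_bij_count_space[symmetric]) (simp add: bij_betw_def)
  finally show ?thesis .
qed

text \<open>Membership in \<open>Omega\<close> only concerns neighbouring coordinates, and each such
  pair is visible in a sufficiently late cut. Paths glued from histories thus stay in
  \<open>Omega\<close>.\<close>

lemma Omega_of_cuts:
  assumes "\<And>m. cut m \<omega> \<in> Omega" shows "\<omega> \<in> Omega"
  unfolding Omega_iff
proof (intro conjI allI impI)
  fix l
  note c = assms[of "Suc (Suc l)"]
  show "fst (\<omega> 0) \<noteq> None" using Omega_start[OF assms[of 0]] by (simp add: cut_def)
  show "0 < snd (\<omega> l)" using Omega_pos[OF c, of l] by (simp add: cut_def)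
  show "\<omega> (Suc l) = (None, \<infinity>)" if "snd (\<omega> l) = \<infinity>" using Omega_end[OF c, of l] that by (simp add: cut_def)
  show "fst (\<omega> (Suc l)) \<noteq> None" if "snd (\<omega> l) \<noteq> \<infinity>" using Omega_next[OF c, of l] that by (simp add: cut_def)
qed

lemma cut_cut_ge: "m \<le> n \<Longrightarrow> cut n (cut m \<omega>) = cut m \<omega>"
  by (auto simp: cut_def fun_eq_iff)

lemma start_path_Omega: "start_path (Some i) \<in> Omega"
  by (auto simp: Omega_iff start_path_def)

lemma pred_path_eq:
  fixes f g :: "'b \<Rightarrow> 's::{countable,discrete_topology} path"
  assumes "f \<in> M \<rightarrow>\<^sub>M borel" "g \<in> M \<rightarrow>\<^sub>M borel"
  shows "Measurable.pred M (\<lambda>x. f x = g x)"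
proof -
  note [measurable] = measurable_compose[OF assms(1) measurable_path_state] measurable_compose[OF assms(1) measurable_path_holding]
    measurable_compose[OF assms(2) measurable_path_state] measurable_compose[OF assms(2) measurable_path_holding]
  have [measurable]: "Measurable.pred M (\<lambda>x. snd (f x l) = snd (g x l))" for l
    unfolding pred_def by (rule borel_measurable_eq) measurable
  have "Measurable.pred M (\<lambda>x. \<forall>l. (\<forall>i. fst (f x l) = i \<longleftrightarrow> fst (g x l) = i) \<and> snd (f x l) = snd (g x l))"
    by measurable
  moreover have "f x = g x \<longleftrightarrow> (\<forall>l. (\<forall>i. fst (f x l) = i \<longleftrightarrow> fst (g x l) = i) \<and> snd (f x l) = snd (g x l))" for x
  proof -
    have "(\<forall>i. (a = i) = (b = i)) = (a = b)" for a b :: "'s option" by auto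
    then show ?thesis unfolding fun_eq_iff[of "f x"] prod_eq_iff by simp
  qed
  ultimately show ?thesis by simp
qed

section \<open>Construction of a law with the prescribed jumps\<close>

context jump_intensity
begin

text \<open>Monotone convergence along integer times in \<open>jump_law_before\<close>. The missing
  mass is the conditional probability that no further jump occurs.\<close>

lemma jump_law_le_1:
  assumes "h \<in> Omega"
  shows "jump_law m (\<lambda>_ _ _. 1) (cut m h) \<le> 1"
proof -
  define f where "f s = (if jump_time m (cut m h) < ennreal s
     then survival m (cut m h) s * (\<integral>\<^sup>+j. rp (cut m h) s j * 1 \<partial>count_space UNIV) else 0)" for s
  have [measurable]: "(\<lambda>s::real. cut m h) \<in> borel \<rightarrow>\<^sub>M path_space" using assms by simp
  have fm: "f \<in> borel_measurable borel" unfolding f_def by measurable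
  have L: "jump_law m (\<lambda>_ s _. if s < t then 1 else 0) (cut m h) = (\<integral>\<^sup>+s. f s * indicator {..<t} s \<partial>lborel)" for t
    unfolding jump_law_def by (intro nn_integral_cong) (auto simp: f_def indicator_def)
  have "jump_law m (\<lambda>_ _ _. 1) (cut m h) = (\<integral>\<^sup>+s. (SUP n. f s * indicator {..<real n} s) \<partial>lborel)"
    unfolding jump_law_def
  proof (intro nn_integral_cong)
    fix s :: real
    obtain n0 where n0: "s < real n0" using reals_Archimedean2 by blast
    have "(SUP n. f s * indicator {..<real n} s) = f s"
      by (rule antisym) (auto intro!: SUP_least SUP_upper2[of n0] simp: indicator_def n0)
    then show "(if jump_time m (cut m h) < ennreal s
     then survival m (cut m h) s * (\<integral>\<^sup>+j. rp (cut m h) s j * 1 \<partial>count_space UNIV) else 0) = (SUP n. f s * indicator {..<real n} s)"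
      by (simp add: f_def)
  qed
  also have "\<dots> = (SUP n. \<integral>\<^sup>+s. f s * indicator {..<real n} s \<partial>lborel)"
    using fm by (intro nn_integral_monotone_convergence_SUP) (auto simp: incseq_def le_fun_def indicator_def)
  also have "\<dots> \<le> 1"
  proof (rule SUP_least)
    fix n :: nat
    have "(\<integral>\<^sup>+s. f s * indicator {..<real n} s \<partial>lborel)
        \<le> jump_law m (\<lambda>_ s _. if s < real n then 1 else 0) (cut m h)
     + (if jump_time m h < ennreal (real n) then survival m (cut m h) (real n) else 0)"
      unfolding L by (rule order_trans[OF _ add_increasing2]) auto
    also have "\<dots> \<le> 1" unfolding jump_law_before[OF assms] by simp
    finally show "(\<integral>\<^sup>+s. f s * indicator {..<real n} s \<partial>lborel) \<le> 1" .
  qed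
  finally show ?thesis .
qed

definition step_density :: "nat \<Rightarrow> 's path \<Rightarrow> 's option \<times> real \<Rightarrow> ennreal" where
  "step_density m h = (\<lambda>(x, t). case x of
      Some j \<Rightarrow> if jump_time m h < ennreal t then survival m h t * rp h t j else 0
    | None \<Rightarrow> (1 - jump_law m (\<lambda>_ _ _. 1) h) * indicator {0<..<1} t)"

text \<open>\<open>None\<close> stands for no further jump. The fallback for times not after the
  jump \<open>m\<close> has density 0 and only keeps the map inside \<open>Omega\<close>.\<close>

definition step_path :: "nat \<Rightarrow> 's path \<Rightarrow> 's option \<times> real \<Rightarrow> 's path" where
  "step_path m h = (\<lambda>(x, t). case x of
      Some j \<Rightarrow> if jump_time m h < ennreal t then append_jump m h t j else h
    | None \<Rightarrow> h)"

text \<open>The law of the path cut at the jump \<open>m + 1\<close>, given the path cut at the jump \<open>m\<close>. The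
  defect of the jump law goes to paths without any further jump; it is spread over the
  dummy time interval \<open>(0, 1)\<close>.\<close>

definition step_kernel :: "nat \<Rightarrow> 's path \<Rightarrow> 's path measure" where
  "step_kernel m h = distr (density (count_space UNIV \<Otimes>\<^sub>M lborel) (step_density m (cut m h))) path_space (step_path m (cut m h))"

lemma measurable_step_density:
  assumes h: "h \<in> Omega" shows "step_density m h \<in> borel_measurable (count_space UNIV \<Otimes>\<^sub>M lborel)"
proof (rule measurable_pair_measure_countable1)
  fix x :: "'s option"
  have [measurable]: "(\<lambda>s::real. h) \<in> borel \<rightarrow>\<^sub>M path_space" using assms by simp
  show "(\<lambda>t. step_density m h (x, t)) \<in> borel_measurable lborel"
    by (cases x) (simp_all add: step_density_def)
qed simp

lemma measurable_step_path:
  assumes h: "h \<in> Omega" shows "step_path m h \<in> count_space UNIV \<Otimes>\<^sub>M lborel \<rightarrow>\<^sub>M path_space"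
proof (rule measurable_pair_measure_countable1)
  fix x :: "'s option"
  have h': "h \<in> space path_space" using h by simp
  have [measurable]: "(\<lambda>s::real. h) \<in> borel \<rightarrow>\<^sub>M path_space" "(\<lambda>s::real. h) \<in> borel \<rightarrow>\<^sub>M borel" using h by simp_all
  show "(\<lambda>t. step_path m h (x, t)) \<in> lborel \<rightarrow>\<^sub>M path_space"
    unfolding measurable_path_space_iff using append_jump_Omega[OF h] h
    by (cases x) (auto simp: step_path_def)
qed simp

text \<open>Either a jump is appended according to the jump law, or the history remains as it is
  with the defect as its weight. The guard by \<open>Omega\<close> turns \<open>g\<close>, which is
  measurable on paths only, into a mark; it holds wherever \<open>jump_law\<close>
  integrates.\<close>

lemma nn_integral_step_kernel:
  assumes h: "h \<in> Omega" and g: "g \<in> borel_measurable path_space"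
  shows "(\<integral>\<^sup>+\<omega>. g \<omega> \<partial>step_kernel m h) =
    jump_law m (\<lambda>h t j. if append_jump m h t j \<in> Omega then g (append_jump m h t j) else 0) (cut m h)
    + (1 - jump_law m (\<lambda>_ _ _. 1) (cut m h)) * g (cut m h)"
proof -
  let ?h = "cut m h" and ?M = "count_space (UNIV :: 's option set) \<Otimes>\<^sub>M (lborel :: real measure)"
  have h': "?h \<in> Omega" using h by simp
  note md = measurable_step_density[OF h', of m] and mp = measurable_step_path[OF h', of m]
  have gp: "(\<lambda>x. g (step_path m ?h x)) \<in> borel_measurable ?M" by (rule measurable_compose[OF mp g])
  have [measurable]: "(\<lambda>s::real. cut m h) \<in> borel \<rightarrow>\<^sub>M path_space" using h' by simp
  have gm: "(\<lambda>t. if jump_time m ?h < ennreal t then survival m ?h t * rp ?h t j * g (append_jump m ?h t j) else 0) \<in> borel_measurable borel" for j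
  proof -
    have "(\<lambda>t. (if jump_time m ?h < ennreal t then survival m ?h t * rp ?h t j else 0) * g (step_path m ?h (Some j, t))) \<in> borel_measurable borel"
      using measurable_Pair2[OF gp, of "Some j"] by (intro borel_measurable_times_ennreal) (measurable, simp)
    then show ?thesis by (rule measurable_cong[THEN iffD1, rotated]) (simp add: step_path_def)
  qed
  have "(\<integral>\<^sup>+\<omega>. g \<omega> \<partial>step_kernel m h) = (\<integral>\<^sup>+x. step_density m ?h x * g (step_path m ?h x) \<partial>?M)"
    unfolding step_kernel_def using md mp gp g by (subst nn_integral_distr) (auto simp: nn_integral_density)
  also have "\<dots> = (\<integral>\<^sup>+x. \<integral>\<^sup>+t. step_density m ?h (x, t) * g (step_path m ?h (x, t)) \<partial>lborel \<partial>count_space UNIV)"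
    using md gp by (intro lborel.nn_integral_fst[symmetric]) simp
  also have "\<dots> = (\<integral>\<^sup>+t. ((1 - jump_law m (\<lambda>_ _ _. 1) ?h) * g ?h) * indicator {0<..<1} t \<partial>(lborel :: real measure))
     + (\<integral>\<^sup>+j. \<integral>\<^sup>+t. (if jump_time m ?h < ennreal t then survival m ?h t * rp ?h t j * g (append_jump m ?h t j) else 0) \<partial>lborel \<partial>count_space UNIV)"
    unfolding nn_integral_count_space_option
    by (intro arg_cong2[where f="(+)"] nn_integral_cong) (simp_all add: step_density_def step_path_def ac_simps)
  finally have 0: "(\<integral>\<^sup>+\<omega>. g \<omega> \<partial>step_kernel m h) =
     (\<integral>\<^sup>+t. ((1 - jump_law m (\<lambda>_ _ _. 1) ?h) * g ?h) * indicator {0<..<1} t \<partial>(lborel :: real measure))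
     + (\<integral>\<^sup>+j. \<integral>\<^sup>+t. (if jump_time m ?h < ennreal t then survival m ?h t * rp ?h t j * g (append_jump m ?h t j) else 0) \<partial>lborel \<partial>count_space UNIV)" .
  have 1: "(\<integral>\<^sup>+t. ((1 - jump_law m (\<lambda>_ _ _. 1) ?h) * g ?h) * indicator {0<..<1} t \<partial>(lborel :: real measure)) = (1 - jump_law m (\<lambda>_ _ _. 1) ?h) * g ?h"
  proof -
    have "(\<integral>\<^sup>+t. c * indicator {0<..<1} t \<partial>(lborel :: real measure)) = c" for c :: ennreal
      using nn_integral_cmult_indicator[of "{0<..<1::real}" lborel c] by simp
    then show ?thesis .
  qed
  have 2: "(\<integral>\<^sup>+j. \<integral>\<^sup>+t. (if jump_time m ?h < ennreal t then survival m ?h t * rp ?h t j * g (append_jump m ?h t j) else 0) \<partial>lborel \<partial>count_space UNIV)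
     = (\<integral>\<^sup>+t. \<integral>\<^sup>+j. (if jump_time m ?h < ennreal t then survival m ?h t * rp ?h t j * g (append_jump m ?h t j) else 0) \<partial>count_space UNIV \<partial>lborel)"
    by (rule nn_integral_count_measure_swap[OF lborel.sigma_finite_measure_axioms]) (unfold measurable_lborel2, rule gm)
  have 3: "(\<integral>\<^sup>+t. \<integral>\<^sup>+j. (if jump_time m ?h < ennreal t then survival m ?h t * rp ?h t j * g (append_jump m ?h t j) else 0) \<partial>count_space UNIV \<partial>lborel)
     = jump_law m (\<lambda>h t j. if append_jump m h t j \<in> Omega then g (append_jump m h t j) else 0) ?h"
    unfolding jump_law_def
  proof (intro nn_integral_cong)
    fix t :: real
    show "(\<integral>\<^sup>+j. (if jump_time m ?h < ennreal t then survival m ?h t * rp ?h t j * g (append_jump m ?h t j) else 0) \<partial>count_space UNIV) =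
      (if jump_time m ?h < ennreal t then survival m ?h t *
        (\<integral>\<^sup>+j. rp ?h t j * (if append_jump m ?h t j \<in> Omega then g (append_jump m ?h t j) else 0) \<partial>count_space UNIV) else 0)"
    proof (cases "jump_time m ?h < ennreal t")
      case True
      then show ?thesis using append_jump_Omega[OF h' True] by (simp add: nn_integral_cmult[symmetric] mult.assoc)
    qed simp
  qed
  show ?thesis unfolding 0 1 2 3 by (rule add.commute)
qed

lemma prob_space_step_kernel:
  assumes h: "h \<in> Omega" shows "prob_space (step_kernel m h)"
proof (rule prob_spaceI)
  have "jump_law m (\<lambda>h t j. if append_jump m h t j \<in> Omega then 1 else 0) (cut m h) = jump_law m (\<lambda>_ _ _. 1) (cut m h)"
    unfolding jump_law_def using append_jump_Omega[OF cut_Omega[OF h], of m m] by (intro nn_integral_cong) simp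
  then have "(\<integral>\<^sup>+\<omega>. 1 \<partial>step_kernel m h) = 1"
    using jump_law_le_1[OF h, of m] by (subst nn_integral_step_kernel[OF h]) (simp_all add: add_diff_inverse_ennreal)
  then show "emeasure (step_kernel m h) (space (step_kernel m h)) = 1" by simp
qed

lemma sets_step_kernel [simp]: "sets (step_kernel m h) = sets path_space"
  by (simp add: step_kernel_def)

lemma measurable_step_kernel: "step_kernel m \<in> path_space \<rightarrow>\<^sub>M subprob_algebra path_space"
proof (rule measurable_subprob_algebra)
  fix h :: "'s path" assume "h \<in> space path_space"
  then show "subprob_space (step_kernel m h)" by (intro prob_space_imp_subprob_space prob_space_step_kernel) simp
next
  fix B :: "'s path set" assume B[measurable]: "B \<in> sets path_space"
  note [measurable] = sets_path_space_borel[OF B]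
  let ?F = "\<lambda>h t j. if append_jump m h t j \<in> Omega then indicator B (append_jump m h t j) else 0 :: ennreal"
  have F: "meas_mark ?F" "meas_mark (\<lambda>_ _ _. 1)" unfolding meas_mark_def by measurable
  note [measurable] = measurable_compose[OF measurable_cut measurable_jump_law[OF F(1)], of m m]
    measurable_compose[OF measurable_cut measurable_jump_law[OF F(2)], of m m]
  have "(\<lambda>h. jump_law m ?F (cut m h) + (1 - jump_law m (\<lambda>_ _ _. 1) (cut m h)) * indicator B (cut m h)) \<in> borel_measurable path_space"
    by measurable
  then show "(\<lambda>h. emeasure (step_kernel m h) B) \<in> borel_measurable path_space"
  proof (rule measurable_cong[THEN iffD1, rotated])
    fix h :: "'s path" assume "h \<in> space path_space"
    then have "(\<integral>\<^sup>+\<omega>. indicator B \<omega> \<partial>step_kernel m h) = jump_law m ?F (cut m h) + (1 - jump_law m (\<lambda>_ _ _. 1) (cut m h)) * indicator B (cut m h)"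
      by (intro nn_integral_step_kernel) simp_all
    then show "jump_law m ?F (cut m h) + (1 - jump_law m (\<lambda>_ _ _. 1) (cut m h)) * indicator B (cut m h) = emeasure (step_kernel m h) B"
      by simp
  qed
qed simp

text \<open>A step extends the history without altering it, so the coordinates of a trajectory fit
  together to a single path.\<close>

lemma step_kernel_cut:
  assumes h: "h \<in> Omega"
  shows "AE \<omega> in step_kernel m h. cut m \<omega> = cut m h \<and> cut (Suc m) \<omega> = \<omega>"
proof -
  have c: "cut k \<in> path_space \<rightarrow>\<^sub>M (borel :: 's path measure)" for k
    by (rule measurable_path_spaceD[OF measurable_cut_borel])
  have i: "(\<lambda>x. x) \<in> path_space \<rightarrow>\<^sub>M (borel :: 's path measure)"
    by (rule measurable_path_spaceD) simp
  have k: "(\<lambda>x. cut m h) \<in> path_space \<rightarrow>\<^sub>M (borel :: 's path measure)" by simp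
  note [measurable] = pred_path_eq[OF c k] pred_path_eq[OF c i]
  have p: "Measurable.pred (path_space :: 's path measure) (\<lambda>\<omega>. cut m \<omega> = cut m h \<and> cut (Suc m) \<omega> = \<omega>)"
    by measurable
  show ?thesis
    unfolding step_kernel_def
  proof (subst AE_distr_iff)
    show "step_path m (cut m h) \<in> density (count_space UNIV \<Otimes>\<^sub>M lborel) (step_density m (cut m h)) \<rightarrow>\<^sub>M path_space"
      using measurable_step_path[OF cut_Omega[OF h], of m m] by simp
    show "{x \<in> space path_space. cut m x = cut m h \<and> cut (Suc m) x = x} \<in> sets path_space"
      using p by (simp only: pred_def)
    have "cut m (step_path m (cut m h) x) = cut m h \<and> cut (Suc m) (step_path m (cut m h) x) = step_path m (cut m h) x" for x
    proof -
      obtain y t where x: "x = (y, t)" by (cases x)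
      show ?thesis
        by (cases y) (simp_all add: x step_path_def cut_append_jump cut_Suc_append_jump cut_cut cut_cut_ge)
    qed
    then show "AE x in density (count_space UNIV \<Otimes>\<^sub>M lborel) (step_density m (cut m h)).
       cut m (step_path m (cut m h) x) = cut m h \<and> cut (Suc m) (step_path m (cut m h) x) = step_path m (cut m h) x"
      by (intro AE_I2)
  qed
qed

text \<open>Each coordinate of the Ionescu-Tulcea product is a whole history, so every kernel
  depends on the preceding coordinate alone. The trajectory of histories is almost surely consistent
  and is then glued to one path.\<close>

lemma ex_transition_law:
  "\<exists>P. prob_space P \<and> sets P = sets path_space \<and>
     (\<forall>i. measure P {\<omega>\<in>Omega. xi \<omega> 0 = Some i} = pmf \<gamma> i) \<and>
     (\<forall>m F. meas_mark F \<longrightarrow> (\<integral>\<^sup>+\<omega>. jump_mark m F \<omega> \<partial>P) = (\<integral>\<^sup>+\<omega>. jump_law m F (cut m \<omega>) \<partial>P))"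
proof -
  define init where "init = distr (measure_pmf \<gamma>) path_space (\<lambda>i. start_path (Some i) :: 's path)"
  have sm: "(\<lambda>i. start_path (Some i) :: 's path) \<in> measure_pmf \<gamma> \<rightarrow>\<^sub>M path_space"
    using start_path_Omega by auto
  define Pk where "Pk i y = (case i of 0 \<Rightarrow> init | Suc m \<Rightarrow> step_kernel m (y m))" for i :: nat and y :: "nat \<Rightarrow> 's path"
  interpret IT: Ionescu_Tulcea Pk "\<lambda>_. path_space"
  proof (rule Ionescu_Tulcea.intro)
    show "Pk i \<in> PiM {0..<i} (\<lambda>_. path_space) \<rightarrow>\<^sub>M subprob_algebra path_space" for i
    proof (cases i)
      case 0
      have "init \<in> space (subprob_algebra path_space)"
        unfolding init_def using sm by (auto simp: space_subprob_algebra intro!: prob_space_imp_subprob_space prob_space.prob_space_distr prob_space_measure_pmf)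
      then show ?thesis by (simp add: 0 Pk_def[abs_def])
    next
      case (Suc m)
      show ?thesis unfolding Suc Pk_def[abs_def] nat.case
        by (rule measurable_compose[OF _ measurable_step_kernel], rule measurable_component_singleton) simp
    qed
    show "prob_space (Pk i y)" if "y \<in> space (PiM {0..<i} (\<lambda>_. path_space))" for i y
    proof (cases i)
      case 0
      then show ?thesis unfolding Pk_def init_def using sm
        by (auto intro!: prob_space.prob_space_distr prob_space_measure_pmf)
    next
      case (Suc m)
      then have "y m \<in> Omega" using that by (auto simp: space_PiM)
      then show ?thesis by (simp add: Suc Pk_def prob_space_step_kernel)
    qed
  qed
  let ?L = "IT.PF.lim"
  interpret L: prob_space ?L by (rule IT.prob_space_lim)
  have sL: "sets ?L = sets (PiM UNIV (\<lambda>_. path_space))" by (rule IT.PF.sets_lim)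
  have spL: "y n \<in> Omega" if "y \<in> space ?L" for y n
    using that unfolding sets_eq_imp_space_eq[OF sL] by (auto simp: space_PiM)
  have cm: "(\<lambda>y. y n) \<in> ?L \<rightarrow>\<^sub>M path_space" for n
    unfolding measurable_cong_sets[OF sL refl] by (rule measurable_component_singleton) simp
  have step0: "(\<integral>\<^sup>+y. g (y 0) \<partial>?L) = (\<integral>\<^sup>+z. g z \<partial>init)" if g: "g \<in> borel_measurable path_space" for g
  proof -
    have "(\<lambda>y. g (y 0)) \<in> borel_measurable (PiM {0..<Suc 0} (\<lambda>_. path_space))"
      by (rule measurable_compose[OF _ g], rule measurable_component_singleton) simp
    from IT.nn_integral_lim_step[OF this] L.emeasure_space_1 show ?thesis
      by (simp add: Pk_def sets_eq_imp_space_eq[OF sL])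
  qed
  have step: "(\<integral>\<^sup>+y. G (y m) (y (Suc m)) \<partial>?L) = (\<integral>\<^sup>+y. (\<integral>\<^sup>+z. G (y m) z \<partial>step_kernel m (y m)) \<partial>?L)"
    if G: "(\<lambda>(x, z). G x z) \<in> borel_measurable (path_space \<Otimes>\<^sub>M path_space)" for G m
  proof -
    have "(\<lambda>y. (y m, y (Suc m))) \<in> PiM {0..<Suc (Suc m)} (\<lambda>_. path_space) \<rightarrow>\<^sub>M path_space \<Otimes>\<^sub>M path_space"
      by (intro measurable_Pair measurable_component_singleton) auto
    from measurable_compose[OF this G]
    have "(\<lambda>y. G (y m) (y (Suc m))) \<in> borel_measurable (PiM {0..<Suc (Suc m)} (\<lambda>_. path_space))" by simp
    from IT.nn_integral_lim_step[OF this] show ?thesis by (simp add: Pk_def)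
  qed
  \<comment> \<open>Consistency is transferred from the kernel to the product measure by integrating
    the indicator of its failure.\<close>
  have AE_step: "AE y in ?L. cut m (y (Suc m)) = cut m (y m) \<and> cut (Suc m) (y (Suc m)) = y (Suc m)" for m
  proof -
    let ?Q = "\<lambda>x z. cut m z = cut m x \<and> cut (Suc m) z = (z :: 's path)"
    have b: "fst \<in> path_space \<Otimes>\<^sub>M path_space \<rightarrow>\<^sub>M (borel :: 's path measure)" "snd \<in> path_space \<Otimes>\<^sub>M path_space \<rightarrow>\<^sub>M (borel :: 's path measure)"
      using measurable_fst[of "path_space :: 's path measure" path_space] measurable_snd[of path_space "path_space :: 's path measure"]
      by (auto simp: measurable_path_space_iff)
    have Q: "Measurable.pred (path_space \<Otimes>\<^sub>M path_space) (\<lambda>p. ?Q (fst p) (snd p))"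
    proof -
      note [measurable] = pred_path_eq[OF measurable_compose[OF b(2) measurable_cut_borel] measurable_compose[OF b(1) measurable_cut_borel]]
        pred_path_eq[OF measurable_compose[OF b(2) measurable_cut_borel] b(2)]
      show ?thesis by measurable
    qed
    then have Gm: "(\<lambda>(x, z). if ?Q x z then 0 else 1 :: ennreal) \<in> borel_measurable (path_space \<Otimes>\<^sub>M path_space)"
      by (simp add: case_prod_unfold)
    have "(\<integral>\<^sup>+y. (if ?Q (y m) (y (Suc m)) then 0 else 1) \<partial>?L) = (\<integral>\<^sup>+y. (\<integral>\<^sup>+z. (if ?Q (y m) z then 0 else 1) \<partial>step_kernel m (y m)) \<partial>?L)"
      by (rule step[OF Gm])
    also have "\<dots> = (\<integral>\<^sup>+y. 0 \<partial>?L)"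
    proof (rule nn_integral_cong)
      fix y assume "y \<in> space ?L"
      from step_kernel_cut[OF spL[OF this], of m m]
      have "(\<integral>\<^sup>+z. (if ?Q (y m) z then 0 else 1) \<partial>step_kernel m (y m)) = (\<integral>\<^sup>+z. 0 \<partial>step_kernel m (y m))"
        by (intro nn_integral_cong_AE) auto
      then show "(\<integral>\<^sup>+z. (if ?Q (y m) z then 0 else 1) \<partial>step_kernel m (y m)) = 0" by simp
    qed
    finally have 0: "(\<integral>\<^sup>+y. (if ?Q (y m) (y (Suc m)) then 0 else 1) \<partial>?L) = 0" by simp
    have "(\<lambda>y. (y m, y (Suc m))) \<in> ?L \<rightarrow>\<^sub>M path_space \<Otimes>\<^sub>M path_space" using cm by simp
    from measurable_compose[OF this Gm] have "(\<lambda>y. if ?Q (y m) (y (Suc m)) then 0 else 1 :: ennreal) \<in> borel_measurable ?L" by simp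
    from nn_integral_0_iff_AE[OF this] 0 have "AE y in ?L. (if ?Q (y m) (y (Suc m)) then 0 else 1 :: ennreal) = 0" by simp
    then show ?thesis by eventually_elim (auto split: if_splits)
  qed
  have AE_0: "AE y in ?L. cut 0 (y 0) = y 0"
  proof -
    have Q: "Measurable.pred (path_space :: 's path measure) (\<lambda>z. cut 0 z = z)"
      by (rule pred_path_eq[OF measurable_path_spaceD[OF measurable_cut_borel] measurable_path_spaceD]) simp
    then have Gm: "(\<lambda>z::'s path. if cut 0 z = z then 0 else 1 :: ennreal) \<in> borel_measurable path_space" by measurable
    have "(\<integral>\<^sup>+y. (if cut 0 (y 0) = y 0 then 0 else 1) \<partial>?L) = (\<integral>\<^sup>+z. (if cut 0 z = z then 0 else 1) \<partial>init)"
      by (rule step0[OF Gm])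
    also have "\<dots> = (\<integral>\<^sup>+i. 0 \<partial>measure_pmf \<gamma>)"
      unfolding init_def
    proof (subst nn_integral_distr[OF sm])
      have "cut 0 (start_path x) = start_path x" for x :: "'s option" by (auto simp: cut_def start_path_def)
      then show "(\<integral>\<^sup>+x. (if cut 0 (start_path (Some x)) = start_path (Some x) then 0 else 1) \<partial>measure_pmf \<gamma>) = (\<integral>\<^sup>+i. 0 \<partial>measure_pmf \<gamma>)" by simp
    qed (use Gm in simp)
    finally have 0: "(\<integral>\<^sup>+y. (if cut 0 (y 0) = y 0 then 0 else 1) \<partial>?L) = 0" by simp
    from measurable_compose[OF cm Gm, of 0] have "(\<lambda>y. if cut 0 (y 0) = y 0 then 0 else 1 :: ennreal) \<in> borel_measurable ?L" .
    from nn_integral_0_iff_AE[OF this] 0 have "AE y in ?L. (if cut 0 (y 0) = y 0 then 0 else 1 :: ennreal) = 0" by simp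
    then show ?thesis by eventually_elim (auto split: if_splits)
  qed
  \<comment> \<open>The history \<open>y l\<close> still has an infinite sojourn at place
    \<open>l\<close>; the true holding time appears in \<open>y (Suc l)\<close> only. The default
    value is taken on a null set and keeps the map inside \<open>Omega\<close>.\<close>
  define lim_path where "lim_path y = (let \<omega> = (\<lambda>l. y (Suc l) l) in if \<omega> \<in> Omega then \<omega> else start_path (Some undefined))" for y :: "nat \<Rightarrow> 's path"
  have good: "AE y in ?L. \<forall>m. cut m (lim_path y) = y m"
  proof -
    have "AE y in ?L. \<forall>m. cut m (y (Suc m)) = cut m (y m) \<and> cut (Suc m) (y (Suc m)) = y (Suc m)"
      using AE_step by (simp add: AE_all_countable)
    with AE_0 show ?thesis using AE_space
    proof eventually_elim
      case (elim y)
      have self: "cut m (y m) = y m" for m using elim by (cases m) auto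
      have le: "cut m (y n) = y m" if "m \<le> n" for m n
        using that
      proof (induction n rule: dec_induct)
        case (step n)
        have "cut m (y (Suc n)) = cut m (cut n (y (Suc n)))" using step by (simp add: cut_cut)
        also have "\<dots> = y m" using elim self step by simp
        finally show ?case .
      qed (simp add: self)
      let ?w = "\<lambda>l. y (Suc l) l"
      have cw: "cut m ?w = y m" for m
      proof
        fix l
        consider "l < m" | "l = m" | "l > m" by linarith
        then show "cut m ?w l = y m l"
        proof cases
          case 1
          then have "y (Suc l) l = cut (Suc l) (y m) l" using le[of "Suc l" m] by simp
          with 1 show ?thesis by (simp add: cut_def)
        next
          case 2
          have "y m m = cut m (y (Suc m)) m" using le[of m "Suc m"] by simp
          with 2 show ?thesis by (simp add: cut_def)
        next
          case 3
          have "y m l = cut m (y m) l" using self by simp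
          with 3 show ?thesis by (simp add: cut_def)
        qed
      qed
      moreover have "?w \<in> Omega" by (rule Omega_of_cuts) (simp add: cw spL[OF elim(3)])
      ultimately show ?case by (simp add: lim_path_def)
    qed
  qed
  have lm: "lim_path \<in> ?L \<rightarrow>\<^sub>M path_space"
  proof -
    have cmb: "(\<lambda>y. y n) \<in> ?L \<rightarrow>\<^sub>M borel" for n using cm[of n] by (simp add: measurable_path_space_iff)
    have w: "(\<lambda>y l. y (Suc l) l) \<in> ?L \<rightarrow>\<^sub>M (borel :: 's path measure)"
      using measurable_compose[OF cmb measurable_path_state] measurable_compose[OF cmb measurable_path_holding]
      by (intro measurable_into_path) auto
    have "{y \<in> space ?L. (\<lambda>l. y (Suc l) l) \<in> Omega} \<in> sets ?L"
      using measurable_sets[OF w Omega_borel] by (simp add: vimage_def Int_def conj_commute)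
    then have "(\<lambda>y. if (\<lambda>l. y (Suc l) l) \<in> Omega then (\<lambda>l. y (Suc l) l) else start_path (Some undefined)) \<in> ?L \<rightarrow>\<^sub>M (borel :: 's path measure)"
      using w by (intro measurable_If) auto
    then show ?thesis unfolding measurable_path_space_iff lim_path_def[abs_def] Let_def
      using start_path_Omega by auto
  qed
  define P where "P = distr ?L path_space lim_path"
  have int: "(\<integral>\<^sup>+\<omega>. g \<omega> \<partial>P) = (\<integral>\<^sup>+y. g (lim_path y) \<partial>?L)" if "g \<in> borel_measurable path_space" for g
    unfolding P_def by (rule nn_integral_distr[OF lm]) (use that in simp)
  have P: "prob_space P" unfolding P_def by (rule L.prob_space_distr[OF lm])
  interpret P: prob_space P by fact
  have sP: "sets P = sets path_space" by (simp add: P_def)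
  have trans: "(\<integral>\<^sup>+\<omega>. jump_mark m F \<omega> \<partial>P) = (\<integral>\<^sup>+\<omega>. jump_law m F (cut m \<omega>) \<partial>P)" if F: "meas_mark F" for m F
  proof -
    \<comment> \<open>The mark of the jump \<open>m + 1\<close> reads the history up to that jump
      only, which almost surely is the coordinate \<open>y (Suc m)\<close>.\<close>
    have jc: "jump_mark m F \<omega> = jump_mark m F (cut (Suc m) \<omega>)" for \<omega>
      by (simp add: jump_mark_def jump_time_cut jump_state_cut cut_cut)
    note jm = measurable_jump_mark[OF F, of m]
    have "(\<integral>\<^sup>+\<omega>. jump_mark m F \<omega> \<partial>P) = (\<integral>\<^sup>+y. jump_mark m F (lim_path y) \<partial>?L)"
      by (rule int[OF jm])
    also have "\<dots> = (\<integral>\<^sup>+y. jump_mark m F (y (Suc m)) \<partial>?L)"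
      by (rule nn_integral_cong_AE) (use good in eventually_elim, subst jc, simp)
    also have "\<dots> = (\<integral>\<^sup>+y. (\<integral>\<^sup>+z. jump_mark m F z \<partial>step_kernel m (y m)) \<partial>?L)"
      by (rule step) (use measurable_compose[OF measurable_snd jm] in \<open>simp add: case_prod_unfold\<close>)
    also have "\<dots> = (\<integral>\<^sup>+y. jump_law m F (cut m (y m)) \<partial>?L)"
    proof (rule nn_integral_cong)
      fix y assume "y \<in> space ?L"
      then have y: "y m \<in> Omega" by (rule spL)
      \<comment> \<open>The part of the kernel that leaves the history as it is contributes nothing,
        since a path cut at \<open>m\<close> has no jump \<open>m + 1\<close>.\<close>
      have "jump_mark m F (cut m (y m)) = 0" by (simp add: jump_mark_def jump_time_cut)
      moreover have "jump_law m (\<lambda>h t j. if append_jump m h t j \<in> Omega then jump_mark m F (append_jump m h t j) else 0) (cut m (y m)) = jump_law m F (cut m (y m))"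
        unfolding jump_law_def
      proof (intro nn_integral_cong if_cong refl arg_cong2[where f="(*)"])
        fix t j assume t: "jump_time m (cut m (y m)) < ennreal t"
        have "0 < t" using less_ennrealD[OF t] .
        then show "(if append_jump m (cut m (y m)) t j \<in> Omega then jump_mark m F (append_jump m (cut m (y m)) t j) else 0) = F (cut m (y m)) t j"
          using append_jump_Omega[OF cut_Omega[OF y] t] jump_time_append_jump[OF t]
          by (simp add: jump_mark_def jump_state_append_jump cut_append_jump cut_cut)
      qed
      ultimately show "(\<integral>\<^sup>+z. jump_mark m F z \<partial>step_kernel m (y m)) = jump_law m F (cut m (y m))"
        by (simp add: nn_integral_step_kernel[OF y jm])
    qed
    also have "\<dots> = (\<integral>\<^sup>+y. jump_law m F (cut m (lim_path y)) \<partial>?L)"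
      by (rule nn_integral_cong_AE) (use good in eventually_elim, metis cut_cut order_refl)
    also have "\<dots> = (\<integral>\<^sup>+\<omega>. jump_law m F (cut m \<omega>) \<partial>P)"
      by (rule int[symmetric]) (rule measurable_compose[OF measurable_cut measurable_jump_law[OF F]])
    finally show ?thesis .
  qed
  have init: "measure P {\<omega>\<in>Omega. xi \<omega> 0 = Some i} = pmf \<gamma> i" for i
  proof -
    let ?S = "{\<omega>\<in>space path_space. jump_state 0 \<omega> = Some i}"
    have S: "?S \<in> sets path_space" by measurable
    have Seq: "{\<omega>\<in>Omega. xi \<omega> 0 = Some i} = ?S" by (auto simp: xi_0)
    have "emeasure P ?S = (\<integral>\<^sup>+y. indicator ?S (lim_path y) \<partial>?L)"
      using int[of "indicator ?S"] S by (simp add: sP)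
    also have "\<dots> = (\<integral>\<^sup>+y. indicator ?S (y 0) \<partial>?L)"
    proof (rule nn_integral_cong_AE)
      show "AE y in ?L. indicator ?S (lim_path y) = (indicator ?S (y 0) :: ennreal)"
        using good AE_space
      proof eventually_elim
        case (elim y)
        have "jump_state 0 (lim_path y) = jump_state 0 (y 0)" using elim(1) jump_state_cut[of 0 0 "lim_path y"] by simp
        moreover have "lim_path y \<in> Omega" using measurable_space[OF lm elim(2)] by simp
        ultimately show ?case using spL[OF elim(2)] by (simp add: indicator_def)
      qed
    qed
    also have "\<dots> = (\<integral>\<^sup>+z. indicator ?S z \<partial>init)" by (rule step0) (use S in simp)
    also have "\<dots> = (\<integral>\<^sup>+k. indicator ?S (start_path (Some k)) \<partial>measure_pmf \<gamma>)"
      unfolding init_def by (rule nn_integral_distr[OF sm]) (use S in simp)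
    also have "\<dots> = (\<integral>\<^sup>+k. indicator {i} k \<partial>measure_pmf \<gamma>)"
      using start_path_Omega by (intro nn_integral_cong) (auto simp: indicator_def jump_state_def start_path_def)
    also have "\<dots> = ennreal (pmf \<gamma> i)" by (simp add: emeasure_pmf_single)
    finally show ?thesis unfolding Seq by (simp add: P.emeasure_eq_measure)
  qed
  show ?thesis using P sP trans init by blast
qed

text \<open>This is what gives the definite description in \<open>controlled_law\<close> a
  meaning.\<close>

theorem ex1_law:
  "\<exists>!P. prob_space P \<and> sets P = sets path_space \<and>
     (\<forall>i. measure P {\<omega>\<in>Omega. xi \<omega> 0 = Some i} = pmf \<gamma> i) \<and>
     dual_predictable_projection P mu comp_measure"
proof (rule ex_ex1I)
  from ex_transition_law[of \<gamma>] show "\<exists>P. prob_space P \<and> sets P = sets path_space \<and>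
     (\<forall>i. measure P {\<omega>\<in>Omega. xi \<omega> 0 = Some i} = pmf \<gamma> i) \<and>
     dual_predictable_projection P mu comp_measure"
    using dual_predictable_projection_iff_transition by blast
next
  fix P Q
  assume P: "prob_space P \<and> sets P = sets path_space \<and>
     (\<forall>i. measure P {\<omega>\<in>Omega. xi \<omega> 0 = Some i} = pmf \<gamma> i) \<and> dual_predictable_projection P mu comp_measure"
    and Q: "prob_space Q \<and> sets Q = sets path_space \<and>
     (\<forall>i. measure Q {\<omega>\<in>Omega. xi \<omega> 0 = Some i} = pmf \<gamma> i) \<and> dual_predictable_projection Q mu comp_measure"
  show "P = Q"
    using P Q dual_predictable_projection_iff_transition[of P] dual_predictable_projection_iff_transition[of Q]
    by (intro transition_law_unique) auto
qed

end

section \<open>The forward equation\<close>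

lemma suminf_ennreal_Suc: "(\<Sum>n. f n) = f 0 + (\<Sum>n. f (Suc n))" for f :: "nat \<Rightarrow> ennreal"
  using sums_Suc[OF summable_sums[OF summableI, of "\<lambda>n. f (Suc n)"]] by (simp add: sums_iff add.commute)

text \<open>A path is in \<open>j\<close> just before \<open>t\<close> exactly when its entries into
  \<open>j\<close>, the start included, exceed its exits by one. The additive form remains true
  after explosion, when both counts may be infinite.\<close>

lemma jump_balance:
  assumes \<omega>: "\<omega> \<in> Omega" and t: "0 \<le> t"
  shows "of_bool (xi_minus \<omega> t = Some j) + (\<Sum>n. of_bool (before (Suc n) \<omega> t \<and> jump_state n \<omega> = Some j)) =
    of_bool (jump_state 0 \<omega> = Some j) + (\<Sum>n. of_bool (before (Suc n) \<omega> t \<and> jump_state (Suc n) \<omega> = Some j) :: ennreal)"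
proof (rule before_cases[of \<omega> t])
  assume b: "\<And>m. before m \<omega> t"
  have "xi_minus \<omega> t = None" using xi_minus_exploded[OF \<omega> t b] .
  moreover have "(\<Sum>n. of_bool (jump_state n \<omega> = Some j) :: ennreal) =
     of_bool (jump_state 0 \<omega> = Some j) + (\<Sum>n. of_bool (jump_state (Suc n) \<omega> = Some j))"
    by (rule suminf_ennreal_Suc)
  ultimately show ?thesis by (simp add: b)
next
  fix m assume b: "before m \<omega> t" "\<not> before (Suc m) \<omega> t"
  have bn: "before (Suc n) \<omega> t \<longleftrightarrow> n \<in> {..<m}" for n
    using before_mono[OF b(1), of "Suc n"] before_mono[of "Suc n" \<omega> t "Suc m"] b(2) by (cases "n < m") auto
  have *: "(\<Sum>n. of_bool (before (Suc n) \<omega> t \<and> P n) :: ennreal) = (\<Sum>n<m. of_bool (P n))" for P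
    unfolding bn by (subst suminf_finite[of "{..<m}"]) auto
  have "of_bool (jump_state m \<omega> = Some j) + (\<Sum>n<m. of_bool (jump_state n \<omega> = Some j) :: ennreal) = (\<Sum>n<Suc m. of_bool (jump_state n \<omega> = Some j))"
    by (simp add: add.commute)
  also have "\<dots> = of_bool (jump_state 0 \<omega> = Some j) + (\<Sum>n<m. of_bool (jump_state (Suc n) \<omega> = Some j))"
    by (subst sum.lessThan_Suc_shift) simp
  finally show ?thesis unfolding * xi_minus_last[OF \<omega> t b] .
qed

lemma measurable_predictable_snd: "snd \<in> borel_measurable (predictable :: ('s path \<times> real) measure)"
  using measurable_compose[OF measurable_predictable_time measurable_restrict_space1[of "\<lambda>x. x" borel borel]] by simp

lemma sets_xi_minus: "0 \<le> t \<Longrightarrow> {\<omega> \<in> Omega. xi_minus \<omega> t = x} \<in> sets (path_space :: 's::{countable,discrete_topology} path measure)"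
proof -
  assume t: "0 \<le> t"
  then have "(\<lambda>\<omega>::'s path. (\<omega>, t)) \<in> path_space \<rightarrow>\<^sub>M path_space \<Otimes>\<^sub>M nonneg_time" by simp
  from measurable_compose[OF this measurable_xi_minus_product]
  have "(\<lambda>\<omega>::'s path. xi_minus \<omega> t) \<in> path_space \<rightarrow>\<^sub>M count_space UNIV" by simp
  from measurable_sets[OF this, of "{x}"] show ?thesis by (simp add: vimage_def Int_def conj_commute)
qed

lemma predictable_countable_compose:
  fixes x :: "('s::{countable,discrete_topology} path \<times> real) \<Rightarrow> 's option"
  assumes "\<And>x. (\<lambda>p. f x p) \<in> predictable \<rightarrow>\<^sub>M N"
  shows "(\<lambda>p. f (xi_minus (fst p) (snd p)) p) \<in> (predictable :: ('s path \<times> real) measure) \<rightarrow>\<^sub>M N"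
  by (rule measurable_compose_countable[OF assms measurable_xi_minus])

context jump_intensity
begin

lemma rp_pos: "0 < s \<Longrightarrow> rp \<omega> s = r \<omega> s"
  by (simp add: rp_def fun_eq_iff)

text \<open>The expectation of \<open>jump_balance\<close>, with the two counts replaced by their
  compensators.\<close>

lemma forward_equation:
  assumes P: "prob_space P" "sets P = sets path_space" and D: "dual_predictable_projection P mu comp_measure"
    and t: "0 \<le> t"
  shows "emeasure P {\<omega>\<in>Omega. xi_minus \<omega> t = Some j}
      + (\<integral>\<^sup>+s. \<integral>\<^sup>+\<omega>. (if xi_minus \<omega> s = Some j then \<integral>\<^sup>+k. r \<omega> s k \<partial>count_space UNIV else 0) \<partial>P * indicator {0<..<t} s \<partial>lborel)
    = emeasure P {\<omega>\<in>Omega. xi \<omega> 0 = Some j} + (\<integral>\<^sup>+s. \<integral>\<^sup>+\<omega>. r \<omega> s j \<partial>P * indicator {0<..<t} s \<partial>lborel)"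
proof -
  interpret P: prob_space P by fact
  interpret PL: pair_sigma_finite P lborel ..
  note [measurable_cong] = P(2)
  have sp: "space P = Omega" using sets_eq_imp_space_eq[OF P(2)] by simp
  note [measurable] = measurable_predictable_snd measurable_xi_minus
  \<comment> \<open>\<open>W1\<close> counts arrivals in \<open>j\<close>, \<open>W2\<close>
    departures from \<open>j\<close>. Both are predictable, as a departure is recognised by the left
    limit; the strict \<open>s < t\<close> matches \<open>before\<close>.\<close>
  define W1 where "W1 = (\<lambda>((\<omega>::'s path, s), k). of_bool (s < t \<and> k = j) :: ennreal)"
  define W2 where "W2 = (\<lambda>((\<omega>, s), k::'s). of_bool (s < t \<and> xi_minus \<omega> s = Some j) :: ennreal)"
  have W1: "W1 \<in> borel_measurable (predictable \<Otimes>\<^sub>M count_space UNIV)"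
    unfolding measurable_pair_countable_iff W1_def case_prod_unfold fst_conv snd_conv of_bool_def by (intro allI) measurable
  have W2: "W2 \<in> borel_measurable (predictable \<Otimes>\<^sub>M count_space UNIV)"
    unfolding measurable_pair_countable_iff W2_def case_prod_unfold fst_conv snd_conv of_bool_def by (intro allI) measurable
  have tt: "enn2real (jump_time (Suc n) \<omega>) < t \<longleftrightarrow> before (Suc n) \<omega> t" if "jump_time (Suc n) \<omega> < \<infinity>" for n and \<omega> :: "'s path"
    using that by (cases "jump_time (Suc n) \<omega>") (auto simp: before_def ennreal_less_iff)
  have mu1: "(\<integral>\<^sup>+(s, k). W1 ((\<omega>, s), k) \<partial>mu \<omega>) = (\<Sum>n. of_bool (before (Suc n) \<omega> t \<and> jump_state (Suc n) \<omega> = Some j))"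
    if \<omega>: "\<omega> \<in> Omega" for \<omega>
  proof -
    have "jump_mark n (mark_of W1) \<omega> = of_bool (before (Suc n) \<omega> t \<and> jump_state (Suc n) \<omega> = Some j)" for n
    proof (cases "jump_time (Suc n) \<omega> < \<infinity>")
      case True
      have "0 < enn2real (jump_time (Suc n) \<omega>)"
        using True jump_time_pos[OF \<omega>, of "Suc n"] by (simp add: enn2real_positive_iff)
      moreover have "the (jump_state (Suc n) \<omega>) = j \<longleftrightarrow> jump_state (Suc n) \<omega> = Some j"
        using jump_state_finite[OF \<omega> True] by auto
      ultimately show ?thesis using True tt[OF True] by (simp add: jump_mark_def mark_of_def W1_def)
    next
      case False
      then have "\<not> before (Suc n) \<omega> t" using before_finite by blast
      with False show ?thesis by (simp add: jump_mark_def)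
    qed
    then show ?thesis using nn_integral_mu_marks[OF W1 \<omega>] by simp
  qed
  have mu2: "(\<integral>\<^sup>+(s, k). W2 ((\<omega>, s), k) \<partial>mu \<omega>) = (\<Sum>n. of_bool (before (Suc n) \<omega> t \<and> jump_state n \<omega> = Some j))"
    if \<omega>: "\<omega> \<in> Omega" for \<omega>
  proof -
    have "jump_mark n (mark_of W2) \<omega> = of_bool (before (Suc n) \<omega> t \<and> jump_state n \<omega> = Some j)" for n
    proof (cases "jump_time (Suc n) \<omega> < \<infinity>")
      case True
      define s where "s = enn2real (jump_time (Suc n) \<omega>)"
      have s: "0 < s" "ennreal s = jump_time (Suc n) \<omega>"
        using True jump_time_pos[OF \<omega>, of "Suc n"] by (auto simp: s_def enn2real_positive_iff)
      have "jump_time n \<omega> < jump_time (Suc n) \<omega>"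
        using jump_time_less_Suc[OF \<omega>, of n] le_less_trans[OF jump_time_mono[of n "Suc n" \<omega>] True] by simp
      then have "before n \<omega> s" using s by (simp add: before_def)
      then have "xi_minus (cut n \<omega>) s = jump_state n \<omega>" using s by (intro xi_minus_cut[OF \<omega>]) auto
      then show ?thesis using True s tt[OF True] by (simp add: jump_mark_def mark_of_def W2_def s_def[symmetric])
    next
      case False
      then have "\<not> before (Suc n) \<omega> t" using before_finite by blast
      with False show ?thesis by (simp add: jump_mark_def)
    qed
    then show ?thesis using nn_integral_mu_marks[OF W2 \<omega>] by simp
  qed
  have sect: "(\<lambda>(s, k). W ((\<omega>, s), k)) \<in> borel_measurable (restrict_space borel {0<..} \<Otimes>\<^sub>M count_space UNIV)"
    if "W \<in> borel_measurable (predictable \<Otimes>\<^sub>M count_space UNIV)" "\<omega> \<in> Omega"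
    for W :: "('s path \<times> real) \<times> 's \<Rightarrow> ennreal" and \<omega>
    using predictable_section[OF that(1)[unfolded measurable_pair_countable_iff, rule_format] that(2)]
    by (simp add: measurable_pair_countable_iff)
  have nu1: "(\<integral>\<^sup>+(s, k). W1 ((\<omega>, s), k) \<partial>comp_measure \<omega>) = (\<integral>\<^sup>+s. rp \<omega> s j * indicator {0<..<t} s \<partial>lborel)"
    if \<omega>: "\<omega> \<in> Omega" for \<omega>
  proof -
    have "(\<integral>\<^sup>+k. r \<omega> s k * W1 ((\<omega>, s), k) \<partial>count_space UNIV) = r \<omega> s j * of_bool (s < t)" for s
    proof -
      have "(\<integral>\<^sup>+k. r \<omega> s k * W1 ((\<omega>, s), k) \<partial>count_space UNIV) = (\<integral>\<^sup>+k. (r \<omega> s k * of_bool (s < t)) * indicator {j} k \<partial>count_space UNIV)"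
        by (intro nn_integral_cong) (auto simp: W1_def indicator_def)
      also have "\<dots> = r \<omega> s j * of_bool (s < t)" by (subst nn_integral_indicator_singleton) simp_all
      finally show ?thesis .
    qed
    then show ?thesis unfolding nn_integral_comp_measure[OF sect[OF W1 \<omega>] \<omega>]
      by (intro nn_integral_cong) (auto simp: rp_def indicator_def)
  qed
  have nu2: "(\<integral>\<^sup>+(s, k). W2 ((\<omega>, s), k) \<partial>comp_measure \<omega>)
     = (\<integral>\<^sup>+s. (if xi_minus \<omega> s = Some j then \<integral>\<^sup>+k. rp \<omega> s k \<partial>count_space UNIV else 0) * indicator {0<..<t} s \<partial>lborel)"
    if \<omega>: "\<omega> \<in> Omega" for \<omega>
    unfolding nn_integral_comp_measure[OF sect[OF W2 \<omega>] \<omega>]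
    by (intro nn_integral_cong) (auto simp: rp_pos indicator_def W2_def)
  have xm: "Measurable.pred (path_space \<Otimes>\<^sub>M borel) (\<lambda>x::'s path \<times> real. 0 < snd x \<and> xi_minus (fst x) (snd x) = Some j)"
  proof -
    have "(\<lambda>x::'s path \<times> real. if 0 < snd x then of_bool (xi_minus (fst x) (snd x) = Some j) else 0 :: ennreal) \<in> borel_measurable (path_space \<Otimes>\<^sub>M borel)"
    proof -
      have "(\<lambda>x. of_bool (xi_minus (fst x) (snd x) = Some j)) \<in> borel_measurable (predictable :: ('s path \<times> real) measure)"
        unfolding of_bool_def by measurable
      from measurable_predictable_compose[OF this measurable_fst measurable_snd] show ?thesis
        by (simp only: fst_conv snd_conv)
    qed
    from measurable_sets[OF this, of "{1}"] show ?thesis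
      unfolding pred_def by (rule back_subst[of "\<lambda>A. A \<in> _"]) (auto split: if_splits)
  qed
  note [measurable] = xm
  have swap1: "(\<integral>\<^sup>+\<omega>. \<integral>\<^sup>+s. rp \<omega> s j * indicator {0<..<t} s \<partial>lborel \<partial>P) = (\<integral>\<^sup>+s. \<integral>\<^sup>+\<omega>. r \<omega> s j \<partial>P * indicator {0<..<t} s \<partial>lborel)"
  proof -
    have "(\<integral>\<^sup>+\<omega>. \<integral>\<^sup>+s. rp \<omega> s j * indicator {0<..<t} s \<partial>lborel \<partial>P) = (\<integral>\<^sup>+s. \<integral>\<^sup>+\<omega>. rp \<omega> s j * indicator {0<..<t} s \<partial>P \<partial>lborel)"
      by (rule PL.Fubini'[symmetric]) measurable
    also have "\<dots> = (\<integral>\<^sup>+s. \<integral>\<^sup>+\<omega>. r \<omega> s j \<partial>P * indicator {0<..<t} s \<partial>lborel)"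
      by (intro nn_integral_cong) (auto simp: indicator_def rp_def)
    finally show ?thesis .
  qed
  have swap2: "(\<integral>\<^sup>+\<omega>. \<integral>\<^sup>+s. (if xi_minus \<omega> s = Some j then \<integral>\<^sup>+k. rp \<omega> s k \<partial>count_space UNIV else 0) * indicator {0<..<t} s \<partial>lborel \<partial>P)
     = (\<integral>\<^sup>+s. \<integral>\<^sup>+\<omega>. (if xi_minus \<omega> s = Some j then \<integral>\<^sup>+k. r \<omega> s k \<partial>count_space UNIV else 0) \<partial>P * indicator {0<..<t} s \<partial>lborel)"
  proof -
    have "(\<integral>\<^sup>+\<omega>. \<integral>\<^sup>+s. (if xi_minus \<omega> s = Some j then \<integral>\<^sup>+k. rp \<omega> s k \<partial>count_space UNIV else 0) * indicator {0<..<t} s \<partial>lborel \<partial>P)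
      = (\<integral>\<^sup>+\<omega>. \<integral>\<^sup>+s. (if 0 < s \<and> xi_minus \<omega> s = Some j then (\<integral>\<^sup>+k. rp \<omega> s k \<partial>count_space UNIV) * indicator {0<..<t} s else 0) \<partial>lborel \<partial>P)"
      by (intro nn_integral_cong) (auto simp: indicator_def)
    also have "\<dots> = (\<integral>\<^sup>+s. \<integral>\<^sup>+\<omega>. (if 0 < s \<and> xi_minus \<omega> s = Some j then (\<integral>\<^sup>+k. rp \<omega> s k \<partial>count_space UNIV) * indicator {0<..<t} s else 0) \<partial>P \<partial>lborel)"
      by (rule PL.Fubini'[symmetric]) measurable
    also have "\<dots> = (\<integral>\<^sup>+s. \<integral>\<^sup>+\<omega>. (if xi_minus \<omega> s = Some j then \<integral>\<^sup>+k. r \<omega> s k \<partial>count_space UNIV else 0) \<partial>P * indicator {0<..<t} s \<partial>lborel)"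
    proof (rule nn_integral_cong)
      fix s :: real
      show "(\<integral>\<^sup>+\<omega>. (if 0 < s \<and> xi_minus \<omega> s = Some j then (\<integral>\<^sup>+k. rp \<omega> s k \<partial>count_space UNIV) * indicator {0<..<t} s else 0) \<partial>P)
        = (\<integral>\<^sup>+\<omega>. (if xi_minus \<omega> s = Some j then \<integral>\<^sup>+k. r \<omega> s k \<partial>count_space UNIV else 0) \<partial>P) * indicator {0<..<t} s"
        by (cases "s \<in> {0<..<t}") (simp_all add: rp_pos cong: if_cong)
    qed
    finally show ?thesis .
  qed
  let ?in = "\<lambda>\<omega>. \<Sum>n. of_bool (before (Suc n) \<omega> t \<and> jump_state (Suc n) \<omega> = Some j) :: ennreal"
  let ?out = "\<lambda>\<omega>. \<Sum>n. of_bool (before (Suc n) \<omega> t \<and> jump_state n \<omega> = Some j) :: ennreal"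
  have [measurable]: "?in \<in> borel_measurable P" "?out \<in> borel_measurable P"
    unfolding of_bool_def before_def by measurable
  have ev: "{\<omega> \<in> Omega. xi_minus \<omega> t = Some j} \<in> sets P" using sets_xi_minus[OF t] P(2) by simp
  have ev0: "{\<omega> \<in> Omega. xi \<omega> 0 = Some j} \<in> sets P"
  proof -
    have "{\<omega> \<in> space P. jump_state 0 \<omega> = Some j} \<in> sets P" by measurable
    also have "{\<omega> \<in> space P. jump_state 0 \<omega> = Some j} = {\<omega> \<in> Omega. xi \<omega> 0 = Some j}" by (auto simp: sp xi_0)
    finally show ?thesis .
  qed
  have "emeasure P {\<omega>\<in>Omega. xi_minus \<omega> t = Some j} + (\<integral>\<^sup>+\<omega>. ?out \<omega> \<partial>P)
     = (\<integral>\<^sup>+\<omega>. indicator {\<omega>\<in>Omega. xi_minus \<omega> t = Some j} \<omega> + ?out \<omega> \<partial>P)"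
    using ev by (simp add: nn_integral_add)
  also have "\<dots> = (\<integral>\<^sup>+\<omega>. indicator {\<omega>\<in>Omega. xi \<omega> 0 = Some j} \<omega> + ?in \<omega> \<partial>P)"
  proof (rule nn_integral_cong)
    fix \<omega> assume "\<omega> \<in> space P"
    then have \<omega>: "\<omega> \<in> Omega" by (simp add: sp)
    show "indicator {\<omega>\<in>Omega. xi_minus \<omega> t = Some j} \<omega> + ?out \<omega> = indicator {\<omega>\<in>Omega. xi \<omega> 0 = Some j} \<omega> + ?in \<omega>"
      using jump_balance[OF \<omega> t, of j] \<omega> by (simp add: indicator_def of_bool_def xi_0 cong: if_cong)
  qed
  also have "\<dots> = emeasure P {\<omega>\<in>Omega. xi \<omega> 0 = Some j} + (\<integral>\<^sup>+\<omega>. ?in \<omega> \<partial>P)"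
    using ev0 by (simp add: nn_integral_add)
  finally have bal: "emeasure P {\<omega>\<in>Omega. xi_minus \<omega> t = Some j} + (\<integral>\<^sup>+\<omega>. ?out \<omega> \<partial>P)
     = emeasure P {\<omega>\<in>Omega. xi \<omega> 0 = Some j} + (\<integral>\<^sup>+\<omega>. ?in \<omega> \<partial>P)" .
  have DD: "(\<integral>\<^sup>+\<omega>. (\<integral>\<^sup>+(t, j). W ((\<omega>, t), j) \<partial>mu \<omega>) \<partial>P) = (\<integral>\<^sup>+\<omega>. (\<integral>\<^sup>+(t, j). W ((\<omega>, t), j) \<partial>comp_measure \<omega>) \<partial>P)"
    if "W \<in> borel_measurable (predictable \<Otimes>\<^sub>M count_space UNIV)" for W
    using D that unfolding dual_predictable_projection_def by blast
  have "(\<integral>\<^sup>+\<omega>. ?in \<omega> \<partial>P) = (\<integral>\<^sup>+\<omega>. (\<integral>\<^sup>+(s, k). W1 ((\<omega>, s), k) \<partial>mu \<omega>) \<partial>P)"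
    by (intro nn_integral_cong) (simp add: mu1 sp)
  also have "\<dots> = (\<integral>\<^sup>+\<omega>. \<integral>\<^sup>+s. rp \<omega> s j * indicator {0<..<t} s \<partial>lborel \<partial>P)"
    unfolding DD[OF W1] by (intro nn_integral_cong) (simp add: nu1 sp)
  finally have i: "(\<integral>\<^sup>+\<omega>. ?in \<omega> \<partial>P) = (\<integral>\<^sup>+s. \<integral>\<^sup>+\<omega>. r \<omega> s j \<partial>P * indicator {0<..<t} s \<partial>lborel)"
    unfolding swap1 .
  have "(\<integral>\<^sup>+\<omega>. ?out \<omega> \<partial>P) = (\<integral>\<^sup>+\<omega>. (\<integral>\<^sup>+(s, k). W2 ((\<omega>, s), k) \<partial>mu \<omega>) \<partial>P)"
    by (intro nn_integral_cong) (simp add: mu2 sp)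
  also have "\<dots> = (\<integral>\<^sup>+\<omega>. \<integral>\<^sup>+s. (if xi_minus \<omega> s = Some j then \<integral>\<^sup>+k. rp \<omega> s k \<partial>count_space UNIV else 0) * indicator {0<..<t} s \<partial>lborel \<partial>P)"
    unfolding DD[OF W2] by (intro nn_integral_cong) (simp add: nu2 sp)
  finally have o: "(\<integral>\<^sup>+\<omega>. ?out \<omega> \<partial>P) = (\<integral>\<^sup>+s. \<integral>\<^sup>+\<omega>. (if xi_minus \<omega> s = Some j then \<integral>\<^sup>+k. r \<omega> s k \<partial>count_space UNIV else 0) \<partial>P * indicator {0<..<t} s \<partial>lborel)"
    unfolding swap2 .
  show ?thesis using bal unfolding i o .
qed

end

section \<open>Uniqueness for the forward equation under a drift condition\<close>

text \<open>The passage from \<open>ennreal\<close> integrals to real ones: infinite values, which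
  \<open>enn2real\<close> sends to 0, and the endpoints of the interval are null sets.\<close>

lemma enn2real_integral_interval:
  fixes f :: "real \<Rightarrow> ennreal"
  assumes f[measurable]: "f \<in> borel_measurable borel" and fin: "(\<integral>\<^sup>+s. f s * indicator {0<..<t} s \<partial>lborel) < \<infinity>"
  shows "(\<lambda>s. enn2real (f s)) absolutely_integrable_on {0..t}"
    and "integral {0..t} (\<lambda>s. enn2real (f s)) = enn2real (\<integral>\<^sup>+s. f s * indicator {0<..<t} s \<partial>lborel)"
proof -
  have AE_end: "AE s in lborel. s \<noteq> 0 \<and> s \<noteq> t"
    using AE_lborel_singleton[of 0] AE_lborel_singleton[of t] by eventually_elim simp
  have "AE s in lborel. f s * indicator {0<..<t} s \<noteq> \<infinity>"
    by (rule nn_integral_PInf_AE) (use fin in auto)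
  then have "AE s in lborel. ennreal (indicator {0..t} s *\<^sub>R enn2real (f s)) = f s * indicator {0<..<t} s"
    using AE_end
  proof eventually_elim
    case (elim s)
    then show ?case
      by (cases "s \<in> {0<..<t}") (auto simp: indicator_def less_top[symmetric])
  qed
  then have eq: "(\<integral>\<^sup>+s. ennreal (indicator {0..t} s *\<^sub>R enn2real (f s)) \<partial>lborel) = (\<integral>\<^sup>+s. f s * indicator {0<..<t} s \<partial>lborel)"
    by (rule nn_integral_cong_AE)
  have m: "(\<lambda>s. indicator {0..t} s *\<^sub>R enn2real (f s)) \<in> borel_measurable lborel"
  proof -
    have "(\<lambda>s. enn2real (f s)) \<in> borel_measurable lborel" by measurable
    then show ?thesis by (intro borel_measurable_scaleR borel_measurable_indicator) simp_all
  qed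
  have i: "set_integrable lborel {0..t} (\<lambda>s. enn2real (f s))"
    unfolding set_integrable_def using fin eq
    by (intro integrableI_nonneg m) auto
  then have "set_integrable lebesgue {0..t} (\<lambda>s. enn2real (f s))"
    unfolding set_integrable_def by (subst integrable_completion[OF m]) simp
  then show "(\<lambda>s. enn2real (f s)) absolutely_integrable_on {0..t}" .
  have "integral {0..t} (\<lambda>s. enn2real (f s)) = (LINT s:{0..t}|lborel. enn2real (f s))"
    using set_borel_integral_eq_integral[OF i] by simp
  also have "\<dots> = enn2real (\<integral>\<^sup>+s. ennreal (indicator {0..t} s *\<^sub>R enn2real (f s)) \<partial>lborel)"
    unfolding set_lebesgue_integral_def by (rule integral_eq_nn_integral[OF m]) auto
  finally show "integral {0..t} (\<lambda>s. enn2real (f s)) = enn2real (\<integral>\<^sup>+s. f s * indicator {0<..<t} s \<partial>lborel)"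
    unfolding eq .
qed

text \<open>In the supremum norm weighted by \<open>exp (- 2 * \<rho> * s)\<close> the integral term
  has norm at most 1/2, hence \<beta> is at most \<open>c + \<beta> / 2\<close>. The bound
  \<open>m\<close> only serves to make \<beta> finite; the estimate must not depend on it, as it is
  used for truncations with growing \<open>m\<close>.\<close>

lemma gronwall_ennreal:
  fixes U :: "real \<Rightarrow> ennreal"
  assumes U: "\<And>t. U t \<le> ennreal m" and c: "0 \<le> c" and \<rho>: "0 < \<rho>" and T: "0 \<le> T"
    and le: "\<And>t. 0 \<le> t \<Longrightarrow> t \<le> T \<Longrightarrow> U t \<le> ennreal c + ennreal \<rho> * (\<integral>\<^sup>+s. U s * indicator {0<..<t} s \<partial>lborel)"
    and t: "0 \<le> t" "t \<le> T"
  shows "U t \<le> ennreal (2 * c * exp (2 * \<rho> * T))"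
proof -
  define u where "u s = enn2real (U s)" for s
  have Uu: "U s = ennreal (u s)" "0 \<le> u s" for s
    using le_less_trans[OF U ennreal_less_top, of s] by (simp_all add: u_def)
  have um: "u s \<le> \<bar>m\<bar>" for s using U[of s] Uu(2)[of s] unfolding Uu(1) by (cases "0 \<le> m") (auto simp: ennreal_neg)
  \<comment> \<open>With the rate doubled, integrating the weight gains the factor
    \<open>1 / (2 * \<rho>)\<close>, which turns \<rho> into 1/2.\<close>
  define \<beta> where "\<beta> = (SUP s\<in>{0..T}. u s * exp (- 2 * \<rho> * s))"
  have bdd: "bdd_above ((\<lambda>s. u s * exp (- 2 * \<rho> * s)) ` {0..T})"
  proof (rule bdd_aboveI2)
    fix s assume "s \<in> {0..T}"
    then show "u s * exp (- 2 * \<rho> * s) \<le> \<bar>m\<bar> * 1" using um[of s] \<rho> by (intro mult_mono) auto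
  qed
  have \<beta>: "u s * exp (- 2 * \<rho> * s) \<le> \<beta>" if "s \<in> {0..T}" for s
    unfolding \<beta>_def by (rule cSUP_upper[OF that bdd])
  have \<beta>0: "0 \<le> \<beta>" using \<beta>[of 0] T Uu(2)[of 0] by (auto intro: order_trans)
  have us: "u s \<le> \<beta> * exp (2 * \<rho> * s)" if "s \<in> {0..T}" for s
    using mult_right_mono[OF \<beta>[OF that], of "exp (2 * \<rho> * s)"] by (simp add: mult.assoc flip: exp_add)
  have "u s * exp (- 2 * \<rho> * s) \<le> c + \<beta> / 2" if s: "s \<in> {0..T}" for s
  proof -
    have "(\<integral>\<^sup>+r. U r * indicator {0<..<s} r \<partial>lborel) \<le> (\<integral>\<^sup>+r. ennreal (\<beta> * exp (2 * \<rho> * r)) * indicator {0..s} r \<partial>lborel)"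
      unfolding Uu(1) using us s by (intro nn_integral_mono) (auto simp: indicator_def intro!: ennreal_leI)
    also have "\<dots> = ennreal (\<beta> * exp (2 * \<rho> * s) / (2 * \<rho>) - \<beta> * exp (2 * \<rho> * 0) / (2 * \<rho>))"
      using \<rho> \<beta>0 s by (intro nn_integral_FTC_Icc) (auto intro!: derivative_eq_intros)
    also have "\<dots> \<le> ennreal (\<beta> * exp (2 * \<rho> * s) / (2 * \<rho>))" using \<beta>0 \<rho> by (intro ennreal_leI) auto
    finally have J: "(\<integral>\<^sup>+r. U r * indicator {0<..<s} r \<partial>lborel) \<le> ennreal (\<beta> * exp (2 * \<rho> * s) / (2 * \<rho>))" .
    have "U s \<le> ennreal c + ennreal \<rho> * (\<integral>\<^sup>+r. U r * indicator {0<..<s} r \<partial>lborel)" using le[of s] s by simp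
    also have "\<dots> \<le> ennreal c + ennreal \<rho> * ennreal (\<beta> * exp (2 * \<rho> * s) / (2 * \<rho>))"
      by (intro add_left_mono mult_left_mono J) simp
    also have "\<dots> = ennreal (c + \<beta> * exp (2 * \<rho> * s) / 2)"
      using c \<rho> \<beta>0 by (simp flip: ennreal_mult ennreal_plus)
    finally have "u s \<le> c + \<beta> * exp (2 * \<rho> * s) / 2"
      unfolding Uu(1) using c \<beta>0 by (subst (asm) ennreal_le_iff) auto
    then have "u s * exp (- 2 * \<rho> * s) \<le> (c + \<beta> * exp (2 * \<rho> * s) / 2) * exp (- 2 * \<rho> * s)"
      by (intro mult_right_mono) auto
    also have "\<dots> = c * exp (- 2 * \<rho> * s) + \<beta> / 2" by (simp add: distrib_right mult.assoc flip: exp_add)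
    also have "\<dots> \<le> c + \<beta> / 2" using c \<rho> s by (simp add: mult_left_le)
    finally show ?thesis .
  qed
  then have "\<beta> \<le> c + \<beta> / 2" unfolding \<beta>_def using T by (intro cSUP_least) auto
  then have "\<beta> \<le> 2 * c" by simp
  then have "u t \<le> 2 * c * exp (2 * \<rho> * t)"
    using us[of t] t by (auto intro: order_trans mult_right_mono)
  also have "\<dots> \<le> 2 * c * exp (2 * \<rho> * T)" using c \<rho> t by (intro mult_left_mono) auto
  finally show ?thesis unfolding Uu(1) by (rule ennreal_leI)
qed

text \<open>The rates are those of transitions to other states, and the exit rate plays the part of
  minus the diagonal entry. The drift condition is the usual one with the diagonal term moved to the
  right, so that everything is nonnegative.\<close>

locale drift_rates =
  fixes a :: "'s::countable \<Rightarrow> 's \<Rightarrow> real \<Rightarrow> ennreal" and w :: "'s \<Rightarrow> real" and L \<rho> b :: real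
  assumes a_meas [measurable]: "\<And>i j. a i j \<in> borel_measurable borel"
    and w_ge_1: "\<And>i. 1 \<le> w i"
    and params: "0 \<le> L" "0 < \<rho>" "0 \<le> b"
    and rate_bound: "\<And>i s. (\<integral>\<^sup>+j. a i j s \<partial>count_space UNIV) \<le> ennreal (L * w i)"
    and drift: "\<And>i s. (\<integral>\<^sup>+j. a i j s * ennreal (w j) \<partial>count_space UNIV)
        \<le> ennreal (\<rho> * w i + b) + ennreal (w i) * (\<integral>\<^sup>+j. a i j s \<partial>count_space UNIV)"
begin

definition exit_rate :: "'s \<Rightarrow> real \<Rightarrow> ennreal" where
  "exit_rate i s = (\<integral>\<^sup>+j. a i j s \<partial>count_space UNIV)"

text \<open>The outflow stands on the left-hand side because subtraction truncates in \<open>ennreal\<close>.\<close>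

definition forward_solution :: "('s \<Rightarrow> ennreal) \<Rightarrow> real \<Rightarrow> (real \<Rightarrow> 's \<Rightarrow> ennreal) \<Rightarrow> bool" where
  "forward_solution \<gamma> T p \<longleftrightarrow> (\<forall>i. (\<lambda>t. p t i) \<in> borel_measurable borel) \<and>
     (\<forall>t. (\<integral>\<^sup>+i. p t i \<partial>count_space UNIV) \<le> 1) \<and>
     (\<forall>t\<in>{0..T}. \<forall>j. p t j + (\<integral>\<^sup>+s. p s j * exit_rate j s * indicator {0<..<t} s \<partial>lborel)
        = \<gamma> j + (\<integral>\<^sup>+s. (\<integral>\<^sup>+i. p s i * a i j s \<partial>count_space UNIV) * indicator {0<..<t} s \<partial>lborel))"

lemma measurable_exit_rate [measurable]: "exit_rate i \<in> borel_measurable borel"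
  unfolding exit_rate_def[abs_def] by measurable

lemma exit_rate_le: "exit_rate i s \<le> ennreal (L * w i)"
  using rate_bound by (simp add: exit_rate_def)

lemma exit_rate_finite: "exit_rate i s < \<infinity>"
  using le_less_trans[OF exit_rate_le ennreal_less_top] by simp

text \<open>\<open>ennreal\<close> cuts negative values to 0, so
  \<open>ennreal (real m - w i)\<close> is \<open>m\<close> minus the truncated weight. Truncation
  preserves the drift bound: below the level \<open>m\<close> it can only lower the incoming weight,
  and from this level on the left side is 0.\<close>

lemma truncated_drift:
  fixes m :: nat
  shows "ennreal (real m - w i) * exit_rate i s
    \<le> (\<integral>\<^sup>+j. a i j s * ennreal (real m - w j) \<partial>count_space UNIV) + ennreal (\<rho> * min (w i) m + b)"
proof (cases "w i < real m")
  case True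
  have w0: "0 \<le> w j" for j using w_ge_1[of j] by simp
  have "ennreal (real m) * exit_rate i s = (\<integral>\<^sup>+j. a i j s * ennreal (real m) \<partial>count_space UNIV)"
    by (subst nn_integral_multc) (simp_all add: exit_rate_def mult.commute)
  also have "\<dots> \<le> (\<integral>\<^sup>+j. a i j s * ennreal (real m - w j) + a i j s * ennreal (w j) \<partial>count_space UNIV)"
  proof (intro nn_integral_mono)
    fix j
    have "ennreal (real m) \<le> ennreal (real m - w j) + ennreal (w j)"
      using w0[of j] by (cases "w j \<le> real m") (auto simp: ennreal_neg intro!: ennreal_leI simp flip: ennreal_plus)
    then show "a i j s * ennreal (real m) \<le> a i j s * ennreal (real m - w j) + a i j s * ennreal (w j)"
      by (simp add: mult_left_mono flip: distrib_left)
  qed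
  also have "\<dots> = (\<integral>\<^sup>+j. a i j s * ennreal (real m - w j) \<partial>count_space UNIV) + (\<integral>\<^sup>+j. a i j s * ennreal (w j) \<partial>count_space UNIV)"
    by (rule nn_integral_add) simp_all
  also have "\<dots> \<le> (\<integral>\<^sup>+j. a i j s * ennreal (real m - w j) \<partial>count_space UNIV) + (ennreal (\<rho> * w i + b) + ennreal (w i) * exit_rate i s)"
    using drift[of i s] by (intro add_left_mono) (simp add: exit_rate_def)
  finally have "ennreal (w i) * exit_rate i s + ennreal (real m - w i) * exit_rate i s
    \<le> ennreal (w i) * exit_rate i s + ((\<integral>\<^sup>+j. a i j s * ennreal (real m - w j) \<partial>count_space UNIV) + ennreal (\<rho> * w i + b))"
    using True w0[of i] by (simp add: add_ac flip: distrib_right ennreal_plus)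
  moreover have "ennreal (w i) * exit_rate i s \<noteq> \<infinity>" using exit_rate_finite[of i s] by (auto simp: ennreal_mult_eq_top_iff)
  ultimately show ?thesis using True by (simp add: ennreal_add_left_cancel_le min_def)
qed (simp add: ennreal_neg)

text \<open>The equation is tested with \<open>m - min (w i) m\<close> rather than with \<open>w\<close>: it vanishes where the rates are
  large, so that all terms are finite and may be subtracted.\<close>

lemma moment_bound:
  assumes p: "forward_solution \<gamma> T p" and \<gamma>: "(\<integral>\<^sup>+i. \<gamma> i \<partial>count_space UNIV) = 1" and T: "0 \<le> T"
    and C: "(\<integral>\<^sup>+i. \<gamma> i * ennreal (w i) \<partial>count_space UNIV) \<le> ennreal C" "0 \<le> C" and t: "0 \<le> t" "t \<le> T"
  shows "(\<integral>\<^sup>+i. p t i * ennreal (w i) \<partial>count_space UNIV) \<le> ennreal (2 * (C + b * T) * exp (2 * \<rho> * T))"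
proof -
  have pm[measurable]: "\<And>i. (\<lambda>t. p t i) \<in> borel_measurable borel"
    and p1: "\<And>t. (\<integral>\<^sup>+i. p t i \<partial>count_space UNIV) \<le> 1"
    and F: "\<And>t j. 0 \<le> t \<Longrightarrow> t \<le> T \<Longrightarrow> p t j + (\<integral>\<^sup>+s. p s j * exit_rate j s * indicator {0<..<t} s \<partial>lborel)
        = \<gamma> j + (\<integral>\<^sup>+s. (\<integral>\<^sup>+i. p s i * a i j s \<partial>count_space UNIV) * indicator {0<..<t} s \<partial>lborel)"
    using p unfolding forward_solution_def by auto
  have w0: "0 \<le> w j" for j using w_ge_1[of j] by simp
  \<comment> \<open>The truncated moment is at most \<open>m\<close>, as the Gronwall lemma
    requires; the resulting constant does not involve \<open>m\<close>, so that \<open>m\<close> may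
    tend to infinity.\<close>
  have trunc: "(\<integral>\<^sup>+i. p t i * ennreal (min (w i) m) \<partial>count_space UNIV) \<le> ennreal (2 * (C + b * T) * exp (2 * \<rho> * T))" for m :: nat
  proof (rule gronwall_ennreal[where m=m and \<rho>=\<rho> and c="C + b * T" and T=T and t=t
      and U="\<lambda>t. \<integral>\<^sup>+i. p t i * ennreal (min (w i) m) \<partial>count_space UNIV"])
    show "0 \<le> C + b * T" "0 < \<rho>" using C params T by auto
    show "(\<integral>\<^sup>+i. p t i * ennreal (min (w i) m) \<partial>count_space UNIV) \<le> ennreal (real m)" for t
    proof -
      have "(\<integral>\<^sup>+i. p t i * ennreal (min (w i) m) \<partial>count_space UNIV) \<le> (\<integral>\<^sup>+i. p t i * ennreal (real m) \<partial>count_space UNIV)"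
        by (intro nn_integral_mono mult_left_mono ennreal_leI) auto
      also have "\<dots> \<le> 1 * ennreal (real m)"
        by (subst nn_integral_multc, simp, rule mult_right_mono[OF p1]) simp
      finally show ?thesis by simp
    qed
    fix t assume t: "0 \<le> t" "t \<le> T"
    let ?I = "\<lambda>f. \<integral>\<^sup>+s. f s * indicator {0<..<t} s \<partial>(lborel :: real measure)"
    let ?S = "\<lambda>f. \<integral>\<^sup>+i. f i \<partial>count_space (UNIV :: 's set)"
    define g where "g i = ennreal (real m - w i)" for i
    define v where "v i = ennreal (min (w i) m)" for i
    have gv: "g i + v i = ennreal (real m)" for i
      using w0[of i] by (cases "w i \<le> real m") (auto simp: g_def v_def min_def ennreal_neg simp flip: ennreal_plus)
    define D where "D = ?I (\<lambda>s. ?S (\<lambda>i. p s i * (g i * exit_rate i s)))"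
    define B where "B = ?I (\<lambda>s. ?S (\<lambda>i. p s i * ennreal (\<rho> * min (w i) m + b)))"
    have exch: "?S (\<lambda>j. g j * ?I (\<lambda>s. f j s)) = ?I (\<lambda>s. ?S (\<lambda>j. g j * f j s))"
      if [measurable]: "\<And>j. f j \<in> borel_measurable borel" for f :: "'s \<Rightarrow> real \<Rightarrow> ennreal"
    proof -
      have "?S (\<lambda>j. g j * ?I (\<lambda>s. f j s)) = (\<integral>\<^sup>+j. \<integral>\<^sup>+s. g j * (f j s * indicator {0<..<t} s) \<partial>lborel \<partial>count_space UNIV)"
        by (intro nn_integral_cong nn_integral_cmult[symmetric]) measurable
      also have "\<dots> = (\<integral>\<^sup>+s. \<integral>\<^sup>+j. g j * (f j s * indicator {0<..<t} s) \<partial>count_space UNIV \<partial>lborel)"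
        by (rule nn_integral_count_measure_swap[OF lborel.sigma_finite_measure_axioms]) measurable
      also have "\<dots> = ?I (\<lambda>s. ?S (\<lambda>j. g j * f j s))"
        by (intro nn_integral_cong) (auto simp: indicator_def)
      finally show ?thesis .
    qed
    \<comment> \<open>Where \<open>g\<close> is positive the weight is below \<open>m\<close> and
      the exit rate at most \<open>L * m\<close>; hence the integrand is bounded by
      \<open>m * (L * m)\<close>.\<close>
    have D_fin: "D \<noteq> \<infinity>"
    proof -
      have "D \<le> (\<integral>\<^sup>+s. ennreal (real m * (L * m)) * indicator {0<..<t} s \<partial>lborel)"
        unfolding D_def
      proof (intro nn_integral_mono mult_right_mono)
        fix s
        have "p s i * (g i * exit_rate i s) \<le> p s i * ennreal (real m * (L * m))" for i
        proof (cases "w i \<le> real m")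
          case True
          have "g i * exit_rate i s \<le> ennreal (real m) * ennreal (L * m)"
            using exit_rate_le[of i s] True params w0[of i]
            by (intro mult_mono) (auto simp: g_def intro!: ennreal_leI mult_left_mono order_trans[of "exit_rate i s" "ennreal (L * w i)"])
          then show ?thesis using params by (intro mult_left_mono) (simp_all add: ennreal_mult')
        qed (simp add: g_def ennreal_neg)
        then have "?S (\<lambda>i. p s i * (g i * exit_rate i s)) \<le> ?S (\<lambda>i. p s i * ennreal (real m * (L * m)))"
          by (intro nn_integral_mono)
        also have "\<dots> \<le> 1 * ennreal (real m * (L * m))"
          by (subst nn_integral_multc, simp, rule mult_right_mono[OF p1]) simp
        finally show "?S (\<lambda>i. p s i * (g i * exit_rate i s)) \<le> ennreal (real m * (L * m))" by simp
      qed simp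
      also have "\<dots> < \<infinity>" using t by (subst nn_integral_cmult_indicator) (auto simp: ennreal_mult_less_top)
      finally show ?thesis by simp
    qed
    \<comment> \<open>The forward equation summed against \<open>g\<close>; Tonelli's theorem moves
      the sum over the target \<open>j\<close> inside.\<close>
    have sum1: "?S (\<lambda>j. g j * p t j) + D = ?S (\<lambda>j. g j * \<gamma> j) + ?I (\<lambda>s. ?S (\<lambda>i. p s i * ?S (\<lambda>j. a i j s * g j)))"
    proof -
      have "?S (\<lambda>j. g j * p t j) + D = ?S (\<lambda>j. g j * p t j) + ?S (\<lambda>j. g j * ?I (\<lambda>s. p s j * exit_rate j s))"
        unfolding D_def by (subst exch) (measurable, simp add: mult_ac)
      also have "\<dots> = ?S (\<lambda>j. g j * (p t j + ?I (\<lambda>s. p s j * exit_rate j s)))"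
        by (subst nn_integral_add[symmetric]) (simp_all add: distrib_left)
      also have "\<dots> = ?S (\<lambda>j. g j * (\<gamma> j + ?I (\<lambda>s. ?S (\<lambda>i. p s i * a i j s))))"
        unfolding F[OF t] ..
      also have "\<dots> = ?S (\<lambda>j. g j * \<gamma> j) + ?S (\<lambda>j. g j * ?I (\<lambda>s. ?S (\<lambda>i. p s i * a i j s)))"
        by (subst nn_integral_add[symmetric]) (simp_all add: distrib_left)
      also have "?S (\<lambda>j. g j * ?I (\<lambda>s. ?S (\<lambda>i. p s i * a i j s))) = ?I (\<lambda>s. ?S (\<lambda>j. g j * ?S (\<lambda>i. p s i * a i j s)))"
        by (rule exch) measurable
      also have "\<dots> = ?I (\<lambda>s. ?S (\<lambda>i. p s i * ?S (\<lambda>j. a i j s * g j)))"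
      proof (rule nn_integral_cong, rule arg_cong2[where f="(*)", OF _ refl])
        fix s
        have "?S (\<lambda>j. g j * ?S (\<lambda>i. p s i * a i j s)) = ?S (\<lambda>j. ?S (\<lambda>i. g j * (p s i * a i j s)))"
          by (intro nn_integral_cong nn_integral_cmult[symmetric]) simp
        also have "\<dots> = ?S (\<lambda>i. ?S (\<lambda>j. g j * (p s i * a i j s)))" by (rule nn_integral_count_measure_swap[OF sigma_finite_measure_count_space]) simp
        also have "\<dots> = ?S (\<lambda>i. p s i * ?S (\<lambda>j. a i j s * g j))"
          by (intro nn_integral_cong, subst nn_integral_cmult[symmetric]) (simp_all add: mult_ac)
        finally show "?S (\<lambda>j. g j * ?S (\<lambda>i. p s i * a i j s)) = ?S (\<lambda>i. p s i * ?S (\<lambda>j. a i j s * g j))" .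
      qed
      finally show ?thesis .
    qed
    have "D \<le> ?I (\<lambda>s. ?S (\<lambda>i. p s i * ?S (\<lambda>j. a i j s * g j)) + ?S (\<lambda>i. p s i * ennreal (\<rho> * min (w i) m + b)))"
      unfolding D_def
    proof (intro nn_integral_mono mult_right_mono)
      fix s
      have "?S (\<lambda>i. p s i * (g i * exit_rate i s)) \<le> ?S (\<lambda>i. p s i * ?S (\<lambda>j. a i j s * g j) + p s i * ennreal (\<rho> * min (w i) m + b))"
        unfolding distrib_left[symmetric] g_def by (intro nn_integral_mono mult_left_mono truncated_drift) simp
      also have "\<dots> = ?S (\<lambda>i. p s i * ?S (\<lambda>j. a i j s * g j)) + ?S (\<lambda>i. p s i * ennreal (\<rho> * min (w i) m + b))"
        by (rule nn_integral_add) simp_all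
      finally show "?S (\<lambda>i. p s i * (g i * exit_rate i s)) \<le> \<dots>" .
    qed simp
    also have "\<dots> = ?I (\<lambda>s. ?S (\<lambda>i. p s i * ?S (\<lambda>j. a i j s * g j))) + B"
      unfolding B_def distrib_right by (rule nn_integral_add) measurable
    finally have "?S (\<lambda>j. g j * \<gamma> j) + D \<le> ?S (\<lambda>j. g j * p t j) + D + B"
      unfolding sum1 add.assoc by (rule add_left_mono)
    then have "D + ?S (\<lambda>j. g j * \<gamma> j) \<le> D + (?S (\<lambda>j. g j * p t j) + B)" by (simp add: add_ac)
    then have le1: "?S (\<lambda>j. g j * \<gamma> j) \<le> ?S (\<lambda>j. g j * p t j) + B"
      using D_fin by (simp add: ennreal_add_left_cancel_le)
    \<comment> \<open>Returns from \<open>g\<close> to the truncated weight \<open>v\<close>. The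
      initial mass is 1 and later masses are at most 1, which is the direction needed for an upper
      bound on the \<open>v\<close>-moment.\<close>
    have sgv: "?S (\<lambda>i. g i * f i) + ?S (\<lambda>i. f i * v i) = ennreal (real m) * ?S f" for f
    proof -
      have "(g i + v i) * f i = g i * f i + f i * v i" for i
        unfolding distrib_right mult.commute[of "f i"] ..
      then have "?S (\<lambda>i. g i * f i) + ?S (\<lambda>i. f i * v i) = ?S (\<lambda>i. (g i + v i) * f i)"
        by (simp add: nn_integral_add)
      then show ?thesis by (simp add: gv nn_integral_cmult)
    qed
    have "ennreal (real m) + ?S (\<lambda>i. p t i * v i) = ?S (\<lambda>i. g i * \<gamma> i) + ?S (\<lambda>i. \<gamma> i * v i) + ?S (\<lambda>i. p t i * v i)"
      unfolding sgv \<gamma> by simp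
    also have "\<dots> \<le> (?S (\<lambda>j. g j * p t j) + B) + ?S (\<lambda>i. \<gamma> i * v i) + ?S (\<lambda>i. p t i * v i)"
      using le1 by (intro add_right_mono)
    also have "\<dots> = (?S (\<lambda>i. g i * p t i) + ?S (\<lambda>i. p t i * v i)) + (?S (\<lambda>i. \<gamma> i * v i) + B)"
      by (simp add: add_ac)
    also have "\<dots> \<le> ennreal (real m) + (?S (\<lambda>i. \<gamma> i * v i) + B)"
      unfolding sgv using mult_left_mono[OF p1[of t], of "ennreal (real m)"] by (intro add_right_mono) simp
    finally have "?S (\<lambda>i. p t i * v i) \<le> ?S (\<lambda>i. \<gamma> i * v i) + B"
      by (simp add: ennreal_add_left_cancel_le)
    also have "?S (\<lambda>i. \<gamma> i * v i) \<le> ennreal C"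
      unfolding v_def by (rule order_trans[OF nn_integral_mono C(1)]) (auto intro!: mult_left_mono ennreal_leI)
    also have "B = ?I (\<lambda>s. ennreal \<rho> * ?S (\<lambda>i. p s i * v i) + ?S (\<lambda>i. p s i) * ennreal b)"
      unfolding B_def
    proof (rule nn_integral_cong, rule arg_cong2[where f="(*)", OF _ refl])
      fix s
      have "?S (\<lambda>i. p s i * ennreal (\<rho> * min (w i) m + b)) = ?S (\<lambda>i. ennreal \<rho> * (p s i * v i) + p s i * ennreal b)"
        using params w0 by (intro nn_integral_cong) (simp add: v_def ennreal_mult distrib_left mult_ac)
      also have "\<dots> = ennreal \<rho> * ?S (\<lambda>i. p s i * v i) + ?S (\<lambda>i. p s i) * ennreal b"
        by (subst nn_integral_add) (simp_all add: nn_integral_cmult nn_integral_multc)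
      finally show "?S (\<lambda>i. p s i * ennreal (\<rho> * min (w i) m + b)) = \<dots>" .
    qed
    also have "\<dots> = ennreal \<rho> * ?I (\<lambda>s. ?S (\<lambda>i. p s i * v i)) + ?I (\<lambda>s. ?S (\<lambda>i. p s i) * ennreal b)"
    proof -
      have "?I (\<lambda>s. ennreal \<rho> * ?S (\<lambda>i. p s i * v i) + ?S (\<lambda>i. p s i) * ennreal b)
         = (\<integral>\<^sup>+s. ennreal \<rho> * (?S (\<lambda>i. p s i * v i) * indicator {0<..<t} s) + (?S (\<lambda>i. p s i) * ennreal b) * indicator {0<..<t} s \<partial>lborel)"
        by (intro nn_integral_cong) (simp add: indicator_def)
      also have "\<dots> = (\<integral>\<^sup>+s. ennreal \<rho> * (?S (\<lambda>i. p s i * v i) * indicator {0<..<t} s) \<partial>lborel) + ?I (\<lambda>s. ?S (\<lambda>i. p s i) * ennreal b)"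
        by (rule nn_integral_add) measurable
      also have "(\<integral>\<^sup>+s. ennreal \<rho> * (?S (\<lambda>i. p s i * v i) * indicator {0<..<t} s) \<partial>lborel) = ennreal \<rho> * ?I (\<lambda>s. ?S (\<lambda>i. p s i * v i))"
        by (rule nn_integral_cmult) measurable
      finally show ?thesis .
    qed
    also have "?I (\<lambda>s. ?S (\<lambda>i. p s i) * ennreal b) \<le> ennreal (b * T)"
    proof -
      have "?I (\<lambda>s. ?S (\<lambda>i. p s i) * ennreal b) \<le> (\<integral>\<^sup>+s. ennreal b * indicator {0<..<t} s \<partial>lborel)"
        using mult_right_mono[OF p1, of "ennreal b"] by (intro nn_integral_mono mult_right_mono) auto
      also have "\<dots> = ennreal (b * t)" using t params by (subst nn_integral_cmult_indicator) (auto simp: ennreal_mult)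
      also have "\<dots> \<le> ennreal (b * T)" using t params by (intro ennreal_leI mult_left_mono)
      finally show ?thesis .
    qed
    finally have "?S (\<lambda>i. p t i * v i) \<le> ennreal C + (ennreal \<rho> * ?I (\<lambda>s. ?S (\<lambda>i. p s i * v i)) + ennreal (b * T))"
      by (simp add: add_left_mono add_right_mono)
    then show "?S (\<lambda>i. p t i * ennreal (min (w i) m)) \<le> ennreal (C + b * T) + ennreal \<rho> * ?I (\<lambda>s. ?S (\<lambda>i. p s i * ennreal (min (w i) m)))"
      using C params T unfolding v_def by (simp add: add_ac)
  qed (use t T in auto)
  have "(\<integral>\<^sup>+i. p t i * ennreal (w i) \<partial>count_space UNIV) = (\<integral>\<^sup>+i. (SUP m. p t i * ennreal (min (w i) (real m))) \<partial>count_space UNIV)"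
  proof (rule nn_integral_cong)
    fix i
    obtain m0 where m0: "w i \<le> real m0" using real_arch_simple by blast
    show "p t i * ennreal (w i) = (SUP m. p t i * ennreal (min (w i) (real m)))"
      by (rule antisym) (auto intro!: SUP_upper2[of m0] SUP_least mult_left_mono ennreal_leI simp: m0)
  qed
  also have "\<dots> = (SUP m. \<integral>\<^sup>+i. p t i * ennreal (min (w i) (real m)) \<partial>count_space UNIV)"
    by (intro nn_integral_monotone_convergence_SUP) (auto simp: incseq_def le_fun_def intro!: mult_left_mono ennreal_leI)
  also have "\<dots> \<le> ennreal (2 * (C + b * T) * exp (2 * \<rho> * T))" by (rule SUP_least) (rule trunc)
  finally show ?thesis .
qed

end

section \<open>Uniqueness from the finite total flow\<close>

context drift_rates
begin

text \<open>This is the purpose of the moment bound: exit rates are at most \<open>L * w\<close>, so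
  the flow is controlled by the \<open>w\<close>-moment, uniformly over the time interval.\<close>

lemma total_flow_finite:
  assumes p: "forward_solution \<gamma> T p" and \<gamma>: "(\<integral>\<^sup>+i. \<gamma> i \<partial>count_space UNIV) = 1"
    and C: "(\<integral>\<^sup>+i. \<gamma> i * ennreal (w i) \<partial>count_space UNIV) < \<infinity>" and t: "0 \<le> t" "t \<le> T"
  shows "(\<integral>\<^sup>+s. (\<integral>\<^sup>+i. p s i * exit_rate i s \<partial>count_space UNIV) * indicator {0<..<t} s \<partial>lborel) < \<infinity>"
proof -
  from C obtain c where c: "(\<integral>\<^sup>+i. \<gamma> i * ennreal (w i) \<partial>count_space UNIV) = ennreal c" "0 \<le> c"
    by (cases "\<integral>\<^sup>+i. \<gamma> i * ennreal (w i) \<partial>count_space UNIV") auto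
  let ?M = "2 * (c + b * T) * exp (2 * \<rho> * T)"
  have "(\<integral>\<^sup>+i. p s i * exit_rate i s \<partial>count_space UNIV) \<le> ennreal (?M * L)" if "0 \<le> s" "s \<le> T" for s
  proof -
    have w0: "0 \<le> w i" for i using w_ge_1[of i] by simp
    have "(\<integral>\<^sup>+i. p s i * exit_rate i s \<partial>count_space UNIV) \<le> (\<integral>\<^sup>+i. p s i * ennreal (w i) * ennreal L \<partial>count_space UNIV)"
      using exit_rate_le params w0 by (intro nn_integral_mono) (simp add: mult.assoc mult_left_mono ennreal_mult'' mult.commute[of L])
    also have "\<dots> = (\<integral>\<^sup>+i. p s i * ennreal (w i) \<partial>count_space UNIV) * ennreal L"
      by (rule nn_integral_multc) simp
    also have "\<dots> \<le> ennreal ?M * ennreal L"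
      by (intro mult_right_mono moment_bound[OF p \<gamma> _ _ c(2)]) (use that t c in auto)
    also have "\<dots> = ennreal (?M * L)" using params by (simp add: ennreal_mult'')
    finally show ?thesis .
  qed
  then have "(\<integral>\<^sup>+s. (\<integral>\<^sup>+i. p s i * exit_rate i s \<partial>count_space UNIV) * indicator {0<..<t} s \<partial>lborel)
     \<le> (\<integral>\<^sup>+s. ennreal (?M * L) * indicator {0<..<t} s \<partial>lborel)"
    using t by (intro nn_integral_mono) (auto simp: indicator_def)
  also have "\<dots> < \<infinity>" using t by (subst nn_integral_cmult_indicator) (auto simp: ennreal_mult_less_top)
  finally show ?thesis .
qed

text \<open>For a single state \<open>j\<close> the exit rate is bounded by \<open>L * w j\<close>,
  even though the rates are unbounded over all states. The difference in this coordinate solves a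
  scalar linear equation, to which \<open>linear_integral_equation_abs_bound\<close>
  applies.\<close>

lemma forward_difference_bound:
  assumes p: "forward_solution \<gamma> T p" and p': "forward_solution \<gamma> T p'"
    and \<gamma>: "(\<integral>\<^sup>+i. \<gamma> i \<partial>count_space UNIV) = 1"
    and C: "(\<integral>\<^sup>+i. \<gamma> i * ennreal (w i) \<partial>count_space UNIV) < \<infinity>" and t: "0 \<le> t" "t \<le> T"
    and d: "\<And>s i. d s i = ennreal \<bar>enn2real (p s i) - enn2real (p' s i)\<bar>"
  shows "d t j + (\<integral>\<^sup>+s. d s j * exit_rate j s * indicator {0<..<t} s \<partial>lborel)
    \<le> (\<integral>\<^sup>+s. (\<integral>\<^sup>+i. d s i * a i j s \<partial>count_space UNIV) * indicator {0<..<t} s \<partial>lborel)"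
proof -
  note sol = p[unfolded forward_solution_def] p'[unfolded forward_solution_def]
  have [measurable]: "\<And>i. (\<lambda>t. p t i) \<in> borel_measurable borel" "\<And>i. (\<lambda>t. p' t i) \<in> borel_measurable borel"
    using sol by auto
  have le1: "p s i \<le> 1" "p' s i \<le> 1" for s i
    using order_trans[OF nn_integral_ge_point[of i UNIV "p s"]] order_trans[OF nn_integral_ge_point[of i UNIV "p' s"]] sol by auto
  have pfin: "p s i < \<infinity>" "p' s i < \<infinity>" for s i
    using le_less_trans[OF le1(1)[of s i], of \<infinity>] le_less_trans[OF le1(2)[of s i], of \<infinity>] by auto
  have \<gamma>fin: "\<gamma> j < \<infinity>" using le_less_trans[OF nn_integral_ge_point[of j UNIV \<gamma>], of \<infinity>] \<gamma> by auto
  define G where "G q s = (\<integral>\<^sup>+i. q s i * a i j s \<partial>count_space UNIV)" for q :: "real \<Rightarrow> 's \<Rightarrow> ennreal" and s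
  have Gm[measurable]: "G p \<in> borel_measurable borel" "G p' \<in> borel_measurable borel" unfolding G_def[abs_def] by measurable
  have a_le: "a i j s \<le> exit_rate i s" for i s
    unfolding exit_rate_def by (rule nn_integral_ge_point) simp
  have G_le: "G q s \<le> (\<integral>\<^sup>+i. q s i * exit_rate i s \<partial>count_space UNIV)" for q s
    unfolding G_def by (intro nn_integral_mono mult_left_mono a_le) simp
  have Gfin: "(\<integral>\<^sup>+s. G q s * indicator {0<..<u} s \<partial>lborel) < \<infinity>" if "q = p \<or> q = p'" "0 \<le> u" "u \<le> t" for q u
  proof -
    have "(\<integral>\<^sup>+s. G q s * indicator {0<..<u} s \<partial>lborel)
       \<le> (\<integral>\<^sup>+s. (\<integral>\<^sup>+i. q s i * exit_rate i s \<partial>count_space UNIV) * indicator {0<..<u} s \<partial>lborel)"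
      by (intro nn_integral_mono mult_right_mono G_le) simp
    also have "\<dots> < \<infinity>" using that t total_flow_finite[OF p \<gamma> C, of u] total_flow_finite[OF p' \<gamma> C, of u] by auto
    finally show ?thesis .
  qed
  have Rfin: "(\<integral>\<^sup>+s. q s j * exit_rate j s * indicator {0<..<u} s \<partial>lborel) < \<infinity>" if "q = p \<or> q = p'" "0 \<le> u" "u \<le> t" for q u
  proof -
    have "(\<integral>\<^sup>+s. q s j * exit_rate j s * indicator {0<..<u} s \<partial>lborel)
       \<le> (\<integral>\<^sup>+s. (\<integral>\<^sup>+i. q s i * exit_rate i s \<partial>count_space UNIV) * indicator {0<..<u} s \<partial>lborel)"
      by (intro nn_integral_mono mult_right_mono) (auto intro: nn_integral_ge_point[where p="\<lambda>i. q _ i * exit_rate i _"])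
    also have "\<dots> < \<infinity>" using that t total_flow_finite[OF p \<gamma> C, of u] total_flow_finite[OF p' \<gamma> C, of u] by auto
    finally show ?thesis .
  qed
  define \<alpha> where "\<alpha> s = enn2real (exit_rate j s)" for s
  define \<beta> where "\<beta> s = enn2real (G p s) - enn2real (G p' s)" for s
  define x where "x s = (if s \<in> {0..t} then enn2real (p s j) - enn2real (p' s j) else 0)" for s
  have eq: "enn2real (q u j) = enn2real (\<gamma> j) + integral {0..u} (\<lambda>s. enn2real (G q s)) - integral {0..u} (\<lambda>s. \<alpha> s * enn2real (q s j))"
    "(\<lambda>s. enn2real (G q s)) integrable_on {0..u}" "(\<lambda>s. \<alpha> s * enn2real (q s j)) integrable_on {0..u}"
    if q: "q = p \<or> q = p'" and u: "0 \<le> u" "u \<le> t" for q u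
  proof -
    have qm[measurable]: "(\<lambda>s. q s j) \<in> borel_measurable borel" "G q \<in> borel_measurable borel" using q by auto
    have R: "(\<lambda>s. q s j * exit_rate j s) \<in> borel_measurable borel" by measurable
    have rr: "enn2real (q s j * exit_rate j s) = \<alpha> s * enn2real (q s j)" for s by (simp add: \<alpha>_def enn2real_mult)
    note i1 = enn2real_integral_interval[OF R Rfin[OF q u], unfolded rr]
    note i2 = enn2real_integral_interval[OF qm(2) Gfin[OF q u]]
    have "q u j + (\<integral>\<^sup>+s. q s j * exit_rate j s * indicator {0<..<u} s \<partial>lborel) = \<gamma> j + (\<integral>\<^sup>+s. G q s * indicator {0<..<u} s \<partial>lborel)"
      using sol q u t unfolding G_def by auto
    from arg_cong[OF this, of enn2real]
    show "enn2real (q u j) = enn2real (\<gamma> j) + integral {0..u} (\<lambda>s. enn2real (G q s)) - integral {0..u} (\<lambda>s. \<alpha> s * enn2real (q s j))"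
      using Rfin[OF q u] Gfin[OF q u] \<gamma>fin pfin[of u j] q unfolding i1(2) i2(2) by (auto simp: enn2real_plus)
    show "(\<lambda>s. enn2real (G q s)) integrable_on {0..u}" "(\<lambda>s. \<alpha> s * enn2real (q s j)) integrable_on {0..u}"
      using i1(1) i2(1) by (auto simp: absolutely_integrable_on_def)
  qed
  have abs\<beta>: "\<beta> absolutely_integrable_on {0..t}"
    unfolding \<beta>_def using enn2real_integral_interval(1)[OF Gm(1) Gfin[of p t]] enn2real_integral_interval(1)[OF Gm(2) Gfin[of p' t]] t
    by (intro set_integral_diff(1)) auto
  have K0: "0 \<le> L * w j" using params w_ge_1[of j] by simp
  have xm: "x \<in> borel_measurable borel" unfolding x_def[abs_def] by measurable
  have \<alpha>m: "\<alpha> \<in> borel_measurable borel" unfolding \<alpha>_def[abs_def] by measurable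
  have r1: "enn2real (p s i) \<le> 1" "enn2real (p' s i) \<le> 1" for s i
    using le1[of s i] by (auto intro: enn2real_leI)
  have xb: "\<bar>x s\<bar> \<le> 1" for s
    using r1[of s j] enn2real_nonneg[of "p s j"] enn2real_nonneg[of "p' s j"] unfolding x_def by (auto simp del: enn2real_nonneg)
  have \<alpha>b: "0 \<le> \<alpha> s" "\<alpha> s \<le> L * w j" for s
    unfolding \<alpha>_def using exit_rate_le[of j s] K0 by (auto intro: enn2real_leI)
  have main: "\<bar>x t\<bar> + integral {0..t} (\<lambda>s. \<alpha> s * \<bar>x s\<bar>) \<le> integral {0..t} (\<lambda>s. \<bar>\<beta> s\<bar>)"
  proof (rule linear_integral_equation_abs_bound[OF t(1) \<alpha>m \<alpha>b abs\<beta> xm xb])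
    fix u assume u: "0 \<le> u" "u \<le> t"
    have "x u = integral {0..u} (\<lambda>s. enn2real (G p s)) - integral {0..u} (\<lambda>s. \<alpha> s * enn2real (p s j))
        - (integral {0..u} (\<lambda>s. enn2real (G p' s)) - integral {0..u} (\<lambda>s. \<alpha> s * enn2real (p' s j)))"
      using eq(1)[of p u] eq(1)[of p' u] u by (simp add: x_def)
    also have "\<dots> = integral {0..u} (\<lambda>s. (enn2real (G p s) - \<alpha> s * enn2real (p s j)) - (enn2real (G p' s) - \<alpha> s * enn2real (p' s j)))"
      using eq(2,3)[of p u] eq(2,3)[of p' u] u
      by (simp add: Henstock_Kurzweil_Integration.integral_diff integrable_diff)
    also have "\<dots> = integral {0..u} (\<lambda>s. \<beta> s - \<alpha> s * x s)"
      using u by (intro integral_cong) (auto simp: \<beta>_def x_def algebra_simps)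
    finally show "x u = integral {0..u} (\<lambda>s. \<beta> s - \<alpha> s * x s)" .
  qed
  have AE_end: "AE s in lborel. s \<noteq> 0 \<and> s \<noteq> t"
    using AE_lborel_singleton[of 0] AE_lborel_singleton[of t] by eventually_elim simp
  have ia: "(\<lambda>s. \<alpha> s * \<bar>x s\<bar>) integrable_on {0..t}"
  proof (rule bounded_measurable_integrable_on)
    show "(\<lambda>s. \<alpha> s * \<bar>x s\<bar>) \<in> borel_measurable borel" using \<alpha>m xm by measurable
    show "\<bar>\<alpha> s * \<bar>x s\<bar>\<bar> \<le> L * w j * 1" for s unfolding abs_mult using \<alpha>b[of s] xb[of s] K0 by (intro mult_mono) auto
  qed
  have i\<beta>: "(\<lambda>s. \<bar>\<beta> s\<bar>) integrable_on {0..t}" using abs\<beta> by (auto simp: absolutely_integrable_on_def)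
  have e1: "ennreal (integral {0..t} (\<lambda>s. \<alpha> s * \<bar>x s\<bar>)) = (\<integral>\<^sup>+s. d s j * exit_rate j s * indicator {0<..<t} s \<partial>lborel)"
  proof -
    have "ennreal (integral {0..t} (\<lambda>s. \<alpha> s * \<bar>x s\<bar>)) = (\<integral>\<^sup>+s. ennreal (\<alpha> s * \<bar>x s\<bar>) * indicator {0..t} s \<partial>lborel)"
      using \<alpha>b by (intro nn_integral_eq_integral_interval[OF ia, symmetric]) simp
    also have "\<dots> = (\<integral>\<^sup>+s. d s j * exit_rate j s * indicator {0<..<t} s \<partial>lborel)"
    proof (rule nn_integral_cong_AE, use AE_end in eventually_elim)
      case (elim s)
      have "ennreal (\<alpha> s) = exit_rate j s" using exit_rate_finite[of j s] by (simp add: \<alpha>_def)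
      then show ?case using elim \<alpha>b[of s] by (auto simp: indicator_def d x_def ennreal_mult mult.commute)
    qed
    finally show ?thesis .
  qed
  have e2: "ennreal (integral {0..t} (\<lambda>s. \<bar>\<beta> s\<bar>)) \<le> (\<integral>\<^sup>+s. (\<integral>\<^sup>+i. d s i * a i j s \<partial>count_space UNIV) * indicator {0<..<t} s \<partial>lborel)"
  proof -
    have "ennreal (integral {0..t} (\<lambda>s. \<bar>\<beta> s\<bar>)) = (\<integral>\<^sup>+s. ennreal \<bar>\<beta> s\<bar> * indicator {0..t} s \<partial>lborel)"
      by (intro nn_integral_eq_integral_interval[OF i\<beta>, symmetric]) simp
    also have "\<dots> \<le> (\<integral>\<^sup>+s. (\<integral>\<^sup>+i. d s i * a i j s \<partial>count_space UNIV) * indicator {0<..<t} s \<partial>lborel)"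
    proof (rule nn_integral_mono_AE)
      have "AE s in lborel. G p s * indicator {0<..<t} s \<noteq> \<infinity>" "AE s in lborel. G p' s * indicator {0<..<t} s \<noteq> \<infinity>"
        using Gfin[of p t] Gfin[of p' t] t by (intro nn_integral_PInf_AE; simp add: less_top)+
      then show "AE s in lborel. ennreal \<bar>\<beta> s\<bar> * indicator {0..t} s \<le> (\<integral>\<^sup>+i. d s i * a i j s \<partial>count_space UNIV) * indicator {0<..<t} s"
        using AE_end
      proof eventually_elim
        case (elim s)
        \<comment> \<open>The bound on the difference of the inflows is proved as two one-sided
          inequalities in \<open>ennreal\<close>. They are passed to the reals where all terms are
          finite; where the inflow of \<open>d\<close> is infinite there is nothing to show.\<close>
        have G_diff: "G q s \<le> G q' s + (\<integral>\<^sup>+i. d s i * a i j s \<partial>count_space UNIV)"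
          if "(q = p \<and> q' = p') \<or> (q = p' \<and> q' = p)" for q q'
        proof -
          have "q s i \<le> q' s i + d s i" for i
          proof -
            have "q s i = ennreal (enn2real (q s i))" "q' s i = ennreal (enn2real (q' s i))" using pfin[of s i] that by auto
            moreover have "ennreal (enn2real (q s i)) \<le> ennreal (enn2real (q' s i) + \<bar>enn2real (p s i) - enn2real (p' s i)\<bar>)"
              using that by (intro ennreal_leI) auto
            ultimately show ?thesis by (simp add: d)
          qed
          then have "G q s \<le> (\<integral>\<^sup>+i. q' s i * a i j s + d s i * a i j s \<partial>count_space UNIV)"
            unfolding G_def distrib_right[symmetric] by (intro nn_integral_mono mult_right_mono) auto
          also have "\<dots> = G q' s + (\<integral>\<^sup>+i. d s i * a i j s \<partial>count_space UNIV)"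
            unfolding G_def by (rule nn_integral_add) simp_all
          finally show ?thesis .
        qed
        let ?X = "\<integral>\<^sup>+i. d s i * a i j s \<partial>count_space UNIV"
        show ?case
        proof (cases "s \<in> {0<..<t} \<and> ?X \<noteq> \<infinity>")
          case True
          then have fin: "G p s = ennreal (enn2real (G p s))" "G p' s = ennreal (enn2real (G p' s))" "?X = ennreal (enn2real ?X)"
            using elim by (auto simp: less_top indicator_def)
          have le_add: "u \<le> v + z" if "ennreal u \<le> ennreal v + ennreal z" "0 \<le> v" "0 \<le> z" for u v z :: real
            using that by (subst (asm) ennreal_plus[symmetric]) (auto simp del: ennreal_plus)
          have "enn2real (G p s) \<le> enn2real (G p' s) + enn2real ?X"
            by (rule le_add) (unfold fin[symmetric], use G_diff[of p p'] in simp_all)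
          moreover have "enn2real (G p' s) \<le> enn2real (G p s) + enn2real ?X"
            by (rule le_add) (unfold fin[symmetric], use G_diff[of p' p] in simp_all)
          ultimately
          have "ennreal \<bar>\<beta> s\<bar> \<le> ennreal (enn2real ?X)" by (intro ennreal_leI) (auto simp: \<beta>_def)
          then show ?thesis using True fin(3) by (simp add: indicator_def)
        next
          case False
          then show ?thesis using elim by (auto simp: indicator_def)
        qed
      qed
    qed
    finally show ?thesis .
  qed
  have "ennreal \<bar>x t\<bar> + ennreal (integral {0..t} (\<lambda>s. \<alpha> s * \<bar>x s\<bar>)) \<le> ennreal (integral {0..t} (\<lambda>s. \<bar>\<beta> s\<bar>))"
    using main \<alpha>b ia by (subst ennreal_plus[symmetric]) (auto intro!: ennreal_leI integral_nonneg)
  moreover have "ennreal \<bar>x t\<bar> = d t j" using t by (simp add: x_def d)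
  ultimately show ?thesis using e1 e2 by auto
qed

theorem forward_solution_unique:
  assumes p: "forward_solution \<gamma> T p" and p': "forward_solution \<gamma> T p'"
    and \<gamma>: "(\<integral>\<^sup>+i. \<gamma> i \<partial>count_space UNIV) = 1"
    and C: "(\<integral>\<^sup>+i. \<gamma> i * ennreal (w i) \<partial>count_space UNIV) < \<infinity>" and t: "0 \<le> t" "t \<le> T"
  shows "p t j = p' t j"
proof -
  note sol = p[unfolded forward_solution_def] p'[unfolded forward_solution_def]
  have [measurable]: "\<And>i. (\<lambda>t. p t i) \<in> borel_measurable borel" "\<And>i. (\<lambda>t. p' t i) \<in> borel_measurable borel"
    using sol by auto
  define d where "d s i = ennreal \<bar>enn2real (p s i) - enn2real (p' s i)\<bar>" for s i
  have dm[measurable]: "(\<lambda>s. d s i) \<in> borel_measurable borel" for i unfolding d_def by measurable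
  let ?I = "\<lambda>f. \<integral>\<^sup>+s. f s * indicator {0<..<t} s \<partial>(lborel :: real measure)"
  let ?S = "\<lambda>f. \<integral>\<^sup>+i. f i \<partial>count_space (UNIV :: 's set)"
  have le1: "p s i \<le> 1" "p' s i \<le> 1" for s i
    using order_trans[OF nn_integral_ge_point[of i UNIV "p s"]] order_trans[OF nn_integral_ge_point[of i UNIV "p' s"]] sol by auto
  have pfin: "p s i < \<infinity>" "p' s i < \<infinity>" for s i
    using le_less_trans[OF le1(1)[of s i], of \<infinity>] le_less_trans[OF le1(2)[of s i], of \<infinity>] by auto
  have d_le: "d s i \<le> p s i + p' s i" for s i
  proof -
    have "d s i \<le> ennreal (enn2real (p s i) + enn2real (p' s i))" unfolding d_def
      using enn2real_nonneg[of "p s i"] enn2real_nonneg[of "p' s i"] by (intro ennreal_leI) (simp only: abs_le_iff, linarith)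
    also have "\<dots> = p s i + p' s i" using pfin[of s i] by simp
    finally show ?thesis .
  qed
  let ?D = "?I (\<lambda>s. ?S (\<lambda>i. d s i * exit_rate i s))"
  \<comment> \<open>The flow of the absolute difference is dominated by the two flows
    together.\<close>
  have D_fin: "?D < \<infinity>"
  proof -
    have "?D \<le> (\<integral>\<^sup>+s. ?S (\<lambda>i. p s i * exit_rate i s) * indicator {0<..<t} s + ?S (\<lambda>i. p' s i * exit_rate i s) * indicator {0<..<t} s \<partial>lborel)"
      unfolding distrib_right[symmetric]
    proof (intro nn_integral_mono mult_right_mono)
      fix s
      have "?S (\<lambda>i. d s i * exit_rate i s) \<le> ?S (\<lambda>i. p s i * exit_rate i s + p' s i * exit_rate i s)"
        unfolding distrib_right[symmetric] by (intro nn_integral_mono mult_right_mono d_le) simp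
      then show "?S (\<lambda>i. d s i * exit_rate i s) \<le> ?S (\<lambda>i. p s i * exit_rate i s) + ?S (\<lambda>i. p' s i * exit_rate i s)"
        by (simp add: nn_integral_add)
    qed simp
    also have "\<dots> = ?I (\<lambda>s. ?S (\<lambda>i. p s i * exit_rate i s)) + ?I (\<lambda>s. ?S (\<lambda>i. p' s i * exit_rate i s))"
      by (rule nn_integral_add) measurable
    also have "\<dots> < \<infinity>" using total_flow_finite[OF p \<gamma> C t] total_flow_finite[OF p' \<gamma> C t] by simp
    finally show ?thesis .
  qed
  have swap: "?S (\<lambda>j. ?I (f j)) = ?I (\<lambda>s. ?S (\<lambda>j. f j s))" if [measurable]: "\<And>j. f j \<in> borel_measurable borel" for f :: "'s \<Rightarrow> real \<Rightarrow> ennreal"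
  proof -
    have "?S (\<lambda>j. ?I (f j)) = (\<integral>\<^sup>+s. ?S (\<lambda>j. f j s * indicator {0<..<t} s) \<partial>lborel)"
      by (rule nn_integral_count_measure_swap[OF lborel.sigma_finite_measure_axioms]) measurable
    also have "\<dots> = ?I (\<lambda>s. ?S (\<lambda>j. f j s))" by (intro nn_integral_cong) (simp add: nn_integral_multc)
    finally show ?thesis .
  qed
  have "?S (\<lambda>j. d t j) + ?D = ?S (\<lambda>j. d t j + ?I (\<lambda>s. d s j * exit_rate j s))"
    by (subst swap[symmetric], measurable, simp add: nn_integral_add)
  also have "\<dots> \<le> ?S (\<lambda>j. ?I (\<lambda>s. ?S (\<lambda>i. d s i * a i j s)))"
    by (intro nn_integral_mono forward_difference_bound[OF p p' \<gamma> C t d_def])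
  also have "\<dots> = ?I (\<lambda>s. ?S (\<lambda>j. ?S (\<lambda>i. d s i * a i j s)))" by (rule swap) measurable
  also have "\<dots> = ?D"
  proof (rule nn_integral_cong, rule arg_cong2[where f="(*)", OF _ refl])
    fix s
    have "?S (\<lambda>j. ?S (\<lambda>i. d s i * a i j s)) = ?S (\<lambda>i. ?S (\<lambda>j. d s i * a i j s))" by (rule nn_integral_count_measure_swap[OF sigma_finite_measure_count_space]) simp
    also have "\<dots> = ?S (\<lambda>i. d s i * exit_rate i s)" unfolding exit_rate_def by (simp add: nn_integral_cmult)
    finally show "?S (\<lambda>j. ?S (\<lambda>i. d s i * a i j s)) = ?S (\<lambda>i. d s i * exit_rate i s)" .
  qed
  finally have "?D + ?S (\<lambda>j. d t j) \<le> ?D + 0" by (simp add: add.commute)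
  then have "?S (\<lambda>j. d t j) = 0" using D_fin by (simp only: ennreal_add_left_cancel_le) auto
  then have "d t j = 0" using nn_integral_ge_point[of j UNIV "d t"] by simp
  then have "enn2real (p t j) = enn2real (p' t j)" by (simp add: d_def)
  then show ?thesis using pfin[of t j] by (metis ennreal_enn2real infinity_ennreal_def)
qed

end

section \<open>Controlled rates\<close>

lemma has_sum_nn_integral_count_space:
  fixes f :: "'s \<Rightarrow> real"
  assumes "\<And>x. 0 \<le> f x" "(f has_sum S) UNIV"
  shows "(\<integral>\<^sup>+x. ennreal (f x) \<partial>count_space UNIV) = ennreal S"
proof -
  have "f summable_on UNIV" using assms(2) by (rule has_sum_imp_summable)
  then have "(\<lambda>x. norm (f x)) summable_on UNIV" using assms(1) by simp
  then have a: "Infinite_Set_Sum.abs_summable_on f UNIV" by (rule abs_summable_equivalent[THEN iffD1])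
  then have "(\<integral>\<^sup>+x. ennreal (f x) \<partial>count_space UNIV) = ennreal (infsetsum f UNIV)"
    using assms(1) by (intro nn_integral_conv_infsetsum) auto
  also have "infsetsum f UNIV = S" using infsetsum_infsum[OF a] infsumI[OF assms(2)] by simp
  finally show ?thesis .
qed

lemma has_sum_remove_point:
  fixes f :: "'s \<Rightarrow> real"
  assumes "(f has_sum S) UNIV"
  shows "((\<lambda>x. if x = i then 0 else f x) has_sum (S - f i)) UNIV"
proof -
  have "((\<lambda>x. if x = i then f i else 0) has_sum f i) UNIV"
    by (rule has_sum_finite_neutralI[of "{i}"]) auto
  then have "((\<lambda>x. f x + - (if x = i then f i else 0)) has_sum (S + - f i)) UNIV"
    by (intro has_sum_add assms) (simp add: has_sum_uminus)
  moreover have "(\<lambda>x. f x + - (if x = i then f i else 0)) = (\<lambda>x. if x = i then 0 else f x)" by auto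
  ultimately show ?thesis by simp
qed

lemma ext_K_measurable:
  fixes f :: "'s \<Rightarrow> 'a::topological_space \<Rightarrow> real"
  assumes A: "A i \<in> sets borel" and f: "f i \<in> borel_measurable (restrict_space borel (A i))"
  shows "ext_K A f (Some i) \<in> borel_measurable borel"
proof -
  have g: "(\<lambda>x. indicator (A i) x *\<^sub>R f i x) \<in> borel_measurable borel"
    using f A by (subst (asm) borel_measurable_restrict_space_iff) auto
  have "(\<lambda>y. if y \<in> range Some then indicator (A i) (the y) *\<^sub>R f i (the y) else 0) \<in> borel_measurable borel"
    by (rule measurable_If_set[OF measurable_compose[OF measurable_the_borel g]]) auto
  also have "(\<lambda>y. if y \<in> range Some then indicator (A i) (the y) *\<^sub>R f i (the y) else 0) = ext_K A f (Some i)"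
  proof
    show "(if y \<in> range Some then indicator (A i) (the y) *\<^sub>R f i (the y) else 0) = ext_K A f (Some i) y" for y
      by (cases y) (auto simp: ext_K_def indicator_def)
  qed
  finally show ?thesis .
qed

lemma ext_K_None [simp]: "ext_K A f None = (\<lambda>_. 0)"
  by (simp add: ext_K_def fun_eq_iff)

locale controlled_rates =
  fixes A :: "'s::{countable, discrete_topology} \<Rightarrow> 'a::polish_space set"
    and q :: "'s \<Rightarrow> 's \<Rightarrow> 'a \<Rightarrow> real"
  assumes A_borel: "\<And>i. A i \<in> sets borel"
    and q_meas: "\<And>i j. q j i \<in> borel_measurable (restrict_space borel (A i))"
    and q_nonneg: "\<And>i j a. a \<in> A i \<Longrightarrow> j \<noteq> i \<Longrightarrow> 0 \<le> q j i a"
    and q_conservative: "\<And>i a. a \<in> A i \<Longrightarrow> ((\<lambda>j. q j i a) has_sum 0) UNIV"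
    and q_stable: "\<And>i. qstar A q i < \<infinity>"
begin

definition on_actions :: "'s \<Rightarrow> 'a option measure \<Rightarrow> bool" where
  "on_actions i \<kappa> \<longleftrightarrow> prob_space \<kappa> \<and> sets \<kappa> = sets borel \<and> measure \<kappa> (Some ` A i) = 1"

text \<open>Rates to other states are nonnegative on admissible actions, so sums and averages of
  them are computed in \<open>ennreal\<close>; conservativity recovers the diagonal rate as minus
  their total.\<close>

definition rate_at :: "'s \<Rightarrow> 's \<Rightarrow> 'a option \<Rightarrow> ennreal" where
  "rate_at i j x = (if j = i then 0 else ennreal (ext_K A (q j) (Some i) x))"

definition mean_rate :: "'a option measure \<Rightarrow> 's \<Rightarrow> 's \<Rightarrow> ennreal" where
  "mean_rate \<kappa> i j = (\<integral>\<^sup>+x. rate_at i j x \<partial>\<kappa>)"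

lemma rate_at_measurable [measurable]: "rate_at i j \<in> borel_measurable borel"
proof -
  note [measurable] = ext_K_measurable[where f="q j" and i=i and A=A, OF A_borel q_meas]
  show ?thesis unfolding rate_at_def[abs_def] by measurable
qed

text \<open>The unconditional real sum includes the diagonal, whose term is removed; what is left is
  nonnegative and may be read as an \<open>ennreal\<close> integral.\<close>

lemma rate_at_sum:
  assumes a: "a \<in> A i" and v: "\<And>j. 0 \<le> v j" "((\<lambda>j. v j * q j i a) has_sum S) UNIV"
  shows "(\<integral>\<^sup>+j. rate_at i j (Some a) * ennreal (v j) \<partial>count_space UNIV) = ennreal (S - v i * q i i a)"
proof -
  have "(\<integral>\<^sup>+j. rate_at i j (Some a) * ennreal (v j) \<partial>count_space UNIV)
     = (\<integral>\<^sup>+j. ennreal (if j = i then 0 else v j * q j i a) \<partial>count_space UNIV)"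
    using a v(1) q_nonneg[OF a] by (intro nn_integral_cong) (auto simp: rate_at_def ext_K_def ennreal_mult mult.commute)
  also have "\<dots> = ennreal (S - v i * q i i a)"
    using has_sum_remove_point[OF v(2), of i] v(1) q_nonneg[OF a]
    by (intro has_sum_nn_integral_count_space) auto
  finally show ?thesis .
qed

lemma rate_at_total: "a \<in> A i \<Longrightarrow> (\<integral>\<^sup>+j. rate_at i j (Some a) \<partial>count_space UNIV) = ennreal (- q i i a)"
  using rate_at_sum[of a i "\<lambda>_. 1" 0] q_conservative[of a i] by simp

lemma rate_at_total_le: "(\<integral>\<^sup>+j. rate_at i j x \<partial>count_space UNIV) \<le> qstar A q i"
proof (cases "\<exists>a. x = Some a \<and> a \<in> A i")
  case True
  then obtain a where a: "x = Some a" "a \<in> A i" by blast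
  have "ennreal (- q i i a) \<le> ennreal \<bar>q i i a\<bar>" by (intro ennreal_leI) simp
  also have "\<dots> \<le> qstar A q i" unfolding qstar_def using a by (intro SUP_upper)
  finally show ?thesis using a by (simp add: rate_at_total)
next
  case False
  then have "rate_at i j x = 0" for j by (cases x) (auto simp: rate_at_def ext_K_def)
  then show ?thesis by simp
qed

lemma on_actions_AE:
  assumes "on_actions i \<kappa>" shows "AE x in \<kappa>. x \<in> Some ` A i"
proof -
  interpret prob_space \<kappa> using assms by (simp add: on_actions_def)
  have "Some ` A i \<in> events" using assms A_borel by (auto simp: on_actions_def)
  then show ?thesis using assms by (subst AE_in_set_eq_1) (auto simp: on_actions_def)
qed

lemma mean_rate_sum:
  assumes \<kappa>: "on_actions i \<kappa>"
  shows "(\<integral>\<^sup>+j. mean_rate \<kappa> i j * v j \<partial>count_space UNIV) = (\<integral>\<^sup>+x. \<integral>\<^sup>+j. rate_at i j x * v j \<partial>count_space UNIV \<partial>\<kappa>)"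
proof -
  interpret prob_space \<kappa> using \<kappa> by (simp add: on_actions_def)
  have s: "sets \<kappa> = sets borel" using \<kappa> by (simp add: on_actions_def)
  have m: "rate_at i j \<in> borel_measurable \<kappa>" for j
    unfolding measurable_cong_sets[OF s refl] by measurable
  have "(\<integral>\<^sup>+j. mean_rate \<kappa> i j * v j \<partial>count_space UNIV) = (\<integral>\<^sup>+j. \<integral>\<^sup>+x. rate_at i j x * v j \<partial>\<kappa> \<partial>count_space UNIV)"
    unfolding mean_rate_def by (intro nn_integral_cong nn_integral_multc[symmetric] m)
  also have "\<dots> = (\<integral>\<^sup>+x. \<integral>\<^sup>+j. rate_at i j x * v j \<partial>count_space UNIV \<partial>\<kappa>)"
    using m by (intro nn_integral_count_measure_swap sigma_finite_measure_axioms) simp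
  finally show ?thesis .
qed

lemma mean_rate_total:
  "on_actions i \<kappa> \<Longrightarrow> (\<integral>\<^sup>+j. mean_rate \<kappa> i j \<partial>count_space UNIV) = (\<integral>\<^sup>+x. \<integral>\<^sup>+j. rate_at i j x \<partial>count_space UNIV \<partial>\<kappa>)"
  using mean_rate_sum[of i \<kappa> "\<lambda>_. 1"] by simp

lemma mean_rate_total_le:
  assumes \<kappa>: "on_actions i \<kappa>"
  shows "(\<integral>\<^sup>+j. mean_rate \<kappa> i j \<partial>count_space UNIV) \<le> qstar A q i"
proof -
  interpret prob_space \<kappa> using \<kappa> by (simp add: on_actions_def)
  have "(\<integral>\<^sup>+x. \<integral>\<^sup>+j. rate_at i j x \<partial>count_space UNIV \<partial>\<kappa>) \<le> (\<integral>\<^sup>+x. qstar A q i \<partial>\<kappa>)"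
    by (intro nn_integral_mono rate_at_total_le)
  then show ?thesis unfolding mean_rate_total[OF \<kappa>] by (simp add: emeasure_space_1)
qed

text \<open>Moving the diagonal term to the right makes the drift inequality linear in nonnegative
  rates, so it can be averaged over the actions without integrability questions.\<close>

lemma mean_rate_drift:
  assumes \<kappa>: "on_actions i \<kappa>" and w: "\<And>j. 0 \<le> w j" and \<rho>: "0 \<le> \<rho> * w i + b"
    and drift: "\<And>a. a \<in> A i \<Longrightarrow> (\<lambda>j. w j * q j i a) summable_on UNIV"
      "\<And>a. a \<in> A i \<Longrightarrow> (\<Sum>\<^sub>\<infinity>j. w j * q j i a) \<le> \<rho> * w i + b"
  shows "(\<integral>\<^sup>+j. mean_rate \<kappa> i j * ennreal (w j) \<partial>count_space UNIV)
     \<le> ennreal (\<rho> * w i + b) + ennreal (w i) * (\<integral>\<^sup>+j. mean_rate \<kappa> i j \<partial>count_space UNIV)"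
proof -
  interpret prob_space \<kappa> using \<kappa> by (simp add: on_actions_def)
  have s: "sets \<kappa> = sets borel" using \<kappa> by (simp add: on_actions_def)
  have m: "rate_at i j \<in> borel_measurable \<kappa>" for j
    unfolding measurable_cong_sets[OF s refl] by measurable
  have "(\<integral>\<^sup>+j. mean_rate \<kappa> i j * ennreal (w j) \<partial>count_space UNIV)
     \<le> (\<integral>\<^sup>+x. ennreal (\<rho> * w i + b) + ennreal (w i) * (\<integral>\<^sup>+j. rate_at i j x \<partial>count_space UNIV) \<partial>\<kappa>)"
    unfolding mean_rate_sum[OF \<kappa>]
  proof (rule nn_integral_mono_AE, use on_actions_AE[OF \<kappa>] in eventually_elim)
    case (elim x)
    then obtain a where a: "x = Some a" "a \<in> A i" by blast
    have q0: "q i i a \<le> 0"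
    proof -
      have "((\<lambda>x. if x = i then 0 else q x i a) has_sum (0 - q i i a)) UNIV"
        by (rule has_sum_remove_point[OF q_conservative[OF a(2)]])
      then have "0 \<le> 0 - q i i a" by (rule has_sum_nonneg) (use q_nonneg[OF a(2)] in auto)
      then show ?thesis by simp
    qed
    have "(\<integral>\<^sup>+j. rate_at i j x * ennreal (w j) \<partial>count_space UNIV) = ennreal ((\<Sum>\<^sub>\<infinity>j. w j * q j i a) - w i * q i i a)"
      unfolding a(1) using drift(1)[OF a(2)] by (intro rate_at_sum a w) (rule has_sum_infsum)
    also have "\<dots> \<le> ennreal ((\<rho> * w i + b) + w i * (- q i i a))"
      using drift(2)[OF a(2)] by (intro ennreal_leI) simp
    also have "\<dots> = ennreal (\<rho> * w i + b) + ennreal (w i) * ennreal (- q i i a)"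
    proof -
      have "ennreal (w i) * ennreal (- q i i a) = ennreal (w i * (- q i i a))"
        using w[of i] q0 by (intro ennreal_mult[symmetric]) auto
      moreover have "0 \<le> w i * (- q i i a)" using w[of i] q0 by (intro mult_nonneg_nonneg) auto
      ultimately show ?thesis using ennreal_plus[OF \<rho>, of "w i * (- q i i a)"] by simp
    qed
    finally show ?case using a by (simp add: rate_at_total)
  qed
  also have "\<dots> = ennreal (\<rho> * w i + b) + ennreal (w i) * (\<integral>\<^sup>+x. \<integral>\<^sup>+j. rate_at i j x \<partial>count_space UNIV \<partial>\<kappa>)"
    using m by (simp add: nn_integral_add nn_integral_cmult emeasure_space_1)
  finally show ?thesis unfolding mean_rate_total[OF \<kappa>] .
qed

lemma policy_kernel:
  "\<pi> \<in> policies A \<Longrightarrow> (\<lambda>p. \<pi> (fst p) (snd p)) \<in> predictable \<rightarrow>\<^sub>M prob_algebra borel"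
  by (simp add: policies_def case_prod_unfold)

lemma policy_prob:
  assumes "\<pi> \<in> policies A" "\<omega> \<in> Omega" "0 \<le> t"
  shows "prob_space (\<pi> \<omega> t)" "sets (\<pi> \<omega> t) = sets borel"
  using measurable_space[OF policy_kernel[OF assms(1)], of "(\<omega>, t)"] assms(2,3)
  by (auto simp: space_prob_algebra)

lemma policy_on_actions:
  assumes "\<pi> \<in> policies A" "\<omega> \<in> Omega" "0 \<le> t" "xi_minus \<omega> t = Some i"
  shows "on_actions i (\<pi> \<omega> t)"
proof -
  have "measure (\<pi> \<omega> t) (act_inf A (xi_minus \<omega> t)) = 1" using assms(1-3) by (simp add: policies_def)
  then show ?thesis using policy_prob[OF assms(1-3)] assms(4) by (simp add: on_actions_def)
qed

text \<open>\<open>jump_rate\<close> is a Bochner integral. It agrees with the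
  \<open>ennreal\<close> average because the integrand is nonnegative and the average is bounded by
  the finite \<open>qstar\<close>.\<close>

lemma jump_rate_eq:
  assumes \<pi>: "\<pi> \<in> policies A" and \<omega>: "\<omega> \<in> Omega" and t: "0 \<le> t"
  shows "ennreal (jump_rate A q \<pi> \<omega> t j) = (case xi_minus \<omega> t of None \<Rightarrow> 0 | Some i \<Rightarrow> mean_rate (\<pi> \<omega> t) i j)"
proof (cases "xi_minus \<omega> t")
  case (Some i)
  note \<kappa> = policy_on_actions[OF \<pi> \<omega> t Some]
  have s: "sets (\<pi> \<omega> t) = sets borel" using \<kappa> by (simp add: on_actions_def)
  show ?thesis
  proof (cases "j = i")
    case False
    have "mean_rate (\<pi> \<omega> t) i j \<le> (\<integral>\<^sup>+j. mean_rate (\<pi> \<omega> t) i j \<partial>count_space UNIV)"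
      by (rule nn_integral_ge_point) simp
    also have "\<dots> < \<infinity>" using le_less_trans[OF mean_rate_total_le[OF \<kappa>] q_stable] .
    finally have fin: "mean_rate (\<pi> \<omega> t) i j < \<infinity>" .
    have m: "ext_K A (q j) (Some i) \<in> borel_measurable (\<pi> \<omega> t)"
      unfolding measurable_cong_sets[OF s refl] by (intro ext_K_measurable A_borel q_meas)
    have "(\<integral>x. ext_K A (q j) (Some i) x \<partial>\<pi> \<omega> t) = enn2real (\<integral>\<^sup>+x. ennreal (ext_K A (q j) (Some i) x) \<partial>\<pi> \<omega> t)"
      using False q_nonneg[of _ i j]
      by (intro integral_eq_nn_integral m AE_I2) (auto simp: ext_K_def split: option.split)
    also have "\<dots> = enn2real (mean_rate (\<pi> \<omega> t) i j)" using False by (simp add: mean_rate_def rate_at_def)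
    finally show ?thesis using False Some fin by (simp add: jump_rate_def)
  qed (simp add: Some jump_rate_def mean_rate_def rate_at_def)
qed (simp add: jump_rate_def)

lemma measurable_mean_rate:
  assumes "\<kappa> \<in> M \<rightarrow>\<^sub>M prob_algebra borel" shows "(\<lambda>x. mean_rate (\<kappa> x) i j) \<in> borel_measurable M"
  unfolding mean_rate_def
  by (rule measurable_compose[OF measurable_prob_algebraD[OF assms] nn_integral_measurable_subprob_algebra[OF rate_at_measurable]])

lemma jump_intensity_policy:
  assumes \<pi>: "\<pi> \<in> policies A"
  shows "jump_intensity (\<lambda>\<omega> t j. ennreal (jump_rate A q \<pi> \<omega> t j)) (\<lambda>i. enn2real (qstar A q i))"
proof
  fix j
  have "(\<lambda>p. case x of None \<Rightarrow> 0 | Some i \<Rightarrow> mean_rate (\<pi> (fst p) (snd p)) i j) \<in> borel_measurable predictable" for x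
    using measurable_mean_rate[OF policy_kernel[OF \<pi>]] by (cases x) simp_all
  from predictable_countable_compose[where f="\<lambda>x p. case x of None \<Rightarrow> 0 | Some i \<Rightarrow> mean_rate (\<pi> (fst p) (snd p)) i j", OF this]
  show "(\<lambda>x. ennreal (jump_rate A q \<pi> (fst x) (snd x) j)) \<in> borel_measurable predictable"
    by (rule measurable_cong[THEN iffD1, rotated]) (auto simp: jump_rate_eq[OF \<pi>] split: option.split)
next
  fix \<omega> :: "'s path" and t :: real and i
  assume *: "\<omega> \<in> Omega" "0 \<le> t" "xi_minus \<omega> t = Some i"
  then show "(\<integral>\<^sup>+j. ennreal (jump_rate A q \<pi> \<omega> t j) \<partial>count_space UNIV) \<le> ennreal (enn2real (qstar A q i))"
    using mean_rate_total_le[OF policy_on_actions[OF \<pi> *]] q_stable[of i] by (simp add: jump_rate_eq[OF \<pi>])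
next
  fix \<omega> :: "'s path" and t :: real and j
  assume "\<omega> \<in> Omega" "0 \<le> t" "xi_minus \<omega> t = None"
  then show "ennreal (jump_rate A q \<pi> \<omega> t j) = 0" by (simp add: jump_rate_eq[OF \<pi>])
qed

text \<open>Unique existence turns the definite description into the properties it stands
  for.\<close>

lemma
  assumes \<pi>: "\<pi> \<in> policies A"
  shows controlled_law_prob: "prob_space (controlled_law A q \<gamma> \<pi>)"
    and sets_controlled_law: "sets (controlled_law A q \<gamma> \<pi>) = sets path_space"
    and controlled_law_init: "measure (controlled_law A q \<gamma> \<pi>) {\<omega>\<in>Omega. xi \<omega> 0 = Some i} = pmf \<gamma> i"
    and controlled_law_compensator: "dual_predictable_projection (controlled_law A q \<gamma> \<pi>) mu (nu A q \<pi>)"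
proof -
  interpret jump_intensity "\<lambda>\<omega> t j. ennreal (jump_rate A q \<pi> \<omega> t j)" "\<lambda>i. enn2real (qstar A q i)"
    by (rule jump_intensity_policy[OF \<pi>])
  have "comp_measure = nu A q \<pi>" by (simp add: fun_eq_iff comp_measure_def nu_def)
  then have "\<exists>!P. prob_space P \<and> sets P = sets path_space \<and>
     (\<forall>i. measure P {\<omega>\<in>Omega. xi \<omega> 0 = Some i} = pmf \<gamma> i) \<and> dual_predictable_projection P mu (nu A q \<pi>)"
    using ex1_law[of \<gamma>] by simp
  from theI'[OF this] show "prob_space (controlled_law A q \<gamma> \<pi>)" "sets (controlled_law A q \<gamma> \<pi>) = sets path_space"
    "measure (controlled_law A q \<gamma> \<pi>) {\<omega>\<in>Omega. xi \<omega> 0 = Some i} = pmf \<gamma> i"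
    "dual_predictable_projection (controlled_law A q \<gamma> \<pi>) mu (nu A q \<pi>)"
    unfolding controlled_law_def by blast+
qed

lemma controlled_forward_equation:
  assumes \<pi>: "\<pi> \<in> policies A" and t: "0 \<le> t"
  shows "emeasure (controlled_law A q \<gamma> \<pi>) {\<omega>\<in>Omega. xi_minus \<omega> t = Some j}
      + (\<integral>\<^sup>+s. \<integral>\<^sup>+\<omega>. (if xi_minus \<omega> s = Some j then \<integral>\<^sup>+k. ennreal (jump_rate A q \<pi> \<omega> s k) \<partial>count_space UNIV else 0) \<partial>controlled_law A q \<gamma> \<pi> * indicator {0<..<t} s \<partial>lborel)
    = ennreal (pmf \<gamma> j) + (\<integral>\<^sup>+s. \<integral>\<^sup>+\<omega>. ennreal (jump_rate A q \<pi> \<omega> s j) \<partial>controlled_law A q \<gamma> \<pi> * indicator {0<..<t} s \<partial>lborel)"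
proof -
  interpret jump_intensity "\<lambda>\<omega> t j. ennreal (jump_rate A q \<pi> \<omega> t j)" "\<lambda>i. enn2real (qstar A q i)"
    by (rule jump_intensity_policy[OF \<pi>])
  interpret P: prob_space "controlled_law A q \<gamma> \<pi>" by (rule controlled_law_prob[OF \<pi>])
  have c: "comp_measure = nu A q \<pi>" by (simp add: fun_eq_iff comp_measure_def nu_def)
  show ?thesis
    using forward_equation[OF controlled_law_prob[OF \<pi>] sets_controlled_law[OF \<pi>]
        controlled_law_compensator[OF \<pi>, folded c] t, of \<gamma> j] controlled_law_init[OF \<pi>, of \<gamma> j]
    by (simp add: P.emeasure_eq_measure)
qed

end

section \<open>Averaging a policy over the history\<close>

lemma measurable_section:
  assumes "f \<in> path_space \<Otimes>\<^sub>M nonneg_time \<rightarrow>\<^sub>M N" "0 \<le> t"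
  shows "(\<lambda>\<omega>. f (\<omega>, t)) \<in> path_space \<rightarrow>\<^sub>M N"
  by (rule measurable_compose[OF _ assms(1)]) (use assms(2) in simp)

lemma measurable_nonneg_time_extend:
  fixes f :: "real \<Rightarrow> ennreal"
  assumes "f \<in> borel_measurable nonneg_time"
  shows "(\<lambda>t. if 0 \<le> t then f t else 0) \<in> borel_measurable borel"
proof -
  have "(\<lambda>t::real. max 0 t) \<in> borel \<rightarrow>\<^sub>M nonneg_time" by (intro measurable_restrict_space2) auto
  from measurable_compose[OF this assms]
  have "(\<lambda>t. if 0 \<le> t then f (max 0 t) else 0) \<in> borel_measurable borel" by measurable
  then show ?thesis by (rule measurable_cong[THEN iffD1, rotated]) (simp add: max_def)
qed

lemma nn_integral_count_of_option:
  fixes m :: "'s \<Rightarrow> ennreal"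
  shows "(\<integral>\<^sup>+i. (if x = Some i then m i else 0) \<partial>count_space UNIV) = (case x of None \<Rightarrow> 0 | Some i \<Rightarrow> m i)"
proof (cases x)
  case (Some k)
  have "(\<integral>\<^sup>+i. (if x = Some i then m i else 0) \<partial>count_space UNIV) = (\<integral>\<^sup>+i. m i * indicator {k} i \<partial>count_space UNIV)"
    by (intro nn_integral_cong) (auto simp: Some indicator_def)
  also have "\<dots> = m k" by (subst nn_integral_indicator_singleton) simp_all
  finally show ?thesis by (simp add: Some)
qed simp

context controlled_rates
begin

definition action_kernel :: "('s \<Rightarrow> real \<Rightarrow> 'a option measure) \<Rightarrow> bool" where
  "action_kernel \<phi> \<longleftrightarrow> (\<forall>i. \<phi> i \<in> nonneg_time \<rightarrow>\<^sub>M prob_algebra borel \<and> (\<forall>t\<ge>0. measure (\<phi> i t) (Some ` A i) = 1))"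

text \<open>Multiplying by the probability of the state, rather than dividing, leaves the kernel
  free where that probability is 0. The measure is a parameter because the property is used under
  the laws of two policies.\<close>

definition averaged_by :: "'s path measure \<Rightarrow> ('s path \<Rightarrow> real \<Rightarrow> 'a option measure) \<Rightarrow> ('s \<Rightarrow> real \<Rightarrow> 'a option measure) \<Rightarrow> bool" where
  "averaged_by P \<pi> \<phi> \<longleftrightarrow> (\<forall>i. \<forall>t\<ge>0. \<forall>h\<in>borel_measurable borel.
     (\<integral>\<^sup>+\<omega>. (if xi_minus \<omega> t = Some i then \<integral>\<^sup>+x. h x \<partial>\<pi> \<omega> t else 0) \<partial>P) =
     emeasure P {\<omega>\<in>Omega. xi_minus \<omega> t = Some i} * (\<integral>\<^sup>+x. h x \<partial>\<phi> i t))"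

lemma action_kernel_on_actions:
  assumes "action_kernel \<phi>" "0 \<le> t" shows "on_actions i (\<phi> i t)"
proof -
  have "\<phi> i t \<in> space (prob_algebra borel)"
    using assms measurable_space[of "\<phi> i" nonneg_time "prob_algebra borel" t] by (simp add: action_kernel_def space_restrict_space)
  then show ?thesis using assms by (simp add: action_kernel_def on_actions_def space_prob_algebra)
qed

lemma measurable_policy_product:
  "\<pi> \<in> policies A \<Longrightarrow> (\<lambda>p. \<pi> (fst p) (snd p)) \<in> path_space \<Otimes>\<^sub>M nonneg_time \<rightarrow>\<^sub>M prob_algebra borel"
  by (rule predictable_imp_product_measurable[OF policy_kernel])

lemma measurable_policy_integral:
  fixes h :: "'a option \<Rightarrow> ennreal"
  assumes \<pi>: "\<pi> \<in> policies A" and h: "h \<in> borel_measurable borel"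
  shows "(\<lambda>p. if xi_minus (fst p) (snd p) = Some i then \<integral>\<^sup>+x. h x \<partial>\<pi> (fst p) (snd p) else 0) \<in> borel_measurable (path_space \<Otimes>\<^sub>M nonneg_time)"
proof -
  note [measurable] = measurable_xi_minus_product
    measurable_compose[OF measurable_prob_algebraD[OF measurable_policy_product[OF \<pi>]] nn_integral_measurable_subprob_algebra[OF h]]
  show ?thesis by measurable
qed

lemma measurable_state_prob:
  assumes P: "prob_space P" "sets P = sets (path_space :: 's path measure)"
  shows "(\<lambda>t. emeasure P {\<omega>\<in>Omega. xi_minus \<omega> t = Some i}) \<in> borel_measurable nonneg_time"
proof -
  interpret prob_space P by fact
  have sp: "space P = Omega" using sets_eq_imp_space_eq[OF P(2)] by simp
  have "(\<lambda>(t, \<omega>). if xi_minus \<omega> t = Some i then 1 else 0 :: ennreal) \<in> borel_measurable (nonneg_time \<Otimes>\<^sub>M path_space)"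
  proof -
    note [measurable] = measurable_compose[OF measurable_Pair[OF measurable_snd measurable_fst] measurable_xi_minus_product, simplified]
    show ?thesis unfolding case_prod_unfold by measurable
  qed
  then have "(\<lambda>(t, \<omega>). if xi_minus \<omega> t = Some i then 1 else 0 :: ennreal) \<in> borel_measurable (nonneg_time \<Otimes>\<^sub>M P)"
    by (simp add: measurable_cong_sets[OF sets_pair_measure_cong[OF refl P(2)] refl])
  from borel_measurable_nn_integral[OF this]
  show ?thesis
  proof (rule measurable_cong[THEN iffD1, rotated])
    fix t :: real assume "t \<in> space nonneg_time"
    then have ev: "{\<omega>\<in>Omega. xi_minus \<omega> t = Some i} \<in> sets P" using sets_xi_minus[of t "Some i"] P(2) by (simp add: space_restrict_space)
    have "(\<integral>\<^sup>+\<omega>. (if xi_minus \<omega> t = Some i then 1 else 0) \<partial>P) = (\<integral>\<^sup>+\<omega>. indicator {\<omega>\<in>Omega. xi_minus \<omega> t = Some i} \<omega> \<partial>P)"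
      by (intro nn_integral_cong) (auto simp: indicator_def sp)
    then show "(\<integral>\<^sup>+\<omega>. (if xi_minus \<omega> t = Some i then 1 else 0) \<partial>P) = emeasure P {\<omega>\<in>Omega. xi_minus \<omega> t = Some i}"
      using ev by simp
  qed
qed

text \<open>At time 0 on the path started in \<open>i\<close>, a policy puts full mass on the
  actions admissible in \<open>i\<close>. This supplies default actions for the averaged
  kernel.\<close>

lemma policy_actions_nonempty:
  assumes "\<pi> \<in> policies A" shows "A i \<noteq> {}"
proof
  assume e: "A i = {}"
  have \<omega>: "start_path (Some i) \<in> Omega" by (rule start_path_Omega)
  have "xi_minus (start_path (Some i)) 0 = Some i"
    using xi_0[OF \<omega>] by (simp add: xi_minus_def jump_state_def start_path_def)
  from policy_on_actions[OF assms \<omega> _ this] show False by (simp add: on_actions_def e)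
qed

text \<open>With countably many states, conditioning on the state is conditioning on an event, and
  averages over the kernel are explicit quotients. Numerator and denominator are measurable in time
  by integrating out the path.\<close>

lemma ex_averaging_kernel:
  assumes \<pi>: "\<pi> \<in> policies A" and P: "prob_space P" "sets P = sets (path_space :: 's path measure)"
  shows "\<exists>\<phi>. action_kernel \<phi> \<and> averaged_by P \<pi> \<phi>"
proof -
  interpret P: prob_space P by fact
  have sp: "space P = Omega" using sets_eq_imp_space_eq[OF P(2)] by simp
  have "\<forall>i. \<exists>a. a \<in> A i" using policy_actions_nonempty[OF \<pi>] by blast
  then obtain a0 where a0: "\<And>i. a0 i \<in> A i" by metis
  define E :: "'s \<Rightarrow> real \<Rightarrow> 's path set" where "E i t = {\<omega>\<in>Omega. xi_minus \<omega> t = Some i}" for i and t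
  have E: "E i t \<in> sets P" if "0 \<le> t" for i t using sets_xi_minus[OF that, of "Some i"] P(2) by (simp add: E_def)
  have Efin: "emeasure P (E i t) \<noteq> \<infinity>" for i t by simp
  have ker: "(\<lambda>\<omega>. \<pi> \<omega> t) \<in> P \<rightarrow>\<^sub>M prob_algebra borel" if "0 \<le> t" for t
    using measurable_section[OF measurable_policy_product[OF \<pi>] that] by (simp add: measurable_cong_sets[OF P(2) refl])
  \<comment> \<open>Where the state has probability 0 a fixed admissible action is chosen, so that
    the kernel is concentrated on \<open>A i\<close> at every time.\<close>
  define \<phi> where "\<phi> i t = (if emeasure P (E i t) = 0 then return borel (Some (a0 i))
     else uniform_measure P (E i t) \<bind> (\<lambda>\<omega>. \<pi> \<omega> t))" for i t
  have ker': "(\<lambda>\<omega>. \<pi> \<omega> t) \<in> uniform_measure P (E i t) \<rightarrow>\<^sub>M subprob_algebra borel" if "0 \<le> t" for i t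
    using measurable_prob_algebraD[OF ker[OF that]] by (simp add: measurable_cong_sets[OF sets_uniform_measure refl])
  \<comment> \<open>The averaging property, the concentration on \<open>A i\<close> and the
    measurability in time are all read off from this formula.\<close>
  have int: "(\<integral>\<^sup>+x. h x \<partial>\<phi> i t) = (if emeasure P (E i t) = 0 then h (Some (a0 i))
      else (\<integral>\<^sup>+\<omega>. (if xi_minus \<omega> t = Some i then \<integral>\<^sup>+x. h x \<partial>\<pi> \<omega> t else 0) \<partial>P) / emeasure P (E i t))"
    if h: "h \<in> borel_measurable borel" and t: "0 \<le> t" for h i t
  proof (cases "emeasure P (E i t) = 0")
    case True
    then show ?thesis using h by (simp add: \<phi>_def nn_integral_return)
  next
    case False
    have m: "(\<lambda>\<omega>. \<integral>\<^sup>+x. h x \<partial>\<pi> \<omega> t) \<in> borel_measurable P"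
      by (rule measurable_compose[OF measurable_prob_algebraD[OF ker[OF t]] nn_integral_measurable_subprob_algebra[OF h]])
    have "(\<integral>\<^sup>+x. h x \<partial>\<phi> i t) = (\<integral>\<^sup>+\<omega>. \<integral>\<^sup>+x. h x \<partial>\<pi> \<omega> t \<partial>uniform_measure P (E i t))"
      using False by (simp add: \<phi>_def nn_integral_bind[OF h ker'[OF t]])
    also have "\<dots> = (\<integral>\<^sup>+\<omega>. (\<integral>\<^sup>+x. h x \<partial>\<pi> \<omega> t) * indicator (E i t) \<omega> \<partial>P) / emeasure P (E i t)"
      by (rule nn_integral_uniform_measure[OF m E[OF t]])
    also have "(\<integral>\<^sup>+\<omega>. (\<integral>\<^sup>+x. h x \<partial>\<pi> \<omega> t) * indicator (E i t) \<omega> \<partial>P) = (\<integral>\<^sup>+\<omega>. (if xi_minus \<omega> t = Some i then \<integral>\<^sup>+x. h x \<partial>\<pi> \<omega> t else 0) \<partial>P)"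
      by (intro nn_integral_cong) (auto simp: indicator_def E_def sp)
    finally show ?thesis using False by simp
  qed
  have prob: "prob_space (\<phi> i t)" "sets (\<phi> i t) = sets borel" if t: "0 \<le> t" for i t
  proof -
    have "prob_space (\<phi> i t) \<and> sets (\<phi> i t) = sets borel"
    proof (cases "emeasure P (E i t) = 0")
      case True
      then show ?thesis by (simp add: \<phi>_def prob_space_return)
    next
      case False
      interpret U: prob_space "uniform_measure P (E i t)" by (rule prob_space_uniform_measure[OF False Efin])
      have "prob_space (uniform_measure P (E i t) \<bind> (\<lambda>\<omega>. \<pi> \<omega> t))"
        using policy_prob(1)[OF \<pi> _ t] by (intro U.prob_space_bind[OF _ ker'[OF t]] AE_I2) (simp add: sp)
      moreover have "sets (uniform_measure P (E i t) \<bind> (\<lambda>\<omega>. \<pi> \<omega> t)) = sets borel"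
        using policy_prob(2)[OF \<pi> _ t] U.not_empty by (intro sets_bind) (auto simp: sp)
      ultimately show ?thesis using False by (simp add: \<phi>_def)
    qed
    then show "prob_space (\<phi> i t)" "sets (\<phi> i t) = sets borel" by auto
  qed
  have avg: "averaged_by P \<pi> \<phi>"
    unfolding averaged_by_def
  proof (intro allI impI ballI)
    fix i and t :: real and h :: "'a option \<Rightarrow> ennreal"
    assume t: "0 \<le> t" and h: "h \<in> borel_measurable borel"
    show "(\<integral>\<^sup>+\<omega>. (if xi_minus \<omega> t = Some i then \<integral>\<^sup>+x. h x \<partial>\<pi> \<omega> t else 0) \<partial>P) =
     emeasure P {\<omega>\<in>Omega. xi_minus \<omega> t = Some i} * (\<integral>\<^sup>+x. h x \<partial>\<phi> i t)"
      unfolding E_def[symmetric]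
    proof (cases "emeasure P (E i t) = 0")
      case True
      have "AE \<omega> in P. \<omega> \<notin> E i t" using True E[OF t] by (intro AE_not_in) (auto simp: null_sets_def)
      then have "AE \<omega> in P. (if xi_minus \<omega> t = Some i then \<integral>\<^sup>+x. h x \<partial>\<pi> \<omega> t else 0) = 0"
        using AE_space by eventually_elim (auto simp: E_def sp)
      then have "(\<integral>\<^sup>+\<omega>. (if xi_minus \<omega> t = Some i then \<integral>\<^sup>+x. h x \<partial>\<pi> \<omega> t else 0) \<partial>P) = (\<integral>\<^sup>+\<omega>. 0 \<partial>P)"
        by (rule nn_integral_cong_AE)
      with True show "(\<integral>\<^sup>+\<omega>. (if xi_minus \<omega> t = Some i then \<integral>\<^sup>+x. h x \<partial>\<pi> \<omega> t else 0) \<partial>P) = emeasure P (E i t) * (\<integral>\<^sup>+x. h x \<partial>\<phi> i t)" by simp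
    next
      case False
      then show "(\<integral>\<^sup>+\<omega>. (if xi_minus \<omega> t = Some i then \<integral>\<^sup>+x. h x \<partial>\<pi> \<omega> t else 0) \<partial>P) = emeasure P (E i t) * (\<integral>\<^sup>+x. h x \<partial>\<phi> i t)"
        unfolding int[OF h t] using Efin[of i t] by (simp add: ennreal_times_divide ennreal_mult_divide_eq mult.commute[of "emeasure P (E i t)"])
    qed
  qed
  have act: "measure (\<phi> i t) (Some ` A i) = 1" if t: "0 \<le> t" for i t
  proof -
    have SA: "Some ` A i \<in> sets borel" using A_borel by measurable
    interpret \<phi>: prob_space "\<phi> i t" by (rule prob[OF t])
    have "emeasure (\<phi> i t) (Some ` A i) = (\<integral>\<^sup>+x. indicator (Some ` A i) x \<partial>\<phi> i t)"
      using SA prob(2)[OF t] by simp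
    also have "\<dots> = 1"
    proof (cases "emeasure P (E i t) = 0")
      case True
      then show ?thesis using a0 SA by (subst int[OF _ t]) simp_all
    next
      case False
      have "(\<integral>\<^sup>+\<omega>. (if xi_minus \<omega> t = Some i then \<integral>\<^sup>+x. indicator (Some ` A i) x \<partial>\<pi> \<omega> t else 0) \<partial>P) = (\<integral>\<^sup>+\<omega>. indicator (E i t) \<omega> \<partial>P)"
      proof (rule nn_integral_cong)
        fix \<omega> assume "\<omega> \<in> space P"
        then have \<omega>: "\<omega> \<in> Omega" by (simp add: sp)
        show "(if xi_minus \<omega> t = Some i then \<integral>\<^sup>+x. indicator (Some ` A i) x \<partial>\<pi> \<omega> t else 0) = indicator (E i t) \<omega>"
        proof (cases "xi_minus \<omega> t = Some i")
          case True
          have oa: "on_actions i (\<pi> \<omega> t)" by (rule policy_on_actions[OF \<pi> \<omega> t True])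
          interpret pi: prob_space "\<pi> \<omega> t" using oa by (simp add: on_actions_def)
          show ?thesis using True oa SA \<omega> by (simp add: E_def on_actions_def pi.emeasure_eq_measure)
        qed (simp add: E_def)
      qed
      also have "\<dots> = emeasure P (E i t)" using E[OF t] by simp
      finally show ?thesis using False SA Efin[of i t]
        by (subst int[OF _ t]) (simp_all add: ennreal_divide_self less_top[symmetric])
    qed
    finally show ?thesis by (simp add: \<phi>.emeasure_eq_measure)
  qed
  have "\<phi> i \<in> nonneg_time \<rightarrow>\<^sub>M prob_algebra borel" for i
  proof (rule measurable_prob_algebraI, goal_cases)
    case (1 t)
    then show ?case using prob(1)[of t i] by (simp add: space_restrict_space)
  next
    case 2
    show ?case
    proof (rule measurable_subprob_algebra)
      fix t :: real assume "t \<in> space nonneg_time"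
      then show "subprob_space (\<phi> i t)" "sets (\<phi> i t) = sets borel"
        using prob[of t i] prob_space_imp_subprob_space by (auto simp: space_restrict_space)
    next
      fix B :: "'a option set" assume B: "B \<in> sets borel"
      then have hB: "indicator B \<in> borel_measurable (borel :: 'a option measure)" by simp
      have "(\<lambda>(t, \<omega>). if xi_minus \<omega> t = Some i then \<integral>\<^sup>+x. indicator B x \<partial>\<pi> \<omega> t else 0) \<in> borel_measurable (nonneg_time \<Otimes>\<^sub>M path_space)"
        using measurable_compose[OF measurable_Pair[OF measurable_snd measurable_fst] measurable_policy_integral[OF \<pi> hB, of i]]
        by (simp add: case_prod_unfold cong: if_cong)
      then have "(\<lambda>(t, \<omega>). if xi_minus \<omega> t = Some i then \<integral>\<^sup>+x. indicator B x \<partial>\<pi> \<omega> t else 0) \<in> borel_measurable (nonneg_time \<Otimes>\<^sub>M P)"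
        by (simp add: measurable_cong_sets[OF sets_pair_measure_cong[OF refl P(2)] refl])
      from P.borel_measurable_nn_integral[OF this]
      have [measurable]: "(\<lambda>t. \<integral>\<^sup>+\<omega>. (if xi_minus \<omega> t = Some i then \<integral>\<^sup>+x. indicator B x \<partial>\<pi> \<omega> t else 0) \<partial>P) \<in> borel_measurable nonneg_time" .
      have [measurable]: "(\<lambda>t. emeasure P (E i t)) \<in> borel_measurable nonneg_time"
        unfolding E_def by (rule measurable_state_prob[OF P])
      have "(\<lambda>t. if emeasure P (E i t) = 0 then indicator B (Some (a0 i))
         else (\<integral>\<^sup>+\<omega>. (if xi_minus \<omega> t = Some i then \<integral>\<^sup>+x. indicator B x \<partial>\<pi> \<omega> t else 0) \<partial>P) / emeasure P (E i t)) \<in> borel_measurable nonneg_time"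
        by measurable
      then show "(\<lambda>t. emeasure (\<phi> i t) B) \<in> borel_measurable nonneg_time"
      proof (rule measurable_cong[THEN iffD1, rotated])
        fix t :: real assume "t \<in> space nonneg_time"
        then have t: "0 \<le> t" by (simp add: space_restrict_space)
        show "(if emeasure P (E i t) = 0 then indicator B (Some (a0 i))
         else (\<integral>\<^sup>+\<omega>. (if xi_minus \<omega> t = Some i then \<integral>\<^sup>+x. indicator B x \<partial>\<pi> \<omega> t else 0) \<partial>P) / emeasure P (E i t)) = emeasure (\<phi> i t) B"
          using int[OF hB t, of i] B prob(2)[OF t, of i] by simp
      qed
    qed
  qed
  then have "action_kernel \<phi>" using act by (simp add: action_kernel_def)
  with avg show ?thesis by blast
qed

lemma ex_markov_policy:
  assumes \<phi>: "action_kernel \<phi>"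
  shows "\<exists>\<pi>\<in>markov_policies A. \<forall>\<omega>\<in>Omega. \<forall>t\<ge>0. \<forall>i. xi_minus \<omega> t = Some i \<longrightarrow> \<pi> \<omega> t = \<phi> i t"
proof -
  \<comment> \<open>After explosion \<open>None\<close> is the only admissible action.\<close>
  define \<Phi> where "\<Phi> = (\<lambda>(x, t). case x of None \<Rightarrow> return borel None | Some i \<Rightarrow> \<phi> i t)"
  have b: "sets (borel :: 's option measure) = sets (count_space UNIV)" using sets_borel_discrete by auto
  have "(\<lambda>t. \<Phi> (x, t)) \<in> nonneg_time \<rightarrow>\<^sub>M prob_algebra borel" for x
  proof (cases x)
    case None
    have "return borel (None :: 'a option) \<in> space (prob_algebra borel)"
      by (simp add: space_prob_algebra prob_space_return)
    then show ?thesis by (simp add: \<Phi>_def None)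
  qed (use \<phi> in \<open>simp add: \<Phi>_def action_kernel_def\<close>)
  then have "\<Phi> \<in> count_space UNIV \<Otimes>\<^sub>M nonneg_time \<rightarrow>\<^sub>M prob_algebra borel"
    by (intro measurable_pair_measure_countable1) auto
  then have \<Phi>: "\<Phi> \<in> borel \<Otimes>\<^sub>M nonneg_time \<rightarrow>\<^sub>M prob_algebra borel"
    by (simp add: measurable_cong_sets[OF sets_pair_measure_cong[OF b refl] refl])
  define \<pi> :: "'s path \<Rightarrow> real \<Rightarrow> 'a option measure" where "\<pi> \<omega> t = \<Phi> (xi_minus \<omega> t, t)" for \<omega> t
  have "(\<lambda>p. (xi_minus (fst p) (snd p), snd p)) \<in> (predictable :: ('s path \<times> real) measure) \<rightarrow>\<^sub>M borel \<Otimes>\<^sub>M nonneg_time"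
    by (intro measurable_Pair measurable_predictable_time measurable_borel_discrete_iff[THEN iffD2] measurable_xi_minus)
  from measurable_compose[OF this \<Phi>]
  have "(\<lambda>(\<omega>, t). \<pi> \<omega> t) \<in> predictable \<rightarrow>\<^sub>M prob_algebra borel"
    by (simp add: \<pi>_def case_prod_unfold)
  moreover have "measure (\<pi> \<omega> t) (act_inf A (xi_minus \<omega> t)) = 1" if "0 \<le> t" for \<omega> t
  proof (cases "xi_minus \<omega> t")
    case None
    then show ?thesis by (simp add: \<pi>_def \<Phi>_def measure_return)
  next
    case (Some i)
    then show ?thesis using \<phi> that by (simp add: \<pi>_def \<Phi>_def action_kernel_def)
  qed
  ultimately have "\<pi> \<in> policies A" by (simp add: policies_def)
  then have "\<pi> \<in> markov_policies A" unfolding markov_policies_def using \<Phi> by (auto simp: \<pi>_def)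
  moreover have "\<pi> \<omega> t = \<phi> i t" if "xi_minus \<omega> t = Some i" for \<omega> t i
    using that by (simp add: \<pi>_def \<Phi>_def)
  ultimately show ?thesis by blast
qed

text \<open>A policy that depends on state and time alone is its own conditional law under every
  measure on paths. Hence the kernel obtained from the original policy also averages the Markov
  policy, under the latter's own law.\<close>

lemma averaged_by_markov:
  assumes P: "sets P = sets (path_space :: 's path measure)"
    and \<pi>: "\<And>\<omega> t i. \<omega> \<in> Omega \<Longrightarrow> 0 \<le> t \<Longrightarrow> xi_minus \<omega> t = Some i \<Longrightarrow> \<pi> \<omega> t = \<phi> i t"
  shows "averaged_by P \<pi> \<phi>"
  unfolding averaged_by_def
proof (intro allI impI ballI)
  fix i and t :: real and h :: "'a option \<Rightarrow> ennreal"
  assume t: "0 \<le> t"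
  have sp: "space P = Omega" using sets_eq_imp_space_eq[OF P] by simp
  have E: "{\<omega>\<in>Omega. xi_minus \<omega> t = Some i} \<in> sets P" using sets_xi_minus[OF t, of "Some i"] P by simp
  have "(\<integral>\<^sup>+\<omega>. (if xi_minus \<omega> t = Some i then \<integral>\<^sup>+x. h x \<partial>\<pi> \<omega> t else 0) \<partial>P) =
    (\<integral>\<^sup>+\<omega>. (\<integral>\<^sup>+x. h x \<partial>\<phi> i t) * indicator {\<omega>\<in>Omega. xi_minus \<omega> t = Some i} \<omega> \<partial>P)"
    by (intro nn_integral_cong) (auto simp: sp indicator_def \<pi> t)
  also have "\<dots> = emeasure P {\<omega>\<in>Omega. xi_minus \<omega> t = Some i} * (\<integral>\<^sup>+x. h x \<partial>\<phi> i t)"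
    using nn_integral_cmult_indicator[OF E] by (simp add: mult.commute)
  finally show "(\<integral>\<^sup>+\<omega>. (if xi_minus \<omega> t = Some i then \<integral>\<^sup>+x. h x \<partial>\<pi> \<omega> t else 0) \<partial>P) =
    emeasure P {\<omega>\<in>Omega. xi_minus \<omega> t = Some i} * (\<integral>\<^sup>+x. h x \<partial>\<phi> i t)" .
qed

end

section \<open>Forward equation of a controlled process\<close>

lemma xi_eq_xi_minus:
  assumes \<omega>: "\<omega> \<in> Omega" and t: "0 < t" and no_jump: "\<And>m. jump_time m \<omega> \<noteq> ennreal t"
  shows "xi \<omega> t = xi_minus \<omega> t"
proof (rule before_cases[of \<omega> t])
  assume b: "\<And>m. before m \<omega> t"
  then show ?thesis using xi_minus_exploded[OF \<omega>, of t] explosion_le_iff[OF \<omega>, of t] t by (simp add: xi_def)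
next
  fix m assume m: "before m \<omega> t" "\<not> before (Suc m) \<omega> t"
  have "jump_time m \<omega> \<le> ennreal t" using m(1) by (auto simp: before_def)
  moreover have "ennreal t < jump_time (Suc m) \<omega>" using m(2) no_jump[of "Suc m"] by (auto simp: before_def not_less less_le)
  ultimately show ?thesis using xi_eqI[OF \<omega>] xi_minus_last[OF \<omega> _ m] t by simp
qed

text \<open>For a fixed path the set of jump times is countable, hence null; exchanging the two
  quantifiers almost everywhere gives the claim. It reconciles \<open>xi\<close> in the occupation
  measure with \<open>xi_minus\<close> everywhere else.\<close>

lemma AE_no_jump:
  assumes P: "prob_space P" "sets P = sets (path_space :: 's::{countable,discrete_topology} path measure)"
  shows "AE t in lborel. 0 < t \<longrightarrow> (AE \<omega> in P. \<forall>m. jump_time m \<omega> \<noteq> ennreal t)"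
proof -
  interpret P: prob_space P by fact
  interpret PL: pair_sigma_finite "lborel :: real measure" P ..
  have [measurable]: "jump_time m \<in> borel_measurable P" for m
    unfolding measurable_cong_sets[OF P(2) refl] by measurable
  have 1: "AE t in lborel. 0 < t \<longrightarrow> (\<forall>m. jump_time m \<omega> \<noteq> ennreal t)" for \<omega> :: "'s path"
  proof -
    have "AE t in lborel. \<forall>m. t \<noteq> enn2real (jump_time m \<omega>)"
      unfolding AE_all_countable using AE_lborel_singleton by blast
    then show ?thesis by eventually_elim (metis enn2real_ennreal less_imp_le)
  qed
  have "{x \<in> space (lborel \<Otimes>\<^sub>M P). 0 < fst x \<longrightarrow> (\<forall>m. jump_time m (snd x) \<noteq> ennreal (fst x))} \<in> sets (lborel \<Otimes>\<^sub>M P)"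
    by measurable
  from PL.AE_commute[OF this] 1
  have "AE t in lborel. AE \<omega> in P. 0 < t \<longrightarrow> (\<forall>m. jump_time m \<omega> \<noteq> ennreal t)" by simp
  then show ?thesis by eventually_elim simp
qed

context controlled_rates
begin

definition kernel_rate :: "('s \<Rightarrow> real \<Rightarrow> 'a option measure) \<Rightarrow> 's \<Rightarrow> 's \<Rightarrow> real \<Rightarrow> ennreal" where
  "kernel_rate \<phi> i j s = (if 0 \<le> s then mean_rate (\<phi> i s) i j else 0)"

definition state_prob :: "'s path measure \<Rightarrow> real \<Rightarrow> 's \<Rightarrow> ennreal" where
  "state_prob P t i = (if 0 \<le> t then emeasure P {\<omega>\<in>Omega. xi_minus \<omega> t = Some i} else 0)"

lemma kernel_drift_rates:
  assumes \<phi>: "action_kernel \<phi>"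
    and w: "\<And>i. 1 \<le> w i"
    and params: "0 \<le> L" "0 < \<rho>" "0 \<le> b"
    and qstar_bound: "\<And>i. qstar A q i \<le> ennreal (L * w i)"
    and drift: "\<And>i a. a \<in> A i \<Longrightarrow> (\<lambda>j. w j * q j i a) summable_on UNIV"
      "\<And>i a. a \<in> A i \<Longrightarrow> (\<Sum>\<^sub>\<infinity>j. w j * q j i a) \<le> \<rho> * w i + b"
  shows "drift_rates (kernel_rate \<phi>) w L \<rho> b"
proof
  show "kernel_rate \<phi> i j \<in> borel_measurable borel" for i j
    unfolding kernel_rate_def[abs_def]
    using \<phi> by (intro measurable_nonneg_time_extend measurable_mean_rate) (simp add: action_kernel_def)
  have w0: "0 \<le> w i" for i using order_trans[OF _ w[of i], of 0] by simp
  have "0 \<le> \<rho> * w i + b" for i using w0 params by simp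
  note dr = mean_rate_drift[OF action_kernel_on_actions[OF \<phi>] w0 this drift]
  note tl = order_trans[OF mean_rate_total_le[OF action_kernel_on_actions[OF \<phi>]] qstar_bound]
  show "(\<integral>\<^sup>+j. kernel_rate \<phi> i j s \<partial>count_space UNIV) \<le> ennreal (L * w i)" for i s
    using tl[of s i] by (cases "0 \<le> s") (simp_all add: kernel_rate_def)
  show "(\<integral>\<^sup>+j. kernel_rate \<phi> i j s * ennreal (w j) \<partial>count_space UNIV)
        \<le> ennreal (\<rho> * w i + b) + ennreal (w i) * (\<integral>\<^sup>+j. kernel_rate \<phi> i j s \<partial>count_space UNIV)" for i s
    using dr[of s i] by (cases "0 \<le> s") (simp_all add: kernel_rate_def)
qed (use w params in auto)

text \<open>Only an inequality, since mass may be lost to explosion.\<close>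

lemma state_prob_sum:
  assumes "prob_space P" "sets P = sets (path_space :: 's path measure)"
  shows "(\<integral>\<^sup>+i. state_prob P t i \<partial>count_space UNIV) \<le> 1"
proof (cases "0 \<le> t")
  case True
  interpret P: prob_space P by fact
  have "emeasure P {\<omega>\<in>Omega. xi_minus \<omega> t = Some i} = (\<integral>\<^sup>+\<omega>. indicator {\<omega>\<in>Omega. xi_minus \<omega> t = Some i} \<omega> \<partial>P)" for i
    using sets_xi_minus[OF True, of "Some i"] assms(2) by simp
  then have "(\<integral>\<^sup>+i. state_prob P t i \<partial>count_space UNIV)
     = (\<integral>\<^sup>+i. \<integral>\<^sup>+\<omega>. indicator {\<omega>\<in>Omega. xi_minus \<omega> t = Some i} \<omega> \<partial>P \<partial>count_space UNIV)"
    using True by (simp add: state_prob_def)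
  also have "\<dots> = (\<integral>\<^sup>+\<omega>. \<integral>\<^sup>+i. indicator {\<omega>\<in>Omega. xi_minus \<omega> t = Some i} \<omega> \<partial>count_space UNIV \<partial>P)"
    using sets_xi_minus[OF True] assms(2)
    by (intro nn_integral_count_measure_swap P.sigma_finite_measure_axioms borel_measurable_indicator) simp
  also have "\<dots> \<le> (\<integral>\<^sup>+\<omega>. 1 \<partial>P)"
  proof (rule nn_integral_mono)
    fix \<omega>
    have "(\<integral>\<^sup>+i. indicator {\<omega>\<in>Omega. xi_minus \<omega> t = Some i} \<omega> \<partial>count_space UNIV)
      \<le> (\<integral>\<^sup>+i. (if xi_minus \<omega> t = Some i then 1 else 0) \<partial>count_space UNIV)"
      by (intro nn_integral_mono) (auto simp: indicator_def)
    also have "\<dots> \<le> 1" unfolding nn_integral_count_of_option by (simp split: option.split)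
    finally show "(\<integral>\<^sup>+i. indicator {\<omega>\<in>Omega. xi_minus \<omega> t = Some i} \<omega> \<partial>count_space UNIV) \<le> (1::ennreal)" .
  qed
  finally show ?thesis by (simp add: P.emeasure_space_1)
qed (simp add: state_prob_def)

text \<open>Here the dependence on the history disappears: split by the current state, the expected
  intensity is linear in the law of the action and so only sees its conditional average.\<close>

lemma mean_jump_rate:
  assumes \<pi>: "\<pi> \<in> policies A" and P: "prob_space P" "sets P = sets (path_space :: 's path measure)"
    and avg: "averaged_by P \<pi> \<phi>" and t: "0 \<le> t"
  shows "(\<integral>\<^sup>+\<omega>. ennreal (jump_rate A q \<pi> \<omega> t j) \<partial>P) = (\<integral>\<^sup>+i. state_prob P t i * kernel_rate \<phi> i j t \<partial>count_space UNIV)"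
proof -
  interpret P: prob_space P by fact
  have sp: "space P = Omega" using sets_eq_imp_space_eq[OF P(2)] by simp
  have m: "(\<lambda>\<omega>. if xi_minus \<omega> t = Some i then mean_rate (\<pi> \<omega> t) i j else 0) \<in> borel_measurable P" for i
    using measurable_section[OF measurable_policy_integral[OF \<pi> rate_at_measurable] t]
    unfolding measurable_cong_sets[OF P(2) refl] by (simp add: mean_rate_def cong: if_cong)
  have "(\<integral>\<^sup>+\<omega>. ennreal (jump_rate A q \<pi> \<omega> t j) \<partial>P)
    = (\<integral>\<^sup>+\<omega>. \<integral>\<^sup>+i. (if xi_minus \<omega> t = Some i then mean_rate (\<pi> \<omega> t) i j else 0) \<partial>count_space UNIV \<partial>P)"
    unfolding nn_integral_count_of_option using t by (intro nn_integral_cong) (simp add: sp jump_rate_eq[OF \<pi>])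
  also have "\<dots> = (\<integral>\<^sup>+i. \<integral>\<^sup>+\<omega>. (if xi_minus \<omega> t = Some i then mean_rate (\<pi> \<omega> t) i j else 0) \<partial>P \<partial>count_space UNIV)"
    by (intro nn_integral_count_measure_swap[symmetric] P.sigma_finite_measure_axioms m)
  also have "\<dots> = (\<integral>\<^sup>+i. state_prob P t i * kernel_rate \<phi> i j t \<partial>count_space UNIV)"
    using avg t unfolding averaged_by_def mean_rate_def by (simp add: state_prob_def kernel_rate_def mean_rate_def)
  finally show ?thesis .
qed

lemma mean_exit_rate:
  assumes \<pi>: "\<pi> \<in> policies A" and P: "sets P = sets (path_space :: 's path measure)"
    and \<phi>: "action_kernel \<phi>" and avg: "averaged_by P \<pi> \<phi>" and t: "0 \<le> t"
  shows "(\<integral>\<^sup>+\<omega>. (if xi_minus \<omega> t = Some j then \<integral>\<^sup>+k. ennreal (jump_rate A q \<pi> \<omega> t k) \<partial>count_space UNIV else 0) \<partial>P)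
    = state_prob P t j * (\<integral>\<^sup>+k. kernel_rate \<phi> j k t \<partial>count_space UNIV)"
proof -
  let ?h = "\<lambda>x. \<integral>\<^sup>+k. rate_at j k x \<partial>count_space UNIV"
  have sp: "space P = Omega" using sets_eq_imp_space_eq[OF P(1)] by simp
  have "?h \<in> borel_measurable borel"
    by (rule measurable_nn_integral_count_space) measurable
  then have "(\<integral>\<^sup>+\<omega>. (if xi_minus \<omega> t = Some j then \<integral>\<^sup>+x. ?h x \<partial>\<pi> \<omega> t else 0) \<partial>P) = state_prob P t j * (\<integral>\<^sup>+x. ?h x \<partial>\<phi> j t)"
    using avg t unfolding averaged_by_def by (simp add: state_prob_def)
  also have "(\<integral>\<^sup>+x. ?h x \<partial>\<phi> j t) = (\<integral>\<^sup>+k. kernel_rate \<phi> j k t \<partial>count_space UNIV)"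
    using mean_rate_total[OF action_kernel_on_actions[OF \<phi> t], of j] t by (simp add: kernel_rate_def)
  also have "(\<integral>\<^sup>+\<omega>. (if xi_minus \<omega> t = Some j then \<integral>\<^sup>+x. ?h x \<partial>\<pi> \<omega> t else 0) \<partial>P)
    = (\<integral>\<^sup>+\<omega>. (if xi_minus \<omega> t = Some j then \<integral>\<^sup>+k. ennreal (jump_rate A q \<pi> \<omega> t k) \<partial>count_space UNIV else 0) \<partial>P)"
    using mean_rate_total[OF policy_on_actions[OF \<pi> _ t]]
    by (intro nn_integral_cong) (auto simp: sp jump_rate_eq[OF \<pi> _ t])
  finally show ?thesis .
qed

text \<open>The rates in the equation are built from \<phi> alone, so all policies averaged by the
  same kernel lead to the same equation with the same initial value.\<close>

theorem policy_forward_solution: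
  assumes dr: "drift_rates (kernel_rate \<phi>) w L \<rho> b"
    and \<pi>: "\<pi> \<in> policies A" and \<phi>: "action_kernel \<phi>" and avg: "averaged_by (controlled_law A q \<gamma> \<pi>) \<pi> \<phi>"
  shows "drift_rates.forward_solution (kernel_rate \<phi>) (\<lambda>j. ennreal (pmf \<gamma> j)) T (state_prob (controlled_law A q \<gamma> \<pi>))"
proof -
  interpret drift_rates "kernel_rate \<phi>" w L \<rho> b by fact
  note P = controlled_law_prob[OF \<pi>, of \<gamma>] sets_controlled_law[OF \<pi>, of \<gamma>]
  show ?thesis
    unfolding forward_solution_def
  proof (intro conjI allI ballI)
    show "(\<lambda>t. state_prob (controlled_law A q \<gamma> \<pi>) t i) \<in> borel_measurable borel" for i
      unfolding state_prob_def by (intro measurable_nonneg_time_extend measurable_state_prob P)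
    show "(\<integral>\<^sup>+i. state_prob (controlled_law A q \<gamma> \<pi>) t i \<partial>count_space UNIV) \<le> 1" for t
      by (rule state_prob_sum[OF P])
    fix t j assume "t \<in> {0..T}"
    then have t: "0 \<le> t" by simp
    have 1: "(\<integral>\<^sup>+s. \<integral>\<^sup>+\<omega>. (if xi_minus \<omega> s = Some j then \<integral>\<^sup>+k. ennreal (jump_rate A q \<pi> \<omega> s k) \<partial>count_space UNIV else 0) \<partial>controlled_law A q \<gamma> \<pi> * indicator {0<..<t} s \<partial>lborel)
      = (\<integral>\<^sup>+s. state_prob (controlled_law A q \<gamma> \<pi>) s j * exit_rate j s * indicator {0<..<t} s \<partial>lborel)"
      using mean_exit_rate[OF \<pi> P(2) \<phi> avg]
      by (intro nn_integral_cong) (auto simp: indicator_def exit_rate_def)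
    have 2: "(\<integral>\<^sup>+s. \<integral>\<^sup>+\<omega>. ennreal (jump_rate A q \<pi> \<omega> s j) \<partial>controlled_law A q \<gamma> \<pi> * indicator {0<..<t} s \<partial>lborel)
      = (\<integral>\<^sup>+s. (\<integral>\<^sup>+i. state_prob (controlled_law A q \<gamma> \<pi>) s i * kernel_rate \<phi> i j s \<partial>count_space UNIV) * indicator {0<..<t} s \<partial>lborel)"
      using mean_jump_rate[OF \<pi> P avg] by (intro nn_integral_cong) (auto simp: indicator_def)
    have 3: "emeasure (controlled_law A q \<gamma> \<pi>) {\<omega>\<in>Omega. xi_minus \<omega> t = Some j} = state_prob (controlled_law A q \<gamma> \<pi>) t j"
      using t by (simp add: state_prob_def)
    show "state_prob (controlled_law A q \<gamma> \<pi>) t j + (\<integral>\<^sup>+s. state_prob (controlled_law A q \<gamma> \<pi>) s j * exit_rate j s * indicator {0<..<t} s \<partial>lborel)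
      = ennreal (pmf \<gamma> j) + (\<integral>\<^sup>+s. (\<integral>\<^sup>+i. state_prob (controlled_law A q \<gamma> \<pi>) s i * kernel_rate \<phi> i j s \<partial>count_space UNIV) * indicator {0<..<t} s \<partial>lborel)"
      using controlled_forward_equation[OF \<pi> t, of \<gamma> j] unfolding 1 2 3 .
  qed
qed

end

section \<open>Occupation measures and costs\<close>

lemma sections_of_occ_space:
  fixes B :: "(real \<times> 's::{countable, discrete_topology} \<times> 'a::polish_space) set"
  assumes "B \<in> sets (restrict_space borel (occ_space A T))" "\<And>i. A i \<in> sets borel"
  shows "{a. (t, i, a) \<in> B} \<in> sets borel"
proof -
  obtain C where C: "C \<in> sets borel" "B = occ_space A T \<inter> C" using assms(1) by (auto simp: sets_restrict_space)
  have "(\<lambda>a. (t, i, a)) \<in> borel_measurable borel"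
    by (intro borel_measurable_continuous_onI continuous_intros)
  from measurable_sets[OF this C(1)] have "{a. (t, i, a) \<in> C} \<in> sets borel" by (simp add: vimage_def)
  moreover have "{a. (t, i, a) \<in> B} = (if t \<in> {0..T} then A i \<inter> {a. (t, i, a) \<in> C} else {})"
    by (auto simp: C(2) occ_space_def)
  ultimately show ?thesis using assms(2) by simp
qed

context controlled_rates
begin

lemma state_action_density:
  assumes \<pi>: "\<pi> \<in> policies A" and P: "sets P = sets (path_space :: 's path measure)"
    and \<phi>: "action_kernel \<phi>" and avg: "averaged_by P \<pi> \<phi>"
    and t: "0 < t" "AE \<omega> in P. \<forall>m. jump_time m \<omega> \<noteq> ennreal t" and D: "D \<in> sets borel"
  shows "(\<integral>\<^sup>+\<omega>. indicator {\<omega>. xi \<omega> t = Some i} \<omega> * emeasure (\<pi> \<omega> t) (Some ` D) \<partial>P)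
    = state_prob P t i * emeasure (\<phi> i t) (Some ` D)"
proof -
  have sp: "space P = Omega" using sets_eq_imp_space_eq[OF P] by simp
  have SD: "Some ` D \<in> sets borel" using D by (rule Some_image_borel)
  have "(\<integral>\<^sup>+\<omega>. indicator {\<omega>. xi \<omega> t = Some i} \<omega> * emeasure (\<pi> \<omega> t) (Some ` D) \<partial>P)
    = (\<integral>\<^sup>+\<omega>. (if xi_minus \<omega> t = Some i then \<integral>\<^sup>+x. indicator (Some ` D) x \<partial>\<pi> \<omega> t else 0) \<partial>P)"
  proof (rule nn_integral_cong_AE, use t(2) AE_space in eventually_elim)
    case (elim \<omega>)
    then have \<omega>: "\<omega> \<in> Omega" by (simp add: sp)
    then have "(\<integral>\<^sup>+x. indicator (Some ` D) x \<partial>\<pi> \<omega> t) = emeasure (\<pi> \<omega> t) (Some ` D)"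
      using t(1) SD policy_prob(2)[OF \<pi>, of \<omega> t] by simp
    moreover have "indicator {\<omega>. xi \<omega> t = Some i} \<omega> = (if xi_minus \<omega> t = Some i then 1 else 0 :: ennreal)"
      using elim xi_eq_xi_minus[OF \<omega> t(1)] by (simp add: indicator_def)
    ultimately show ?case by simp
  qed
  also have "\<dots> = emeasure P {\<omega>\<in>Omega. xi_minus \<omega> t = Some i} * (\<integral>\<^sup>+x. indicator (Some ` D) x \<partial>\<phi> i t)"
    using avg t(1) SD by (simp add: averaged_by_def)
  also have "\<dots> = state_prob P t i * emeasure (\<phi> i t) (Some ` D)"
    using t(1) SD action_kernel_on_actions[OF \<phi>, of t i] by (simp add: state_prob_def on_actions_def)
  finally show ?thesis .
qed

text \<open>Both measures come from set functions through \<open>measure_of\<close>, so it suffices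
  that these agree on measurable sets. Their densities in time agree off the null set of times at
  which jumps have positive probability.\<close>

theorem occupation_measure_eqI:
  assumes \<pi>: "\<pi> \<in> policies A" "averaged_by (controlled_law A q \<gamma> \<pi>) \<pi> \<phi>"
    and \<pi>': "\<pi>' \<in> policies A" "averaged_by (controlled_law A q \<gamma> \<pi>') \<pi>' \<phi>"
    and \<phi>: "action_kernel \<phi>"
    and eq: "\<And>t i. t \<in> {0..T} \<Longrightarrow> state_prob (controlled_law A q \<gamma> \<pi>) t i = state_prob (controlled_law A q \<gamma> \<pi>') t i"
  shows "occupation_measure A q \<gamma> T \<pi> = occupation_measure A q \<gamma> T \<pi>'"
  unfolding occupation_measure_def
proof (rule measure_of_eq)
  let ?X = "restrict_space borel (occ_space A T) :: (real \<times> 's \<times> 'a) measure"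
  have spX: "space ?X = occ_space A T" by (simp add: space_restrict_space)
  show "sets ?X \<subseteq> Pow (occ_space A T)" using sets.space_closed[of ?X] by (simp add: spX)
  fix B assume "B \<in> sigma_sets (occ_space A T) (sets ?X)"
  then have B: "B \<in> sets ?X" using sets.sigma_sets_eq[of ?X] by (simp add: spX)
  note D = sections_of_occ_space[OF B A_borel]
  have density: "AE t in lborel. t \<in> {0..T} \<longrightarrow> (\<integral>\<^sup>+\<omega>. indicator {\<omega>. xi \<omega> t = Some i} \<omega> *
        emeasure (\<sigma> \<omega> t) (Some ` {a. (t, i, a) \<in> B}) \<partial>controlled_law A q \<gamma> \<sigma>)
      = state_prob (controlled_law A q \<gamma> \<sigma>) t i * emeasure (\<phi> i t) (Some ` {a. (t, i, a) \<in> B})"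
    if \<sigma>: "\<sigma> \<in> policies A" "averaged_by (controlled_law A q \<gamma> \<sigma>) \<sigma> \<phi>" for \<sigma> i
    using AE_no_jump[OF controlled_law_prob[OF \<sigma>(1)] sets_controlled_law[OF \<sigma>(1)], of \<gamma>] AE_lborel_singleton[of 0]
  proof eventually_elim
    case (elim t)
    then show ?case
      using state_action_density[where t=t and i=i, OF \<sigma>(1) sets_controlled_law[OF \<sigma>(1)] \<phi> \<sigma>(2) _ _ D] by auto
  qed
  have "AE t in lborel. \<forall>i. t \<in> {0..T} \<longrightarrow>
      (\<integral>\<^sup>+\<omega>. indicator {\<omega>. xi \<omega> t = Some i} \<omega> * emeasure (\<pi> \<omega> t) (Some ` {a. (t, i, a) \<in> B}) \<partial>controlled_law A q \<gamma> \<pi>) =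
      (\<integral>\<^sup>+\<omega>. indicator {\<omega>. xi \<omega> t = Some i} \<omega> * emeasure (\<pi>' \<omega> t) (Some ` {a. (t, i, a) \<in> B}) \<partial>controlled_law A q \<gamma> \<pi>')"
    unfolding AE_all_countable
  proof
    fix i
    show "AE t in lborel. t \<in> {0..T} \<longrightarrow>
      (\<integral>\<^sup>+\<omega>. indicator {\<omega>. xi \<omega> t = Some i} \<omega> * emeasure (\<pi> \<omega> t) (Some ` {a. (t, i, a) \<in> B}) \<partial>controlled_law A q \<gamma> \<pi>) =
      (\<integral>\<^sup>+\<omega>. indicator {\<omega>. xi \<omega> t = Some i} \<omega> * emeasure (\<pi>' \<omega> t) (Some ` {a. (t, i, a) \<in> B}) \<partial>controlled_law A q \<gamma> \<pi>')"
      using density[OF \<pi>, of i] density[OF \<pi>', of i] by eventually_elim (simp add: eq)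
  qed
  then have "AE t in lborel.
      (\<integral>\<^sup>+i. \<integral>\<^sup>+\<omega>. indicator {\<omega>. xi \<omega> t = Some i} \<omega> * emeasure (\<pi> \<omega> t) (Some ` {a. (t, i, a) \<in> B}) \<partial>controlled_law A q \<gamma> \<pi> \<partial>count_space UNIV) * indicator {0..T} t =
      (\<integral>\<^sup>+i. \<integral>\<^sup>+\<omega>. indicator {\<omega>. xi \<omega> t = Some i} \<omega> * emeasure (\<pi>' \<omega> t) (Some ` {a. (t, i, a) \<in> B}) \<partial>controlled_law A q \<gamma> \<pi>' \<partial>count_space UNIV) * indicator {0..T} t"
  proof eventually_elim
    case (elim t)
    show ?case by (cases "t \<in> {0..T}") (use elim in simp_all)
  qed
  from nn_integral_cong_AE[OF this]
  show "ennreal (1 / T) * (\<integral>\<^sup>+t\<in>{0..T}. (\<integral>\<^sup>+i. \<integral>\<^sup>+\<omega>. indicator {\<omega>. xi \<omega> t = Some i} \<omega> * emeasure (\<pi> \<omega> t) (Some ` {a. (t, i, a) \<in> B}) \<partial>controlled_law A q \<gamma> \<pi> \<partial>count_space UNIV) \<partial>lborel) =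
    ennreal (1 / T) * (\<integral>\<^sup>+t\<in>{0..T}. (\<integral>\<^sup>+i. \<integral>\<^sup>+\<omega>. indicator {\<omega>. xi \<omega> t = Some i} \<omega> * emeasure (\<pi>' \<omega> t) (Some ` {a. (t, i, a) \<in> B}) \<partial>controlled_law A q \<gamma> \<pi>' \<partial>count_space UNIV) \<partial>lborel)"
    by simp
qed

text \<open>\<open>ennreal\<close> cuts negative values to 0, so this averages the positive part of
  the cost; the negative part is the same expression for the cost with opposite sign.\<close>

definition path_cost :: "('s \<Rightarrow> 'a \<Rightarrow> real) \<Rightarrow> ('s path \<Rightarrow> real \<Rightarrow> 'a option measure) \<Rightarrow> 's path \<Rightarrow> real \<Rightarrow> ennreal" where
  "path_cost f \<pi> \<omega> t = (case xi_minus \<omega> t of None \<Rightarrow> 0 | Some i \<Rightarrow> \<integral>\<^sup>+x. ennreal (ext_K A f (Some i) x) \<partial>\<pi> \<omega> t)"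

definition kernel_cost :: "('s \<Rightarrow> 'a \<Rightarrow> real) \<Rightarrow> ('s \<Rightarrow> real \<Rightarrow> 'a option measure) \<Rightarrow> (real \<Rightarrow> 's \<Rightarrow> ennreal) \<Rightarrow> real \<Rightarrow> ennreal" where
  "kernel_cost f \<phi> p T = (\<integral>\<^sup>+t. indicator {0..T} t * (\<integral>\<^sup>+i. p t i * (\<integral>\<^sup>+x. ennreal (ext_K A f (Some i) x) \<partial>\<phi> i t) \<partial>count_space UNIV) \<partial>lborel)"

lemma ext_K_le:
  assumes "\<And>a. a \<in> A i \<Longrightarrow> f i a \<le> K" "0 \<le> K" shows "ext_K A f (Some i) x \<le> K"
  using assms by (cases x) (auto simp: ext_K_def)

lemma on_actions_cost_le:
  assumes \<kappa>: "on_actions i \<kappa>" and f: "\<And>a. a \<in> A i \<Longrightarrow> f i a \<le> K" "0 \<le> K"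
  shows "(\<integral>\<^sup>+x. ennreal (ext_K A f (Some i) x) \<partial>\<kappa>) \<le> ennreal K"
proof -
  interpret prob_space \<kappa> using \<kappa> by (simp add: on_actions_def)
  have "(\<integral>\<^sup>+x. ennreal (ext_K A f (Some i) x) \<partial>\<kappa>) \<le> (\<integral>\<^sup>+x. ennreal K \<partial>\<kappa>)"
    by (intro nn_integral_mono ennreal_leI ext_K_le f)
  then show ?thesis by (simp add: emeasure_space_1)
qed

lemma measurable_path_cost:
  assumes \<pi>: "\<pi> \<in> policies A" and f: "\<And>i. f i \<in> borel_measurable (restrict_space borel (A i))"
  shows "(\<lambda>p. path_cost f \<pi> (fst p) (snd p)) \<in> borel_measurable (path_space \<Otimes>\<^sub>M nonneg_time)"
proof -
  have h: "(\<lambda>x. ennreal (ext_K A f (Some i) x)) \<in> borel_measurable borel" for i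
    using ext_K_measurable[where A=A and f=f and i=i, OF A_borel f] by measurable
  show ?thesis
    unfolding path_cost_def nn_integral_count_of_option[symmetric]
    by (intro measurable_nn_integral_count_space measurable_policy_integral[OF \<pi> h])
qed

lemma integral_path_cost:
  assumes \<pi>: "\<pi> \<in> policies A" and P: "prob_space P" "sets P = sets (path_space :: 's path measure)"
    and avg: "averaged_by P \<pi> \<phi>" and f: "\<And>i. f i \<in> borel_measurable (restrict_space borel (A i))"
    and t: "0 \<le> t"
  shows "(\<integral>\<^sup>+\<omega>. path_cost f \<pi> \<omega> t \<partial>P) = (\<integral>\<^sup>+i. state_prob P t i * (\<integral>\<^sup>+x. ennreal (ext_K A f (Some i) x) \<partial>\<phi> i t) \<partial>count_space UNIV)"
proof -
  interpret P: prob_space P by fact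
  have h: "(\<lambda>x. ennreal (ext_K A f (Some i) x)) \<in> borel_measurable borel" for i
    using ext_K_measurable[where A=A and f=f and i=i, OF A_borel f] by measurable
  have "(\<integral>\<^sup>+\<omega>. path_cost f \<pi> \<omega> t \<partial>P)
    = (\<integral>\<^sup>+i. \<integral>\<^sup>+\<omega>. (if xi_minus \<omega> t = Some i then \<integral>\<^sup>+x. ennreal (ext_K A f (Some i) x) \<partial>\<pi> \<omega> t else 0) \<partial>P \<partial>count_space UNIV)"
    unfolding path_cost_def nn_integral_count_of_option[symmetric]
  proof (intro nn_integral_count_measure_swap[symmetric] P.sigma_finite_measure_axioms)
    show "(\<lambda>\<omega>. if xi_minus \<omega> t = Some i then \<integral>\<^sup>+x. ennreal (ext_K A f (Some i) x) \<partial>\<pi> \<omega> t else 0) \<in> borel_measurable P" for i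
      using measurable_section[OF measurable_policy_integral[OF \<pi> h, of i i] t]
      unfolding measurable_cong_sets[OF P(2) refl] by (simp cong: if_cong)
  qed
  also have "\<dots> = (\<integral>\<^sup>+i. state_prob P t i * (\<integral>\<^sup>+x. ennreal (ext_K A f (Some i) x) \<partial>\<phi> i t) \<partial>count_space UNIV)"
    using avg t h by (intro nn_integral_cong) (simp add: averaged_by_def state_prob_def)
  finally show ?thesis .
qed

lemma kernel_cost_finite:
  assumes \<phi>: "action_kernel \<phi>" and w: "\<And>i. 0 \<le> w i" and M: "0 \<le> M" and T: "0 \<le> T"
    and f: "\<And>i a. a \<in> A i \<Longrightarrow> f i a \<le> M * w i"
    and C: "\<And>t. t \<in> {0..T} \<Longrightarrow> (\<integral>\<^sup>+i. p t i * ennreal (w i) \<partial>count_space UNIV) \<le> ennreal C"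
  shows "kernel_cost f \<phi> p T < \<infinity>"
proof -
  have "kernel_cost f \<phi> p T \<le> (\<integral>\<^sup>+t. ennreal M * ennreal C * indicator {0..T} t \<partial>lborel)"
    unfolding kernel_cost_def
  proof (rule nn_integral_mono)
    fix t :: real
    show "indicator {0..T} t * (\<integral>\<^sup>+i. p t i * (\<integral>\<^sup>+x. ennreal (ext_K A f (Some i) x) \<partial>\<phi> i t) \<partial>count_space UNIV)
      \<le> ennreal M * ennreal C * indicator {0..T} t"
    proof (cases "t \<in> {0..T}")
      case True
      have "(\<integral>\<^sup>+i. p t i * (\<integral>\<^sup>+x. ennreal (ext_K A f (Some i) x) \<partial>\<phi> i t) \<partial>count_space UNIV)
         \<le> (\<integral>\<^sup>+i. p t i * ennreal (M * w i) \<partial>count_space UNIV)"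
        using True f M w by (intro nn_integral_mono mult_left_mono on_actions_cost_le action_kernel_on_actions \<phi>) auto
      also have "\<dots> = ennreal M * (\<integral>\<^sup>+i. p t i * ennreal (w i) \<partial>count_space UNIV)"
        by (subst nn_integral_cmult[symmetric]) (auto simp: ennreal_mult M w ac_simps)
      also have "\<dots> \<le> ennreal M * ennreal C" by (intro mult_left_mono C True) simp
      finally show ?thesis using True by simp
    qed simp
  qed
  also have "\<dots> < \<infinity>" using T by (subst nn_integral_cmult_indicator) (auto simp: ennreal_mult_less_top)
  finally show ?thesis .
qed

text \<open>Positive and negative parts are integrable over paths and time by the moment bound, so
  Fubini's theorem applies to their difference. Each part then depends only on the state
  probabilities and the kernel.\<close>

theorem expected_cost_eq:
  assumes \<pi>: "\<pi> \<in> policies A" and \<phi>: "action_kernel \<phi>" and avg: "averaged_by (controlled_law A q \<gamma> \<pi>) \<pi> \<phi>"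
    and f: "\<And>i. f i \<in> borel_measurable (restrict_space borel (A i))"
    and bound: "\<And>i a. a \<in> A i \<Longrightarrow> \<bar>f i a\<bar> \<le> M * w i" and w: "\<And>i. 0 \<le> w i" and M: "0 \<le> M" and T: "0 \<le> T"
    and C: "\<And>t. t \<in> {0..T} \<Longrightarrow> (\<integral>\<^sup>+i. state_prob (controlled_law A q \<gamma> \<pi>) t i * ennreal (w i) \<partial>count_space UNIV) \<le> ennreal C"
  shows "expected_cost A q \<gamma> T f \<pi> = enn2real (kernel_cost f \<phi> (state_prob (controlled_law A q \<gamma> \<pi>)) T)
     - enn2real (kernel_cost (\<lambda>i a. - f i a) \<phi> (state_prob (controlled_law A q \<gamma> \<pi>)) T)"
proof -
  define P where "P = controlled_law A q \<gamma> \<pi>"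
  have P: "prob_space P" "sets P = sets (path_space :: 's path measure)"
    unfolding P_def by (rule controlled_law_prob[OF \<pi>], rule sets_controlled_law[OF \<pi>])
  interpret P: prob_space P by fact
  interpret PL: pair_sigma_finite P "lborel :: real measure" ..
  have sp: "space P = Omega" using sets_eq_imp_space_eq[OF P(2)] by simp
  \<comment> \<open>Measurability of \<open>path_cost\<close> is known for nonnegative times only;
    \<open>max 0\<close> extends it to the line, and the indicator discards the values
    added.\<close>
  define F where "F g x = indicator {0..T} (snd x) * path_cost g \<pi> (fst x) (max 0 (snd x))" for g x
  have F: "has_bochner_integral (P \<Otimes>\<^sub>M lborel) (\<lambda>x. enn2real (F g x)) (enn2real (kernel_cost g \<phi> (state_prob P) T))"
    and finite: "\<And>\<omega> t. \<omega> \<in> Omega \<Longrightarrow> 0 \<le> t \<Longrightarrow> path_cost g \<pi> \<omega> t < \<infinity>"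
    if g: "\<And>i. g i \<in> borel_measurable (restrict_space borel (A i))" "\<And>i a. a \<in> A i \<Longrightarrow> g i a \<le> M * w i" for g
  proof -
    have le: "path_cost g \<pi> \<omega> t \<le> ennreal (M * w i)" if "\<omega> \<in> Omega" "0 \<le> t" "xi_minus \<omega> t = Some i" for \<omega> t i
      unfolding path_cost_def that(3) option.case using g(2) M w
      by (intro on_actions_cost_le policy_on_actions[OF \<pi> that]) auto
    then show fin: "path_cost g \<pi> \<omega> t < \<infinity>" if "\<omega> \<in> Omega" "0 \<le> t" for \<omega> t
      using le[OF that, THEN le_less_trans[OF _ ennreal_less_top]] by (cases "xi_minus \<omega> t") (auto simp: path_cost_def)
    have "(\<lambda>x. (fst x, max 0 (snd x))) \<in> P \<Otimes>\<^sub>M lborel \<rightarrow>\<^sub>M path_space \<Otimes>\<^sub>M nonneg_time"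
    proof (intro measurable_Pair)
      show "(\<lambda>x. max 0 (snd x)) \<in> P \<Otimes>\<^sub>M lborel \<rightarrow>\<^sub>M nonneg_time"
        by (rule measurable_restrict_space2) auto
      show "fst \<in> P \<Otimes>\<^sub>M lborel \<rightarrow>\<^sub>M path_space" using measurable_fst[of P lborel] by (simp add: measurable_cong_sets[OF refl P(2)])
    qed
    from measurable_compose[OF this measurable_path_cost[OF \<pi> g(1)]]
    have Fm[measurable]: "F g \<in> borel_measurable (P \<Otimes>\<^sub>M lborel)" unfolding F_def[abs_def] by simp
    have "(\<integral>\<^sup>+x. F g x \<partial>(P \<Otimes>\<^sub>M lborel)) = (\<integral>\<^sup>+t. \<integral>\<^sup>+\<omega>. F g (\<omega>, t) \<partial>P \<partial>lborel)"
      by (rule PL.nn_integral_snd[symmetric]) (rule Fm)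
    also have "\<dots> = kernel_cost g \<phi> (state_prob P) T"
      unfolding kernel_cost_def
    proof (rule nn_integral_cong)
      fix t :: real
      have "(\<integral>\<^sup>+\<omega>. F g (\<omega>, t) \<partial>P) = (\<integral>\<^sup>+\<omega>. path_cost g \<pi> \<omega> t \<partial>P)" if "t \<in> {0..T}"
        using that by (simp add: F_def max_def)
      moreover have "(\<integral>\<^sup>+\<omega>. F g (\<omega>, t) \<partial>P) = 0" if "t \<notin> {0..T}" using that by (simp add: F_def)
      ultimately show "(\<integral>\<^sup>+\<omega>. F g (\<omega>, t) \<partial>P) = indicator {0..T} t *
         (\<integral>\<^sup>+i. state_prob P t i * (\<integral>\<^sup>+x. ennreal (ext_K A g (Some i) x) \<partial>\<phi> i t) \<partial>count_space UNIV)"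
        using integral_path_cost[OF \<pi> P avg[folded P_def] g(1), of t] by (cases "t \<in> {0..T}") simp_all
    qed
    finally have int: "(\<integral>\<^sup>+x. F g x \<partial>(P \<Otimes>\<^sub>M lborel)) = kernel_cost g \<phi> (state_prob P) T" .
    have "(\<integral>\<^sup>+x. ennreal (enn2real (F g x)) \<partial>(P \<Otimes>\<^sub>M lborel)) = (\<integral>\<^sup>+x. F g x \<partial>(P \<Otimes>\<^sub>M lborel))"
    proof (rule nn_integral_cong)
      fix x assume "x \<in> space (P \<Otimes>\<^sub>M (lborel :: real measure))"
      then have "fst x \<in> Omega" by (auto simp: space_pair_measure sp)
      then have "F g x < \<infinity>"
        using fin[of "fst x" "max 0 (snd x)"] by (cases "snd x \<in> {0..T}") (simp_all add: F_def)
      then show "ennreal (enn2real (F g x)) = F g x" by simp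
    qed
    also have "\<dots> = ennreal (enn2real (kernel_cost g \<phi> (state_prob P) T))"
      unfolding int using kernel_cost_finite[OF \<phi> w M T g(2) C] by (simp add: P_def)
    finally show "has_bochner_integral (P \<Otimes>\<^sub>M lborel) (\<lambda>x. enn2real (F g x)) (enn2real (kernel_cost g \<phi> (state_prob P) T))"
      by (intro has_bochner_integral_nn_integral) auto
  qed
  let ?nf = "\<lambda>i a. - f i a"
  have pos: "\<And>i. f i \<in> borel_measurable (restrict_space borel (A i))" "\<And>i a. a \<in> A i \<Longrightarrow> f i a \<le> M * w i"
    and neg: "\<And>i. ?nf i \<in> borel_measurable (restrict_space borel (A i))" "\<And>i a. a \<in> A i \<Longrightarrow> ?nf i a \<le> M * w i"
    using f bound by (auto intro: order_trans[OF abs_ge_self] order_trans[OF abs_ge_minus_self])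
  note hb = has_bochner_integral_diff[OF F[OF pos] F[OF neg]]
  have cost: "(\<integral>a. ext_K A f (xi_minus \<omega> t) a \<partial>\<pi> \<omega> t) = enn2real (path_cost f \<pi> \<omega> t) - enn2real (path_cost ?nf \<pi> \<omega> t)"
    if \<omega>: "\<omega> \<in> Omega" and t: "0 \<le> t" for \<omega> t
  proof (cases "xi_minus \<omega> t")
    case (Some i)
    note \<kappa> = policy_on_actions[OF \<pi> \<omega> t Some]
    then interpret \<kappa>: prob_space "\<pi> \<omega> t" by (simp add: on_actions_def)
    have s: "sets (\<pi> \<omega> t) = sets borel" using \<kappa> by (simp add: on_actions_def)
    have m: "ext_K A f (Some i) \<in> borel_measurable (\<pi> \<omega> t)"
      unfolding measurable_cong_sets[OF s refl] by (rule ext_K_measurable[where A=A and f=f and i=i, OF A_borel f])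
    have "\<bar>ext_K A f (Some i) x\<bar> \<le> M * w i" for x
      using bound M w by (cases x) (auto simp: ext_K_def)
    then have "integrable (\<pi> \<omega> t) (ext_K A f (Some i))"
      by (intro \<kappa>.integrable_const_bound[where B="M * w i"] m) auto
    moreover have "ext_K A ?nf (Some i) x = - ext_K A f (Some i) x" for x
      by (cases x) (auto simp: ext_K_def)
    ultimately show ?thesis by (simp add: Some path_cost_def real_lebesgue_integral_def)
  qed (simp add: path_cost_def)
  have "expected_cost A q \<gamma> T f \<pi> = (\<integral>\<omega>. \<integral>t. enn2real (F f (\<omega>, t)) - enn2real (F ?nf (\<omega>, t)) \<partial>lborel \<partial>P)"
    unfolding expected_cost_def P_def[symmetric] set_lebesgue_integral_def
  proof (intro Bochner_Integration.integral_cong refl)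
    fix \<omega> and t :: real assume "\<omega> \<in> space P"
    then show "indicator {0..T} t *\<^sub>R (\<integral>a. ext_K A f (xi_minus \<omega> t) a \<partial>\<pi> \<omega> t) = enn2real (F f (\<omega>, t)) - enn2real (F ?nf (\<omega>, t))"
      using cost[of \<omega> t] by (cases "t \<in> {0..T}") (simp_all add: F_def sp max_def)
  qed
  also have "\<dots> = (\<integral>x. enn2real (F f x) - enn2real (F ?nf x) \<partial>(P \<Otimes>\<^sub>M lborel))"
    using PL.integral_fst'[of "\<lambda>x. enn2real (F f x) - enn2real (F ?nf x)"] integrable.intros[OF hb] by simp
  also have "\<dots> = enn2real (kernel_cost f \<phi> (state_prob P) T) - enn2real (kernel_cost ?nf \<phi> (state_prob P) T)"
    using hb by (rule has_bochner_integral_integral_eq)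
  finally show ?thesis unfolding P_def .
qed

end

theorem mainTheorem5:
  fixes A :: "'s::{countable, discrete_topology} \<Rightarrow> 'a::polish_space set"
    and q :: "'s \<Rightarrow> 's \<Rightarrow> 'a \<Rightarrow> real"
    and c :: "nat \<Rightarrow> 's \<Rightarrow> 'a \<Rightarrow> real"
    and N :: nat
    and Tm :: real
    and \<gamma> :: "'s pmf"
    and w :: "'s \<Rightarrow> real"
    and \<rho>1 \<rho>2 \<rho>3 b1 b2 b3 L M :: real
  assumes A_borel: "\<And>i. A i \<in> sets borel"
    and q_meas: "\<And>i j. q j i \<in> borel_measurable (restrict_space borel (A i))"
    and q_nonneg: "\<And>i j a. a \<in> A i \<Longrightarrow> j \<noteq> i \<Longrightarrow> 0 \<le> q j i a"
    and q_conservative: "\<And>i a. a \<in> A i \<Longrightarrow> ((\<lambda>j. q j i a) has_sum 0) UNIV"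
    and q_stable: "\<And>i. qstar A q i < \<infinity>"
    and c_meas: "\<And>n i. n \<le> N \<Longrightarrow> c n i \<in> borel_measurable (restrict_space borel (A i))"
    and Tm_pos: "0 < Tm"
    and w_ge_1: "\<And>i. 1 \<le> w i"
    and const_bounds: "0 < \<rho>1" "0 < \<rho>2" "0 < \<rho>3" "0 \<le> b1" "0 \<le> b2" "0 \<le> b3" "0 < L" "0 < M"
    and w_drift:
      "\<And>i a. a \<in> A i \<Longrightarrow> (\<lambda>j. w j * q j i a) summable_on UNIV"
      "\<And>i a. a \<in> A i \<Longrightarrow> (\<Sum>\<^sub>\<infinity>j. w j * q j i a) \<le> \<rho>1 * w i + b1"
    and qstar_bound: "\<And>i. qstar A q i \<le> ennreal (L * w i)"
    and w_init: "(\<lambda>i. w i * pmf \<gamma> i) summable_on UNIV"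
    and c_bound: "\<And>n i a. n \<le> N \<Longrightarrow> a \<in> A i \<Longrightarrow> \<bar>c n i a\<bar> \<le> M * w i"
    and w2_drift:
      "\<And>i a. a \<in> A i \<Longrightarrow> (\<lambda>j. (w j)\<^sup>2 * q j i a) summable_on UNIV"
      "\<And>i a. a \<in> A i \<Longrightarrow> (\<Sum>\<^sub>\<infinity>j. (w j)\<^sup>2 * q j i a) \<le> \<rho>2 * (w i)\<^sup>2 + b2"
    and w3_drift:
      "\<And>i a. a \<in> A i \<Longrightarrow> (\<lambda>j. (w j) ^ 3 * q j i a) summable_on UNIV"
      "\<And>i a. a \<in> A i \<Longrightarrow> (\<Sum>\<^sub>\<infinity>j. (w j) ^ 3 * q j i a) \<le> \<rho>3 * (w i) ^ 3 + b3"
    and A_compact: "\<And>i. compact (A i)"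
    and c_cont: "\<And>n i. n \<le> N \<Longrightarrow> continuous_on (A i) (c n i)"
    and q_cont: "\<And>i j. continuous_on (A i) (q j i)"
    and wq_cont: "\<And>i. continuous_on (A i) (\<lambda>a. \<Sum>\<^sub>\<infinity>k. w k * q k i a)"
    and sublevel: "\<And>m::nat. 1 \<le> m \<Longrightarrow> {i. w i \<le> real m} \<noteq> {} \<and> finite {i. w i \<le> real m}"
    and w2_init: "(\<lambda>i. (w i)\<^sup>2 * pmf \<gamma> i) summable_on UNIV"
    and w3_init: "(\<lambda>i. (w i) ^ 3 * pmf \<gamma> i) summable_on UNIV"
  shows "(\<forall>\<pi>\<in>policies A. \<exists>\<pi>'\<in>markov_policies A.
            occupation_measure A q \<gamma> Tm \<pi>' = occupation_measure A q \<gamma> Tm \<pi>) \<and>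
         (\<forall>\<pi>\<in>policies A. \<exists>\<pi>'\<in>markov_policies A. \<forall>n\<in>{1..N}.
            expected_cost A q \<gamma> Tm (c n) \<pi> = expected_cost A q \<gamma> Tm (c n) \<pi>')"
proof -
  interpret controlled_rates A q
    using A_borel q_meas q_nonneg q_conservative q_stable by unfold_locales
  have w0: "0 \<le> w i" for i using order_trans[OF _ w_ge_1[of i], of 0] by simp
  define C where "C = (\<Sum>\<^sub>\<infinity>i. w i * pmf \<gamma> i)"
  have C0: "0 \<le> C" unfolding C_def using w0 by (intro infsum_nonneg) simp
  have "(\<integral>\<^sup>+i. ennreal (pmf \<gamma> i) * ennreal (w i) \<partial>count_space UNIV) = (\<integral>\<^sup>+i. ennreal (w i * pmf \<gamma> i) \<partial>count_space UNIV)"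
    using w0 by (intro nn_integral_cong) (simp add: ennreal_mult mult.commute)
  also have "\<dots> = ennreal C"
    unfolding C_def using w0 w_init by (intro has_sum_nn_integral_count_space has_sum_infsum) auto
  finally have C: "(\<integral>\<^sup>+i. ennreal (pmf \<gamma> i) * ennreal (w i) \<partial>count_space UNIV) = ennreal C" .
  have \<gamma>: "(\<integral>\<^sup>+i. ennreal (pmf \<gamma> i) \<partial>count_space UNIV) = 1" by (simp add: nn_integral_pmf)
  \<comment> \<open>One Markov policy serves for both claims. The equality of costs is read off from
    state probabilities and kernel, in parallel with that of the occupation measures.\<close>
  have "\<exists>\<pi>'\<in>markov_policies A. occupation_measure A q \<gamma> Tm \<pi>' = occupation_measure A q \<gamma> Tm \<pi> \<and>
      (\<forall>n\<in>{1..N}. expected_cost A q \<gamma> Tm (c n) \<pi> = expected_cost A q \<gamma> Tm (c n) \<pi>')"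
    if \<pi>: "\<pi> \<in> policies A" for \<pi>
  proof -
    obtain \<phi> where \<phi>: "action_kernel \<phi>" and avg: "averaged_by (controlled_law A q \<gamma> \<pi>) \<pi> \<phi>"
      using ex_averaging_kernel[OF \<pi> controlled_law_prob[OF \<pi>] sets_controlled_law[OF \<pi>]] by blast
    obtain \<pi>' where \<pi>'_markov: "\<pi>' \<in> markov_policies A"
      and \<pi>'_eq: "\<And>\<omega> t i. \<omega> \<in> Omega \<Longrightarrow> 0 \<le> t \<Longrightarrow> xi_minus \<omega> t = Some i \<Longrightarrow> \<pi>' \<omega> t = \<phi> i t"
      using ex_markov_policy[OF \<phi>] by metis
    have \<pi>': "\<pi>' \<in> policies A" using \<pi>'_markov by (simp add: markov_policies_def)
    have avg': "averaged_by (controlled_law A q \<gamma> \<pi>') \<pi>' \<phi>"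
      by (rule averaged_by_markov[OF sets_controlled_law[OF \<pi>'] \<pi>'_eq])
    have dr: "drift_rates (kernel_rate \<phi>) w L \<rho>1 b1"
      using const_bounds by (intro kernel_drift_rates \<phi> w_ge_1 qstar_bound w_drift) auto
    interpret drift_rates "kernel_rate \<phi>" w L \<rho>1 b1 by (rule dr)
    let ?p = "state_prob (controlled_law A q \<gamma> \<pi>)" and ?p' = "state_prob (controlled_law A q \<gamma> \<pi>')"
    have sol: "forward_solution (\<lambda>j. ennreal (pmf \<gamma> j)) Tm ?p" "forward_solution (\<lambda>j. ennreal (pmf \<gamma> j)) Tm ?p'"
      using policy_forward_solution[OF dr \<pi> \<phi> avg] policy_forward_solution[OF dr \<pi>' \<phi> avg'] by blast+
    have eq: "?p t i = ?p' t i" if "t \<in> {0..Tm}" for t i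
      using that C by (intro forward_solution_unique[OF sol \<gamma>]) auto
    have occ: "occupation_measure A q \<gamma> Tm \<pi>' = occupation_measure A q \<gamma> Tm \<pi>"
      by (rule occupation_measure_eqI[OF \<pi>' avg' \<pi> avg \<phi>]) (simp add: eq)
    have "expected_cost A q \<gamma> Tm (c n) \<pi> = expected_cost A q \<gamma> Tm (c n) \<pi>'" if n: "n \<le> N" for n
    proof -
      \<comment> \<open>The constant of \<open>moment_bound\<close>, valid for both policies because
        it depends on the initial moment and the drift parameters only.\<close>
      let ?C = "2 * (C + b1 * Tm) * exp (2 * \<rho>1 * Tm)"
      have cost: "expected_cost A q \<gamma> Tm (c n) \<sigma> = enn2real (kernel_cost (c n) \<phi> (state_prob (controlled_law A q \<gamma> \<sigma>)) Tm)
         - enn2real (kernel_cost (\<lambda>i a. - c n i a) \<phi> (state_prob (controlled_law A q \<gamma> \<sigma>)) Tm)"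
        if "\<sigma> \<in> policies A" "averaged_by (controlled_law A q \<gamma> \<sigma>) \<sigma> \<phi>"
          "forward_solution (\<lambda>j. ennreal (pmf \<gamma> j)) Tm (state_prob (controlled_law A q \<gamma> \<sigma>))" for \<sigma>
      proof (rule expected_cost_eq[OF that(1) \<phi> that(2) c_meas[OF n] c_bound[OF n] w0])
        show "(\<integral>\<^sup>+i. state_prob (controlled_law A q \<gamma> \<sigma>) t i * ennreal (w i) \<partial>count_space UNIV) \<le> ennreal ?C" if "t \<in> {0..Tm}" for t
          using that Tm_pos C C0 \<open>forward_solution _ Tm (state_prob (controlled_law A q \<gamma> \<sigma>))\<close>
          by (intro moment_bound[OF _ \<gamma>]) auto
      qed (use const_bounds Tm_pos in auto)
      have "kernel_cost f \<phi> ?p Tm = kernel_cost f \<phi> ?p' Tm" for f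
        unfolding kernel_cost_def by (intro nn_integral_cong) (simp add: eq indicator_def)
      then show ?thesis using cost[OF \<pi> avg sol(1)] cost[OF \<pi>' avg' sol(2)] by simp
    qed
    with occ \<pi>'_markov show ?thesis by (intro bexI[of _ \<pi>']) auto
  qed
  then show ?thesis by blast
qed

end
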